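(* Let $\Bbbk$ be a field of prime characteristic $p$, $n\ge2$, and $1\le i\le n-1$. Write $P_0=0={}_0P$. All differentials below are prescribed on module generators and extended by the Leibniz rule; generators lying in $P_0$ or ${}_0P$ are zero. Left modules: consider the graded left $A_n^!$-module $X_i=P_i\{2-2p\}\oplus\bigoplus_{k=1}^{p-1}\big(P_{i-1}\{1-2k\}\oplus P_{i+1}\{1-2k\}\big)\oplus P_i$ with respective generators (the images of the idempotents) $v$, $a_k$, $b_k$, $w$. Right modules: consider the graded right $A_n^!$-module ${}_iX={}_iP\{2-2p\}\oplus\bigoplus_{k=1}^{p-1}\big({}_{i-1}P\{1-2k\}\oplus{}_{i+1}P\{1-2k\}\big)\oplus{}_iP$ with respective generators $v',a_k',b_k',w'$. (i) For $\lambda=0$: the left $p$-DG module $L_i$ over $(A_n^!,\partial_0)$ is quasi-isomorphic to the finite cell module $X_i$ with $\partial v=(i|i-1)a_{p-1}-(i|i+1)b_{p-1}$; $\partial a_k=a_{k-1}$ for $k\ge2$; $\partial a_1=(i-1|i)w$; $\partial b_k=b_{k-1}+(i+1|i|i-1)a_k$ for $k\ge2$; $\partial b_1=(i+1|i)w+(i+1|i|i-1)a_1$; $\partial w=0$. The right $p$-DG module ${}_iL$ over $(A_n^!,\partial_0)$ is quasi-isomorphic to the finite cell module ${}_iX$ with $\partial v'=a'_{p-1}(i-1|i)-b'_{p-1}(i+1|i)$; $\partial a'_k=a'_{k-1}+b'_k(i+1|i|i-1)$ for $k\ge2$; $\partial a'_1=w'(i|i-1)+b'_1(i+1|i|i-1)$;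 $\partial b'_k=b'_{k-1}$ for $k\ge2$; $\partial b'_1=w'(i|i+1)$; $\partial w'=0$. (ii) For $\lambda=1$: the left $p$-DG module $L_i$ over $(A_n^!,\partial_1)$ is quasi-isomorphic to the finite cell module $X_i$ with $\partial v=(i|i-1)a_{p-1}-(i|i+1)b_{p-1}$; $\partial a_k=a_{k-1}+(i-1|i|i+1)b_k$ for $k\ge2$; $\partial a_1=(i-1|i)w+(i-1|i|i+1)b_1$; $\partial b_k=b_{k-1}$ for $k\ge2$; $\partial b_1=(i+1|i)w$; $\partial w=0$. The right $p$-DG module ${}_iL$ over $(A_n^!,\partial_1)$ is quasi-isomorphic to the finite cell module ${}_iX$ with $\partial v'=a'_{p-1}(i-1|i)-b'_{p-1}(i+1|i)$; $\partial a'_k=a'_{k-1}$ for $k\ge2$; $\partial a'_1=w'(i|i-1)$; $\partial b'_k=b'_{k-1}+a'_k(i-1|i|i+1)$ for $k\ge2$; $\partial b'_1=w'(i|i+1)+a'_1(i-1|i|i+1)$; $\partial w'=0$.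
   Context: $\Bbbk$ is a field of characteristic $p>0$; $H=\Bbbk[\partial]/(\partial^p)$ with $\deg\partial=2$; graded $H$-modules are called $p$-complexes. A $p$-DG algebra is a $\mathbb Z$-graded algebra $A$ with a degree-two derivation $\partial$ with $\partial^p=0$. A left (right) $p$-DG module is a graded left (right) $A$-module with a degree-two endomorphism $\partial$, $\partial^p=0$, satisfying $\partial(am)=\partial(a)m+a\partial(m)$ (resp. $\partial(ma)=\partial(m)a+m\partial(a)$). $M\{l\}$ is $M$ with $M\{l\}^i=M^{i-l}$. A morphism of $p$-DG modules is a quasi-isomorphism if it becomes an isomorphism in the stable category of $p$-complexes; two $p$-DG modules are quasi-isomorphic if they are isomorphic in the derived category $\mathcal D(A)$ obtained by inverting quasi-isomorphisms. A finite cell module is a $p$-DG module with a finite exhaustive filtration by $p$-DG submodules whose subquotients are grading shifts of the projective $p$-DG modules $P_j=A\cdot(j)$ (left case), resp. ${}_jP=(j)\cdot A$ (right case). The algebra. Let $Q_n$ be the quiver with vertices $1,\dots,n$ and one arrow $i\to i+1$ and one arrow $i+1\to i$ for each $1\le i\le n-1$. $(i_1|i_2|\cdots|i_r)$ is the path starting at $i_1$, passing through $i_2,\dots$ and ending at $i_r$; products of paths are concatenations read left to right ($0$ if not composable); $(i)$ is the idempotent at $i$. $A_n^!$ is the quotient of $\Bbbk Q_n$ by $(i|i-1|i)=(i|i+1|i)$ for $2\le i\le n-1$ and $(1|2|1)=0$, graded by path length. The derivation $\partial_\lambda$ is determined by $\partial_\lambda(i)=0$, $\partial_\lambda(i|i+1)=\lambda(i|i+1|i|i+1)$,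 $\partial_\lambda(i|i-1)=(1-\lambda)(i|i-1|i|i-1)$. $P_i=A_n^!\cdot(i)$, ${}_iP=(i)\cdot A_n^!$. $L_i$ (resp. ${}_iL$) is the one-dimensional simple left (resp. right) module on which $(i)$ acts as the identity, in degree $0$ with zero differential. *)

theory Defs
  imports
    "HOL-Algebra.QuotRing"
    "HOL-Algebra.Module"
    "HOL-Algebra.Algebraic_Closure_Type"
    "HOL-Library.Poly_Mapping"
begin

section \<open>\<open>p\<close>-complexes\<close>

text \<open>
  The ground field is a type of class \<open>field\<close>, seen as a HOL-Algebra ring. The fields
  \<open>mult\<close> and \<open>one\<close> of the record \<open>module\<close> are meaningful only for algebras.
\<close>

abbreviation scalars :: "'k::field ring" where
  "scalars \<equiv> ring_of_type_algebra"

record ('k, 'v) pcomplex = "('k, 'v) module" +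
  grade :: "int \<Rightarrow> 'v set"
  del :: "'v \<Rightarrow> 'v"

record ('k, 'a, 'v) pdg_module = "('k, 'v) pcomplex" +
  act :: "'a \<Rightarrow> 'v \<Rightarrow> 'v"

definition direct_sum_of ::
  "('k::field, 'v, 'z) module_scheme \<Rightarrow> 'v set \<Rightarrow> (int \<Rightarrow> 'v set) \<Rightarrow> bool" where
  "direct_sum_of M S G \<longleftrightarrow>
     submodule S scalars M \<and> (\<forall>d. submodule (G d) scalars M \<and> G d \<subseteq> S) \<and>
     (\<forall>x\<in>S. \<exists>!c. (\<forall>d. c d \<in> G d) \<and> finite {d. c d \<noteq> \<zero>\<^bsub>M\<^esub>} \<and>
                  x = finsum M c {d. c d \<noteq> \<zero>\<^bsub>M\<^esub>})"

definition graded_linear ::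
  "int \<Rightarrow> ('k::field, 'v, 'z) pcomplex_scheme \<Rightarrow> ('k, 'w, 'y) pcomplex_scheme
     \<Rightarrow> ('v \<Rightarrow> 'w) \<Rightarrow> bool" where
  "graded_linear d M N f \<longleftrightarrow>
     f \<in> carrier M \<rightarrow> carrier N \<and>
     (\<forall>x\<in>carrier M. \<forall>y\<in>carrier M. f (x \<oplus>\<^bsub>M\<^esub> y) = f x \<oplus>\<^bsub>N\<^esub> f y) \<and>
     (\<forall>c. \<forall>x\<in>carrier M. f (c \<odot>\<^bsub>M\<^esub> x) = c \<odot>\<^bsub>N\<^esub> f x) \<and>
     (\<forall>e. \<forall>x\<in>grade M e. f x \<in> grade N (e + d))"

definition is_pcomplex :: "nat \<Rightarrow> ('k::field, 'v, 'z) pcomplex_scheme \<Rightarrow> bool" where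
  "is_pcomplex p M \<longleftrightarrow>
     module scalars M \<and> direct_sum_of M (carrier M) (grade M) \<and>
     graded_linear 2 M M (del M) \<and> (\<forall>x\<in>carrier M. (del M ^^ p) x = \<zero>\<^bsub>M\<^esub>)"

definition pcomplex_hom ::
  "('k::field, 'v, 'z) pcomplex_scheme \<Rightarrow> ('k, 'w, 'y) pcomplex_scheme
     \<Rightarrow> ('v \<Rightarrow> 'w) \<Rightarrow> bool" where
  "pcomplex_hom M N f \<longleftrightarrow>
     graded_linear 0 M N f \<and> (\<forall>x\<in>carrier M. f (del M x) = del N (f x))"

text \<open>
  The stable category is the quotient of the category of graded \<open>H\<close>-modules by the
  morphisms that factor through a projective object. A graded \<open>H\<close>-module is free when it is
  of the form \<open>H \<otimes> V\<close> for a graded vector space \<open>V\<close>, that is, when every element is uniquely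
  \<open>\<Sum>j<p. \<partial>\<^sup>j v\<^sub>j\<close> with \<open>v\<^sub>j \<in> V\<close>; projective means direct summand of a free one.
\<close>

definition free_pcomplex :: "nat \<Rightarrow> ('k::field, 'v, 'z) pcomplex_scheme \<Rightarrow> bool" where
  "free_pcomplex p F \<longleftrightarrow> is_pcomplex p F \<and>
     (\<exists>V. direct_sum_of F V (\<lambda>d. grade F d \<inter> V) \<and>
          (\<forall>x\<in>carrier F. \<exists>!v. v \<in> {..<p} \<rightarrow>\<^sub>E V \<and>
             x = finsum F (\<lambda>j. (del F ^^ j) (v j)) {..<p}))"

text \<open>
  Requiring the ambient free module to live on the same type as \<open>Q\<close> is harmless: over the
  graded local ring \<open>H\<close> every graded projective is itself free.
\<close>

definition projective_pcomplex :: "nat \<Rightarrow> ('k::field, 'v) pcomplex \<Rightarrow> bool" where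
  "projective_pcomplex p Q \<longleftrightarrow> is_pcomplex p Q \<and>
     (\<exists>(F :: ('k, 'v) pcomplex) s r. free_pcomplex p F \<and>
        pcomplex_hom Q F s \<and> pcomplex_hom F Q r \<and> (\<forall>x\<in>carrier Q. r (s x) = x))"

text \<open>
  The intermediate projective may be taken on the type \<open>nat \<Rightarrow> 'w\<close> without loss of generality:
  a morphism into \<open>N\<close> that factors through some projective factors through the free cover
  \<open>N \<otimes> H \<rightarrow> N\<close>, whose underlying space consists of \<open>p\<close>-tuples of elements of \<open>N\<close>.
\<close>

definition stably_zero ::
  "nat \<Rightarrow> ('k::field, 'v, 'z) pcomplex_scheme \<Rightarrow> ('k, 'w, 'y) pcomplex_scheme
     \<Rightarrow> ('v \<Rightarrow> 'w) \<Rightarrow> bool" where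
  "stably_zero p M N f \<longleftrightarrow>
     (\<exists>(Q :: ('k, nat \<Rightarrow> 'w) pcomplex) g h. projective_pcomplex p Q \<and>
        pcomplex_hom M Q g \<and> pcomplex_hom Q N h \<and> (\<forall>x\<in>carrier M. f x = h (g x)))"

definition stable_iso ::
  "nat \<Rightarrow> ('k::field, 'v, 'z) pcomplex_scheme \<Rightarrow> ('k, 'w, 'y) pcomplex_scheme
     \<Rightarrow> ('v \<Rightarrow> 'w) \<Rightarrow> bool" where
  "stable_iso p M N f \<longleftrightarrow> pcomplex_hom M N f \<and>
     (\<exists>g. pcomplex_hom N M g \<and>
          stably_zero p M M (\<lambda>x. g (f x) \<ominus>\<^bsub>M\<^esub> x) \<and>
          stably_zero p N N (\<lambda>y. f (g y) \<ominus>\<^bsub>N\<^esub> y))"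

section \<open>\<open>p\<close>-DG algebras and modules\<close>

definition pdg_algebra :: "nat \<Rightarrow> ('k::field, 'a, 'z) pcomplex_scheme \<Rightarrow> bool" where
  "pdg_algebra p A \<longleftrightarrow> ring A \<and> is_pcomplex p A \<and>
     (\<forall>c. \<forall>a\<in>carrier A. \<forall>b\<in>carrier A.
        (c \<odot>\<^bsub>A\<^esub> a) \<otimes>\<^bsub>A\<^esub> b = c \<odot>\<^bsub>A\<^esub> (a \<otimes>\<^bsub>A\<^esub> b) \<and> a \<otimes>\<^bsub>A\<^esub> (c \<odot>\<^bsub>A\<^esub> b) = c \<odot>\<^bsub>A\<^esub> (a \<otimes>\<^bsub>A\<^esub> b)) \<and>
     \<one>\<^bsub>A\<^esub> \<in> grade A 0 \<and>
     (\<forall>d e. \<forall>a\<in>grade A d. \<forall>b\<in>grade A e. a \<otimes>\<^bsub>A\<^esub> b \<in> grade A (d + e)) \<and>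
     (\<forall>a\<in>carrier A. \<forall>b\<in>carrier A.
        del A (a \<otimes>\<^bsub>A\<^esub> b) = (del A a \<otimes>\<^bsub>A\<^esub> b) \<oplus>\<^bsub>A\<^esub> (a \<otimes>\<^bsub>A\<^esub> del A b))"

text \<open>
  The axioms common to left and right modules. For a right module, \<open>act M a m\<close> stands for
  \<open>m a\<close>.
\<close>

definition pdg_action ::
  "nat \<Rightarrow> ('k::field, 'a, 'z) pcomplex_scheme \<Rightarrow> ('k, 'a, 'v) pdg_module \<Rightarrow> bool" where
  "pdg_action p A M \<longleftrightarrow> pdg_algebra p A \<and> is_pcomplex p M \<and>
     act M \<in> carrier A \<rightarrow> carrier M \<rightarrow> carrier M \<and>
     (\<forall>a\<in>carrier A. \<forall>b\<in>carrier A. \<forall>m\<in>carrier M.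
        act M (a \<oplus>\<^bsub>A\<^esub> b) m = act M a m \<oplus>\<^bsub>M\<^esub> act M b m) \<and>
     (\<forall>a\<in>carrier A. \<forall>x\<in>carrier M. \<forall>y\<in>carrier M.
        act M a (x \<oplus>\<^bsub>M\<^esub> y) = act M a x \<oplus>\<^bsub>M\<^esub> act M a y) \<and>
     (\<forall>c. \<forall>a\<in>carrier A. \<forall>m\<in>carrier M.
        act M (c \<odot>\<^bsub>A\<^esub> a) m = c \<odot>\<^bsub>M\<^esub> act M a m \<and> act M a (c \<odot>\<^bsub>M\<^esub> m) = c \<odot>\<^bsub>M\<^esub> act M a m) \<and>
     (\<forall>m\<in>carrier M. act M \<one>\<^bsub>A\<^esub> m = m) \<and>
     (\<forall>d e. \<forall>a\<in>grade A d. \<forall>m\<in>grade M e. act M a m \<in> grade M (d + e)) \<and>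
     (\<forall>a\<in>carrier A. \<forall>m\<in>carrier M.
        del M (act M a m) = act M (del A a) m \<oplus>\<^bsub>M\<^esub> act M a (del M m))"

definition left_pdg_module ::
  "nat \<Rightarrow> ('k::field, 'a, 'z) pcomplex_scheme \<Rightarrow> ('k, 'a, 'v) pdg_module \<Rightarrow> bool" where
  "left_pdg_module p A M \<longleftrightarrow> pdg_action p A M \<and>
     (\<forall>a\<in>carrier A. \<forall>b\<in>carrier A. \<forall>m\<in>carrier M. act M (a \<otimes>\<^bsub>A\<^esub> b) m = act M a (act M b m))"

definition right_pdg_module ::
  "nat \<Rightarrow> ('k::field, 'a, 'z) pcomplex_scheme \<Rightarrow> ('k, 'a, 'v) pdg_module \<Rightarrow> bool" where
  "right_pdg_module p A M \<longleftrightarrow> pdg_action p A M \<and>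
     (\<forall>a\<in>carrier A. \<forall>b\<in>carrier A. \<forall>m\<in>carrier M. act M (a \<otimes>\<^bsub>A\<^esub> b) m = act M b (act M a m))"

definition pdg_hom ::
  "('k::field, 'a, 'z) pcomplex_scheme \<Rightarrow> ('k, 'a, 'v) pdg_module \<Rightarrow> ('k, 'a, 'w) pdg_module
     \<Rightarrow> ('v \<Rightarrow> 'w) \<Rightarrow> bool" where
  "pdg_hom A M N f \<longleftrightarrow> pcomplex_hom M N f \<and>
     (\<forall>a\<in>carrier A. \<forall>m\<in>carrier M. f (act M a m) = act N a (f m))"

definition pdg_isomorphic ::
  "('k::field, 'a, 'z) pcomplex_scheme \<Rightarrow> ('k, 'a, 'v) pdg_module \<Rightarrow> ('k, 'a, 'w) pdg_module
     \<Rightarrow> bool" where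
  "pdg_isomorphic A M N \<longleftrightarrow>
     (\<exists>f g. pdg_hom A M N f \<and> pdg_hom A N M g \<and>
        (\<forall>x\<in>carrier M. g (f x) = x) \<and> (\<forall>y\<in>carrier N. f (g y) = y))"

definition pdg_quasi_iso ::
  "nat \<Rightarrow> ('k::field, 'a, 'z) pcomplex_scheme \<Rightarrow> ('k, 'a, 'v) pdg_module
     \<Rightarrow> ('k, 'a, 'w) pdg_module \<Rightarrow> ('v \<Rightarrow> 'w) \<Rightarrow> bool" where
  "pdg_quasi_iso p A M N f \<longleftrightarrow> pdg_hom A M N f \<and> stable_iso p M N f"

section \<open>The derived category\<close>

text \<open>
  \<open>\<D>(A)\<close> is the localisation of the category of \<open>p\<close>-DG modules at the quasi-isomorphisms, in
  the usual presentation: morphisms are words in morphisms and formal inverses of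
  quasi-isomorphisms, composed by concatenation (leftmost letter applied first), modulo the
  congruence generated by composition, identities and inverses. The predicate \<open>ob\<close> selects
  left or right \<open>p\<close>-DG modules. \<open>Mor M f N\<close> is a morphism \<open>f : M \<rightarrow> N\<close>; \<open>Inv M s N\<close> is the
  formal inverse \<open>N \<rightarrow> M\<close> of a quasi-isomorphism \<open>s : M \<rightarrow> N\<close>. All objects share the
  carrier type \<open>'v\<close>; an isomorphism over this class of modules remains one in the
  localisation of any larger class.
\<close>

datatype ('m, 'f) letter = Mor 'm 'f 'm | Inv 'm 'f 'm

inductive derived_word ::
  "(('k::field, 'a, 'v) pdg_module \<Rightarrow> bool) \<Rightarrow> nat \<Rightarrow> ('k, 'a, 'z) pcomplex_scheme
     \<Rightarrow> ('k, 'a, 'v) pdg_module \<Rightarrow> (('k, 'a, 'v) pdg_module, 'v \<Rightarrow> 'v) letter list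
     \<Rightarrow> ('k, 'a, 'v) pdg_module \<Rightarrow> bool"
  for ob :: "('k, 'a, 'v) pdg_module \<Rightarrow> bool" and p :: nat and A :: "('k, 'a, 'z) pcomplex_scheme"
where
  word_nil: "ob M \<Longrightarrow> derived_word ob p A M [] M"
| word_mor: "\<lbrakk>ob M; ob N; pdg_hom A M N f; derived_word ob p A N u P\<rbrakk>
    \<Longrightarrow> derived_word ob p A M (Mor M f N # u) P"
| word_inv: "\<lbrakk>ob M; ob N; pdg_quasi_iso p A M N s; derived_word ob p A M u P\<rbrakk>
    \<Longrightarrow> derived_word ob p A N (Inv M s N # u) P"

inductive derived_eq ::
  "(('k::field, 'a, 'v) pdg_module \<Rightarrow> bool) \<Rightarrow> nat \<Rightarrow> ('k, 'a, 'z) pcomplex_scheme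
     \<Rightarrow> ('k, 'a, 'v) pdg_module \<Rightarrow> ('k, 'a, 'v) pdg_module
     \<Rightarrow> (('k, 'a, 'v) pdg_module, 'v \<Rightarrow> 'v) letter list
     \<Rightarrow> (('k, 'a, 'v) pdg_module, 'v \<Rightarrow> 'v) letter list \<Rightarrow> bool"
  for ob :: "('k, 'a, 'v) pdg_module \<Rightarrow> bool" and p :: nat and A :: "('k, 'a, 'z) pcomplex_scheme"
where
  eq_refl: "derived_word ob p A M u N \<Longrightarrow> derived_eq ob p A M N u u"
| eq_sym: "derived_eq ob p A M N u v \<Longrightarrow> derived_eq ob p A M N v u"
| eq_trans: "\<lbrakk>derived_eq ob p A M N u v; derived_eq ob p A M N v w\<rbrakk>
    \<Longrightarrow> derived_eq ob p A M N u w"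
| eq_context: "\<lbrakk>derived_word ob p A L x M; derived_eq ob p A M N u v; derived_word ob p A N y P\<rbrakk>
    \<Longrightarrow> derived_eq ob p A L P (x @ u @ y) (x @ v @ y)"
| eq_id: "\<lbrakk>ob M; pdg_hom A M M f; \<forall>x\<in>carrier M. f x = x\<rbrakk>
    \<Longrightarrow> derived_eq ob p A M M [Mor M f M] []"
| eq_comp: "\<lbrakk>ob M; ob N; ob P; pdg_hom A M N f; pdg_hom A N P g; pdg_hom A M P h;
      \<forall>x\<in>carrier M. h x = g (f x)\<rbrakk>
    \<Longrightarrow> derived_eq ob p A M P [Mor M f N, Mor N g P] [Mor M h P]"
| eq_inv_right: "\<lbrakk>ob M; ob N; pdg_quasi_iso p A M N s\<rbrakk>
    \<Longrightarrow> derived_eq ob p A M M [Mor M s N, Inv M s N] []"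
| eq_inv_left: "\<lbrakk>ob M; ob N; pdg_quasi_iso p A M N s\<rbrakk>
    \<Longrightarrow> derived_eq ob p A N N [Inv M s N, Mor M s N] []"

definition quasi_isomorphic ::
  "(('k::field, 'a, 'v) pdg_module \<Rightarrow> bool) \<Rightarrow> nat \<Rightarrow> ('k, 'a, 'z) pcomplex_scheme
     \<Rightarrow> ('k, 'a, 'v) pdg_module \<Rightarrow> ('k, 'a, 'v) pdg_module \<Rightarrow> bool" where
  "quasi_isomorphic ob p A M N \<longleftrightarrow> ob M \<and> ob N \<and>
     (\<exists>u v. derived_word ob p A M u N \<and> derived_word ob p A N v M \<and>
        derived_eq ob p A M M (u @ v) [] \<and> derived_eq ob p A N N (v @ u) [])"

section \<open>Finite cell modules\<close>

definition shift :: "int \<Rightarrow> ('k, 'a, 'v) pdg_module \<Rightarrow> ('k, 'a, 'v) pdg_module" where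
  "shift l M = M\<lparr>grade := \<lambda>d. grade M (d - l)\<rparr>"

definition restrict_module :: "('k, 'a, 'v) pdg_module \<Rightarrow> 'v set \<Rightarrow> ('k, 'a, 'v) pdg_module" where
  "restrict_module M S = M\<lparr>carrier := S, grade := \<lambda>d. grade M d \<inter> S\<rparr>"

definition quotient_module ::
  "('k, 'a, 'v) pdg_module \<Rightarrow> 'v set \<Rightarrow> ('k, 'a, 'v set) pdg_module" where
  "quotient_module M S =
     \<lparr>carrier = a_rcosets\<^bsub>M\<^esub> S, monoid.mult = undefined, one = undefined, zero = S, add = set_add M,
      module.smult = (\<lambda>c Y. \<Union>x\<in>Y. S +>\<^bsub>M\<^esub> (c \<odot>\<^bsub>M\<^esub> x)),
      grade = (\<lambda>d. (\<lambda>x. S +>\<^bsub>M\<^esub> x) ` grade M d),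
      del = (\<lambda>Y. \<Union>x\<in>Y. S +>\<^bsub>M\<^esub> del M x),
      act = (\<lambda>a Y. \<Union>x\<in>Y. S +>\<^bsub>M\<^esub> act M a x)\<rparr>"

text \<open>
  \<open>P j\<close>, for \<open>j \<in> J\<close>, are the indecomposable cells. A subset is a \<open>p\<close>-DG submodule when it is
  itself a \<open>p\<close>-DG module under the restricted structure, which includes being homogeneous.
\<close>

definition finite_cell_module ::
  "(('k::field, 'a, 'v) pdg_module \<Rightarrow> bool) \<Rightarrow> ('k, 'a, 'z) pcomplex_scheme
     \<Rightarrow> ('j \<Rightarrow> ('k, 'a, 'a) pdg_module) \<Rightarrow> 'j set \<Rightarrow> ('k, 'a, 'v) pdg_module \<Rightarrow> bool" where
  "finite_cell_module ob A P J M \<longleftrightarrow> ob M \<and>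
     (\<exists>N F. F 0 = {\<zero>\<^bsub>M\<^esub>} \<and> F N = carrier M \<and>
        (\<forall>t\<le>N. F t \<subseteq> carrier M \<and> ob (restrict_module M (F t))) \<and>
        (\<forall>t<N. F t \<subseteq> F (Suc t) \<and>
           (\<exists>j\<in>J. \<exists>l. pdg_isomorphic A
              (quotient_module (restrict_module M (F (Suc t))) (F t)) (shift l (P j)))))"

definition left_projective ::
  "('k, 'a, 'z) pcomplex_scheme \<Rightarrow> 'a \<Rightarrow> ('k, 'a, 'a) pdg_module" where
  "left_projective A e =
     \<lparr>carrier = {a \<otimes>\<^bsub>A\<^esub> e | a. a \<in> carrier A}, monoid.mult = undefined, one = undefined,
      zero = \<zero>\<^bsub>A\<^esub>, add = add A, module.smult = module.smult A,
      grade = (\<lambda>d. grade A d \<inter> {a \<otimes>\<^bsub>A\<^esub> e | a. a \<in> carrier A}), del = del A,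
      act = (\<lambda>a x. a \<otimes>\<^bsub>A\<^esub> x)\<rparr>"

definition right_projective ::
  "('k, 'a, 'z) pcomplex_scheme \<Rightarrow> 'a \<Rightarrow> ('k, 'a, 'a) pdg_module" where
  "right_projective A e =
     \<lparr>carrier = {e \<otimes>\<^bsub>A\<^esub> a | a. a \<in> carrier A}, monoid.mult = undefined, one = undefined,
      zero = \<zero>\<^bsub>A\<^esub>, add = add A, module.smult = module.smult A,
      grade = (\<lambda>d. grade A d \<inter> {e \<otimes>\<^bsub>A\<^esub> a | a. a \<in> carrier A}), del = del A,
      act = (\<lambda>a x. x \<otimes>\<^bsub>A\<^esub> a)\<rparr>"

text \<open>
  The direct sum of the shifted projectives \<open>A e(g){wt g}\<close> over generators \<open>g \<in> G\<close>. An
  element is its family of coordinates, extended by zero off \<open>G\<close>; the generator \<open>g\<close> has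
  coordinate \<open>e g\<close> at \<open>g\<close>. The parameter \<open>dg\<close> prescribes \<open>\<partial>g\<close> as an element of the sum, and
  the Leibniz rule gives \<open>\<partial>(\<Sum> x\<^sub>g g) = \<Sum> \<partial>(x\<^sub>g) g + \<Sum> x\<^sub>g \<partial>g\<close>.
\<close>

definition left_cell_sum ::
  "('k, 'a, 'z) pcomplex_scheme \<Rightarrow> 'g set \<Rightarrow> ('g \<Rightarrow> 'a) \<Rightarrow> ('g \<Rightarrow> int) \<Rightarrow> ('g \<Rightarrow> 'g \<Rightarrow> 'a)
     \<Rightarrow> ('k, 'a, 'g \<Rightarrow> 'a) pdg_module" where
  "left_cell_sum A G e wt dg =
     (let Y = {x. (\<forall>g\<in>G. x g \<in> carrier (left_projective A (e g))) \<and> (\<forall>g. g \<notin> G \<longrightarrow> x g = \<zero>\<^bsub>A\<^esub>)}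
      in \<lparr>carrier = Y, monoid.mult = undefined, one = undefined, zero = (\<lambda>g. \<zero>\<^bsub>A\<^esub>),
          add = (\<lambda>x y g. x g \<oplus>\<^bsub>A\<^esub> y g), module.smult = (\<lambda>c x g. c \<odot>\<^bsub>A\<^esub> x g),
          grade = (\<lambda>d. {x \<in> Y. \<forall>g\<in>G. x g \<in> grade (shift (wt g) (left_projective A (e g))) d}),
          del = (\<lambda>x h. del A (x h) \<oplus>\<^bsub>A\<^esub> finsum A (\<lambda>g. x g \<otimes>\<^bsub>A\<^esub> dg g h) G),
          act = (\<lambda>a x g. a \<otimes>\<^bsub>A\<^esub> x g)\<rparr>)"

definition right_cell_sum ::
  "('k, 'a, 'z) pcomplex_scheme \<Rightarrow> 'g set \<Rightarrow> ('g \<Rightarrow> 'a) \<Rightarrow> ('g \<Rightarrow> int) \<Rightarrow> ('g \<Rightarrow> 'g \<Rightarrow> 'a)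
     \<Rightarrow> ('k, 'a, 'g \<Rightarrow> 'a) pdg_module" where
  "right_cell_sum A G e wt dg =
     (let Y = {x. (\<forall>g\<in>G. x g \<in> carrier (right_projective A (e g))) \<and> (\<forall>g. g \<notin> G \<longrightarrow> x g = \<zero>\<^bsub>A\<^esub>)}
      in \<lparr>carrier = Y, monoid.mult = undefined, one = undefined, zero = (\<lambda>g. \<zero>\<^bsub>A\<^esub>),
          add = (\<lambda>x y g. x g \<oplus>\<^bsub>A\<^esub> y g), module.smult = (\<lambda>c x g. c \<odot>\<^bsub>A\<^esub> x g),
          grade = (\<lambda>d. {x \<in> Y. \<forall>g\<in>G. x g \<in> grade (shift (wt g) (right_projective A (e g))) d}),
          del = (\<lambda>x h. del A (x h) \<oplus>\<^bsub>A\<^esub> finsum A (\<lambda>g. dg g h \<otimes>\<^bsub>A\<^esub> x g) G),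
          act = (\<lambda>a x g. x g \<otimes>\<^bsub>A\<^esub> a)\<rparr>)"

section \<open>The algebra \<open>A\<^sub>n\<^sup>!\<close>\<close>

text \<open>
  A path is the list of vertices it visits, so the trivial path at \<open>i\<close> is \<open>[i]\<close>; elements of
  the path algebra are finitely supported coefficient functions on paths.
\<close>

type_synonym 'k path_comb = "nat list \<Rightarrow>\<^sub>0 'k"

definition quiver_paths :: "nat \<Rightarrow> nat list set" where
  "quiver_paths n = {q. q \<noteq> [] \<and> set q \<subseteq> {1..n} \<and> successively (\<lambda>i j. j = Suc i \<or> i = Suc j) q}"

definition path_scale :: "'k::field \<Rightarrow> 'k path_comb \<Rightarrow> 'k path_comb" where
  "path_scale c f = Poly_Mapping.map ((*) c) f"

definition path_mult :: "'k::field path_comb \<Rightarrow> 'k path_comb \<Rightarrow> 'k path_comb" where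
  "path_mult f g = (\<Sum>q\<in>Poly_Mapping.keys f. \<Sum>r\<in>Poly_Mapping.keys g.
     if last q = hd r
     then Poly_Mapping.single (q @ tl r) (Poly_Mapping.lookup f q * Poly_Mapping.lookup g r)
     else 0)"

definition path_algebra :: "nat \<Rightarrow> 'k::field path_comb ring" where
  "path_algebra n =
     \<lparr>carrier = {f. Poly_Mapping.keys f \<subseteq> quiver_paths n}, monoid.mult = path_mult,
      one = (\<Sum>i\<in>{1..n}. Poly_Mapping.single [i] 1), zero = 0, add = (+)\<rparr>"

definition relations :: "nat \<Rightarrow> 'k::field path_comb set" where
  "relations n =
     {Poly_Mapping.single [i, i - 1, i] 1 - Poly_Mapping.single [i, i + 1, i] 1 | i.
        2 \<le> i \<and> i \<le> n - 1}
     \<union> {Poly_Mapping.single [1, 2, 1] 1}"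

definition relation_ideal :: "nat \<Rightarrow> 'k::field path_comb set" where
  "relation_ideal n = Idl\<^bsub>path_algebra n\<^esub> (relations n)"

definition arrow_del :: "'k::field \<Rightarrow> nat \<Rightarrow> nat \<Rightarrow> 'k path_comb" where
  "arrow_del lam i j = Poly_Mapping.single [i, j, i, j] (if j = Suc i then lam else 1 - lam)"

fun path_del :: "'k::field \<Rightarrow> nat list \<Rightarrow> 'k path_comb" where
  "path_del lam [] = 0"
| "path_del lam [i] = 0"
| "path_del lam (i # j # q) =
     path_mult (arrow_del lam i j) (Poly_Mapping.single (j # q) 1)
     + path_mult (Poly_Mapping.single [i, j] 1) (path_del lam (j # q))"

definition path_algebra_del :: "'k::field \<Rightarrow> 'k path_comb \<Rightarrow> 'k path_comb" where
  "path_algebra_del lam f =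
     (\<Sum>q\<in>Poly_Mapping.keys f. path_scale (Poly_Mapping.lookup f q) (path_del lam q))"

abbreviation Ashriek_ring :: "nat \<Rightarrow> 'k::field path_comb set ring" where
  "Ashriek_ring n \<equiv> path_algebra n Quot relation_ideal n"

text \<open>\<open>(A\<^sub>n\<^sup>!, \<partial>\<^sub>\<lambda>)\<close>: the grading by path length and the derivation are induced on cosets.\<close>

definition Ashriek :: "nat \<Rightarrow> 'k::field \<Rightarrow> ('k, 'k path_comb set) pcomplex" where
  "Ashriek n lam =
     \<lparr>carrier = carrier (Ashriek_ring n), monoid.mult = monoid.mult (Ashriek_ring n),
      one = monoid.one (Ashriek_ring n), zero = ring.zero (Ashriek_ring n), add = ring.add (Ashriek_ring n),
      module.smult = (\<lambda>c Y. \<Union>f\<in>Y. relation_ideal n +>\<^bsub>path_algebra n\<^esub> path_scale c f),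
      grade = (\<lambda>d. {relation_ideal n +>\<^bsub>path_algebra n\<^esub> f | f. f \<in> carrier (path_algebra n) \<and>
                      (\<forall>q\<in>Poly_Mapping.keys f. int (length q) - 1 = d)}),
      del = (\<lambda>Y. \<Union>f\<in>Y. relation_ideal n +>\<^bsub>path_algebra n\<^esub> path_algebra_del lam f)\<rparr>"

text \<open>
  The class of \<open>(i\<^sub>1|\<dots>|i\<^sub>r)\<close>. Lists that are not paths give \<open>0\<close>; in particular every list that
  visits the vertex \<open>0\<close> does, which implements the convention \<open>P\<^sub>0 = 0\<close>.
\<close>

definition path_class :: "nat \<Rightarrow> nat list \<Rightarrow> 'k::field path_comb set" where
  "path_class n q =
     (if q \<in> quiver_paths n
      then relation_ideal n +>\<^bsub>path_algebra n\<^esub> Poly_Mapping.single q 1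
      else \<zero>\<^bsub>Ashriek_ring n\<^esub>)"

section \<open>The simple modules and the cell modules \<open>X\<^sub>i\<close>\<close>

text \<open>The generators \<open>v\<close>, \<open>a\<^sub>k\<close>, \<open>b\<^sub>k\<close>, \<open>w\<close>, respectively their primed versions.\<close>

datatype gen = GenV | GenA nat | GenB nat | GenW

definition gens :: "nat \<Rightarrow> gen set" where
  "gens p = {GenV, GenW} \<union> GenA ` {1..p - 1} \<union> GenB ` {1..p - 1}"

fun gen_vertex :: "nat \<Rightarrow> gen \<Rightarrow> nat" where
  "gen_vertex i GenV = i"
| "gen_vertex i (GenA k) = i - 1"
| "gen_vertex i (GenB k) = i + 1"
| "gen_vertex i GenW = i"

fun gen_degree :: "nat \<Rightarrow> gen \<Rightarrow> int" where
  "gen_degree p GenV = 2 - 2 * int p"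
| "gen_degree p (GenA k) = 1 - 2 * int k"
| "gen_degree p (GenB k) = 1 - 2 * int k"
| "gen_degree p GenW = 0"

text \<open>
  \<open>gterm n q g\<close> is the path \<open>q\<close> times the generator \<open>g\<close>, from the left for left modules and
  from the right for right modules.
\<close>

definition gterm :: "nat \<Rightarrow> nat list \<Rightarrow> gen \<Rightarrow> gen \<Rightarrow> 'k::field path_comb set" where
  "gterm n q g = (\<lambda>h. if h = g then path_class n q else \<zero>\<^bsub>Ashriek_ring n\<^esub>)"

definition gplus ::
  "nat \<Rightarrow> (gen \<Rightarrow> 'k::field path_comb set) \<Rightarrow> (gen \<Rightarrow> 'k path_comb set)
     \<Rightarrow> gen \<Rightarrow> 'k path_comb set" where
  "gplus n x y = (\<lambda>h. x h \<oplus>\<^bsub>Ashriek_ring n\<^esub> y h)"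

definition gminus ::
  "nat \<Rightarrow> (gen \<Rightarrow> 'k::field path_comb set) \<Rightarrow> (gen \<Rightarrow> 'k path_comb set)
     \<Rightarrow> gen \<Rightarrow> 'k path_comb set" where
  "gminus n x y = (\<lambda>h. x h \<ominus>\<^bsub>Ashriek_ring n\<^esub> y h)"

fun left_del0 :: "nat \<Rightarrow> nat \<Rightarrow> nat \<Rightarrow> gen \<Rightarrow> gen \<Rightarrow> 'k::field path_comb set" where
  "left_del0 n p i GenV =
     gminus n (gterm n [i, i - 1] (GenA (p - 1))) (gterm n [i, i + 1] (GenB (p - 1)))"
| "left_del0 n p i (GenA k) =
     (if k = 1 then gterm n [i - 1, i] GenW else gterm n [i - 1] (GenA (k - 1)))"
| "left_del0 n p i (GenB k) =
     gplus n (if k = 1 then gterm n [i + 1, i] GenW else gterm n [i + 1] (GenB (k - 1)))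
             (gterm n [i + 1, i, i - 1] (GenA k))"
| "left_del0 n p i GenW = (\<lambda>h. \<zero>\<^bsub>Ashriek_ring n\<^esub>)"

fun right_del0 :: "nat \<Rightarrow> nat \<Rightarrow> nat \<Rightarrow> gen \<Rightarrow> gen \<Rightarrow> 'k::field path_comb set" where
  "right_del0 n p i GenV =
     gminus n (gterm n [i - 1, i] (GenA (p - 1))) (gterm n [i + 1, i] (GenB (p - 1)))"
| "right_del0 n p i (GenA k) =
     gplus n (if k = 1 then gterm n [i, i - 1] GenW else gterm n [i - 1] (GenA (k - 1)))
             (gterm n [i + 1, i, i - 1] (GenB k))"
| "right_del0 n p i (GenB k) =
     (if k = 1 then gterm n [i, i + 1] GenW else gterm n [i + 1] (GenB (k - 1)))"
| "right_del0 n p i GenW = (\<lambda>h. \<zero>\<^bsub>Ashriek_ring n\<^esub>)"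

fun left_del1 :: "nat \<Rightarrow> nat \<Rightarrow> nat \<Rightarrow> gen \<Rightarrow> gen \<Rightarrow> 'k::field path_comb set" where
  "left_del1 n p i GenV =
     gminus n (gterm n [i, i - 1] (GenA (p - 1))) (gterm n [i, i + 1] (GenB (p - 1)))"
| "left_del1 n p i (GenA k) =
     gplus n (if k = 1 then gterm n [i - 1, i] GenW else gterm n [i - 1] (GenA (k - 1)))
             (gterm n [i - 1, i, i + 1] (GenB k))"
| "left_del1 n p i (GenB k) =
     (if k = 1 then gterm n [i + 1, i] GenW else gterm n [i + 1] (GenB (k - 1)))"
| "left_del1 n p i GenW = (\<lambda>h. \<zero>\<^bsub>Ashriek_ring n\<^esub>)"

fun right_del1 :: "nat \<Rightarrow> nat \<Rightarrow> nat \<Rightarrow> gen \<Rightarrow> gen \<Rightarrow> 'k::field path_comb set" where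
  "right_del1 n p i GenV =
     gminus n (gterm n [i - 1, i] (GenA (p - 1))) (gterm n [i + 1, i] (GenB (p - 1)))"
| "right_del1 n p i (GenA k) =
     (if k = 1 then gterm n [i, i - 1] GenW else gterm n [i - 1] (GenA (k - 1)))"
| "right_del1 n p i (GenB k) =
     gplus n (if k = 1 then gterm n [i, i + 1] GenW else gterm n [i + 1] (GenB (k - 1)))
             (gterm n [i - 1, i, i + 1] (GenA k))"
| "right_del1 n p i GenW = (\<lambda>h. \<zero>\<^bsub>Ashriek_ring n\<^esub>)"

definition left_X ::
  "nat \<Rightarrow> nat \<Rightarrow> nat \<Rightarrow> 'k::field \<Rightarrow> (gen \<Rightarrow> gen \<Rightarrow> 'k path_comb set)
     \<Rightarrow> ('k, 'k path_comb set, gen \<Rightarrow> 'k path_comb set) pdg_module" where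
  "left_X n p i lam dg =
     left_cell_sum (Ashriek n lam) (gens p) (\<lambda>g. path_class n [gen_vertex i g]) (gen_degree p) dg"

definition right_X ::
  "nat \<Rightarrow> nat \<Rightarrow> nat \<Rightarrow> 'k::field \<Rightarrow> (gen \<Rightarrow> gen \<Rightarrow> 'k path_comb set)
     \<Rightarrow> ('k, 'k path_comb set, gen \<Rightarrow> 'k path_comb set) pdg_module" where
  "right_X n p i lam dg =
     right_cell_sum (Ashriek n lam) (gens p) (\<lambda>g. path_class n [gen_vertex i g]) (gen_degree p) dg"

text \<open>
  The coefficient of \<open>(i)\<close>. It does not depend on the representative, since all relations have
  degree two.
\<close>

definition idem_coeff :: "nat \<Rightarrow> 'k::field path_comb set \<Rightarrow> 'k" where
  "idem_coeff i Y = Poly_Mapping.lookup (SOME f. f \<in> Y) [i]"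

text \<open>
  \<open>L\<^sub>i\<close> and \<open>\<^sub>iL\<close> are the one-dimensional space with \<open>a \<in> A\<^sub>n\<^sup>!\<close> acting by the scalar \<open>idem_coeff i a\<close>; the same
  record serves as a left and as a right module. Objects of one derived category share a carrier
  type, so the line is realised in the type of elements of \<open>X\<^sub>i\<close>, as the span of the family
  with \<open>(i)\<close> in the slot \<open>w\<close>.
\<close>

definition simple_module ::
  "nat \<Rightarrow> nat \<Rightarrow> 'k::field \<Rightarrow> ('k, 'k path_comb set, gen \<Rightarrow> 'k path_comb set) pdg_module" where
  "simple_module n i lam =
     (let A = Ashriek n lam;
          sc = (\<lambda>c x g. c \<odot>\<^bsub>A\<^esub> x g);
          L = {sc c (gterm n [i] GenW) | c. True}
      in \<lparr>carrier = L, monoid.mult = undefined, one = undefined, zero = (\<lambda>g. \<zero>\<^bsub>A\<^esub>),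
          add = (\<lambda>x y g. x g \<oplus>\<^bsub>A\<^esub> y g), module.smult = sc,
          grade = (\<lambda>d. if d = 0 then L else {\<lambda>g. \<zero>\<^bsub>A\<^esub>}),
          del = (\<lambda>x g. \<zero>\<^bsub>A\<^esub>),
          act = (\<lambda>a x. sc (idem_coeff i a) x)\<rparr>)"

abbreviation left_P :: "nat \<Rightarrow> 'k::field \<Rightarrow> nat \<Rightarrow> ('k, 'k path_comb set, 'k path_comb set) pdg_module" where
  "left_P n lam j \<equiv> left_projective (Ashriek n lam) (path_class n [j])"

abbreviation right_P :: "nat \<Rightarrow> 'k::field \<Rightarrow> nat \<Rightarrow> ('k, 'k path_comb set, 'k path_comb set) pdg_module" where
  "right_P n lam j \<equiv> right_projective (Ashriek n lam) (path_class n [j])"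

end

theory Submission
  imports Defs "HOL-Library.Function_Algebras"
begin

text \<open>
  Modulo the relations, a path is determined by its first vertex \<open>h\<close>, its last vertex \<open>l\<close> and the
  number \<open>D\<close> of its steps in one chosen direction, and its class vanishes exactly when \<open>D\<close> is at
  least \<open>l\<close> for the direction up, or \<open>h\<close> for the direction down (\<open>cutoff\<close>). The direction is recorded by a Boolean \<open>u\<close>: up for
  \<open>\<lambda> = 1\<close>, down for \<open>\<lambda> = 0\<close>. These triples are coordinates on the algebra in which concatenation
  adds \<open>D\<close> and the derivation is the weighted shift \<open>D \<mapsto> D + 1\<close> with weight \<open>D\<close>, because each
  step in the chosen direction contributes one. All that the proof needs of the algebra is collected
  in the locale \<open>coord_algebra\<close>. Right modules are left modules over the opposite algebra, which
  satisfies the same axioms with the opposite \<open>u\<close>. So the four cases of the theorem become two,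
  and these differ only by exchanging the generators \<open>a\<^sub>k\<close> and \<open>b\<^sub>k\<close> and by a sign at \<open>v\<close>.

  The cell module is arranged in two strands of length \<open>p\<close>: a main one, which starts with \<open>w\<close>, and
  another one, which ends with \<open>v\<close>. Its differential is the weighted shift plus one step down
  each strand plus a map from the second strand to the first. A change of coordinates
  (\<open>untwist_del\<close>) removes that last map; the remaining two summands commute, so the binomial
  theorem in characteristic \<open>p\<close> gives \<open>\<partial>\<^sup>p = 0\<close> (\<open>strand_del_pow_zero\<close>). The differential of a
  generator involves only generators that come earlier, so adding the generators one at a
  time filters the module by shifted projectives (\<open>X_finite_cell\<close>).

  The quasi-isomorphism onto the simple module is the coefficient of \<open>(i) w\<close>. All the other
  basis vectors split into chains of length \<open>p\<close> on which \<open>\<partial>\<close> is one step along the chain, up to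
  terms whose \<open>D\<close> is smaller (\<open>strand_map_triangular\<close>). On a single chain the map \<open>h\<close> that sends
  one end to the other satisfies \<open>\<Sum> \<partial>\<^sup>j h \<partial>\<^bsup>p-1-j\<^esup> = id\<close>, and a Neumann series corrects it for the
  lower terms (\<open>triangular_contraction\<close>). A map of the form \<open>\<Sum> \<partial>\<^sup>j h \<partial>\<^bsup>p-1-j\<^esup>\<close> factors
  through a free \<open>p\<close>-complex (\<open>stably_zero_homotopy\<close>), hence the projection is invertible in the
  stable category.
\<close>

section \<open>The path algebra\<close>

text \<open>
  Everything in sight is linear in the combination of paths, so identities are checked on
  single paths.
\<close>

lemma path_comb_induct [consumes 1, case_names zero single add]:
  fixes f :: "'a \<Rightarrow>\<^sub>0 'k::comm_monoid_add"
  assumes "Poly_Mapping.keys f \<subseteq> S"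
    and "P 0"
    and "\<And>q c. q \<in> S \<Longrightarrow> P (Poly_Mapping.single q c)"
    and "\<And>f g. Poly_Mapping.keys f \<subseteq> S \<Longrightarrow> Poly_Mapping.keys g \<subseteq> S \<Longrightarrow> P f \<Longrightarrow> P g \<Longrightarrow> P (f + g)"
  shows "P f"
proof -
  have eq: "f = (\<Sum>q\<in>Poly_Mapping.keys f. Poly_Mapping.single q (Poly_Mapping.lookup f q))"
    by (rule poly_mapping_eqI) (auto simp: lookup_sum lookup_single when_def in_keys_iff)
  have "Poly_Mapping.keys (\<Sum>q\<in>K. Poly_Mapping.single q (Poly_Mapping.lookup f q)) \<subseteq> S
      \<and> P (\<Sum>q\<in>K. Poly_Mapping.single q (Poly_Mapping.lookup f q))"
    if "finite K" "K \<subseteq> S" for K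
    using that
  proof (induction K rule: finite_induct)
    case (insert q K)
    have s: "Poly_Mapping.keys (Poly_Mapping.single q (Poly_Mapping.lookup f q)) \<subseteq> S"
      using insert.prems by auto
    have "Poly_Mapping.keys (\<Sum>q\<in>K. Poly_Mapping.single q (Poly_Mapping.lookup f q)) \<subseteq> S"
      "P (\<Sum>q\<in>K. Poly_Mapping.single q (Poly_Mapping.lookup f q))"
      using insert by auto
    with s show ?case
      using insert.hyps insert.prems keys_add[of "Poly_Mapping.single q (Poly_Mapping.lookup f q)"
          "\<Sum>q\<in>K. Poly_Mapping.single q (Poly_Mapping.lookup f q)"]
        assms(4)[OF s _ assms(3)[of q "Poly_Mapping.lookup f q"]]
      by auto
  qed (use assms(2) in simp)
  with eq assms(1) show ?thesis by (metis finite_keys)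
qed

lemma keys_add_subset:
  "Poly_Mapping.keys f \<subseteq> S \<Longrightarrow> Poly_Mapping.keys g \<subseteq> S \<Longrightarrow> Poly_Mapping.keys (f + g) \<subseteq> S"
  using keys_add[of f g] by blast

lemma path_mult_single:
  "path_mult (Poly_Mapping.single q c) (Poly_Mapping.single r d) =
     (if last q = hd r then Poly_Mapping.single (q @ tl r) (c * d) else 0)"
  by (auto simp: path_mult_def)

lemma path_mult_zero [simp]: "path_mult 0 g = 0" "path_mult f 0 = 0"
  by (auto simp: path_mult_def)

lemma path_mult_add_left: "path_mult (f + f') g = path_mult f g + path_mult f' g"
proof -
  define F where "F q c = (\<Sum>r\<in>Poly_Mapping.keys g. if last q = hd r
     then Poly_Mapping.single (q @ tl r) (c * Poly_Mapping.lookup g r) else 0)" for q c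
  have "F q 0 = 0" for q
    by (simp add: F_def cong: if_cong)
  moreover have "F q (c + d) = F q c + F q d" for q c d
    unfolding F_def sum.distrib[symmetric]
    by (rule sum.cong) (simp_all add: single_add distrib_right)
  ultimately have "(\<Sum>q\<in>Poly_Mapping.keys (f + f'). F q (Poly_Mapping.lookup (f + f') q)) =
      (\<Sum>q\<in>Poly_Mapping.keys f. F q (Poly_Mapping.lookup f q)) +
      (\<Sum>q\<in>Poly_Mapping.keys f'. F q (Poly_Mapping.lookup f' q))"
    by (rule setsum_keys_plus_distrib)
  then show ?thesis by (simp only: path_mult_def F_def)
qed

lemma path_mult_add_right: "path_mult f (g + g') = path_mult f g + path_mult f g'"
proof -
  have "(\<Sum>r\<in>Poly_Mapping.keys (g + g'). if last q = hd r
      then Poly_Mapping.single (q @ tl r) (c * Poly_Mapping.lookup (g + g') r) else 0) =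
    (\<Sum>r\<in>Poly_Mapping.keys g. if last q = hd r
      then Poly_Mapping.single (q @ tl r) (c * Poly_Mapping.lookup g r) else 0) +
    (\<Sum>r\<in>Poly_Mapping.keys g'. if last q = hd r
      then Poly_Mapping.single (q @ tl r) (c * Poly_Mapping.lookup g' r) else 0)" for q and c :: 'a
    using setsum_keys_plus_distrib[of "\<lambda>r d. if last q = hd r
      then Poly_Mapping.single (q @ tl r) (c * d) else 0" g g']
    by (simp add: single_add distrib_left cong: if_cong)
  then show ?thesis by (simp only: path_mult_def sum.distrib)
qed

lemma path_scale_add: "path_scale c (f + g) = path_scale c f + path_scale c g"
  and path_scale_single: "path_scale c (Poly_Mapping.single q d) = Poly_Mapping.single q (c * d)"
  and path_scale_zero [simp]: "path_scale c 0 = 0"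
  and lookup_path_scale: "Poly_Mapping.lookup (path_scale c f) q = c * Poly_Mapping.lookup f q"
proof -
  have *: "Poly_Mapping.lookup (path_scale c f) q = c * Poly_Mapping.lookup f q" for f q
    unfolding path_scale_def by transfer (auto simp: when_def)
  show "path_scale c (f + g) = path_scale c f + path_scale c g"
    by (rule poly_mapping_eqI) (simp add: * lookup_add distrib_left)
  show "path_scale c (Poly_Mapping.single q d) = Poly_Mapping.single q (c * d)"
    by (rule poly_mapping_eqI) (simp add: * lookup_single when_def)
  show "path_scale c 0 = 0"
    by (rule poly_mapping_eqI) (simp add: *)
  show "Poly_Mapping.lookup (path_scale c f) q = c * Poly_Mapping.lookup f q" by (rule *)
qed

lemma keys_path_scale: "Poly_Mapping.keys (path_scale c f) \<subseteq> Poly_Mapping.keys f"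
  by (auto simp: in_keys_iff lookup_path_scale)

lemma Nil_no_path [simp]: "[] \<notin> quiver_paths n"
  by (simp add: quiver_paths_def)

lemma quiver_pathsD:
  assumes "q \<in> quiver_paths n"
  shows "q \<noteq> []" "hd q \<in> {1..n}" "last q \<in> {1..n}"
  using assms last_in_set[of q] hd_in_set[of q] by (auto simp: quiver_paths_def simp del: last_in_set hd_in_set)

lemma quiver_paths_Cons:
  "i # q \<in> quiver_paths n \<longleftrightarrow> i \<in> {1..n} \<and>
     (q = [] \<or> q \<in> quiver_paths n \<and> (hd q = Suc i \<or> i = Suc (hd q)))"
  by (auto simp: quiver_paths_def successively_Cons)

lemma quiver_paths_glue:
  assumes "q \<in> quiver_paths n" "r \<in> quiver_paths n" "last q = hd r"
  shows "q @ tl r \<in> quiver_paths n"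
  using assms by (cases r) (auto simp: quiver_paths_def successively_append_iff successively_Cons)

lemma hd_last_glue:
  assumes "q \<noteq> []" "r \<noteq> []" "last q = hd r"
  shows "hd (q @ tl r) = hd q" "last (q @ tl r) = last r"
  using assms by (cases r; auto simp: last_append)+

lemma path_mult_closed:
  assumes "Poly_Mapping.keys f \<subseteq> quiver_paths n" "Poly_Mapping.keys g \<subseteq> quiver_paths n"
  shows "Poly_Mapping.keys (path_mult f g) \<subseteq> quiver_paths n"
  using assms(1)
proof (induction rule: path_comb_induct)
  case (single q c)
  from assms(2) show ?case
  proof (induction rule: path_comb_induct)
    case (single r d)
    then show ?case using quiver_paths_glue[OF \<open>q \<in> quiver_paths n\<close> \<open>r \<in> quiver_paths n\<close>]
      by (simp add: path_mult_single)
  qed (simp_all add: path_mult_add_right keys_add_subset)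
qed (simp_all add: path_mult_add_left keys_add_subset)

lemma path_mult_assoc:
  assumes "Poly_Mapping.keys f \<subseteq> quiver_paths n" "Poly_Mapping.keys g \<subseteq> quiver_paths n"
    "Poly_Mapping.keys h \<subseteq> quiver_paths n"
  shows "path_mult (path_mult f g) h = path_mult f (path_mult g h)"
  using assms(1)
proof (induction rule: path_comb_induct)
  case (single q c)
  from assms(2) show ?case
  proof (induction rule: path_comb_induct)
    case (single r d)
    from assms(3) show ?case
    proof (induction rule: path_comb_induct)
      case (single s e)
      then have ne: "q \<noteq> []" "r \<noteq> []" "s \<noteq> []"
        using \<open>q \<in> quiver_paths n\<close> \<open>r \<in> quiver_paths n\<close> by auto
      then have "(q @ tl r) @ tl s = q @ tl (r @ tl s)" by (cases r) auto
      with ne show ?case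
        by (simp add: path_mult_single hd_last_glue mult.assoc)
    qed (auto simp: path_mult_add_right)
  qed (auto simp: path_mult_add_right path_mult_add_left)
qed (auto simp: path_mult_add_left)

abbreviation path_one :: "nat \<Rightarrow> 'k::field path_comb" where
  "path_one n \<equiv> (\<Sum>i\<in>{1..n}. Poly_Mapping.single [i] 1)"

lemma path_mult_sum_left: "path_mult (sum F S) g = (\<Sum>x\<in>S. path_mult (F x) g)"
  by (induction S rule: infinite_finite_induct) (auto simp: path_mult_add_left)

lemma path_mult_sum_right: "path_mult g (sum F S) = (\<Sum>x\<in>S. path_mult g (F x))"
  by (induction S rule: infinite_finite_induct) (auto simp: path_mult_add_right)

lemma path_one_left:
  assumes "Poly_Mapping.keys f \<subseteq> quiver_paths n"
  shows "path_mult (path_one n) f = f"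
  using assms
proof (induction rule: path_comb_induct)
  case (single q c)
  have "path_mult (path_one n) (Poly_Mapping.single q c) =
      (\<Sum>i\<in>{1..n}. if i = hd q then Poly_Mapping.single q c else 0)"
    using single by (subst path_mult_sum_left, intro sum.cong)
      (auto simp: path_mult_single quiver_pathsD(1))
  with quiver_pathsD[OF single] show ?case by simp
qed (auto simp: path_mult_add_right)

lemma path_one_right:
  assumes "Poly_Mapping.keys f \<subseteq> quiver_paths n"
  shows "path_mult f (path_one n) = f"
  using assms
proof (induction rule: path_comb_induct)
  case (single q c)
  have "path_mult (Poly_Mapping.single q c) (path_one n) =
      (\<Sum>i\<in>{1..n}. if i = last q then Poly_Mapping.single q c else 0)"
    using single by (subst path_mult_sum_right, intro sum.cong)
      (auto simp: path_mult_single quiver_pathsD(1))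
  with quiver_pathsD[OF single] show ?case by simp
qed (auto simp: path_mult_add_left)

lemma path_one_closed: "Poly_Mapping.keys (path_one n :: 'k::field path_comb) \<subseteq> quiver_paths n"
proof -
  have "Poly_Mapping.lookup (path_one n :: 'k path_comb) q = 0" if "q \<notin> quiver_paths n" for q
    using that by (auto simp: lookup_sum lookup_single when_def quiver_paths_def intro!: sum.neutral split: if_splits)
  then show ?thesis by (auto simp: in_keys_iff)
qed

lemma path_algebra_simps [simp]:
  "carrier (path_algebra n) = {f. Poly_Mapping.keys f \<subseteq> quiver_paths n}"
  "monoid.mult (path_algebra n) = path_mult" "one (path_algebra n) = path_one n"
  "zero (path_algebra n) = 0" "add (path_algebra n) = (+)"
  by (auto simp: path_algebra_def)

lemma path_algebra_ring: "ring (path_algebra n :: 'k::field path_comb ring)"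
proof (rule ringI)
  show "abelian_group (path_algebra n :: 'k path_comb ring)"
  proof (rule abelian_groupI)
    fix f :: "'k path_comb" assume "f \<in> carrier (path_algebra n)"
    then show "\<exists>g\<in>carrier (path_algebra n). g \<oplus>\<^bsub>path_algebra n\<^esub> f = \<zero>\<^bsub>path_algebra n\<^esub>"
      by (intro bexI[of _ "- f"]) (auto simp: in_keys_iff)
  qed (simp_all add: keys_add_subset add.assoc add.commute)
  show "monoid (path_algebra n :: 'k path_comb ring)"
    by (rule monoidI)
      (simp_all add: path_mult_closed path_one_closed path_mult_assoc path_one_left path_one_right
        del: One_nat_def)
qed (simp_all add: path_mult_add_left path_mult_add_right)

lemma path_algebra_a_inv:
  "f \<in> carrier (path_algebra n) \<Longrightarrow> \<ominus>\<^bsub>path_algebra n\<^esub> f = - (f :: 'k::field path_comb)"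
proof -
  assume f: "f \<in> carrier (path_algebra n)"
  interpret ring "path_algebra n :: 'k path_comb ring" by (rule path_algebra_ring)
  from f have "- f \<in> carrier (path_algebra n)" by (auto simp: in_keys_iff)
  with f show ?thesis using minus_equality[of "- f" f] by simp
qed

section \<open>Steps in one direction\<close>

text \<open>
  The Boolean selects which steps are counted: those to the next higher vertex, or those to
  the next lower one.
\<close>

fun steps :: "bool \<Rightarrow> nat list \<Rightarrow> nat" where
  "steps u [] = 0"
| "steps u [i] = 0"
| "steps u (i # j # q) = (if (j = Suc i) = u then 1 else 0) + steps u (j # q)"

lemma steps_Cons:
  "q \<noteq> [] \<Longrightarrow> steps u (i # q) = (if (hd q = Suc i) = u then 1 else 0) + steps u q"
  by (cases q) simp_all

lemma steps_append:
  "q \<noteq> [] \<Longrightarrow> steps u (q @ r) = steps u q + steps u (last q # r)"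
  by (induction q) (simp_all add: steps_Cons)

lemma steps_glue:
  assumes "q \<noteq> []" "r \<noteq> []" "last q = hd r"
  shows "steps u (q @ tl r) = steps u q + steps u r"
  using assms by (simp add: steps_append)

lemma steps_length: "q \<noteq> [] \<Longrightarrow> Suc (steps True q + steps False q) = length q"
proof (induction q)
  case (Cons i q)
  then show ?case by (cases "q = []") (simp_all add: steps_Cons)
qed simp

text \<open>
  The difference of the two step counts is the difference of the end points; one count
  therefore determines the other.
\<close>

lemma steps_hd_last:
  assumes "q \<in> quiver_paths n"
  shows "hd q + steps True q = last q + steps False q"
  using assms
proof (induction q)
  case (Cons i q)
  then show ?case
    by (cases "q = []") (auto simp: quiver_paths_Cons steps_Cons)
qed simp

text \<open>
  A path that makes at least as many steps up as its last vertex, or equivalently at least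
  as many steps down as its first vertex, can be moved to one that contains
  \<open>(1|2|1)\<close>.
\<close>

definition cutoff :: "bool \<Rightarrow> nat \<Rightarrow> nat \<Rightarrow> nat" where
  "cutoff u h l = (if u then l else h)"

text \<open>
  The sum of the coefficients of all paths with the given data; paths beyond the cutoff are
  dropped because their classes vanish.
\<close>

definition pcoord :: "bool \<Rightarrow> 'k::field path_comb \<Rightarrow> nat \<Rightarrow> nat \<Rightarrow> nat \<Rightarrow> 'k" where
  "pcoord u f h l D = (\<Sum>q\<in>Poly_Mapping.keys f.
     if hd q = h \<and> last q = l \<and> steps u q = D \<and> D < cutoff u h l then Poly_Mapping.lookup f q else 0)"

lemma pcoord_zero [simp]: "pcoord u 0 h l D = 0"
  by (simp add: pcoord_def)

lemma pcoord_single: "pcoord u (Poly_Mapping.single q c) h l D =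
    (if hd q = h \<and> last q = l \<and> steps u q = D \<and> D < cutoff u h l then c else 0)"
  by (auto simp: pcoord_def)

lemma pcoord_add: "pcoord u (f + g) h l D = pcoord u f h l D + pcoord u g h l D"
  unfolding pcoord_def
  by (subst setsum_keys_plus_distrib[of "\<lambda>q c. if hd q = h \<and> last q = l \<and> steps u q = D \<and>
    D < cutoff u h l then c else 0"]) auto

lemma pcoord_scale: "pcoord u (path_scale c f) h l D = c * pcoord u f h l D"
proof (induction rule: path_comb_induct[OF subset_UNIV])
  show "\<And>q d. q \<in> UNIV \<Longrightarrow> pcoord u (path_scale c (Poly_Mapping.single q d)) h l D =
    c * pcoord u (Poly_Mapping.single q d) h l D" by (simp add: path_scale_single pcoord_single)
qed (auto simp: path_scale_add pcoord_add distrib_left)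

lemma pcoord_sum: "pcoord u (sum F S) h l D = (\<Sum>x\<in>S. pcoord u (F x) h l D)"
  by (induction S rule: infinite_finite_induct) (auto simp: pcoord_add)

lemma cutoff_source:
  assumes "q \<in> quiver_paths n" "steps u q + m < cutoff u (hd q) l"
  shows "m < cutoff u (last q) l"
  using steps_hd_last[OF assms(1)] assms(2) by (cases u) (simp_all add: cutoff_def)

lemma cutoff_target:
  assumes "q \<in> quiver_paths n" "m + steps u q < cutoff u h (last q)"
  shows "m < cutoff u h (hd q)"
  using steps_hd_last[OF assms(1)] assms(2) by (cases u) (simp_all add: cutoff_def)

lemma pcoord_single_mult:
  assumes "q \<in> quiver_paths n" "Poly_Mapping.keys f \<subseteq> quiver_paths n"
  shows "pcoord u (path_mult (Poly_Mapping.single q c) f) h l D =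
    (if h = hd q \<and> steps u q \<le> D \<and> D < cutoff u h l then c * pcoord u f (last q) l (D - steps u q) else 0)"
  using assms(2)
proof (induction rule: path_comb_induct)
  case (single r d)
  have ne: "q \<noteq> []" "r \<noteq> []"
    using quiver_pathsD(1)[OF assms(1)] quiver_pathsD(1)[OF single] by auto
  show ?case
    using ne cutoff_source[OF assms(1), where u = u and m = "steps u r" and l = l]
    by (auto simp: path_mult_single pcoord_single hd_last_glue steps_glue)
qed (auto simp: path_mult_add_right pcoord_add distrib_left)

lemma pcoord_mult_single:
  assumes "q \<in> quiver_paths n" "Poly_Mapping.keys f \<subseteq> quiver_paths n"
  shows "pcoord u (path_mult f (Poly_Mapping.single q c)) h l D =
    (if l = last q \<and> steps u q \<le> D \<and> D < cutoff u h l then pcoord u f h (hd q) (D - steps u q) * c else 0)"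
  using assms(2)
proof (induction rule: path_comb_induct)
  case (single r d)
  have ne: "q \<noteq> []" "r \<noteq> []"
    using quiver_pathsD(1)[OF assms(1)] quiver_pathsD(1)[OF single] by auto
  show ?case
    using ne cutoff_target[OF assms(1), where u = u and m = "steps u r" and h = h]
    by (auto simp: path_mult_single pcoord_single hd_last_glue steps_glue)
qed (auto simp: path_mult_add_left pcoord_add distrib_right)

section \<open>The derivation in coordinates\<close>

lemma arrow_del_of_bool:
  "arrow_del (of_bool u) i j = Poly_Mapping.single [i, j, i, j] (if (j = Suc i) = u then 1 else 0)"
  by (auto simp: arrow_del_def)

lemma path_del_closed:
  assumes "q \<in> quiver_paths n"
  shows "Poly_Mapping.keys (path_del (of_bool u :: 'k::field) q) \<subseteq> quiver_paths n"
  using assms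
proof (induction "of_bool u :: 'k" q rule: path_del.induct)
  case (3 i j q)
  then have jq: "j # q \<in> quiver_paths n" and ij: "[i, j] \<in> quiver_paths n" "[i, j, i, j] \<in> quiver_paths n"
    by (auto simp: quiver_paths_Cons)
  show ?case
    unfolding path_del.simps arrow_del_of_bool
    using jq ij 3(1)[OF jq] by (intro keys_add_subset path_mult_closed) auto
qed auto

lemma pcoord_path_del:
  assumes "q \<in> quiver_paths n"
  shows "pcoord u (path_del (of_bool u :: 'k::field) q) h l D =
    (if hd q = h \<and> last q = l \<and> Suc (steps u q) = D \<and> D < cutoff u h l then of_nat (steps u q) else 0)"
  using assms
proof (induction q arbitrary: h D rule: induct_list012)
  case (3 i j q)
  have jq: "j # q \<in> quiver_paths n" and ij: "[i, j] \<in> quiver_paths n"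
    and step: "j = Suc i \<or> i = Suc j"
    using 3(3) by (auto simp: quiver_paths_Cons)
  define a where "a = (if (j = Suc i) = u then 1 else 0 :: nat)"
  have a: "steps u [i, j] = a" "steps u (i # j # q) = a + steps u (j # q)"
    "steps u (i # j # i # j # q) = a + 1 + steps u (j # q)"
    using step by (auto simp: a_def)
  have first: "path_mult (arrow_del (of_bool u) i j) (Poly_Mapping.single (j # q) (1::'k)) =
      Poly_Mapping.single (i # j # i # j # q) (of_nat a)"
    by (simp add: arrow_del_of_bool path_mult_single a_def)
  have "pcoord u (path_mult (Poly_Mapping.single [i, j] 1) (path_del (of_bool u :: 'k) (j # q))) h l D =
      (if h = i \<and> a \<le> D \<and> D < cutoff u h l then
        if last (j # q) = l \<and> Suc (steps u (j # q)) = D - a \<and> D - a < cutoff u j l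
        then of_nat (steps u (j # q)) else 0 else 0)"
    unfolding pcoord_single_mult[OF ij path_del_closed[OF jq]] a(1) 3(2)[OF jq] by (auto simp del: steps.simps)
  moreover have "Suc (steps u (j # q)) < cutoff u j l" if "a + Suc (steps u (j # q)) < cutoff u i l"
    using cutoff_source[OF ij, where u = u and m = "Suc (steps u (j # q))" and l = l] that
    by (simp only: a list.sel last.simps if_False list.distinct simp_thms if_True)
  ultimately have second: "pcoord u (path_mult (Poly_Mapping.single [i, j] 1) (path_del (of_bool u :: 'k) (j # q))) h l D =
      (if i = h \<and> last (j # q) = l \<and> Suc (a + steps u (j # q)) = D \<and> D < cutoff u h l
       then of_nat (steps u (j # q)) else 0)"
    by (auto simp del: steps.simps)
  show ?case
    unfolding path_del.simps pcoord_add first second pcoord_single a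
    by (cases "a = 0") (auto simp: a_def split: if_splits simp del: steps.simps)
qed auto

lemma path_algebra_del_single: "path_algebra_del lam (Poly_Mapping.single q c) = path_scale c (path_del lam q)"
  by (auto simp: path_algebra_del_def poly_mapping_eq_iff fun_eq_iff lookup_path_scale)

lemma path_algebra_del_add:
  "path_algebra_del lam (f + g) = path_algebra_del lam f + path_algebra_del lam g"
  unfolding path_algebra_del_def
  by (rule setsum_keys_plus_distrib[of "\<lambda>q c. path_scale c (path_del lam q)"])
    (auto simp: poly_mapping_eq_iff fun_eq_iff lookup_path_scale lookup_add distrib_right)

lemma path_algebra_del_zero [simp]: "path_algebra_del lam 0 = 0"
  by (simp add: path_algebra_del_def)

lemma path_algebra_del_closed:
  assumes "Poly_Mapping.keys f \<subseteq> quiver_paths n"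
  shows "Poly_Mapping.keys (path_algebra_del (of_bool u :: 'k::field) f) \<subseteq> quiver_paths n"
  using assms
proof (induction rule: path_comb_induct)
  case (single q c)
  then show ?case using path_del_closed[OF single, of u] keys_path_scale
    unfolding path_algebra_del_single by (meson order_trans)
qed (simp_all add: path_algebra_del_add keys_add_subset)

text \<open>
  For \<open>\<lambda>\<close> equal to 0 or 1 only the steps in the chosen direction are
  differentiated, and each of them is replaced by a detour with one more such step. All the
  resulting paths have the same data, whence the factor \<open>D - 1\<close>.
\<close>

lemma pcoord_del:
  assumes "Poly_Mapping.keys f \<subseteq> quiver_paths n"
  shows "pcoord u (path_algebra_del (of_bool u :: 'k::field) f) h l D =
    (if 0 < D \<and> D < cutoff u h l then of_nat (D - 1) * pcoord u f h l (D - 1) else 0)"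
  using assms
proof (induction rule: path_comb_induct)
  case (single q c)
  then show ?case
    by (auto simp: path_algebra_del_single pcoord_scale pcoord_path_del pcoord_single)
qed (auto simp: path_algebra_del_add pcoord_add distrib_left)

section \<open>The relation ideal\<close>

text \<open>
  The least number of steps in the chosen direction on a path with given end points.
\<close>

definition low :: "bool \<Rightarrow> nat \<Rightarrow> nat \<Rightarrow> nat" where
  "low u h l = (if u then l - h else h - l)"

lemma path_exists:
  assumes "2 \<le> n" "h \<in> {1..n}" "l \<in> {1..n}" "h \<le> l + d" "l \<le> h + d" "even (h + l + d)"
  shows "\<exists>q\<in>quiver_paths n. hd q = h \<and> last q = l \<and> length q = Suc d"
  using assms(2,4,5,6)
proof (induction d arbitrary: h)
  case 0
  then have "h = l" by simp
  with 0 show ?case by (intro bexI[of _ "[h]"]) (simp_all add: quiver_paths_def)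
next
  case (Suc d)
  obtain k where k: "h + l + Suc d = 2 * k" using Suc.prems(4) by (elim evenE)
  have b: "1 \<le> h" "h \<le> n" "1 \<le> l" "l \<le> n" "h \<le> l + Suc d" "l \<le> h + Suc d"
    using Suc.prems assms(3) by simp_all
  have ind: ?case if h': "1 \<le> h'" "h' \<le> n" "h' \<le> l + d" "l \<le> h' + d" "h' + l + d = 2 * m"
    "h' = Suc h \<or> h = Suc h'" for h' m
  proof -
    have "even (h' + l + d)" unfolding h'(5) by simp
    from Suc.IH[OF _ h'(3,4) this] h'(1,2) obtain q
      where q: "q \<in> quiver_paths n" "hd q = h'" "last q = l" "length q = Suc d" by auto
    have "q \<noteq> []" using q by auto
    moreover from this have "h # q \<in> quiver_paths n" using Suc.prems(1) q h'(6) by (simp add: quiver_paths_Cons)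
    ultimately show ?thesis using q by (intro bexI[of _ "h # q"]) simp_all
  qed
  show ?case
  proof (cases "h < l \<or> h = l \<and> h < n")
    case True
    have "Suc h \<le> n" using True b(4) by linarith
    moreover have "d \<noteq> 0" if "h = l" using that Suc.prems(4) by (cases d) auto
    then have "Suc h \<le> l + d" using True by (cases d) auto
    moreover have "l \<le> Suc h + d" using b(6) by linarith
    ultimately     show ?thesis using k by (intro ind[of "Suc h" k]) simp_all
  next
    case False
    then have "l < h \<or> l = h \<and> h = n" using b(2) by linarith
    moreover from this have "2 \<le> h" using b(3) assms(1) by auto
    moreover obtain g where "h = Suc g" using b(1) by (cases h) auto
    ultimately have g: "h = Suc g" "1 \<le> g" "l \<le> h" by auto
    have "d \<noteq> 0" if "h = l" using that Suc.prems(4) by (cases d) auto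
    then have "l \<le> g + d" using g by (cases "h = l"; cases d) auto
    moreover have "g + l + d = 2 * (k - 1)" using g(1) k by simp
    ultimately show ?thesis using g b by (intro ind[of g "k - 1"]) simp_all
  qed
qed

lemma steps_eq_iff_length:
  assumes "q \<in> quiver_paths n" "r \<in> quiver_paths n" "hd q = hd r" "last q = last r"
  shows "steps u q = steps u r \<longleftrightarrow> length q = length r"
proof -
  have "q \<noteq> []" "r \<noteq> []" using assms by auto
  note len = steps_length[OF this(1)] steps_length[OF this(2)]
  show ?thesis
    using assms(3,4) steps_hd_last[OF assms(1)] steps_hd_last[OF assms(2)] len
    by (cases u; simp only:; linarith)
qed

lemma steps_cutoff_iff_length:
  assumes "q \<in> quiver_paths n"
  shows "steps u q < cutoff u (hd q) (last q) \<longleftrightarrow> length q \<le> hd q + last q"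
proof -
  have "q \<noteq> []" using assms by auto
  from steps_hd_last[OF assms(1)] steps_length[OF this] show ?thesis
    by (cases u; simp only: cutoff_def if_True if_False; linarith)
qed

text \<open>
  Below the bound there is no path at all; from the bound on, detours supply every value of
  \<open>D\<close>.
\<close>

lemma path_of_coordinates:
  assumes "2 \<le> n" "h \<in> {1..n}" "l \<in> {1..n}" "low u h l \<le> D"
  shows "\<exists>q\<in>quiver_paths n. hd q = h \<and> last q = l \<and> steps u q = D"
proof -
  define d where "d = (if u then 2 * D + h - l else 2 * D + l - h)"
  have d: "h + l + d = 2 * (D + (if u then h else l))"
    using assms(4) by (cases u) (simp_all add: d_def low_def)
  have "h \<le> l + d" "l \<le> h + d"
    using assms(4) by (cases u; simp add: d_def low_def)+
  moreover have "even (h + l + d)" by (simp only: d dvd_triv_left)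
  ultimately obtain q where q: "q \<in> quiver_paths n" "hd q = h" "last q = l" "length q = Suc d"
    using path_exists[OF assms(1-3)] by blast
  then have "q \<noteq> []" by auto
  then have "Suc (steps True q + steps False q) = Suc d" "h + steps True q = l + steps False q"
    using steps_length[of q] steps_hd_last[OF q(1)] q by simp_all
  then have "steps u q = D" using d by (cases u) simp_all
  with q show ?thesis by blast
qed

lemma steps_low:
  assumes "q \<in> quiver_paths n"
  shows "low u (hd q) (last q) \<le> steps u q"
  using steps_hd_last[OF assms] by (cases u) (auto simp: low_def)

lemma relations_closed:
  assumes "2 \<le> n"
  shows "relations n \<subseteq> carrier (path_algebra n)"
proof
  fix x :: "'k::field path_comb" assume "x \<in> relations n"
  then consider i where "2 \<le> i" "i \<le> n - 1"
      "x = Poly_Mapping.single [i, i - 1, i] 1 - Poly_Mapping.single [i, i + 1, i] 1"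
    | "x = Poly_Mapping.single [1, 2, 1] 1"
    unfolding relations_def Un_iff mem_Collect_eq singleton_iff by blast
  then show "x \<in> carrier (path_algebra n)"
  proof cases
    case 1
    then have "[i, i - 1, i] \<in> quiver_paths n" "[i, i + 1, i] \<in> quiver_paths n"
      by (auto simp: quiver_paths_Cons)
    then show ?thesis
      using keys_add_subset[of "Poly_Mapping.single [i, i - 1, i] (1::'k)" "quiver_paths n"
          "- Poly_Mapping.single [i, i + 1, i] 1"]
      unfolding 1(3) by simp
  qed (use assms in \<open>simp add: quiver_paths_Cons\<close>)
qed

lemma relation_ideal_ideal:
  assumes "2 \<le> n"
  shows "ideal (relation_ideal n) (path_algebra n)"
  unfolding relation_ideal_def
  by (rule ring.genideal_ideal[OF path_algebra_ring relations_closed[OF assms]])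

lemma relation_ideal_closed:
  assumes "2 \<le> n"
  shows "0 \<in> relation_ideal n" "relation_ideal n \<subseteq> carrier (path_algebra n)"
    "f \<in> relation_ideal n \<Longrightarrow> g \<in> relation_ideal n \<Longrightarrow> f + g \<in> relation_ideal n"
    "f \<in> relation_ideal n \<Longrightarrow> - f \<in> relation_ideal n"
    "f \<in> relation_ideal n \<Longrightarrow> Poly_Mapping.keys g \<subseteq> quiver_paths n \<Longrightarrow> path_mult f g \<in> relation_ideal n"
    "f \<in> relation_ideal n \<Longrightarrow> Poly_Mapping.keys g \<subseteq> quiver_paths n \<Longrightarrow> path_mult g f \<in> relation_ideal n"
proof -
  note I = relation_ideal_ideal[OF assms]
  note A = ideal.axioms(1)[OF I]
  show sub: "relation_ideal n \<subseteq> carrier (path_algebra n)" by (rule additive_subgroup.a_subset[OF A])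
  show "0 \<in> relation_ideal n"
    using additive_subgroup.zero_closed[OF A] by (simp only: path_algebra_simps)
  show "f + g \<in> relation_ideal n" if "f \<in> relation_ideal n" "g \<in> relation_ideal n"
    using additive_subgroup.a_closed[OF A that] by (simp only: path_algebra_simps)
  show "- f \<in> relation_ideal n" if "f \<in> relation_ideal n"
    using additive_subgroup.a_inv_closed[OF A that] path_algebra_a_inv[OF subsetD[OF sub that]] by (simp only:)
  show "path_mult f g \<in> relation_ideal n"
    if "f \<in> relation_ideal n" "Poly_Mapping.keys g \<subseteq> quiver_paths n"
    using ideal.I_r_closed[OF I that(1), of g] that(2) by (simp only: path_algebra_simps mem_Collect_eq simp_thms)
  show "path_mult g f \<in> relation_ideal n"
    if "f \<in> relation_ideal n" "Poly_Mapping.keys g \<subseteq> quiver_paths n"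
    using ideal.I_l_closed[OF I that(1), of g] that(2) by (simp only: path_algebra_simps mem_Collect_eq simp_thms)
qed

lemma relations_in_ideal:
  assumes "2 \<le> n"
  shows "relations n \<subseteq> relation_ideal n"
  unfolding relation_ideal_def
  by (rule ring.genideal_self[OF path_algebra_ring relations_closed[OF assms]])

lemma single_Cons:
  "q \<noteq> [] \<Longrightarrow> Poly_Mapping.single (i # q) c = path_mult (Poly_Mapping.single [i, hd q] 1) (Poly_Mapping.single q c)"
  by (cases q) (auto simp: path_mult_single)

lemma path_mult_diff_right: "path_mult f (g - h) = path_mult f g - path_mult f h"
proof -
  have "path_mult f ((g - h) + h) = path_mult f (g - h) + path_mult f h" by (rule path_mult_add_right)
  then show ?thesis by simp
qed

lemma path_mult_diff_left: "path_mult (g - h) f = path_mult g f - path_mult h f"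
proof -
  have "path_mult ((g - h) + h) f = path_mult (g - h) f + path_mult h f" by (rule path_mult_add_left)
  then show ?thesis by simp
qed

lemma paths_congruent_Cons:
  assumes "2 \<le> n" "i # q \<in> quiver_paths n" "q \<noteq> []" "r \<noteq> []" "hd q = hd r"
    and "Poly_Mapping.single q (1::'k::field) - Poly_Mapping.single r 1 \<in> relation_ideal n"
  shows "Poly_Mapping.single (i # q) (1::'k) - Poly_Mapping.single (i # r) 1 \<in> relation_ideal n"
proof -
  have "[i, hd q] \<in> quiver_paths n"
    using assms(2,3) quiver_pathsD[of q n] by (simp add: quiver_paths_Cons)
  then have "path_mult (Poly_Mapping.single [i, hd q] 1)
      (Poly_Mapping.single q (1::'k) - Poly_Mapping.single r 1) \<in> relation_ideal n"
    by (intro relation_ideal_closed(6)[OF assms(1,6)]) simp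
  moreover have "path_mult (Poly_Mapping.single [i, hd q] 1) (Poly_Mapping.single q (1::'k)) = Poly_Mapping.single (i # q) 1"
    by (rule single_Cons[OF assms(3), symmetric])
  moreover have "path_mult (Poly_Mapping.single [i, hd q] 1) (Poly_Mapping.single r (1::'k)) = Poly_Mapping.single (i # r) 1"
    unfolding assms(5) by (rule single_Cons[OF assms(4), symmetric])
  ultimately show ?thesis by (simp only: path_mult_diff_right)
qed

lemma paths_congruent_turn:
  assumes "2 \<le> n" "2 \<le> i" "i \<le> n - 1" "i # r \<in> quiver_paths n"
  shows "Poly_Mapping.single (i # (i - 1) # i # r) (1::'k::field) - Poly_Mapping.single (i # Suc i # i # r) 1
    \<in> relation_ideal n"
proof -
  have "Poly_Mapping.single [i, i - 1, i] (1::'k) - Poly_Mapping.single [i, i + 1, i] 1 \<in> relation_ideal n"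
    by (rule subsetD[OF relations_in_ideal[OF assms(1)]])
      (use assms(2,3) in \<open>simp only: relations_def Un_iff mem_Collect_eq; blast\<close>)
  then have "path_mult (Poly_Mapping.single [i, i - 1, i] 1 - Poly_Mapping.single [i, i + 1, i] 1)
      (Poly_Mapping.single (i # r) (1::'k)) \<in> relation_ideal n"
    using assms(4) by (intro relation_ideal_closed(5) assms(1)) simp_all
  then show ?thesis by (simp add: path_mult_diff_left path_mult_single)
qed

lemma paths_congruent_trans:
  assumes "2 \<le> n" "f - g \<in> relation_ideal n" "g - h \<in> relation_ideal n"
  shows "f - h \<in> relation_ideal n"
  using relation_ideal_closed(3)[OF assms] by simp

lemma paths_congruent_sym:
  assumes "2 \<le> n" "f - g \<in> relation_ideal n"
  shows "g - f \<in> relation_ideal n"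
  using relation_ideal_closed(4)[OF assms] by simp

lemma opposite_steps_count:
  fixes h l d :: nat
  assumes "Suc h + x = l + x'" "Suc (x + x') = d" "g + y = l + y'" "Suc (y + y') = d" "h = Suc g"
  shows "2 \<le> d \<and> h \<le> l + (d - 2) \<and> l \<le> h + (d - 2) \<and> h + l + (d - 2) = 2 * (h + x)"
proof -
  have "2 \<le> d" using assms by linarith
  then obtain e where e: "d = e + 2" by (metis le_add_diff_inverse2)
  have "h \<le> l + e" using assms e by linarith
  moreover have "l \<le> h + e" using assms e by linarith
  moreover have "h + l + e = 2 * (h + x)" using assms(1,2) e by simp
  ultimately show ?thesis using e by simp
qed

text \<open>
  Two paths with the same data differ by moving back-and-forth steps from one vertex to the
  next, and the relations allow each such move.
\<close>

lemma paths_congruent: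
  assumes "2 \<le> n" "q \<in> quiver_paths n" "r \<in> quiver_paths n"
    and "hd q = hd r" "last q = last r" "length q = length r"
  shows "Poly_Mapping.single q (1::'k::field) - Poly_Mapping.single r 1 \<in> relation_ideal n"
  using assms(2-)
proof (induction "length q" arbitrary: q r)
  case 0
  then show ?case by simp
next
  case (Suc d)
  have "q \<noteq> []" "r \<noteq> []" using Suc.prems(1,2) by auto
  then obtain h q' h' r' where "q = h # q'" "r = h' # r'" by (meson list.exhaust)
  with Suc.prems(3) have qr: "q = h # q'" "r = h # r'" by simp_all
  show ?case
  proof (cases "q' = []")
    case True
    then show ?thesis using Suc.prems(5) qr relation_ideal_closed(1)[OF assms(1)] by simp
  next
    case False
    then have ne: "q' \<noteq> []" "r' \<noteq> []" using Suc.prems(5) qr by auto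
    then have q': "q' \<in> quiver_paths n" "hd q' = Suc h \<or> h = Suc (hd q')" "h \<in> {1..n}"
      and r': "r' \<in> quiver_paths n" "hd r' = Suc h \<or> h = Suc (hd r')"
      and eq: "last q' = last r'" "length q' = length r'" "length q' = d"
      using Suc.prems Suc.hyps(2) unfolding qr by (simp_all add: quiver_paths_Cons)
    show ?thesis
    proof (cases "hd q' = hd r'")
      case True
      have "Poly_Mapping.single q' (1::'k) - Poly_Mapping.single r' 1 \<in> relation_ideal n"
        using Suc.hyps(1)[OF eq(3)[symmetric] q'(1) r'(1) True eq(1,2)] .
      then show ?thesis
        unfolding qr using Suc.prems(1) qr(1) ne True by (intro paths_congruent_Cons assms(1)) simp_all
    next
      case False
      define l where "l = last q'"
      have l: "l \<in> {1..n}" "last q' = l" "last r' = l"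
        using quiver_pathsD[OF q'(1)] eq by (auto simp: l_def)
      have turn: "2 \<le> h" "h \<le> n - 1"
        using False q'(2) r'(2) quiver_pathsD(2)[OF q'(1)] quiver_pathsD(2)[OF r'(1)] by auto
      have aux: "d \<ge> 2 \<and> h \<le> l + (d - 2) \<and> l \<le> h + (d - 2) \<and> h + l + (d - 2) = 2 * (h + steps True x)"
        if xy: "x \<in> quiver_paths n" "y \<in> quiver_paths n" "hd x = Suc h" "h = Suc (hd y)"
          "last x = l" "last y = l" "length x = d" "length y = d" for x y
      proof -
        have "x \<noteq> []" "y \<noteq> []" using xy(1,2) by auto
        note len = steps_length[OF this(1), unfolded xy(7)] steps_length[OF this(2), unfolded xy(8)]
        show ?thesis
          by (rule opposite_steps_count[OF _ len(1) _ len(2) xy(4)])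
            (use steps_hd_last[OF xy(1)] steps_hd_last[OF xy(2)] xy(3,5,6) in \<open>simp_all only:\<close>)
      qed
      have "hd q' = Suc h \<and> h = Suc (hd r') \<or> hd r' = Suc h \<and> h = Suc (hd q')"
        using False q'(2) r'(2) by auto
      then obtain x y where xy: "x \<in> {q', r'}" "y \<in> {q', r'}" "hd x = Suc h" "h = Suc (hd y)"
        by blast
      have d: "d \<ge> 2" "h \<le> l + (d - 2)" "l \<le> h + (d - 2)" and m: "h + l + (d - 2) = 2 * (h + steps True x)"
        using aux[OF _ _ xy(3,4)] xy(1,2) q'(1) r'(1) eq l by auto
      have ev: "even (h + l + (d - 2))" unfolding m by simp
      obtain s where s: "s \<in> quiver_paths n" "hd s = h" "last s = l" "length s = Suc (d - 2)"
        using path_exists[OF assms(1) q'(3) l(1) d(2,3) ev] by blast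
      then obtain s' where s': "s = h # s'" by (cases s) auto
      have up: "Suc h # s \<in> quiver_paths n" "(h - 1) # s \<in> quiver_paths n"
        using s turn by (auto simp: quiver_paths_Cons)
      have key: "Poly_Mapping.single (h # (h - 1) # s) (1::'k) - Poly_Mapping.single (h # Suc h # s) 1 \<in> relation_ideal n"
        using paths_congruent_turn[OF assms(1) turn, of s'] s(1) s' by simp
      have step: "Poly_Mapping.single (h # t) (1::'k) - Poly_Mapping.single (h # hd t # s) 1 \<in> relation_ideal n"
        if t: "t \<in> quiver_paths n" "hd t = Suc h \<or> hd t = h - 1" "last t = l" "length t = d" "h # t \<in> quiver_paths n"
        for t
      proof (rule paths_congruent_Cons[OF assms(1) t(5)])
        show "t \<noteq> []" using t(1) by auto
        have "Suc (length s) = d" using s d(1) by simp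
        then show "Poly_Mapping.single t 1 - Poly_Mapping.single (hd t # s) (1::'k) \<in> relation_ideal n"
          using t up s' s by (intro Suc.hyps(1)) auto
      qed auto
      have "Poly_Mapping.single q (1::'k) - Poly_Mapping.single (h # hd q' # s) 1 \<in> relation_ideal n"
        "Poly_Mapping.single r (1::'k) - Poly_Mapping.single (h # hd r' # s) 1 \<in> relation_ideal n"
        using step[of q'] step[of r'] q' r' l eq Suc.prems(1,2) qr by auto
      moreover have "Poly_Mapping.single (h # hd q' # s) (1::'k) - Poly_Mapping.single (h # hd r' # s) 1 \<in> relation_ideal n"
        using False q'(2) r'(2) key paths_congruent_sym[OF assms(1) key] by auto
      ultimately show ?thesis
        using paths_congruent_trans[OF assms(1)] paths_congruent_sym[OF assms(1)] by blast
    qed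
  qed
qed

text \<open>
  The path can be rearranged within its class so that it contains \<open>(1|2|1)\<close>.
\<close>

lemma long_path_in_ideal:
  assumes "2 \<le> n" "q \<in> quiver_paths n" "hd q + last q < length q"
  shows "Poly_Mapping.single q (1::'k::field) \<in> relation_ideal n"
proof -
  define h l d where "h = hd q" and "l = last q" and "d = length q - 1"
  have hl: "h \<in> {1..n}" "l \<in> {1..n}" using quiver_pathsD[OF assms(2)] by (auto simp: h_def l_def)
  have one: "(1::nat) \<in> {1..n}" using assms(1) by simp
  have "q \<noteq> []" using assms(2) by auto
  then have d: "length q = Suc d" "Suc (steps True q + steps False q) = Suc d" "h + l \<le> d"
    using steps_length[of q] assms(3) unfolding h_def l_def d_def by simp_all
  have "h + steps True q = l + steps False q"
    using steps_hd_last[OF assms(2)] by (simp add: h_def l_def)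
  moreover have "h + 1 \<le> d" using d(3) hl by simp
  ultimately have par: "1 + l + (d - h - 1) = 2 * steps True q"
    using d(2) by linarith
  obtain s where s: "s \<in> quiver_paths n" "hd s = h" "last s = 1" "length s = Suc (h - 1)"
  proof -
    have "h + 1 + (h - 1) = 2 * h" "h \<le> 1 + (h - 1)" "1 \<le> h + (h - 1)" using hl(1) by auto
    moreover from this(1) have "even (h + 1 + (h - 1))" by (simp only: dvd_triv_left)
    ultimately show ?thesis
      using path_exists[OF assms(1) hl(1) one] that by blast
  qed
  obtain t where t: "t \<in> quiver_paths n" "hd t = 1" "last t = l" "length t = Suc (d - h - 1)"
  proof -
    have "even (1 + l + (d - h - 1))" by (simp only: par dvd_triv_left)
    moreover have "1 \<le> l + (d - h - 1)" "l \<le> 1 + (d - h - 1)" using hl(2) d(3) by auto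
    ultimately show ?thesis
      using path_exists[OF assms(1) one hl(2)] that by blast
  qed
  have ne: "s \<noteq> []" "t \<noteq> []" using s t by auto
  have "Poly_Mapping.single [1, 2, 1] (1::'k) \<in> relation_ideal n"
    by (rule subsetD[OF relations_in_ideal[OF assms(1)]]) (simp add: relations_def)
  from relation_ideal_closed(6)[OF assms(1) this, of "Poly_Mapping.single s 1"] s(1)
  have "path_mult (Poly_Mapping.single s 1) (Poly_Mapping.single [1, 2, 1] (1::'k)) \<in> relation_ideal n"
    by simp
  from relation_ideal_closed(5)[OF assms(1) this, of "Poly_Mapping.single t 1"] t(1)
  have "path_mult (path_mult (Poly_Mapping.single s 1) (Poly_Mapping.single [1, 2, 1] (1::'k)))
      (Poly_Mapping.single t 1) \<in> relation_ideal n" by simp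
  then have mem: "Poly_Mapping.single ((s @ [2, 1]) @ tl t) (1::'k) \<in> relation_ideal n"
    using s(3) t(2) by (simp add: path_mult_single)
  have st: "s @ [2, 1] \<in> quiver_paths n"
    using quiver_paths_glue[OF s(1), of "[1,2,1]"] s(3) assms(1) by (simp add: quiver_paths_Cons)
  then have "(s @ [2, 1]) @ tl t \<in> quiver_paths n"
    using t(1,2) by (intro quiver_paths_glue) simp_all
  moreover have "last ((s @ [2, 1]) @ tl t) = l"
    using hd_last_glue(2)[of "s @ [2, 1]" t] t ne by simp
  ultimately have "Poly_Mapping.single q (1::'k) - Poly_Mapping.single ((s @ [2, 1]) @ tl t) 1 \<in> relation_ideal n"
    using s(2,4) t(4) d(1,3) ne hl by (intro paths_congruent assms(1,2)) (simp_all add: h_def[symmetric] l_def[symmetric])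
  from relation_ideal_closed(3)[OF assms(1) this mem] show ?thesis by simp
qed

section \<open>Complexes with a finite homogeneous basis\<close>

text \<open>
  Linear algebra with an explicit finite homogeneous basis. The coordinate functional
  \<open>C x b\<close> is total and vanishes off the basis, which keeps sums over basis
  vectors out of the statements.
\<close>

locale based =
  fixes M :: "('k::field, 'v, 'z) pcomplex_scheme" and B :: "'b set" and deg :: "'b \<Rightarrow> int"
    and C :: "'v \<Rightarrow> 'b \<Rightarrow> 'k"
  assumes finite_basis: "finite B"
    and zero_in: "\<zero>\<^bsub>M\<^esub> \<in> carrier M"
    and add_in: "\<lbrakk>x \<in> carrier M; y \<in> carrier M\<rbrakk> \<Longrightarrow> x \<oplus>\<^bsub>M\<^esub> y \<in> carrier M"
    and smult_in: "x \<in> carrier M \<Longrightarrow> c \<odot>\<^bsub>M\<^esub> x \<in> carrier M"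
    and coord_off: "\<lbrakk>x \<in> carrier M; b \<notin> B\<rbrakk> \<Longrightarrow> C x b = 0"
    and coord_inj: "\<lbrakk>x \<in> carrier M; y \<in> carrier M; \<And>b. b \<in> B \<Longrightarrow> C x b = C y b\<rbrakk> \<Longrightarrow> x = y"
    and coord_surj: "\<exists>x\<in>carrier M. \<forall>b\<in>B. C x b = F b"
    and coord_zero: "C \<zero>\<^bsub>M\<^esub> b = 0"
    and coord_add: "\<lbrakk>x \<in> carrier M; y \<in> carrier M\<rbrakk> \<Longrightarrow> C (x \<oplus>\<^bsub>M\<^esub> y) b = C x b + C y b"
    and coord_smult: "x \<in> carrier M \<Longrightarrow> C (c \<odot>\<^bsub>M\<^esub> x) b = c * C x b"
    and grade_iff: "x \<in> grade M d \<longleftrightarrow> x \<in> carrier M \<and> (\<forall>b. C x b \<noteq> 0 \<longrightarrow> deg b = d)"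
begin

lemma coord_eqI: "\<lbrakk>x \<in> carrier M; y \<in> carrier M; \<And>b. C x b = C y b\<rbrakk> \<Longrightarrow> x = y"
  using coord_inj by blast

definition vec :: "('b \<Rightarrow> 'k) \<Rightarrow> 'v" where
  "vec F = (SOME x. x \<in> carrier M \<and> (\<forall>b\<in>B. C x b = F b))"

lemma vec_in: "vec F \<in> carrier M" and coord_vec': "b \<in> B \<Longrightarrow> C (vec F) b = F b"
proof -
  have "\<exists>x. x \<in> carrier M \<and> (\<forall>b\<in>B. C x b = F b)" using coord_surj by blast
  from someI_ex[OF this] show "vec F \<in> carrier M" "b \<in> B \<Longrightarrow> C (vec F) b = F b"
    unfolding vec_def by blast+
qed

lemma coord_vec: "C (vec F) b = (if b \<in> B then F b else 0)"
  using coord_vec' coord_off vec_in by auto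

lemma vec_coord: "x \<in> carrier M \<Longrightarrow> vec (C x) = x"
  by (rule coord_inj) (simp_all add: vec_in coord_vec)

lemma is_module: "module scalars M"
proof (rule moduleI)
  show "abelian_group M"
  proof (rule abelian_groupI)
    fix x assume x: "x \<in> carrier M"
    have "((-1) \<odot>\<^bsub>M\<^esub> x) \<oplus>\<^bsub>M\<^esub> x = \<zero>\<^bsub>M\<^esub>"
      by (rule coord_eqI) (simp_all add: x zero_in add_in smult_in coord_zero coord_add coord_smult)
    with smult_in[OF x] show "\<exists>y\<in>carrier M. y \<oplus>\<^bsub>M\<^esub> x = \<zero>\<^bsub>M\<^esub>" by blast
  qed (auto intro!: coord_eqI simp: zero_in add_in coord_zero coord_add)
qed (auto intro!: coord_eqI simp: ring_of_type_algebra_def smult_in add_in coord_add coord_smult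
      algebra_simps cring_from_type_algebra[unfolded ring_of_type_algebra_def])

lemma coord_a_inv: "x \<in> carrier M \<Longrightarrow> C (\<ominus>\<^bsub>M\<^esub> x) b = - C x b"
proof -
  assume x: "x \<in> carrier M"
  interpret M: abelian_group M using is_module by (rule module.axioms)
  have "C (\<ominus>\<^bsub>M\<^esub> x) b + C x b = 0"
    using coord_add[of "\<ominus>\<^bsub>M\<^esub> x" x b] x by (simp add: M.l_neg coord_zero)
  then show ?thesis by (simp add: eq_neg_iff_add_eq_0)
qed

lemma coord_minus: "\<lbrakk>x \<in> carrier M; y \<in> carrier M\<rbrakk> \<Longrightarrow> C (x \<ominus>\<^bsub>M\<^esub> y) b = C x b - C y b"
proof -
  interpret M: abelian_group M using is_module by (rule module.axioms)
  show "\<lbrakk>x \<in> carrier M; y \<in> carrier M\<rbrakk> \<Longrightarrow> C (x \<ominus>\<^bsub>M\<^esub> y) b = C x b - C y b"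
    by (simp add: a_minus_def coord_add coord_a_inv)
qed

lemma coord_finsum:
  assumes "\<And>j. j \<in> J \<Longrightarrow> f j \<in> carrier M"
  shows "finsum M f J \<in> carrier M \<and> C (finsum M f J) b = (\<Sum>j\<in>J. C (f j) b)"
proof -
  interpret M: abelian_group M using is_module by (rule module.axioms)
  show ?thesis
    using assms
  proof (induction J rule: infinite_finite_induct)
    case (insert j J)
    then have "finsum M f (insert j J) = f j \<oplus>\<^bsub>M\<^esub> finsum M f J" by (intro M.finsum_insert) auto
    with insert show ?case by (simp add: add_in coord_add)
  qed (simp_all add: coord_zero zero_in)
qed

definition coord_subspace :: "'b set \<Rightarrow> 'v set" where
  "coord_subspace T = {x \<in> carrier M. \<forall>b. b \<notin> T \<longrightarrow> C x b = 0}"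

lemma coord_subspace_submodule: "submodule (coord_subspace T) scalars M"
  by (rule module.submoduleI[OF is_module])
    (auto simp: coord_subspace_def zero_in add_in smult_in coord_zero coord_add coord_smult coord_a_inv
      abelian_group.a_inv_closed[OF module.axioms(2)[OF is_module]])

lemma grade_subspace: "grade M d = coord_subspace {b. deg b = d}"
  by (auto simp: grade_iff coord_subspace_def)

lemma coord_subspace_Int: "coord_subspace S \<inter> coord_subspace T = coord_subspace (S \<inter> T)"
  by (auto simp: coord_subspace_def)

text \<open>
  A coordinate subspace is graded because the homogeneous part of degree \<open>d\<close> is
  obtained by keeping the coordinates of degree \<open>d\<close>.
\<close>

lemma direct_sum_subspace: "direct_sum_of M (coord_subspace T) (\<lambda>d. grade M d \<inter> coord_subspace T)"
  unfolding direct_sum_of_def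
proof (intro conjI allI ballI)
  show "submodule (coord_subspace T) scalars M" by (rule coord_subspace_submodule)
  show "submodule (grade M d \<inter> coord_subspace T) scalars M" for d
    by (simp add: grade_subspace coord_subspace_Int coord_subspace_submodule)
  show "grade M d \<inter> coord_subspace T \<subseteq> coord_subspace T" for d by blast
next
  fix x assume x: "x \<in> coord_subspace T"
  define c where "c d = vec (\<lambda>b. if deg b = d then C x b else 0)" for d
  have coord_c: "C (c d) b = (if deg b = d then C x b else 0)" for b d
  proof -
    have "x \<in> carrier M" using x by (simp add: coord_subspace_def)
    from coord_off[OF this] show ?thesis by (simp add: c_def coord_vec)
  qed
  have c_in: "c d \<in> carrier M" for d by (simp add: c_def vec_in)
  have sum_at: "C (finsum M e {d. e d \<noteq> \<zero>\<^bsub>M\<^esub>}) b = C (e (deg b)) b"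
    if e: "\<And>d. e d \<in> grade M d" "finite {d. e d \<noteq> \<zero>\<^bsub>M\<^esub>}" for e b
  proof -
    have "C (finsum M e {d. e d \<noteq> \<zero>\<^bsub>M\<^esub>}) b = (\<Sum>d\<in>{d. e d \<noteq> \<zero>\<^bsub>M\<^esub>}. C (e d) b)"
      using coord_finsum[of "{d. e d \<noteq> \<zero>\<^bsub>M\<^esub>}" e b] e(1) by (auto simp: grade_iff)
    also have "\<dots> = (\<Sum>d\<in>{d. e d \<noteq> \<zero>\<^bsub>M\<^esub>}. if d = deg b then C (e (deg b)) b else 0)"
    proof (rule sum.cong)
      fix d
      show "C (e d) b = (if d = deg b then C (e (deg b)) b else 0)"
        using e(1)[of d] unfolding grade_iff by auto
    qed simp
    also have "\<dots> = C (e (deg b)) b"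
      using e(2) by (simp add: coord_zero)
    finally show ?thesis .
  qed
  have "{d. c d \<noteq> \<zero>\<^bsub>M\<^esub>} \<subseteq> deg ` B"
  proof
    fix d assume "d \<in> {d. c d \<noteq> \<zero>\<^bsub>M\<^esub>}"
    then obtain b where b: "b \<in> B" "C (c d) b \<noteq> C \<zero>\<^bsub>M\<^esub> b" using coord_inj[OF c_in[of d] zero_in] by blast
    then have "deg b = d" unfolding coord_c coord_zero by presburger
    with b(1) show "d \<in> deg ` B" by blast
  qed
  then have c_fin: "finite {d. c d \<noteq> \<zero>\<^bsub>M\<^esub>}" by (rule finite_subset) (simp add: finite_basis)
  have c_grade: "c d \<in> grade M d \<inter> coord_subspace T" for d
  proof
    show "c d \<in> grade M d" unfolding grade_iff coord_c using c_in by simp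
    show "c d \<in> coord_subspace T" using x unfolding coord_subspace_def mem_Collect_eq coord_c using c_in by simp
  qed
  show "\<exists>!c. (\<forall>d. c d \<in> grade M d \<inter> coord_subspace T) \<and> finite {d. c d \<noteq> \<zero>\<^bsub>M\<^esub>} \<and>
      x = finsum M c {d. c d \<noteq> \<zero>\<^bsub>M\<^esub>}"
  proof (intro ex1I[of _ c] conjI allI)
    show "x = finsum M c {d. c d \<noteq> \<zero>\<^bsub>M\<^esub>}"
    proof (rule coord_eqI)
      show "x \<in> carrier M" using x by (simp add: coord_subspace_def)
      show "finsum M c {d. c d \<noteq> \<zero>\<^bsub>M\<^esub>} \<in> carrier M" by (rule conjunct1[OF coord_finsum[OF c_in]])
      show "C x b = C (finsum M c {d. c d \<noteq> \<zero>\<^bsub>M\<^esub>}) b" for b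
        using sum_at[OF _ c_fin, of b] c_grade unfolding coord_c by simp
    qed
  next
    fix e assume e: "(\<forall>d. e d \<in> grade M d \<inter> coord_subspace T) \<and> finite {d. e d \<noteq> \<zero>\<^bsub>M\<^esub>} \<and>
      x = finsum M e {d. e d \<noteq> \<zero>\<^bsub>M\<^esub>}"
    then have grade: "\<And>d. e d \<in> grade M d" and fin: "finite {d. e d \<noteq> \<zero>\<^bsub>M\<^esub>}"
      and eq: "x = finsum M e {d. e d \<noteq> \<zero>\<^bsub>M\<^esub>}" by blast+
    have at: "C x b = C (e (deg b)) b" for b
      unfolding eq by (rule sum_at[OF grade fin])
    show "e = c"
    proof
      fix d
      have e: "e d \<in> carrier M" "C (e d) b \<noteq> 0 \<Longrightarrow> deg b = d" for b
        using grade[of d] unfolding grade_iff by blast+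
      show "e d = c d"
      proof (rule coord_eqI[OF e(1) c_in])
        show "C (e d) b = C (c d) b" for b
          using e(2)[of b] by (cases "deg b = d") (auto simp: coord_c at)
      qed
    qed
  qed (use c_fin c_grade in \<open>simp_all only: Int_iff simp_thms\<close>)
qed

lemma direct_sum: "direct_sum_of M (carrier M) (grade M)"
proof -
  have "coord_subspace UNIV = carrier M" by (simp add: coord_subspace_def)
  moreover have "grade M d \<inter> carrier M = grade M d" for d by (auto simp: grade_iff)
  ultimately show ?thesis using direct_sum_subspace[of UNIV] by simp
qed

lemma is_pcomplexI:
  assumes "graded_linear 2 M M (del M)" "\<And>x. x \<in> carrier M \<Longrightarrow> (del M ^^ p) x = \<zero>\<^bsub>M\<^esub>"
  shows "is_pcomplex p M"
  unfolding is_pcomplex_def using assms is_module direct_sum by blast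

end

lemma graded_linearD:
  assumes "graded_linear d M N f"
  shows "x \<in> carrier M \<Longrightarrow> f x \<in> carrier N"
    and "\<lbrakk>x \<in> carrier M; y \<in> carrier M\<rbrakk> \<Longrightarrow> f (x \<oplus>\<^bsub>M\<^esub> y) = f x \<oplus>\<^bsub>N\<^esub> f y"
    and "x \<in> carrier M \<Longrightarrow> f (c \<odot>\<^bsub>M\<^esub> x) = c \<odot>\<^bsub>N\<^esub> f x"
    and "x \<in> grade M e \<Longrightarrow> f x \<in> grade N (e + d)"
  using assms unfolding graded_linear_def by auto

lemma graded_linear_compose:
  assumes "graded_linear d M N f" "graded_linear e N L g"
  shows "graded_linear (d + e) M L (\<lambda>x. g (f x))"
  unfolding graded_linear_def
  using graded_linearD[OF assms(1)] graded_linearD[OF assms(2)]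
  by (auto simp: add.assoc[symmetric])

lemma graded_linear_funpow:
  assumes "graded_linear d M M f" "\<And>e. grade M e \<subseteq> carrier M"
  shows "graded_linear (int j * d) M M (f ^^ j)"
proof (induction j)
  case 0
  then show ?case by (auto simp: graded_linear_def)
next
  case (Suc j)
  have "int (Suc j) * d = int j * d + d" by (simp add: algebra_simps)
  with graded_linear_compose[OF Suc assms(1)] show ?case by (simp add: comp_def)
qed

section \<open>Null-homotopies\<close>

text \<open>
  A quasi-isomorphism is invertible in the derived category; the inverse is the one-letter
  word that formally inverts it.
\<close>

lemma quasi_isomorphicI:
  assumes "ob M" "ob N" "pdg_quasi_iso p A M N s"
  shows "quasi_isomorphic ob p A N M"
proof -
  have hom: "pdg_hom A M N s" using assms(3) by (simp add: pdg_quasi_iso_def)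
  have "derived_word ob p A N [Inv M s N] M"
    by (intro derived_word.word_inv derived_word.word_nil assms)
  moreover have "derived_word ob p A M [Mor M s N] N"
    by (intro derived_word.word_mor derived_word.word_nil assms hom)
  moreover have "derived_eq ob p A N N ([Inv M s N] @ [Mor M s N]) []"
    using derived_eq.eq_inv_left[OF assms] by simp
  moreover have "derived_eq ob p A M M ([Mor M s N] @ [Inv M s N]) []"
    using derived_eq.eq_inv_right[OF assms] by simp
  ultimately show ?thesis unfolding quasi_isomorphic_def using assms(1,2) by blast
qed

text \<open>
  The free \<open>p\<close>-complex \<open>H \<otimes> N\<close> on the underlying graded
  space of \<open>N\<close>: the entry at \<open>k\<close> is the coefficient of
  \<open>\<partial>\<^sup>k\<close>.
\<close>

definition induced :: "nat \<Rightarrow> ('k::field, 'v, 'z) pcomplex_scheme \<Rightarrow> ('k, nat \<Rightarrow> 'v) pcomplex" where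
  "induced p N = \<lparr>carrier = {q. (\<forall>k<p. q k \<in> carrier N) \<and> (\<forall>k\<ge>p. q k = \<zero>\<^bsub>N\<^esub>)},
     monoid.mult = undefined, one = undefined, zero = (\<lambda>k. \<zero>\<^bsub>N\<^esub>), add = (\<lambda>x y k. x k \<oplus>\<^bsub>N\<^esub> y k),
     module.smult = (\<lambda>c x k. c \<odot>\<^bsub>N\<^esub> x k),
     grade = (\<lambda>d. {q. (\<forall>k<p. q k \<in> grade N (d - 2 * int k)) \<and> (\<forall>k\<ge>p. q k = \<zero>\<^bsub>N\<^esub>)}),
     del = (\<lambda>q k. if k = 0 \<or> p \<le> k then \<zero>\<^bsub>N\<^esub> else q (k - 1))\<rparr>"

context based
begin

lemma smult_zero: "c \<odot>\<^bsub>M\<^esub> \<zero>\<^bsub>M\<^esub> = \<zero>\<^bsub>M\<^esub>"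
  by (rule coord_eqI) (simp_all add: smult_in zero_in coord_smult coord_zero)

lemma add_zero: "\<zero>\<^bsub>M\<^esub> \<oplus>\<^bsub>M\<^esub> \<zero>\<^bsub>M\<^esub> = \<zero>\<^bsub>M\<^esub>"
  by (rule coord_eqI) (simp_all add: add_in zero_in coord_add coord_zero)

lemma induced_based: "based (induced p M) ({..<p} \<times> B) (\<lambda>(k, b). deg b + 2 * int k) (\<lambda>q (k, b). C (q k) b)"
proof
  have in_M: "q k \<in> carrier M" if "q \<in> carrier (induced p M)" for q k
    using that zero_in by (cases "k < p") (simp_all add: induced_def)
  fix x y and kb :: "nat \<times> 'b" and F :: "nat \<times> 'b \<Rightarrow> 'k" and c d
  obtain k b where kb: "kb = (k, b)" by (cases kb)
  show "finite ({..<p} \<times> B)" using finite_basis by simp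
  show "\<zero>\<^bsub>induced p M\<^esub> \<in> carrier (induced p M)" by (simp add: induced_def zero_in)
  show "(case kb of (k, b) \<Rightarrow> C (\<zero>\<^bsub>induced p M\<^esub> k) b) = 0" by (simp add: kb induced_def coord_zero)
  show "\<exists>x\<in>carrier (induced p M). \<forall>kb\<in>{..<p} \<times> B. (case kb of (k, b) \<Rightarrow> C (x k) b) = F kb"
    by (rule bexI[of _ "\<lambda>k. if k < p then vec (\<lambda>b. F (k, b)) else \<zero>\<^bsub>M\<^esub>"])
      (auto simp: induced_def vec_in coord_vec)
  show "x \<in> grade (induced p M) d \<longleftrightarrow> x \<in> carrier (induced p M) \<and>
      (\<forall>kb. (case kb of (k, b) \<Rightarrow> C (x k) b) \<noteq> 0 \<longrightarrow> (case kb of (k, b) \<Rightarrow> deg b + 2 * int k) = d)"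
  proof
    assume L: "x \<in> grade (induced p M) d"
    have "deg b + 2 * int k = d" if "C (x k) b \<noteq> 0" for k b
    proof (cases "k < p")
      case True
      then have "x k \<in> grade M (d - 2 * int k)" using L by (simp add: induced_def)
      then have "deg b = d - 2 * int k" using that by (simp add: grade_iff)
      then show ?thesis by simp
    next
      case False
      then show ?thesis using L that by (simp add: induced_def coord_zero)
    qed
    then show "x \<in> carrier (induced p M) \<and>
      (\<forall>kb. (case kb of (k, b) \<Rightarrow> C (x k) b) \<noteq> 0 \<longrightarrow> (case kb of (k, b) \<Rightarrow> deg b + 2 * int k) = d)"
      using L by (simp add: induced_def grade_iff split_beta)
  next
    assume R: "x \<in> carrier (induced p M) \<and>
      (\<forall>kb. (case kb of (k, b) \<Rightarrow> C (x k) b) \<noteq> 0 \<longrightarrow> (case kb of (k, b) \<Rightarrow> deg b + 2 * int k) = d)"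
    have "C (x k) b \<noteq> 0 \<longrightarrow> deg b = d - 2 * int k" for k b
      using R[THEN conjunct2, THEN spec, of "(k, b)"] by (simp add: algebra_simps)
    with R show "x \<in> grade (induced p M) d" by (simp add: induced_def grade_iff)
  qed
  assume x: "x \<in> carrier (induced p M)"
  show "c \<odot>\<^bsub>induced p M\<^esub> x \<in> carrier (induced p M)"
    using x by (simp add: induced_def smult_in smult_zero)
  show "(case kb of (k, b) \<Rightarrow> C ((c \<odot>\<^bsub>induced p M\<^esub> x) k) b) = c * (case kb of (k, b) \<Rightarrow> C (x k) b)"
    using in_M[OF x] by (simp add: kb induced_def coord_smult)
  show "(case kb of (k, b) \<Rightarrow> C (x k) b) = 0" if "kb \<notin> {..<p} \<times> B"
    using that x coord_off[OF in_M[OF x, of k], of b] by (cases "k < p") (simp_all add: kb induced_def coord_zero)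
  assume y: "y \<in> carrier (induced p M)"
  show "x \<oplus>\<^bsub>induced p M\<^esub> y \<in> carrier (induced p M)"
    using x y by (simp add: induced_def add_in add_zero)
  show "(case kb of (k, b) \<Rightarrow> C ((x \<oplus>\<^bsub>induced p M\<^esub> y) k) b) =
      (case kb of (k, b) \<Rightarrow> C (x k) b) + (case kb of (k, b) \<Rightarrow> C (y k) b)"
    using in_M[OF x] in_M[OF y] by (simp add: kb induced_def coord_add)
  assume eq: "\<And>kb. kb \<in> {..<p} \<times> B \<Longrightarrow> (case kb of (k, b) \<Rightarrow> C (x k) b) = (case kb of (k, b) \<Rightarrow> C (y k) b)"
  show "x = y"
  proof
    fix k
    show "x k = y k"
    proof (cases "k < p")
      case True
      then have "C (x k) b = C (y k) b" if "b \<in> B" for b using eq[of "(k, b)"] that by simp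
      then show ?thesis by (rule coord_inj[OF in_M[OF x] in_M[OF y]])
    next
      case False
      then show ?thesis using x y by (simp add: induced_def)
    qed
  qed
qed

lemma induced_del_pow:
  assumes "q \<in> carrier (induced p M)"
  shows "(del (induced p M) ^^ j) q = (\<lambda>k. if j \<le> k \<and> k < p then q (k - j) else \<zero>\<^bsub>M\<^esub>)"
proof (induction j)
  case 0
  show ?case using assms by (auto simp: induced_def)
next
  case (Suc j)
  show ?case by (rule ext, simp only: funpow.simps comp_apply Suc) (auto simp: induced_def)
qed

lemma induced_pcomplex: "is_pcomplex p (induced p M)"
proof -
  interpret Q: based "induced p M" "{..<p} \<times> B" "\<lambda>(k, b). deg b + 2 * int k" "\<lambda>q (k, b). C (q k) b"
    by (rule induced_based)
  show ?thesis
  proof (rule Q.is_pcomplexI)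
    show "(del (induced p M) ^^ p) x = \<zero>\<^bsub>induced p M\<^esub>" if "x \<in> carrier (induced p M)" for x
      unfolding induced_del_pow[OF that] by (auto simp: induced_def fun_eq_iff)
    have grade: "del (induced p M) x \<in> grade (induced p M) (e + 2)" if x: "x \<in> grade (induced p M) e" for x e
    proof -
      have "x (k - 1) \<in> grade M (e + 2 - 2 * int k)" if "k \<noteq> 0" "k < p" for k
      proof -
        have "e - 2 * int (k - 1) = e + 2 - 2 * int k" using that by (cases k) simp_all
        moreover have "\<forall>k<p. x k \<in> grade M (e - 2 * int k)" using x by (simp add: induced_def)
        moreover have "k - 1 < p" using that by simp
        ultimately have "x (k - 1) \<in> grade M (e + 2 - 2 * int k)" by metis
        then show ?thesis .
      qed
      moreover have "\<zero>\<^bsub>M\<^esub> \<in> grade M d" for d by (simp add: grade_iff zero_in coord_zero)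
      ultimately show ?thesis by (simp add: induced_def)
    qed
    show "graded_linear 2 (induced p M) (induced p M) (del (induced p M))"
      unfolding graded_linear_def
    proof (intro conjI ballI allI funcsetI grade)
      fix x y c assume x: "x \<in> carrier (induced p M)"
      show "del (induced p M) x \<in> carrier (induced p M)" using x by (simp add: induced_def zero_in)
      show "del (induced p M) (c \<odot>\<^bsub>induced p M\<^esub> x) = c \<odot>\<^bsub>induced p M\<^esub> del (induced p M) x"
        by (auto simp: induced_def smult_zero)
      show "del (induced p M) (x \<oplus>\<^bsub>induced p M\<^esub> y) = del (induced p M) x \<oplus>\<^bsub>induced p M\<^esub> del (induced p M) y"
        by (auto simp: induced_def add_zero)
    qed
  qed
qed

lemma induced_free:
  assumes "0 < p"
  shows "free_pcomplex p (induced p M)"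
  unfolding free_pcomplex_def
proof (intro conjI induced_pcomplex)
  interpret Q: based "induced p M" "{..<p} \<times> B" "\<lambda>(k, b). deg b + 2 * int k" "\<lambda>q (k, b). C (q k) b"
    by (rule induced_based)
  define V where "V = Q.coord_subspace ({0} \<times> UNIV)"
  have V_iff: "v \<in> V \<longleftrightarrow> v \<in> carrier (induced p M) \<and> (\<forall>k. k \<noteq> 0 \<longrightarrow> v k = \<zero>\<^bsub>M\<^esub>)" for v
  proof -
    have in_M: "v k \<in> carrier M" if "v \<in> carrier (induced p M)" for k
      using that zero_in by (cases "k < p") (simp_all add: induced_def)
    show ?thesis
      unfolding V_def Q.coord_subspace_def
      by (auto simp: coord_zero intro!: coord_eqI in_M zero_in)
  qed
  have sum: "finsum (induced p M) (\<lambda>j. (del (induced p M) ^^ j) (v j)) {..<p} = (\<lambda>k. if k < p then v k 0 else \<zero>\<^bsub>M\<^esub>)"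
    (is "?s = ?r") if v: "\<And>j. j < p \<Longrightarrow> v j \<in> V" for v
  proof -
    have term_in: "(del (induced p M) ^^ j) (v j) \<in> carrier (induced p M)" if "j \<in> {..<p}" for j
      using v[of j] that unfolding V_iff by (auto simp: induced_del_pow) (auto simp: induced_def zero_in)
    note fs = Q.coord_finsum[of "{..<p}" "\<lambda>j. (del (induced p M) ^^ j) (v j)", OF term_in]
    show ?thesis
    proof (rule Q.coord_eqI)
      show "?s \<in> carrier (induced p M)" using fs by blast
      show "?r \<in> carrier (induced p M)" using v unfolding V_iff by (auto simp: induced_def)
      fix kb :: "nat \<times> 'b"
      obtain k b where kb: "kb = (k, b)" by (cases kb)
      have "(case kb of (k, b) \<Rightarrow> C (?s k) b) = (\<Sum>j<p. C (((del (induced p M) ^^ j) (v j)) k) b)"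
        using conjunct2[OF fs, of kb] unfolding kb by simp
      also have "\<dots> = (\<Sum>j<p. if j = k then C (v k 0) b else 0)"
      proof (rule sum.cong)
        fix j assume "j \<in> {..<p}"
        then have vj: "v j \<in> carrier (induced p M)" "\<And>k. k \<noteq> 0 \<Longrightarrow> v j k = \<zero>\<^bsub>M\<^esub>" using v[of j] unfolding V_iff by auto
        show "C ((del (induced p M) ^^ j) (v j) k) b = (if j = k then C (v k 0) b else 0)"
          unfolding induced_del_pow[OF vj(1)] using vj(2)[of "k - j"] \<open>j \<in> {..<p}\<close> by (auto simp: coord_zero)
      qed simp
      also have "\<dots> = (case kb of (k, b) \<Rightarrow> C (?r k) b)" by (simp add: kb coord_zero)
      finally show "(case kb of (k, b) \<Rightarrow> C (?s k) b) = (case kb of (k, b) \<Rightarrow> C (?r k) b)" .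
    qed
  qed
  show "\<exists>V. direct_sum_of (induced p M) V (\<lambda>d. grade (induced p M) d \<inter> V) \<and>
      (\<forall>x\<in>carrier (induced p M). \<exists>!v. v \<in> {..<p} \<rightarrow>\<^sub>E V \<and>
         x = finsum (induced p M) (\<lambda>j. (del (induced p M) ^^ j) (v j)) {..<p})"
  proof (intro exI[of _ V] conjI ballI)
    show "direct_sum_of (induced p M) V (\<lambda>d. grade (induced p M) d \<inter> V)"
      unfolding V_def by (rule Q.direct_sum_subspace)
    fix x assume x: "x \<in> carrier (induced p M)"
    define v where "v j = (if j < p then (\<lambda>k::nat. if k = 0 then x j else \<zero>\<^bsub>M\<^esub>) else undefined)" for j
    have v: "v \<in> {..<p} \<rightarrow>\<^sub>E V"
      using x assms by (auto simp: v_def V_iff induced_def zero_in)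
    show "\<exists>!v. v \<in> {..<p} \<rightarrow>\<^sub>E V \<and> x = finsum (induced p M) (\<lambda>j. (del (induced p M) ^^ j) (v j)) {..<p}"
    proof (intro ex1I[of _ v] conjI v)
      have "finsum (induced p M) (\<lambda>j. (del (induced p M) ^^ j) (v j)) {..<p} = (\<lambda>k. if k < p then v k 0 else \<zero>\<^bsub>M\<^esub>)"
        using v by (intro sum) auto
      also have "\<dots> = x" using x by (auto simp: v_def induced_def)
      finally show "x = finsum (induced p M) (\<lambda>j. (del (induced p M) ^^ j) (v j)) {..<p}" by simp
    next
      fix w assume w: "w \<in> {..<p} \<rightarrow>\<^sub>E V \<and> x = finsum (induced p M) (\<lambda>j. (del (induced p M) ^^ j) (w j)) {..<p}"
      then have wV: "\<And>j. j < p \<Longrightarrow> w j \<in> V" by auto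
      have x_eq: "x = (\<lambda>k. if k < p then w k 0 else \<zero>\<^bsub>M\<^esub>)"
        using w sum[of w] wV by simp
      show "w = v"
      proof
        fix j
        show "w j = v j"
        proof (cases "j < p")
          case True
          have "w j k = v j k" for k
            using wV[OF True] True unfolding V_iff v_def x_eq by auto
          then show ?thesis by (rule ext)
        next
          case False
          with w show ?thesis by (auto simp: v_def PiE_def extensional_def)
        qed
      qed
    qed
  qed
qed

lemma induced_projective:
  assumes "0 < p"
  shows "projective_pcomplex p (induced p M)"
proof -
  have "pcomplex_hom (induced p M) (induced p M) (\<lambda>x. x)"
    by (auto simp: pcomplex_hom_def graded_linear_def)
  with induced_free[OF assms] induced_pcomplex show ?thesis
    unfolding projective_pcomplex_def by blast
qed

lemma graded_linear_zero:
  assumes f: "graded_linear d M M f"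
  shows "f \<zero>\<^bsub>M\<^esub> = \<zero>\<^bsub>M\<^esub>"
proof -
  have "f \<zero>\<^bsub>M\<^esub> = 0 \<odot>\<^bsub>M\<^esub> f \<zero>\<^bsub>M\<^esub>"
    using graded_linearD(3)[OF f zero_in, of 0] by (simp add: smult_zero)
  also have "\<dots> = \<zero>\<^bsub>M\<^esub>"
    by (rule coord_eqI) (simp_all add: graded_linearD(1)[OF f] zero_in smult_in coord_smult coord_zero)
  finally show ?thesis .
qed

lemma graded_linear_finsum:
  assumes f: "graded_linear d M M f" and e: "\<And>j. j \<in> J \<Longrightarrow> e j \<in> carrier M" and fin: "finite J"
  shows "f (finsum M e J) = finsum M (\<lambda>j. f (e j)) J"
proof -
  interpret M: abelian_group M using is_module by (rule module.axioms)
  note fD = graded_linearD[OF f]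
  note f0 = graded_linear_zero[OF f]
  show ?thesis
    using fin e
  proof (induction J rule: finite_induct)
    case (insert j J)
    have "finsum M e (insert j J) = e j \<oplus>\<^bsub>M\<^esub> finsum M e J"
      using insert by (intro M.finsum_insert) auto
    moreover have "finsum M (\<lambda>j. f (e j)) (insert j J) = f (e j) \<oplus>\<^bsub>M\<^esub> finsum M (\<lambda>j. f (e j)) J"
      using insert fD(1) by (intro M.finsum_insert) auto
    moreover have "finsum M e J \<in> carrier M" using insert.prems by (intro M.finsum_closed) auto
    ultimately show ?case using insert fD(2) by simp
  qed (simp add: f0)
qed

lemma finsum_graded:
  assumes "\<And>j. j \<in> J \<Longrightarrow> e j \<in> grade M d"
  shows "finsum M e J \<in> grade M d"
proof -
  have in_M: "e j \<in> carrier M" if "j \<in> J" for j using assms[OF that] by (simp add: grade_iff)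
  have "deg b = d" if nz: "(\<Sum>j\<in>J. C (e j) b) \<noteq> 0" for b
  proof -
    obtain j where "j \<in> J" "C (e j) b \<noteq> 0" using nz by (meson sum.not_neutral_contains_not_neutral)
    then show ?thesis using assms[of j] by (simp add: grade_iff)
  qed
  then show ?thesis
    using coord_finsum[of J e, OF in_M] by (simp add: grade_iff)
qed

text \<open>
  The map factors as \<open>x \<mapsto> (h (\<partial>\<^bsup>p-1-k\<^esup>
  x))\<^sub>k\<close> into the free complex, followed by the action map
  \<open>(x\<^sub>k)\<^sub>k \<mapsto> \<Sum> \<partial>\<^sup>k x\<^sub>k\<close>.
\<close>

lemma stably_zero_homotopy:
  assumes p: "0 < p" and M: "is_pcomplex p M"
    and h: "graded_linear (2 - 2 * int p) M M h"
    and f: "\<And>x. x \<in> carrier M \<Longrightarrow> f x = finsum M (\<lambda>j. (del M ^^ j) (h ((del M ^^ (p - 1 - j)) x))) {..<p}"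
  shows "stably_zero p M M f"
proof -
  interpret Q: based "induced p M" "{..<p} \<times> B" "\<lambda>(k, b). deg b + 2 * int k" "\<lambda>q (k, b). C (q k) b"
    by (rule induced_based)
  have D: "graded_linear 2 M M (del M)" and Dp: "\<And>x. x \<in> carrier M \<Longrightarrow> (del M ^^ p) x = \<zero>\<^bsub>M\<^esub>"
    using M by (auto simp: is_pcomplex_def)
  have sub: "grade M e \<subseteq> carrier M" for e by (auto simp: grade_iff)
  note Dj = graded_linear_funpow[OF D sub]
  note DjD = graded_linearD[OF Dj] and hD = graded_linearD[OF h] and DD = graded_linearD[OF D]
  define g where "g x = (\<lambda>k. if k < p then h ((del M ^^ (p - 1 - k)) x) else \<zero>\<^bsub>M\<^esub>)" for x
  define r where "r q = finsum M (\<lambda>j. (del M ^^ j) (q j)) {..<p}" for q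
  note h0 = graded_linear_zero[OF h]
  have g: "pcomplex_hom M (induced p M) g"
    unfolding pcomplex_hom_def graded_linear_def
  proof (intro conjI ballI allI funcsetI)
    fix x assume x: "x \<in> carrier M"
    show "g x \<in> carrier (induced p M)" using x by (simp add: g_def induced_def DjD(1) hD(1))
    show "g (c \<odot>\<^bsub>M\<^esub> x) = c \<odot>\<^bsub>induced p M\<^esub> g x" for c
      using x by (auto simp: g_def induced_def DjD(1,3) hD(3) smult_zero)
    show "g (x \<oplus>\<^bsub>M\<^esub> y) = g x \<oplus>\<^bsub>induced p M\<^esub> g y" if "y \<in> carrier M" for y
      using x that by (auto simp: g_def induced_def DjD(1,2) hD(2) add_zero)
    show "g (del M x) = del (induced p M) (g x)"
    proof
      fix k
      consider "k = 0" | "p \<le> k" | l where "k = Suc l" "k < p" by (metis not_le not0_implies_Suc)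
      then show "g (del M x) k = del (induced p M) (g x) k"
      proof cases
        case 1
        have "(del M ^^ (p - 1)) (del M x) = (del M ^^ p) x"
          using p by (cases p) (simp_all add: funpow_swap1)
        with 1 show ?thesis using p Dp[OF x] h0 by (simp add: g_def induced_def)
      next
        case 3
        have "(del M ^^ (p - 1 - k)) (del M x) = (del M ^^ Suc (p - 1 - k)) x" by (simp add: funpow_swap1)
        moreover have "Suc (p - 1 - k) = p - 1 - l" using 3 by simp
        ultimately have "(del M ^^ (p - 1 - k)) (del M x) = (del M ^^ (p - 1 - l)) x" by (simp only:)
        with 3 show ?thesis by (simp add: g_def induced_def)
      qed (simp add: g_def induced_def)
    qed
  next
    fix x e assume x: "x \<in> grade M e"
    have "h ((del M ^^ (p - 1 - k)) x) \<in> grade M (e - 2 * int k)" if "k < p" for k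
    proof -
      have "e + int (p - 1 - k) * 2 + (2 - 2 * int p) = e - 2 * int k"
        using that by (cases p) (simp_all add: of_nat_diff algebra_simps)
      with hD(4)[OF DjD(4)[OF x, of "p - 1 - k"]] show ?thesis by (simp only:)
    qed
    then show "g x \<in> grade (induced p M) (e + 0)" by (simp add: induced_def g_def)
  qed
  have r: "pcomplex_hom (induced p M) M r"
    unfolding pcomplex_hom_def graded_linear_def
  proof (intro conjI ballI allI funcsetI)
    have term_in: "(del M ^^ j) (q j) \<in> carrier M" if "q \<in> carrier (induced p M)" "j \<in> {..<p}" for q j
      using that DjD(1) by (simp add: induced_def)
    have coord_r: "r q \<in> carrier M \<and> C (r q) b = (\<Sum>j<p. C ((del M ^^ j) (q j)) b)"
      if "q \<in> carrier (induced p M)" for q b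
      unfolding r_def by (rule coord_finsum) (rule term_in[OF that])
    fix q assume q: "q \<in> carrier (induced p M)"
    have qj: "q j \<in> carrier M" if "j < p" for j using q that by (simp add: induced_def)
    show r_in: "r q \<in> carrier M" using coord_r[OF q] by blast
    show "r (c \<odot>\<^bsub>induced p M\<^esub> q) = c \<odot>\<^bsub>M\<^esub> r q" for c
    proof (rule coord_eqI)
      have cq: "c \<odot>\<^bsub>induced p M\<^esub> q \<in> carrier (induced p M)" by (rule Q.smult_in[OF q])
      then show "r (c \<odot>\<^bsub>induced p M\<^esub> q) \<in> carrier M" using coord_r by blast
      show "C (r (c \<odot>\<^bsub>induced p M\<^esub> q)) b = C (c \<odot>\<^bsub>M\<^esub> r q) b" for b
        using coord_r[OF q, of b] coord_r[OF cq, of b]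
        by (simp add: coord_smult r_in sum_distrib_left)
          (simp add: induced_def qj DjD(1,3) coord_smult cong: sum.cong_simp)
    qed (simp add: smult_in r_in)
    show "r (q \<oplus>\<^bsub>induced p M\<^esub> s) = r q \<oplus>\<^bsub>M\<^esub> r s" if s: "s \<in> carrier (induced p M)" for s
    proof (rule coord_eqI)
      have sj: "s j \<in> carrier M" if "j < p" for j using s that by (simp add: induced_def)
      have qs: "q \<oplus>\<^bsub>induced p M\<^esub> s \<in> carrier (induced p M)" by (rule Q.add_in[OF q s])
      then show "r (q \<oplus>\<^bsub>induced p M\<^esub> s) \<in> carrier M" using coord_r by blast
      have s_in: "r s \<in> carrier M" using coord_r[OF s] by blast
      then show "r q \<oplus>\<^bsub>M\<^esub> r s \<in> carrier M" using r_in by (rule add_in[rotated])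
      show "C (r (q \<oplus>\<^bsub>induced p M\<^esub> s)) b = C (r q \<oplus>\<^bsub>M\<^esub> r s) b" for b
        using coord_r[OF q, of b] coord_r[OF qs, of b] coord_r[OF s, of b]
        by (simp add: coord_add r_in s_in sum.distrib[symmetric]) (simp add: induced_def qj sj DjD(1,2) coord_add)
    qed
    show "r (del (induced p M) q) = del M (r q)"
    proof (rule coord_eqI)
      have dq: "del (induced p M) q \<in> carrier (induced p M)"
        using q by (simp add: induced_def zero_in)
      then show "r (del (induced p M) q) \<in> carrier M" using coord_r by blast
      show "del M (r q) \<in> carrier M" by (rule DD(1)[OF r_in])
      obtain m where m: "p = Suc m" using p by (cases p) auto
      fix b
      have "del M (r q) = finsum M (\<lambda>j. del M ((del M ^^ j) (q j))) {..<p}"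
        unfolding r_def by (rule graded_linear_finsum[OF D term_in[OF q]]) simp_all
      then have "C (del M (r q)) b = (\<Sum>j<p. C ((del M ^^ Suc j) (q j)) b)"
        using coord_finsum[of "{..<p}" "\<lambda>j. del M ((del M ^^ j) (q j))"] DD(1)[OF term_in[OF q]] by simp
      also have "\<dots> = (\<Sum>j<m. C ((del M ^^ Suc j) (q j)) b)"
        using Dp[OF qj[of m]] by (simp add: m coord_zero del: funpow.simps)
      also have "\<dots> = (\<Sum>j<p. C ((del M ^^ j) (del (induced p M) q j)) b)"
      proof -
        have "C ((del M ^^ Suc j) (del (induced p M) q (Suc j))) b = C ((del M ^^ Suc j) (q j)) b" if "j < m" for j
          using that by (simp add: m induced_def del: funpow.simps)
        moreover have "del (induced p M) q 0 = \<zero>\<^bsub>M\<^esub>" by (simp add: induced_def)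
        ultimately show ?thesis unfolding m sum.lessThan_Suc_shift by (simp add: coord_zero del: funpow.simps(2))
      qed
      also have "\<dots> = C (r (del (induced p M) q)) b" using coord_r[OF dq, of b] by simp
      finally show "C (r (del (induced p M) q)) b = C (del M (r q)) b" by simp
    qed
  next
    fix q e assume q: "q \<in> grade (induced p M) e"
    show "r q \<in> grade M (e + 0)"
      unfolding r_def
    proof (rule finsum_graded)
      fix j assume "j \<in> {..<p}"
      then have "q j \<in> grade M (e - 2 * int j)" using q by (simp add: induced_def)
      from DjD(4)[OF this, of j] show "(del M ^^ j) (q j) \<in> grade M (e + 0)" by simp
    qed
  qed
  have "f x = r (g x)" if "x \<in> carrier M" for x
    unfolding f[OF that] r_def
  proof (rule abelian_monoid.finsum_cong')
    show "abelian_monoid M" using module.axioms(2)[OF is_module] by (simp add: abelian_group_def)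
  qed (auto simp: g_def DjD(1) hD(1) that)
  with induced_projective[OF p] g r show ?thesis unfolding stably_zero_def by blast
qed

end

section \<open>Coordinates on the quotient\<close>

text \<open>
  The triples that occur for some path with nonvanishing class.
\<close>

definition coords :: "bool \<Rightarrow> nat \<Rightarrow> (nat \<times> nat \<times> nat) set" where
  "coords u n = {(h, l, D). h \<in> {1..n} \<and> l \<in> {1..n} \<and> low u h l \<le> D \<and> D < cutoff u h l}"

lemma finite_coords: "finite (coords u n)"
proof (rule finite_subset)
  show "coords u n \<subseteq> {1..n} \<times> {1..n} \<times> {..<n}"
    by (auto simp: coords_def cutoff_def split: if_splits)
qed simp

text \<open>
  A choice of one path for each triple of data.
\<close>

definition rep :: "bool \<Rightarrow> nat \<Rightarrow> nat \<Rightarrow> nat \<Rightarrow> nat \<Rightarrow> nat list" where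
  "rep u n h l D = (SOME q. q \<in> quiver_paths n \<and> hd q = h \<and> last q = l \<and> steps u q = D)"

lemma rep:
  assumes "2 \<le> n" "(h, l, D) \<in> coords u n"
  shows "rep u n h l D \<in> quiver_paths n" "hd (rep u n h l D) = h" "last (rep u n h l D) = l"
    "steps u (rep u n h l D) = D"
proof -
  have "\<exists>q. q \<in> quiver_paths n \<and> hd q = h \<and> last q = l \<and> steps u q = D"
    using path_of_coordinates[OF assms(1), of h l u D] assms(2) by (auto simp: coords_def)
  from someI_ex[OF this] show "rep u n h l D \<in> quiver_paths n" "hd (rep u n h l D) = h"
    "last (rep u n h l D) = l" "steps u (rep u n h l D) = D"
    unfolding rep_def by blast+
qed

text \<open>
  The combination of chosen paths with the same coordinates.
\<close>

definition normal :: "bool \<Rightarrow> nat \<Rightarrow> (nat \<Rightarrow> nat \<Rightarrow> nat \<Rightarrow> 'k::field) \<Rightarrow> 'k path_comb" where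
  "normal u n F = (\<Sum>(h, l, D)\<in>coords u n. Poly_Mapping.single (rep u n h l D) (F h l D))"

lemma keys_sum_subset:
  assumes "\<And>x. x \<in> S \<Longrightarrow> Poly_Mapping.keys (F x) \<subseteq> K"
  shows "Poly_Mapping.keys (sum F S) \<subseteq> K"
  using assms by (induction S rule: infinite_finite_induct) (simp_all add: keys_add_subset)

lemma keys_normal:
  assumes "2 \<le> n" "\<And>h l D. (h, l, D) \<in> coords u n \<Longrightarrow> F h l D \<noteq> 0 \<Longrightarrow> rep u n h l D \<in> K"
  shows "Poly_Mapping.keys (normal u n F) \<subseteq> K"
  unfolding normal_def by (rule keys_sum_subset) (use assms in \<open>auto split: if_splits\<close>)

lemma normal_closed: "2 \<le> n \<Longrightarrow> Poly_Mapping.keys (normal u n F) \<subseteq> quiver_paths n"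
  by (rule keys_normal) (simp_all add: rep(1))

lemma pcoord_normal:
  assumes "2 \<le> n"
  shows "pcoord u (normal u n F) h l D = (if (h, l, D) \<in> coords u n then F h l D else 0)"
proof -
  have "pcoord u (normal u n F) h l D = (\<Sum>t\<in>coords u n. if t = (h, l, D) then F h l D else 0)"
    unfolding normal_def pcoord_sum
  proof (rule sum.cong)
    fix t assume t: "t \<in> coords u n"
    obtain h' l' D' where t': "t = (h', l', D')" by (cases t)
    note r = rep[OF assms t[unfolded t']]
    have "D' < cutoff u h' l'" using t by (simp add: t' coords_def)
    then show "pcoord u (case t of (h, l, D) \<Rightarrow> Poly_Mapping.single (rep u n h l D) (F h l D)) h l D =
        (if t = (h, l, D) then F h l D else 0)"
      unfolding t' by (auto simp: pcoord_single r)
  qed simp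
  then show ?thesis by (simp add: finite_coords)
qed

lemma pcoord_support:
  assumes "Poly_Mapping.keys f \<subseteq> quiver_paths n" "pcoord u f h l D \<noteq> 0"
  shows "(h, l, D) \<in> coords u n"
proof -
  obtain q where q: "q \<in> Poly_Mapping.keys f" "hd q = h \<and> last q = l \<and> steps u q = D \<and> D < cutoff u h l"
  proof -
    obtain q where "q \<in> Poly_Mapping.keys f" "(if hd q = h \<and> last q = l \<and> steps u q = D \<and> D < cutoff u h l
        then Poly_Mapping.lookup f q else 0) \<noteq> 0"
      using assms(2) unfolding pcoord_def by (rule sum.not_neutral_contains_not_neutral)
    then show ?thesis using that by (simp split: if_splits)
  qed
  then have "q \<in> quiver_paths n" using assms(1) by blast
  with q(2) steps_low[OF this, of u] quiver_pathsD[OF this] show ?thesis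
    unfolding coords_def by simp
qed

lemma normal_add: "normal u n (\<lambda>h l D. F h l D + G h l D) = normal u n F + normal u n G"
  unfolding normal_def sum.distrib[symmetric] by (rule sum.cong) (auto simp: single_add)

lemma path_mult_scale_left: "path_mult (path_scale c g) f = path_scale c (path_mult g f)"
proof -
  have "Poly_Mapping.keys g \<subseteq> UNIV" by simp
  then show ?thesis
  proof (induction rule: path_comb_induct)
    case (single q d)
    have "Poly_Mapping.keys f \<subseteq> UNIV" by simp
    then show ?case
      by (induction rule: path_comb_induct)
        (simp_all add: path_scale_add path_mult_add_right path_scale_single path_mult_single mult.assoc)
  qed (simp_all add: path_scale_add path_mult_add_left)
qed

lemma path_mult_scale_right: "path_mult f (path_scale c g) = path_scale c (path_mult f g)"
proof -
  have "Poly_Mapping.keys f \<subseteq> UNIV" by simp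
  then show ?thesis
  proof (induction rule: path_comb_induct)
    case (single q d)
    have "Poly_Mapping.keys g \<subseteq> UNIV" by simp
    then show ?case
      by (induction rule: path_comb_induct)
        (simp_all add: path_scale_add path_mult_add_right path_scale_single path_mult_single mult_ac)
  qed (simp_all add: path_scale_add path_mult_add_left)
qed

lemma normal_zero [simp]: "normal u n (\<lambda>h l D. 0) = 0"
  by (simp add: normal_def split_beta)

lemma scaled_in_ideal:
  assumes "2 \<le> n" "f \<in> relation_ideal n"
  shows "path_scale c f \<in> relation_ideal n"
proof -
  have "Poly_Mapping.keys (path_scale c (path_one n)) \<subseteq> quiver_paths n"
    using keys_path_scale path_one_closed by blast
  from relation_ideal_closed(6)[OF assms this]
  have "path_mult (path_scale c (path_one n)) f \<in> relation_ideal n" .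
  moreover have "path_mult (path_scale c (path_one n)) f = path_scale c f"
  proof -
    have f: "Poly_Mapping.keys f \<subseteq> quiver_paths n" using relation_ideal_closed(2)[OF assms(1)] assms(2) by auto
    have "path_mult (path_scale c g) f = path_scale c (path_mult g f)" for g
      by (rule path_mult_scale_left)
    then show ?thesis by (simp only: path_one_left[OF f])
  qed
  ultimately show ?thesis by simp
qed

lemma normal_congruent:
  assumes "2 \<le> n" "Poly_Mapping.keys f \<subseteq> quiver_paths n"
  shows "f - normal u n (pcoord u f) \<in> relation_ideal n"
  using assms(2)
proof (induction rule: path_comb_induct)
  case zero
  show ?case by (simp add: relation_ideal_closed(1)[OF assms(1)])
next
  case (single q c)
  have scale: "Poly_Mapping.single q c = path_scale c (Poly_Mapping.single q 1)"
    by (simp add: path_scale_single)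
  show ?case
  proof (cases "steps u q < cutoff u (hd q) (last q)")
    case False
    then have "normal u n (pcoord u (Poly_Mapping.single q c)) = 0"
      unfolding normal_def by (intro sum.neutral) (auto simp: pcoord_single)
    moreover have "Poly_Mapping.single q (1::'a) \<in> relation_ideal n"
      using False long_path_in_ideal[OF assms(1) single] steps_cutoff_iff_length[OF single, of u] by simp
    ultimately show ?thesis using scaled_in_ideal[OF assms(1)] scale by simp
  next
    case True
    define r where "r = rep u n (hd q) (last q) (steps u q)"
    have mem: "(hd q, last q, steps u q) \<in> coords u n"
      using True steps_low[OF single, of u] quiver_pathsD[OF single] by (simp add: coords_def)
    note rr = rep[OF assms(1) mem, folded r_def]
    have "normal u n (pcoord u (Poly_Mapping.single q c)) =
        (\<Sum>t\<in>coords u n. if t = (hd q, last q, steps u q) then Poly_Mapping.single r c else 0)"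
      unfolding normal_def
    proof (rule sum.cong)
      fix t assume "t \<in> coords u n"
      then show "(case t of (h, l, D) \<Rightarrow> Poly_Mapping.single (rep u n h l D) (pcoord u (Poly_Mapping.single q c) h l D)) =
          (if t = (hd q, last q, steps u q) then Poly_Mapping.single r c else 0)"
        using True by (cases t) (simp add: pcoord_single r_def coords_def)
    qed simp
    then have nf: "normal u n (pcoord u (Poly_Mapping.single q c)) = Poly_Mapping.single r c"
      using mem by (simp add: finite_coords)
    have "length q = length r"
      using steps_eq_iff_length[OF single rr(1), of u] rr by simp
    then have "Poly_Mapping.single q (1::'a) - Poly_Mapping.single r 1 \<in> relation_ideal n"
      using rr by (intro paths_congruent assms(1) single) simp_all
    from scaled_in_ideal[OF assms(1) this, of c]
    have "path_scale c (Poly_Mapping.single q (1::'a) - Poly_Mapping.single r 1) \<in> relation_ideal n" .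
    moreover have "path_scale c (Poly_Mapping.single q (1::'a) - Poly_Mapping.single r 1) =
        Poly_Mapping.single q c - Poly_Mapping.single r c"
      by (rule poly_mapping_eqI) (simp add: lookup_path_scale lookup_minus lookup_single when_def)
    ultimately show ?thesis by (simp add: nf)
  qed
next
  case (add f g)
  have "pcoord u (f + g) = (\<lambda>h l D. pcoord u f h l D + pcoord u g h l D)"
    by (intro ext) (rule pcoord_add)
  then have "f + g - normal u n (pcoord u (f + g)) =
      (f - normal u n (pcoord u f)) + (g - normal u n (pcoord u g))"
    by (simp add: normal_add)
  then show ?case using relation_ideal_closed(3)[OF assms(1) add(3,4)] by (simp only:)
qed

lemma pcoord_uminus: "pcoord u (- f) h l D = - pcoord u f h l D"
proof -
  have "pcoord u (- f + f) h l D = 0" by simp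
  then show ?thesis unfolding pcoord_add by (simp add: eq_neg_iff_add_eq_0)
qed

lemma pcoord_diff: "pcoord u (f - g) h l D = pcoord u f h l D - pcoord u g h l D"
  using pcoord_add[of u f "- g"] by (simp add: pcoord_uminus)

lemma pcoord_ideal:
  assumes "2 \<le> n" "f \<in> relation_ideal n"
  shows "pcoord u f h l D = 0"
proof -
  define Z where "Z = {f :: 'a path_comb. Poly_Mapping.keys f \<subseteq> quiver_paths n \<and> (\<forall>h l D. pcoord u f h l D = 0)}"
  have Z_add: "f + g \<in> Z" if "f \<in> Z" "g \<in> Z" for f g
    using that by (simp add: Z_def pcoord_add keys_add_subset)
  have Z_left: "path_mult g f \<in> Z" if g: "Poly_Mapping.keys g \<subseteq> quiver_paths n" and f: "f \<in> Z" for f g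
    using g
  proof (induction rule: path_comb_induct)
    case (single q c)
    then show ?case using f path_mult_closed[of "Poly_Mapping.single q c" n f]
      by (simp add: Z_def pcoord_single_mult[OF single])
  qed (simp_all add: path_mult_add_left Z_add, simp add: Z_def)
  have Z_right: "path_mult f g \<in> Z" if g: "Poly_Mapping.keys g \<subseteq> quiver_paths n" and f: "f \<in> Z" for f g
    using g
  proof (induction rule: path_comb_induct)
    case (single q c)
    then show ?case using f path_mult_closed[of f n "Poly_Mapping.single q c"]
      by (simp add: Z_def pcoord_mult_single[OF single])
  qed (simp_all add: path_mult_add_right Z_add, simp add: Z_def)
  have "ideal Z (path_algebra n)"
  proof (rule idealI[OF path_algebra_ring])
    show "subgroup Z (add_monoid (path_algebra n))"
    proof (rule group.subgroupI)
      show "group (add_monoid (path_algebra n :: 'a path_comb ring))"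
        using abelian_group.a_group[OF ring.is_abelian_group[OF path_algebra_ring]] .
      fix f assume f: "f \<in> Z"
      then have "inv\<^bsub>add_monoid (path_algebra n)\<^esub> f = - f"
        using path_algebra_a_inv[of f n] by (simp add: a_inv_def Z_def)
      with f show "inv\<^bsub>add_monoid (path_algebra n)\<^esub> f \<in> Z" by (simp add: Z_def pcoord_uminus)
      show "f \<otimes>\<^bsub>add_monoid (path_algebra n)\<^esub> g \<in> Z" if "g \<in> Z" for g
        using Z_add[OF f that] by simp
    next
      have "0 \<in> Z" by (simp add: Z_def)
      then show "Z \<noteq> {}" by blast
      show "Z \<subseteq> carrier (add_monoid (path_algebra n))" by (auto simp: Z_def)
    qed
  qed (simp_all add: Z_left Z_right)
  moreover have "relations n \<subseteq> Z"
  proof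
    fix x :: "'a path_comb" assume x: "x \<in> relations n"
    then have keys: "Poly_Mapping.keys x \<subseteq> quiver_paths n" using relations_closed[OF assms(1)] by auto
    from x consider i where "2 \<le> i" "i \<le> n - 1"
        "x = Poly_Mapping.single [i, i - 1, i] 1 - Poly_Mapping.single [i, i + 1, i] 1"
      | "x = Poly_Mapping.single [1, 2, 1] 1"
      unfolding relations_def Un_iff mem_Collect_eq singleton_iff by blast
    then have "pcoord u x h l D = 0" for h l D
    proof cases
      case 1
      then have "steps u [i, i - 1, i] = 1" "steps u [i, i + 1, i] = 1" by auto
      then show ?thesis unfolding 1(3) pcoord_diff pcoord_single by simp
    next
      case 2
      have "steps u [1, 2, 1] = 1" by simp
      then show ?thesis unfolding 2 pcoord_single by (auto simp: cutoff_def)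
    qed
    with keys show "x \<in> Z" by (simp add: Z_def)
  qed
  ultimately have "relation_ideal n \<subseteq> Z"
    unfolding relation_ideal_def by (rule ring.genideal_minimal[OF path_algebra_ring])
  then show ?thesis using assms(2) by (auto simp: Z_def)
qed

text \<open>
  The coordinates vanish on the relations and the ideal they generate; conversely a
  combination without coordinates is congruent to its normal form, which is zero.
\<close>

lemma relation_ideal_iff:
  assumes "2 \<le> n" "Poly_Mapping.keys f \<subseteq> quiver_paths n"
  shows "f \<in> relation_ideal n \<longleftrightarrow> (\<forall>h l D. pcoord u f h l D = 0)"
proof
  assume "\<forall>h l D. pcoord u f h l D = 0"
  then have "pcoord u f = (\<lambda>h l D. 0)" by (intro ext) simp
  then have "normal u n (pcoord u f) = 0" by (simp only: normal_zero)
  with normal_congruent[OF assms, of u] show "f \<in> relation_ideal n" by simp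
qed (use pcoord_ideal[OF assms(1)] in blast)

section \<open>The weighted shift\<close>

text \<open>
  The derivation of the algebra in coordinates: the basis vector at \<open>D\<close> goes to
  \<open>D\<close> times the one at \<open>D + 1\<close>.
\<close>

definition shift_del :: "(nat \<Rightarrow> 'k::field) \<Rightarrow> nat \<Rightarrow> 'k" where
  "shift_del f D = (if 0 < D then of_nat (D - 1) * f (D - 1) else 0)"

text \<open>
  Iterating multiplies consecutive weights, and a product of \<open>r\<close> consecutive
  integers is \<open>r!\<close> times a binomial coefficient.
\<close>

lemma shift_del_pow:
  "(shift_del ^^ r) f D = (if r \<le> D then of_nat (fact r * ((D - 1) choose r)) * f (D - r) else 0)"
proof (induction r arbitrary: D)
  case (Suc r)
  show ?case
  proof (cases D)
    case (Suc E)
    have eq: "E * ((E - 1) choose r) = Suc r * (E choose Suc r)"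
      using Suc_times_binomial_eq[of "E - 1" r] by (cases E) (simp_all add: mult.commute)
    have "E * (fact r * ((E - 1) choose r)) = fact r * (E * ((E - 1) choose r))"
      by (rule mult.left_commute)
    also have "\<dots> = fact (Suc r) * (E choose Suc r)"
      by (simp only: eq fact_Suc of_nat_id mult_ac)
    finally have bin: "of_nat E * (of_nat (fact r * ((E - 1) choose r)) :: 'a) = of_nat (fact (Suc r) * (E choose Suc r))"
      unfolding of_nat_mult[symmetric] by (rule arg_cong)
    have "(shift_del ^^ Suc r) f (Suc E) = of_nat E * (shift_del ^^ r) f E"
      by (simp only: funpow.simps comp_apply shift_del_def[of "(shift_del ^^ r) f"]) simp
    also have "\<dots> = (if r \<le> E then (of_nat E * of_nat (fact r * ((E - 1) choose r))) * f (E - r) else 0)"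
      unfolding Suc.IH by (simp only: mult.assoc if_distrib[of "(*) (of_nat E)"] mult_zero_right)
    finally show ?thesis unfolding Suc bin by simp
  next
    case 0
    then show ?thesis by (simp only: funpow.simps comp_apply shift_del_def[of "(shift_del ^^ r) f"]) simp
  qed
qed simp

lemma shift_del_pow_char:
  assumes "CHAR('k::field) = p" "0 < p"
  shows "(shift_del ^^ p) (f :: nat \<Rightarrow> 'k) D = 0"
proof -
  have "p dvd fact p * ((D - 1) choose p)" using assms(2) by (simp add: dvd_fact)
  then have "of_nat (fact p * ((D - 1) choose p)) = (0 :: 'k)"
    using assms of_nat_eq_0_iff_char_dvd by blast
  then show ?thesis by (simp only: shift_del_pow mult_zero_left if_cancel)
qed

section \<open>The quotient algebra\<close>

definition cls :: "nat \<Rightarrow> 'k::field path_comb \<Rightarrow> 'k path_comb set" where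
  "cls n f = relation_ideal n +>\<^bsub>path_algebra n\<^esub> f"

text \<open>
  Any representative of the class may be used, as the coordinates vanish on the ideal.
\<close>

definition coord :: "bool \<Rightarrow> 'k::field path_comb set \<Rightarrow> nat \<Rightarrow> nat \<Rightarrow> nat \<Rightarrow> 'k" where
  "coord u Y = pcoord u (SOME f. f \<in> Y)"

lemma mem_cls: "g \<in> cls n f \<longleftrightarrow> g - f \<in> relation_ideal n"
proof -
  have "cls n f = (\<Union>h\<in>relation_ideal n. {h + f})"
    by (simp add: cls_def a_r_coset_def')
  also have "g \<in> \<dots> \<longleftrightarrow> g - f \<in> relation_ideal n"
    by (auto intro: bexI[of _ "g - f"])
  finally show ?thesis .
qed

lemma cls_self: "2 \<le> n \<Longrightarrow> f \<in> cls n f"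
  using relation_ideal_closed(1) by (simp add: mem_cls)

lemma cls_eq_iff: "2 \<le> n \<Longrightarrow> cls n f = cls n g \<longleftrightarrow> f - g \<in> relation_ideal n"
proof
  assume n: "2 \<le> n" and "f - g \<in> relation_ideal n"
  then have "h - f \<in> relation_ideal n \<longleftrightarrow> h - g \<in> relation_ideal n" for h
    using paths_congruent_trans[OF n, of h f g] paths_congruent_trans[OF n, of h g f]
      paths_congruent_sym[OF n, of f g] by blast
  then show "cls n f = cls n g" by (simp add: set_eq_iff mem_cls)
qed (use cls_self in \<open>auto simp: mem_cls[symmetric]\<close>)

lemma cls_eqI:
  assumes "2 \<le> n" "Poly_Mapping.keys f \<subseteq> quiver_paths n" "Poly_Mapping.keys g \<subseteq> quiver_paths n"
    and "\<And>h l D. pcoord u f h l D = pcoord u g h l D"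
  shows "cls n f = cls n g"
proof -
  have "Poly_Mapping.keys (- g) = Poly_Mapping.keys g" by (simp add: set_eq_iff in_keys_iff)
  then have "Poly_Mapping.keys (f - g) \<subseteq> quiver_paths n"
    using keys_add_subset[of f _ "- g"] assms(2,3) by simp
  then show ?thesis
    unfolding cls_eq_iff[OF assms(1)] using assms(4) relation_ideal_iff[OF assms(1), of "f - g" u]
    by (simp add: pcoord_diff)
qed

lemma coord_cls: "2 \<le> n \<Longrightarrow> coord u (cls n f) = pcoord u f"
proof (intro ext)
  fix h l D
  assume n: "2 \<le> n"
  have "(SOME g. g \<in> cls n f) \<in> cls n f" by (rule someI[of _ f]) (rule cls_self[OF n])
  then have "(SOME g. g \<in> cls n f) - f \<in> relation_ideal n" by (simp add: mem_cls)
  from pcoord_ideal[OF n this, of u h l D] show "coord u (cls n f) h l D = pcoord u f h l D"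
    by (simp add: coord_def pcoord_diff)
qed

lemma UN_cls:
  assumes "2 \<le> n" "\<And>g. g - f \<in> relation_ideal n \<Longrightarrow> F g - F f \<in> relation_ideal n"
  shows "(\<Union>g\<in>cls n f. cls n (F g)) = cls n (F f)"
proof -
  have "cls n (F g) = cls n (F f)" if "g \<in> cls n f" for g
    using assms that by (simp add: cls_eq_iff mem_cls)
  then show ?thesis using cls_self[OF assms(1), of f] by blast
qed

lemma path_scale_diff: "path_scale c (f - g) = path_scale c f - path_scale c g"
  by (rule poly_mapping_eqI) (simp add: lookup_path_scale lookup_minus right_diff_distrib)

lemma path_algebra_del_diff: "path_algebra_del lam (f - g) = path_algebra_del lam f - path_algebra_del lam g"
  using path_algebra_del_add[of lam "f - g" g] by simp

lemma del_in_ideal: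
  assumes "2 \<le> n" "f \<in> relation_ideal n"
  shows "path_algebra_del (of_bool u) f \<in> relation_ideal n"
proof -
  have "Poly_Mapping.keys f \<subseteq> quiver_paths n" using relation_ideal_closed(2)[OF assms(1)] assms(2) by auto
  with assms show ?thesis
    by (simp add: relation_ideal_iff[of n _ u] path_algebra_del_closed pcoord_del pcoord_ideal)
qed

lemma Ashriek_ops:
  assumes n: "2 \<le> n"
  shows "carrier (Ashriek n lam) = cls n ` {f. Poly_Mapping.keys f \<subseteq> quiver_paths n}"
    and "\<one>\<^bsub>Ashriek n lam\<^esub> = cls n (path_one n)"
    and "\<zero>\<^bsub>Ashriek n lam\<^esub> = cls n 0"
    and "c \<odot>\<^bsub>Ashriek n lam\<^esub> cls n f = cls n (path_scale c f)"
    and "\<lbrakk>Poly_Mapping.keys f \<subseteq> quiver_paths n; Poly_Mapping.keys g \<subseteq> quiver_paths n\<rbrakk>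
      \<Longrightarrow> cls n f \<otimes>\<^bsub>Ashriek n lam\<^esub> cls n g = cls n (path_mult f g)"
    and "\<lbrakk>Poly_Mapping.keys f \<subseteq> quiver_paths n; Poly_Mapping.keys g \<subseteq> quiver_paths n\<rbrakk>
      \<Longrightarrow> cls n f \<oplus>\<^bsub>Ashriek n lam\<^esub> cls n g = cls n (f + g)"
    and "lam = of_bool u \<Longrightarrow> del (Ashriek n lam) (cls n f) = cls n (path_algebra_del lam f)"
    and "grade (Ashriek n lam) d = cls n ` {f. Poly_Mapping.keys f \<subseteq> quiver_paths n \<and>
       (\<forall>q\<in>Poly_Mapping.keys f. int (length q) - 1 = d)}"
proof -
  note I = relation_ideal_ideal[OF n]
  note hom = ideal.rcos_ring_hom[OF I]
  show "carrier (Ashriek n lam) = cls n ` {f. Poly_Mapping.keys f \<subseteq> quiver_paths n}"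
    by (auto simp: Ashriek_def FactRing_def A_RCOSETS_def' cls_def)
  show "\<one>\<^bsub>Ashriek n lam\<^esub> = cls n (path_one n)"
    by (simp add: Ashriek_def FactRing_def cls_def)
  show "\<zero>\<^bsub>Ashriek n lam\<^esub> = cls n 0"
    by (auto simp: Ashriek_def FactRing_def mem_cls)
  show "c \<odot>\<^bsub>Ashriek n lam\<^esub> cls n f = cls n (path_scale c f)"
    using UN_cls[OF n, of f "path_scale c"] scaled_in_ideal[OF n, of _ c]
    by (simp add: Ashriek_def cls_def[symmetric] path_scale_diff[symmetric])
  show "cls n f \<otimes>\<^bsub>Ashriek n lam\<^esub> cls n g = cls n (path_mult f g)"
    if "Poly_Mapping.keys f \<subseteq> quiver_paths n" "Poly_Mapping.keys g \<subseteq> quiver_paths n"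
    using ring_hom_mult[OF hom, of f g] that by (simp add: Ashriek_def cls_def)
  show "cls n f \<oplus>\<^bsub>Ashriek n lam\<^esub> cls n g = cls n (f + g)"
    if "Poly_Mapping.keys f \<subseteq> quiver_paths n" "Poly_Mapping.keys g \<subseteq> quiver_paths n"
    using ring_hom_add[OF hom, of f g] that by (simp add: Ashriek_def cls_def)
  show "del (Ashriek n lam) (cls n f) = cls n (path_algebra_del lam f)" if "lam = of_bool u"
  proof -
    have "(\<Union>g\<in>cls n f. cls n (path_algebra_del lam g)) = cls n (path_algebra_del lam f)"
      by (rule UN_cls[OF n])
        (simp only: path_algebra_del_diff[symmetric] that, rule del_in_ideal[OF n])
    then show ?thesis by (simp add: Ashriek_def cls_def[symmetric])
  qed
  show "grade (Ashriek n lam) d = cls n ` {f. Poly_Mapping.keys f \<subseteq> quiver_paths n \<and>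
       (\<forall>q\<in>Poly_Mapping.keys f. int (length q) - 1 = d)}"
    by (auto simp: Ashriek_def cls_def)
qed

text \<open>
  Path length in terms of the coordinates.
\<close>

definition cdeg :: "bool \<Rightarrow> nat \<Rightarrow> nat \<Rightarrow> nat \<Rightarrow> int" where
  "cdeg u h l D = 2 * int D + (if u then int h - int l else int l - int h)"

lemma length_cdeg:
  assumes "q \<in> quiver_paths n"
  shows "int (length q) - 1 = cdeg u (hd q) (last q) (steps u q)"
proof -
  have "q \<noteq> []" using assms by auto
  from steps_length[OF this] steps_hd_last[OF assms] show ?thesis
    by (cases u) (simp_all add: cdeg_def)
qed

lemma Ashriek_based:
  assumes n: "2 \<le> n"
  shows "based (Ashriek n (of_bool u :: 'k::field)) (coords u n) (\<lambda>(h, l, D). cdeg u h l D)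
    (\<lambda>a (h, l, D). coord u a h l D)"
proof
  let ?A = "Ashriek n (of_bool u :: 'k)"
  note ops = Ashriek_ops[OF n]
  note cc = coord_cls[OF n]
  fix x y :: "'k path_comb set" and b :: "nat \<times> nat \<times> nat" and F :: "nat \<times> nat \<times> nat \<Rightarrow> 'k" and c d
  obtain h l D where b: "b = (h, l, D)" by (cases b)
  show "finite (coords u n)" by (rule finite_coords)
  show "\<zero>\<^bsub>?A\<^esub> \<in> carrier ?A" by (auto simp: ops)
  show "(case b of (h, l, D) \<Rightarrow> coord u \<zero>\<^bsub>?A\<^esub> h l D) = 0" by (simp add: b ops cc)
  show "\<exists>x\<in>carrier ?A. \<forall>b\<in>coords u n. (case b of (h, l, D) \<Rightarrow> coord u x h l D) = F b"
    by (rule bexI[of _ "cls n (normal u n (\<lambda>h l D. F (h, l, D)))"])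
      (auto simp: ops cc pcoord_normal[OF n] normal_closed[OF n])
  show "x \<in> grade ?A d \<longleftrightarrow> x \<in> carrier ?A \<and>
      (\<forall>b. (case b of (h, l, D) \<Rightarrow> coord u x h l D) \<noteq> 0 \<longrightarrow> (case b of (h, l, D) \<Rightarrow> cdeg u h l D) = d)"
    (is "_ \<longleftrightarrow> ?R")
  proof
    assume "x \<in> grade ?A d"
    then obtain f where f: "x = cls n f" "Poly_Mapping.keys f \<subseteq> quiver_paths n"
      "\<And>q. q \<in> Poly_Mapping.keys f \<Longrightarrow> int (length q) - 1 = d" by (auto simp: ops)
    have "cdeg u h l D = d" if nz: "pcoord u f h l D \<noteq> 0" for h l D
    proof -
      obtain q where q: "q \<in> Poly_Mapping.keys f" "(if hd q = h \<and> last q = l \<and> steps u q = D \<and> D < cutoff u h l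
          then Poly_Mapping.lookup f q else 0) \<noteq> 0"
        using nz unfolding pcoord_def by (rule sum.not_neutral_contains_not_neutral)
      then have "hd q = h" "last q = l" "steps u q = D" by (auto split: if_splits)
      then show ?thesis using f(3)[OF q(1)] length_cdeg[of q n u] f(2) q(1) by auto
    qed
    then show ?R using f(1,2) by (auto simp: ops cc)
  next
    assume R: ?R
    then obtain f where f: "x = cls n f" "Poly_Mapping.keys f \<subseteq> quiver_paths n" by (auto simp: ops)
    have deg: "cdeg u h l D = d" if "pcoord u f h l D \<noteq> 0" for h l D
      using R[THEN conjunct2, THEN spec, of "(h, l, D)"] that by (simp add: f cc)
    have "cls n f = cls n (normal u n (pcoord u f))"
      using normal_congruent[OF n f(2)] by (simp add: cls_eq_iff[OF n])
    moreover have "Poly_Mapping.keys (normal u n (pcoord u f)) \<subseteq>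
        {q \<in> quiver_paths n. int (length q) - 1 = d}"
    proof (rule keys_normal[OF n])
      fix h l D assume m: "(h, l, D) \<in> coords u n" "pcoord u f h l D \<noteq> 0"
      show "rep u n h l D \<in> {q \<in> quiver_paths n. int (length q) - 1 = d}"
        using length_cdeg[OF rep(1)[OF n m(1)], of u] deg[OF m(2)] by (simp add: rep[OF n m(1)])
    qed
    ultimately show "x \<in> grade ?A d" unfolding ops f(1) by blast
  qed
  assume "x \<in> carrier ?A"
  then obtain f where f: "x = cls n f" "Poly_Mapping.keys f \<subseteq> quiver_paths n" by (auto simp: ops)
  show "c \<odot>\<^bsub>?A\<^esub> x \<in> carrier ?A"
    using f order_trans[OF keys_path_scale f(2)] by (simp add: ops)
  show "(case b of (h, l, D) \<Rightarrow> coord u (c \<odot>\<^bsub>?A\<^esub> x) h l D) = c * (case b of (h, l, D) \<Rightarrow> coord u x h l D)"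
    by (simp add: f b ops cc pcoord_scale)
  show "(case b of (h, l, D) \<Rightarrow> coord u x h l D) = 0" if "b \<notin> coords u n"
    using pcoord_support[OF f(2)] that by (auto simp: b f cc)
  assume "y \<in> carrier ?A"
  then obtain g where g: "y = cls n g" "Poly_Mapping.keys g \<subseteq> quiver_paths n" by (auto simp: ops)
  show "x \<oplus>\<^bsub>?A\<^esub> y \<in> carrier ?A"
    unfolding f(1) g(1) ops(6)[OF f(2) g(2)] ops(1) using keys_add_subset[OF f(2) g(2)] by blast
  show "(case b of (h, l, D) \<Rightarrow> coord u (x \<oplus>\<^bsub>?A\<^esub> y) h l D) =
      (case b of (h, l, D) \<Rightarrow> coord u x h l D) + (case b of (h, l, D) \<Rightarrow> coord u y h l D)"
    unfolding f(1) g(1) ops(6)[OF f(2) g(2)] by (simp add: b cc pcoord_add)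
  assume eq: "\<And>b. b \<in> coords u n \<Longrightarrow> (case b of (h, l, D) \<Rightarrow> coord u x h l D) = (case b of (h, l, D) \<Rightarrow> coord u y h l D)"
  have "pcoord u f h l D = pcoord u g h l D" for h l D
  proof (cases "(h, l, D) \<in> coords u n")
    case True
    then show ?thesis using eq[of "(h, l, D)"] unfolding f(1) g(1) cc by simp
  next
    case False
    then have "pcoord u f h l D = 0" "pcoord u g h l D = 0"
      using pcoord_support[OF f(2)] pcoord_support[OF g(2)] by blast+
    then show ?thesis by simp
  qed
  then show "x = y" unfolding f(1) g(1) by (rule cls_eqI[OF n f(2) g(2)])
qed

lemma coord_Ashriek_del:
  assumes n: "2 \<le> n" and a: "a \<in> carrier (Ashriek n (of_bool u :: 'k::field))"
  shows "del (Ashriek n (of_bool u)) a \<in> carrier (Ashriek n (of_bool u))"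
    and "coord u (del (Ashriek n (of_bool u)) a) h l D = (if D < cutoff u h l then shift_del (coord u a h l) D else 0)"
proof -
  obtain f where f: "a = cls n f" "Poly_Mapping.keys f \<subseteq> quiver_paths n" using a by (auto simp: Ashriek_ops[OF n])
  show "del (Ashriek n (of_bool u)) a \<in> carrier (Ashriek n (of_bool u))"
    using path_algebra_del_closed[OF f(2), of u] by (simp add: f Ashriek_ops[OF n])
  show "coord u (del (Ashriek n (of_bool u)) a) h l D = (if D < cutoff u h l then shift_del (coord u a h l) D else 0)"
    by (simp add: f Ashriek_ops[OF n] coord_cls[OF n] pcoord_del[OF f(2)] shift_del_def)
qed

lemma pcoord_leibniz:
  assumes "Poly_Mapping.keys f \<subseteq> quiver_paths n" "Poly_Mapping.keys g \<subseteq> quiver_paths n"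
  shows "pcoord u (path_algebra_del (of_bool u :: 'k::field) (path_mult f g)) h l D =
    pcoord u (path_mult (path_algebra_del (of_bool u) f) g + path_mult f (path_algebra_del (of_bool u) g)) h l D"
  using assms(1)
proof (induction rule: path_comb_induct)
  case q: (single q c)
  from assms(2) show ?case
  proof (induction rule: path_comb_induct)
    case r: (single r d)
    have ne: "q \<noteq> []" "r \<noteq> []" using q r by auto
    have del: "pcoord u (path_algebra_del (of_bool u :: 'k) (Poly_Mapping.single s e)) h l D =
        (if hd s = h \<and> last s = l \<and> Suc (steps u s) = D \<and> D < cutoff u h l then e * of_nat (steps u s) else 0)"
      if "s \<in> quiver_paths n" for s e h l D
      by (simp add: path_algebra_del_single pcoord_scale pcoord_path_del[OF that])
    have closed: "Poly_Mapping.keys (path_algebra_del (of_bool u :: 'k) (Poly_Mapping.single s e)) \<subseteq> quiver_paths n"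
      if "s \<in> quiver_paths n" for s e using that by (intro path_algebra_del_closed) simp
    show ?case
    proof (cases "last q = hd r")
      case True
      have lhs: "pcoord u (path_algebra_del (of_bool u :: 'k) (path_mult (Poly_Mapping.single q c) (Poly_Mapping.single r d))) h l D =
          (if hd q = h \<and> last r = l \<and> Suc (steps u q + steps u r) = D \<and> D < cutoff u h l
           then c * d * of_nat (steps u q + steps u r) else 0)"
        using ne by (simp add: path_mult_single True del[OF quiver_paths_glue[OF q r True]] hd_last_glue steps_glue)
      have "pcoord u (path_mult (path_algebra_del (of_bool u) (Poly_Mapping.single q c)) (Poly_Mapping.single r d)) h l D =
          (if hd q = h \<and> last r = l \<and> Suc (steps u q + steps u r) = D \<and> D < cutoff u h l
           then c * d * of_nat (steps u q) else 0)"
        unfolding pcoord_mult_single[OF r closed[OF q]] del[OF q]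
        using True cutoff_target[OF r, of "Suc (steps u q)" u h] by auto
      moreover have "pcoord u (path_mult (Poly_Mapping.single q c) (path_algebra_del (of_bool u) (Poly_Mapping.single r d))) h l D =
          (if hd q = h \<and> last r = l \<and> Suc (steps u q + steps u r) = D \<and> D < cutoff u h l
           then c * d * of_nat (steps u r) else 0)"
        unfolding pcoord_single_mult[OF q closed[OF r]] del[OF r]
        using True cutoff_source[OF q, of u "Suc (steps u r)" l] by auto
      ultimately show ?thesis unfolding lhs pcoord_add by (simp add: distrib_left)
    next
      case False
      then show ?thesis
        unfolding pcoord_add pcoord_mult_single[OF r closed[OF q]] pcoord_single_mult[OF q closed[OF r]]
        using del[OF q] del[OF r] by (simp add: path_mult_single)
    qed
  qed (simp_all add: path_mult_add_right path_algebra_del_add pcoord_add)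
qed (simp_all add: path_mult_add_left path_algebra_del_add pcoord_add)

section \<open>Algebras with path coordinates\<close>

text \<open>
  What the argument uses of \<open>A\<^sub>n\<^sup>!\<close>. Only products with a single
  basis vector occur, on either side, together with the multiplicativity of the coefficient
  of an idempotent. The axioms are symmetric under passage to the opposite algebra.
\<close>

locale coord_algebra =
  fixes A :: "('k::field, 'a) pcomplex" and p n :: nat and u :: bool
    and co :: "'a \<Rightarrow> nat \<Rightarrow> nat \<Rightarrow> nat \<Rightarrow> 'k"
  assumes n: "2 \<le> n" and p: "0 < p" and char: "CHAR('k) = p"
    and A_ring: "ring A"
    and A_based: "based A (coords u n) (\<lambda>(h, l, D). cdeg u h l D) (\<lambda>a (h, l, D). co a h l D)"
    and A_scalar: "\<lbrakk>a \<in> carrier A; b \<in> carrier A\<rbrakk> \<Longrightarrow> (c \<odot>\<^bsub>A\<^esub> a) \<otimes>\<^bsub>A\<^esub> b = c \<odot>\<^bsub>A\<^esub> (a \<otimes>\<^bsub>A\<^esub> b)"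
      "\<lbrakk>a \<in> carrier A; b \<in> carrier A\<rbrakk> \<Longrightarrow> a \<otimes>\<^bsub>A\<^esub> (c \<odot>\<^bsub>A\<^esub> b) = c \<odot>\<^bsub>A\<^esub> (a \<otimes>\<^bsub>A\<^esub> b)"
    and A_one: "\<one>\<^bsub>A\<^esub> \<in> grade A 0"
    and A_grade: "\<lbrakk>a \<in> grade A d; b \<in> grade A e\<rbrakk> \<Longrightarrow> a \<otimes>\<^bsub>A\<^esub> b \<in> grade A (d + e)"
    and A_leibniz: "\<lbrakk>a \<in> carrier A; b \<in> carrier A\<rbrakk>
      \<Longrightarrow> del A (a \<otimes>\<^bsub>A\<^esub> b) = (del A a \<otimes>\<^bsub>A\<^esub> b) \<oplus>\<^bsub>A\<^esub> (a \<otimes>\<^bsub>A\<^esub> del A b)"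
    and A_del_in: "a \<in> carrier A \<Longrightarrow> del A a \<in> carrier A"
    and co_del: "a \<in> carrier A \<Longrightarrow>
      co (del A a) h l D = (if D < cutoff u h l then shift_del (co a h l) D else 0)"
    and co_mult_monomial: "\<lbrakk>a \<in> carrier A; b \<in> carrier A;
        \<And>h l D. co b h l D = (if (h, l, D) = (m, m', x) then c else 0)\<rbrakk>
      \<Longrightarrow> co (a \<otimes>\<^bsub>A\<^esub> b) h l D =
        (if l = m' \<and> x \<le> D \<and> D < cutoff u h l then co a h m (D - x) * c else 0)"
    and co_monomial_mult: "\<lbrakk>a \<in> carrier A; b \<in> carrier A;
        \<And>h l D. co b h l D = (if (h, l, D) = (m, m', x) then c else 0)\<rbrakk>
      \<Longrightarrow> co (b \<otimes>\<^bsub>A\<^esub> a) h l D =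
        (if h = m \<and> x \<le> D \<and> D < cutoff u h l then co a m' l (D - x) * c else 0)"
    and co_mult_loop: "\<lbrakk>a \<in> carrier A; b \<in> carrier A\<rbrakk> \<Longrightarrow> co (a \<otimes>\<^bsub>A\<^esub> b) i i 0 = co a i i 0 * co b i i 0"
begin

sublocale A: ring A by (rule A_ring)

sublocale AB: based A "coords u n" "\<lambda>(h, l, D). cdeg u h l D" "\<lambda>a (h, l, D). co a h l D"
  by (rule A_based)

lemma co_off: "a \<in> carrier A \<Longrightarrow> (h, l, D) \<notin> coords u n \<Longrightarrow> co a h l D = 0"
  using AB.coord_off[of a "(h, l, D)"] by simp

lemma co_zero: "co \<zero>\<^bsub>A\<^esub> h l D = 0"
  using AB.coord_zero[of "(h, l, D)"] by simp

lemma co_add: "\<lbrakk>a \<in> carrier A; b \<in> carrier A\<rbrakk> \<Longrightarrow> co (a \<oplus>\<^bsub>A\<^esub> b) h l D = co a h l D + co b h l D"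
  using AB.coord_add[of a b "(h, l, D)"] by simp

lemma co_smult: "a \<in> carrier A \<Longrightarrow> co (c \<odot>\<^bsub>A\<^esub> a) h l D = c * co a h l D"
  using AB.coord_smult[of a c "(h, l, D)"] by simp

lemma co_eqI: "\<lbrakk>a \<in> carrier A; b \<in> carrier A; \<And>h l D. co a h l D = co b h l D\<rbrakk> \<Longrightarrow> a = b"
  by (rule AB.coord_eqI) (auto simp: split_beta)

lemma co_finsum:
  assumes "\<And>j. j \<in> J \<Longrightarrow> f j \<in> carrier A"
  shows "finsum A f J \<in> carrier A" "co (finsum A f J) h l D = (\<Sum>j\<in>J. co (f j) h l D)"
  using AB.coord_finsum[of J f "(h, l, D)", OF assms] by simp_all

lemma A_grade_iff: "a \<in> grade A d \<longleftrightarrow> a \<in> carrier A \<and> (\<forall>h l D. co a h l D \<noteq> 0 \<longrightarrow> cdeg u h l D = d)"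
  unfolding AB.grade_iff by auto

lemma A_del_graded: "graded_linear 2 A A (del A)"
  unfolding graded_linear_def
proof (intro conjI ballI allI)
  show "del A \<in> carrier A \<rightarrow> carrier A" by (rule funcsetI) (rule A_del_in)
next
  fix x y assume x: "x \<in> carrier A" and y: "y \<in> carrier A"
  have xy: "x \<oplus>\<^bsub>A\<^esub> y \<in> carrier A" by (rule AB.add_in[OF x y])
  show "del A (x \<oplus>\<^bsub>A\<^esub> y) = del A x \<oplus>\<^bsub>A\<^esub> del A y"
  proof (rule co_eqI)
    fix h l D
    show "co (del A (x \<oplus>\<^bsub>A\<^esub> y)) h l D = co (del A x \<oplus>\<^bsub>A\<^esub> del A y) h l D"
      unfolding co_add[OF A_del_in[OF x] A_del_in[OF y]] co_del[OF xy] co_del[OF x] co_del[OF y]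
        shift_del_def co_add[OF x y] by (simp add: distrib_left)
  qed (intro A_del_in xy AB.add_in x y)+
next
  fix x c assume x: "x \<in> carrier A"
  have cx: "c \<odot>\<^bsub>A\<^esub> x \<in> carrier A" by (rule AB.smult_in[OF x])
  show "del A (c \<odot>\<^bsub>A\<^esub> x) = c \<odot>\<^bsub>A\<^esub> del A x"
  proof (rule co_eqI)
    fix h l D
    show "co (del A (c \<odot>\<^bsub>A\<^esub> x)) h l D = co (c \<odot>\<^bsub>A\<^esub> del A x) h l D"
      unfolding co_smult[OF A_del_in[OF x]] co_del[OF cx] co_del[OF x] shift_del_def co_smult[OF x]
      by simp
  qed (intro A_del_in cx AB.smult_in x)+
next
  fix e x assume x: "x \<in> grade A e"
  have x_in: "x \<in> carrier A" and deg: "\<And>h l D. co x h l D \<noteq> 0 \<Longrightarrow> cdeg u h l D = e"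
    using x unfolding A_grade_iff by blast+
  have "cdeg u h l D = e + 2" if nz: "co (del A x) h l D \<noteq> 0" for h l D
  proof (cases D)
    case 0
    then show ?thesis using nz unfolding co_del[OF x_in] shift_del_def by (simp split: if_splits)
  next
    case (Suc E)
    then have "co x h l E \<noteq> 0" using nz unfolding co_del[OF x_in] shift_del_def by (simp split: if_splits)
    from deg[OF this] show ?thesis unfolding Suc cdeg_def by simp
  qed
  then show "del A x \<in> grade A (e + 2)" unfolding A_grade_iff using A_del_in[OF x_in] by blast
qed

lemma co_del_pow:
  assumes "a \<in> carrier A"
  shows "(del A ^^ r) a \<in> carrier A \<and> co ((del A ^^ r) a) h l D = (if D < cutoff u h l then (shift_del ^^ r) (co a h l) D else 0)"
proof (induction r arbitrary: D)
  case 0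
  then show ?case using assms co_off[OF assms, of h l D] by (auto simp: coords_def)
next
  case (Suc r)
  then have "(del A ^^ r) a \<in> carrier A" by blast
  then show ?case using Suc[of "D - 1"]
    by (cases "D < cutoff u h l") (simp_all add: A_del_in co_del shift_del_def less_imp_diff_less)
qed

lemma A_pcomplex: "is_pcomplex p A"
proof (rule AB.is_pcomplexI[OF A_del_graded])
  fix x assume x: "x \<in> carrier A"
  show "(del A ^^ p) x = \<zero>\<^bsub>A\<^esub>"
    by (rule co_eqI) (simp_all add: co_del_pow[OF x] co_zero shift_del_pow_char[OF char p])
qed

lemma A_pdg: "pdg_algebra p A"
  unfolding pdg_algebra_def
  by (intro conjI allI ballI A_ring A_pcomplex A_one A_scalar A_grade A_leibniz; assumption)

end

text \<open>
  Only the product changes, so that left modules over the opposite algebra are right modules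
  with the same underlying record.
\<close>

definition opp :: "('k, 'a) pcomplex \<Rightarrow> ('k, 'a) pcomplex" where
  "opp A = A\<lparr>monoid.mult := (\<lambda>a b. b \<otimes>\<^bsub>A\<^esub> a)\<rparr>"

lemma opp_simps [simp]:
  "carrier (opp A) = carrier A" "one (opp A) = one A" "zero (opp A) = zero A" "add (opp A) = add A"
  "module.smult (opp A) = module.smult A" "grade (opp A) = grade A" "del (opp A) = del A"
  "a \<otimes>\<^bsub>opp A\<^esub> b = b \<otimes>\<^bsub>A\<^esub> a"
  by (simp_all add: opp_def)

lemma pcoord_mult_loop:
  assumes "Poly_Mapping.keys f \<subseteq> quiver_paths n" "Poly_Mapping.keys g \<subseteq> quiver_paths n"
  shows "pcoord u (path_mult f g) i i 0 = pcoord u f i i 0 * pcoord u g i i 0"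
  using assms(1)
proof (induction rule: path_comb_induct)
  case (single q c)
  show ?case
  proof (cases "hd q = i \<and> steps u q = 0 \<and> last q \<noteq> i")
    case True
    then have "(last q, i, 0) \<notin> coords u n"
      using steps_low[OF single, of u] by (auto simp: coords_def low_def split: if_splits)
    then have "pcoord u g (last q) i 0 = 0" using pcoord_support[OF assms(2)] by blast
    then show ?thesis using True by (simp add: pcoord_single_mult[OF single assms(2)] pcoord_single)
  next
    case False
    then show ?thesis by (auto simp: pcoord_single_mult[OF single assms(2)] pcoord_single)
  qed
qed (simp_all add: path_mult_add_left pcoord_add distrib_right)

lemma Ashriek_coord_algebra:
  assumes n: "2 \<le> n" and p: "0 < p" "CHAR('k::field) = p"
  shows "coord_algebra (Ashriek n (of_bool u :: 'k)) p n u (coord u)"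
proof (rule coord_algebra.intro)
  let ?A = "Ashriek n (of_bool u :: 'k)"
  note ops = Ashriek_ops[OF n] and cc = coord_cls[OF n]
  interpret AB: based ?A "coords u n" "\<lambda>(h, l, D). cdeg u h l D" "\<lambda>a (h, l, D). coord u a h l D"
    by (rule Ashriek_based[OF n])
  show "2 \<le> n" "0 < p" "CHAR('k) = p" by fact+
  have ex: "\<exists>f. a = cls n f \<and> Poly_Mapping.keys f \<subseteq> quiver_paths n" if "a \<in> carrier ?A" for a
    using that by (auto simp: ops)
  have cls_in: "cls n f \<in> carrier ?A" if "Poly_Mapping.keys f \<subseteq> quiver_paths n" for f
    using that by (simp add: ops)
  show "ring ?A"
  proof (rule ringI)
    show "abelian_group ?A" using AB.is_module by (rule module.axioms)
    show "monoid ?A"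
    proof (rule monoidI)
      fix x y z assume "x \<in> carrier ?A" "y \<in> carrier ?A" "z \<in> carrier ?A"
      then obtain f g h where fgh: "x = cls n f" "y = cls n g" "z = cls n h"
        and k: "Poly_Mapping.keys f \<subseteq> quiver_paths n" "Poly_Mapping.keys g \<subseteq> quiver_paths n"
          "Poly_Mapping.keys h \<subseteq> quiver_paths n" using ex[of x] ex[of y] ex[of z] by blast
      show "x \<otimes>\<^bsub>?A\<^esub> y \<in> carrier ?A" by (simp only: fgh ops(5) k cls_in path_mult_closed)
      show "x \<otimes>\<^bsub>?A\<^esub> y \<otimes>\<^bsub>?A\<^esub> z = x \<otimes>\<^bsub>?A\<^esub> (y \<otimes>\<^bsub>?A\<^esub> z)"
        by (simp only: fgh ops(5) k path_mult_closed path_mult_assoc[OF k])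
      show "\<one>\<^bsub>?A\<^esub> \<otimes>\<^bsub>?A\<^esub> x = x" "x \<otimes>\<^bsub>?A\<^esub> \<one>\<^bsub>?A\<^esub> = x"
        by (simp_all only: fgh ops(2,5) k path_one_closed path_one_left path_one_right)
    qed (simp only: ops(2) cls_in path_one_closed)
    fix x y z assume "x \<in> carrier ?A" "y \<in> carrier ?A" "z \<in> carrier ?A"
    then obtain f g h where fgh: "x = cls n f" "y = cls n g" "z = cls n h"
      and k: "Poly_Mapping.keys f \<subseteq> quiver_paths n" "Poly_Mapping.keys g \<subseteq> quiver_paths n"
        "Poly_Mapping.keys h \<subseteq> quiver_paths n" using ex[of x] ex[of y] ex[of z] by blast
    show "(x \<oplus>\<^bsub>?A\<^esub> y) \<otimes>\<^bsub>?A\<^esub> z = x \<otimes>\<^bsub>?A\<^esub> z \<oplus>\<^bsub>?A\<^esub> y \<otimes>\<^bsub>?A\<^esub> z"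
      "z \<otimes>\<^bsub>?A\<^esub> (x \<oplus>\<^bsub>?A\<^esub> y) = z \<otimes>\<^bsub>?A\<^esub> x \<oplus>\<^bsub>?A\<^esub> z \<otimes>\<^bsub>?A\<^esub> y"
      by (simp_all only: fgh ops(5,6) k keys_add_subset path_mult_closed path_mult_add_left path_mult_add_right)
  qed
  show "based ?A (coords u n) (\<lambda>(h, l, D). cdeg u h l D) (\<lambda>a (h, l, D). coord u a h l D)"
    by (rule Ashriek_based[OF n])
  show "\<one>\<^bsub>?A\<^esub> \<in> grade ?A 0"
  proof -
    have "Poly_Mapping.keys (path_one n :: 'k path_comb) \<subseteq> {q. int (length q) - 1 = 0}"
      by (rule keys_sum_subset) simp
    then show ?thesis using path_one_closed[of n, where 'k = 'k] unfolding ops by blast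
  qed
  fix a b c d e h l D i m m' x
  show "a \<otimes>\<^bsub>?A\<^esub> b \<in> grade ?A (d + e)" if "a \<in> grade ?A d" "b \<in> grade ?A e"
  proof -
    from that obtain f g where fg: "a = cls n f" "b = cls n g"
      and k: "Poly_Mapping.keys f \<subseteq> quiver_paths n" "Poly_Mapping.keys g \<subseteq> quiver_paths n"
      and kd: "Poly_Mapping.keys f \<subseteq> {q \<in> quiver_paths n. int (length q) - 1 = d}"
        "Poly_Mapping.keys g \<subseteq> {q \<in> quiver_paths n. int (length q) - 1 = e}"
      unfolding ops by blast
    have "Poly_Mapping.keys (path_mult f g) \<subseteq> {q \<in> quiver_paths n. int (length q) - 1 = d + e}"
      using kd(1)
    proof (induction rule: path_comb_induct)
      case q: (single q s)
      from kd(2) show ?case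
      proof (induction rule: path_comb_induct)
        case r: (single r t)
        have "int (length (q @ tl r)) - 1 = d + e" using q r by (cases r) auto
        then show ?case using q r quiver_paths_glue[of q n r] by (simp add: path_mult_single)
      qed (simp_all add: path_mult_add_right keys_add_subset)
    qed (simp_all add: path_mult_add_left keys_add_subset)
    then show ?thesis unfolding fg ops(5)[OF k] ops(8) by blast
  qed
  assume a: "a \<in> carrier ?A"
  then obtain f where f: "a = cls n f" "Poly_Mapping.keys f \<subseteq> quiver_paths n" using ex by blast
  note fs = order_trans[OF keys_path_scale f(2)]
  show "del ?A a \<in> carrier ?A" "coord u (del ?A a) h l D = (if D < cutoff u h l then shift_del (coord u a h l) D else 0)"
    using coord_Ashriek_del[OF n a] by blast+
  assume b: "b \<in> carrier ?A"
  then obtain g where g: "b = cls n g" "Poly_Mapping.keys g \<subseteq> quiver_paths n" using ex by blast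
  note gs = order_trans[OF keys_path_scale g(2)]
  show "(c \<odot>\<^bsub>?A\<^esub> a) \<otimes>\<^bsub>?A\<^esub> b = c \<odot>\<^bsub>?A\<^esub> (a \<otimes>\<^bsub>?A\<^esub> b)"
    by (simp only: f(1) g(1) ops(4,5) f(2) g(2) fs path_mult_scale_left)
  show "a \<otimes>\<^bsub>?A\<^esub> (c \<odot>\<^bsub>?A\<^esub> b) = c \<odot>\<^bsub>?A\<^esub> (a \<otimes>\<^bsub>?A\<^esub> b)"
    by (simp only: f(1) g(1) ops(4,5) f(2) g(2) gs path_mult_scale_right)
  note df = path_algebra_del_closed[OF f(2), of u] and dg = path_algebra_del_closed[OF g(2), of u]
  show "del ?A (a \<otimes>\<^bsub>?A\<^esub> b) = (del ?A a \<otimes>\<^bsub>?A\<^esub> b) \<oplus>\<^bsub>?A\<^esub> (a \<otimes>\<^bsub>?A\<^esub> del ?A b)"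
    unfolding f(1) g(1) ops(5)[OF f(2) g(2)] ops(7)[OF refl] ops(5)[OF df g(2)] ops(5)[OF f(2) dg]
      ops(6)[OF path_mult_closed[OF df g(2)] path_mult_closed[OF f(2) dg]]
    by (rule cls_eqI[OF n _ _ pcoord_leibniz[OF f(2) g(2)]])
      (intro path_algebra_del_closed keys_add_subset path_mult_closed f(2) g(2) df dg)+
  show "coord u (a \<otimes>\<^bsub>?A\<^esub> b) i i 0 = coord u a i i 0 * coord u b i i 0"
    unfolding f(1) g(1) ops(5)[OF f(2) g(2)] cc by (rule pcoord_mult_loop[OF f(2) g(2)])
  show "coord u (a \<otimes>\<^bsub>?A\<^esub> b) h l D =
        (if l = m' \<and> x \<le> D \<and> D < cutoff u h l then coord u a h m (D - x) * c else 0)"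
    if mono: "\<And>h l D. coord u b h l D = (if (h, l, D) = (m, m', x) then c else 0)"
  proof (cases "(m, m', x) \<in> coords u n")
    case True
    note r = rep[OF n True]
    define r where "r = rep u n m m' x"
    have r': "r \<in> quiver_paths n" "hd r = m" "last r = m'" "steps u r = x" using r by (simp_all add: r_def)
    have rk: "Poly_Mapping.keys (Poly_Mapping.single r c) \<subseteq> quiver_paths n" using r'(1) by simp
    have "x < cutoff u m m'" using True by (simp add: coords_def)
    then have "cls n g = cls n (Poly_Mapping.single r c)"
      using mono unfolding g(1) cc
      by (intro cls_eqI[OF n g(2) rk, of u]) (auto simp: pcoord_single r'(2-4))
    then show ?thesis
      unfolding f(1) g(1) by (simp only: ops(5)[OF f(2) rk] cc pcoord_mult_single[OF r'(1) f(2)] r'(2-4))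
  next
    case False
    then have "coord u b m m' x = 0" using pcoord_support[OF g(2)] unfolding g(1) cc by blast
    then have c: "c = 0" using mono[of m m' x] by simp
    have k0: "Poly_Mapping.keys (0 :: 'k path_comb) \<subseteq> quiver_paths n" by simp
    have g0: "cls n g = cls n 0"
      using mono unfolding g(1) cc by (intro cls_eqI[OF n g(2) k0, of u]) (simp add: c)
    have "a \<otimes>\<^bsub>?A\<^esub> b = cls n 0"
      unfolding f(1) g(1) g0 ops(5)[OF f(2) k0] path_mult_zero(2) by (rule refl)
    then have "coord u (a \<otimes>\<^bsub>?A\<^esub> b) h l D = 0"
      by (simp only: cc pcoord_zero)
    then show ?thesis unfolding c mult_zero_right if_cancel .
  qed
  show "coord u (b \<otimes>\<^bsub>?A\<^esub> a) h l D =
        (if h = m \<and> x \<le> D \<and> D < cutoff u h l then coord u a m' l (D - x) * c else 0)"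
    if mono: "\<And>h l D. coord u b h l D = (if (h, l, D) = (m, m', x) then c else 0)"
  proof (cases "(m, m', x) \<in> coords u n")
    case True
    note r = rep[OF n True]
    define r where "r = rep u n m m' x"
    have r': "r \<in> quiver_paths n" "hd r = m" "last r = m'" "steps u r = x" using r by (simp_all add: r_def)
    have rk: "Poly_Mapping.keys (Poly_Mapping.single r c) \<subseteq> quiver_paths n" using r'(1) by simp
    have "x < cutoff u m m'" using True by (simp add: coords_def)
    then have "cls n g = cls n (Poly_Mapping.single r c)"
      using mono unfolding g(1) cc
      by (intro cls_eqI[OF n g(2) rk, of u]) (auto simp: pcoord_single r'(2-4))
    then show ?thesis
      unfolding f(1) g(1) by (simp only: ops(5)[OF rk f(2)] cc mult.commute[of _ c] pcoord_single_mult[OF r'(1) f(2)] r'(2-4))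
  next
    case False
    then have "coord u b m m' x = 0" using pcoord_support[OF g(2)] unfolding g(1) cc by blast
    then have c: "c = 0" using mono[of m m' x] by simp
    have k0: "Poly_Mapping.keys (0 :: 'k path_comb) \<subseteq> quiver_paths n" by simp
    have g0: "cls n g = cls n 0"
      using mono unfolding g(1) cc by (intro cls_eqI[OF n g(2) k0, of u]) (simp add: c)
    have "b \<otimes>\<^bsub>?A\<^esub> a = cls n 0"
      unfolding f(1) g(1) g0 ops(5)[OF k0 f(2)] path_mult_zero(1) by (rule refl)
    then have "coord u (b \<otimes>\<^bsub>?A\<^esub> a) h l D = 0"
      by (simp only: cc pcoord_zero)
    then show ?thesis unfolding c mult_zero_right if_cancel .
  qed
qed

lemma based_swap:
  fixes M :: "('k::field, 'v, 'z) pcomplex_scheme" and B :: "'b set" and deg :: "'b \<Rightarrow> int"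
    and C :: "'v \<Rightarrow> 'b \<Rightarrow> 'k" and \<pi> :: "'b \<Rightarrow> 'b"
  assumes "based M B deg C" "\<And>b. \<pi> (\<pi> b) = b"
  shows "based M (\<pi> ` B) (\<lambda>b. deg (\<pi> b)) (\<lambda>x b. C x (\<pi> b))"
proof -
  interpret M: based M B deg C by fact
  have mem: "b \<in> \<pi> ` B \<longleftrightarrow> \<pi> b \<in> B" for b using assms(2) by (metis image_iff)
  show ?thesis
  proof (rule based.intro)
    show "finite (\<pi> ` B)" using M.finite_basis by (rule finite_imageI)
    fix x y and F :: "'b \<Rightarrow> 'k" and d
    show "\<exists>x\<in>carrier M. \<forall>b\<in>\<pi> ` B. C x (\<pi> b) = F b"
    proof -
      obtain x where x: "x \<in> carrier M" "\<forall>b\<in>B. C x b = F (\<pi> b)" using M.coord_surj[of "\<lambda>b. F (\<pi> b)"] by blast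
      show ?thesis by (rule bexI[OF _ x(1)]) (use x(2) assms(2) in simp)
    qed
    show "x = y" if "x \<in> carrier M" "y \<in> carrier M" "\<And>b. b \<in> \<pi> ` B \<Longrightarrow> C x (\<pi> b) = C y (\<pi> b)"
    proof (rule M.coord_inj[OF that(1,2)])
      fix b assume "b \<in> B"
      then show "C x b = C y b" using that(3)[of "\<pi> b"] assms(2) by simp
    qed
    show "x \<in> grade M d \<longleftrightarrow> x \<in> carrier M \<and> (\<forall>b. C x (\<pi> b) \<noteq> 0 \<longrightarrow> deg (\<pi> b) = d)"
      unfolding M.grade_iff using assms(2) by metis
  qed (simp_all add: mem M.zero_in M.add_in M.smult_in M.coord_off M.coord_zero M.coord_add M.coord_smult)
qed

text \<open>
  Reading paths backwards exchanges their end points and turns steps up into steps down.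
\<close>

lemma coord_algebra_opp:
  fixes A :: "('k::field, 'a) pcomplex"
  assumes "coord_algebra A p n u co"
  shows "coord_algebra (opp A) p n (\<not> u) (\<lambda>a h l D. co a l h D)"
proof -
  interpret A: coord_algebra A p n u co by fact
  have cut: "cutoff (\<not> u) h l = cutoff u l h" for h l by (simp add: cutoff_def)
  show ?thesis
  proof (rule coord_algebra.intro)
    show "2 \<le> n" "0 < p" "CHAR('k) = p" by (rule A.n, rule A.p, rule A.char)
    show "ring (opp A)"
    proof (rule ringI)
      show "abelian_group (opp A)"
      proof (rule abelian_groupI)
        fix x assume "x \<in> carrier (opp A)"
        then show "\<exists>y\<in>carrier (opp A). y \<oplus>\<^bsub>opp A\<^esub> x = \<zero>\<^bsub>opp A\<^esub>"
          by (intro bexI[of _ "\<ominus>\<^bsub>A\<^esub> x"]) (simp_all add: A.A.l_neg)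
      qed (simp_all add: A.A.a_ac)
      show "monoid (opp A)"
        by (rule monoidI) (simp_all add: A.A.m_assoc)
    qed (simp_all add: A.A.l_distr A.A.r_distr)
    show "based (opp A) (coords (\<not> u) n) (\<lambda>(h, l, D). cdeg (\<not> u) h l D) (\<lambda>a (h, l, D). co a l h D)"
    proof -
      define \<pi> :: "nat \<times> nat \<times> nat \<Rightarrow> nat \<times> nat \<times> nat" where "\<pi> = (\<lambda>(h, l, D). (l, h, D))"
      have inv: "\<pi> (\<pi> b) = b" for b by (cases b) (simp add: \<pi>_def)
      have "coords (\<not> u) n = \<pi> ` coords u n"
      proof -
        have "b \<in> \<pi> ` coords u n \<longleftrightarrow> \<pi> b \<in> coords u n" for b using inv by (metis image_iff)
        then have "\<pi> ` coords u n = {b. \<pi> b \<in> coords u n}" by blast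
        then show ?thesis by (auto simp: \<pi>_def coords_def low_def cutoff_def)
      qed
      moreover have "(\<lambda>(h, l, D). cdeg (\<not> u) h l D) = (\<lambda>b. case \<pi> b of (h, l, D) \<Rightarrow> cdeg u h l D)"
        by (rule ext) (simp add: \<pi>_def split_beta cdeg_def)
      moreover have "(\<lambda>a (h, l, D). co a l h D) = (\<lambda>a b. case \<pi> b of (h, l, D) \<Rightarrow> co a h l D)"
        by (intro ext) (simp add: \<pi>_def split_beta)
      moreover have "based (opp A) B deg C \<longleftrightarrow> based A B deg C"
        for B :: "(nat \<times> nat \<times> nat) set" and deg :: "nat \<times> nat \<times> nat \<Rightarrow> int" and C by (simp add: based_def)
      ultimately show ?thesis using based_swap[OF A.A_based inv] by (simp only:)
    qed
    fix a b c d e h l D m m' x i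
    show "\<one>\<^bsub>opp A\<^esub> \<in> grade (opp A) 0" by (simp only: opp_simps A.A_one)
    show "a \<otimes>\<^bsub>opp A\<^esub> b \<in> grade (opp A) (d + e)" if "a \<in> grade (opp A) d" "b \<in> grade (opp A) e"
      using A.A_grade[of b e a d] that by (simp only: opp_simps add.commute)
    assume "a \<in> carrier (opp A)"
    then have a: "a \<in> carrier A" by (simp only: opp_simps)
    show "del (opp A) a \<in> carrier (opp A)" using A.A_del_in[OF a] by (simp only: opp_simps)
    show "co (del (opp A) a) l h D = (if D < cutoff (\<not> u) h l then shift_del (co a l h) D else 0)"
      using A.co_del[OF a] by (simp only: opp_simps cut)
    assume "b \<in> carrier (opp A)"
    then have b: "b \<in> carrier A" by (simp only: opp_simps)
    show "(c \<odot>\<^bsub>opp A\<^esub> a) \<otimes>\<^bsub>opp A\<^esub> b = c \<odot>\<^bsub>opp A\<^esub> (a \<otimes>\<^bsub>opp A\<^esub> b)"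
      using A.A_scalar(2)[OF b a] by (simp only: opp_simps)
    show "a \<otimes>\<^bsub>opp A\<^esub> (c \<odot>\<^bsub>opp A\<^esub> b) = c \<odot>\<^bsub>opp A\<^esub> (a \<otimes>\<^bsub>opp A\<^esub> b)"
      using A.A_scalar(1)[OF b a] by (simp only: opp_simps)
    show "del (opp A) (a \<otimes>\<^bsub>opp A\<^esub> b) =
        (del (opp A) a \<otimes>\<^bsub>opp A\<^esub> b) \<oplus>\<^bsub>opp A\<^esub> (a \<otimes>\<^bsub>opp A\<^esub> del (opp A) b)"
      unfolding opp_simps A.A_leibniz[OF b a]
      by (intro A.A.a_comm A.A.m_closed A.A_del_in a b)
    show "co (a \<otimes>\<^bsub>opp A\<^esub> b) i i 0 = co a i i 0 * co b i i 0"
      using A.co_mult_loop[OF b a, of i] by (simp only: opp_simps mult.commute)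
    assume mono: "\<And>h l D. co b l h D = (if (h, l, D) = (m, m', x) then c else 0)"
    have mono': "co b h l D = (if (h, l, D) = (m', m, x) then c else 0)" for h l D
      by (auto simp: mono)
    show "co (a \<otimes>\<^bsub>opp A\<^esub> b) l h D =
        (if l = m' \<and> x \<le> D \<and> D < cutoff (\<not> u) h l then co a m h (D - x) * c else 0)"
      using A.co_monomial_mult[OF a b mono', of l h D] by (simp only: opp_simps cut)
    show "co (b \<otimes>\<^bsub>opp A\<^esub> a) l h D =
        (if h = m \<and> x \<le> D \<and> D < cutoff (\<not> u) h l then co a l m' (D - x) * c else 0)"
      using A.co_mult_monomial[OF a b mono', of l h D] by (simp only: opp_simps cut)
  qed
qed

section \<open>Contracting a triangular complex\<close>

definition homotopy_sum :: "nat \<Rightarrow> ('v \<Rightarrow> 'v) \<Rightarrow> ('v \<Rightarrow> 'v) \<Rightarrow> 'v \<Rightarrow> 'v::comm_monoid_add" where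
  "homotopy_sum p T h x = (\<Sum>j<p. (T ^^ j) (h ((T ^^ (p - 1 - j)) x)))"

lemma additive_funpow:
  fixes T :: "'v::ab_group_add \<Rightarrow> 'v"
  shows "Modules.additive T \<Longrightarrow> Modules.additive (T ^^ j)"
  by (induction j) (simp_all add: Modules.additive_def)

text \<open>
  If \<open>h\<^sub>0\<close> contracts up to a nilpotent error that commutes with the
  differential, the finite Neumann series of the error turns it into an exact contraction.
\<close>

lemma unipotent_homotopy:
  fixes T h \<rho> :: "'v::ab_group_add \<Rightarrow> 'v"
  assumes T: "Modules.additive T" and h: "Modules.additive h" and \<rho>: "Modules.additive \<rho>"
    and \<rho>T: "\<And>x. \<rho> (T x) = T x" and T\<rho>: "\<And>x. T (\<rho> x) = T x"
    and \<rho>h: "\<And>x. \<rho> (h x) = h x" and \<rho>\<rho>: "\<And>x. \<rho> (\<rho> x) = \<rho> x"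
    and Tp: "\<And>x. (T ^^ p) x = 0" and p: "0 < p"
    and e: "\<And>x. e x = \<rho> x - homotopy_sum p T h x"
    and nil: "\<And>x. (e ^^ R) x = 0" and R: "0 < R"
  shows "homotopy_sum p T (\<lambda>x. h (\<Sum>r<R. (e ^^ r) x)) x = \<rho> x"
proof -
  interpret T: Modules.additive T by fact
  interpret h: Modules.additive h by fact
  interpret \<rho>: Modules.additive \<rho> by fact
  interpret Tj: Modules.additive "T ^^ j" for j by (rule additive_funpow[OF T])
  obtain m where m: "p = Suc m" using p by (cases p) auto
  obtain q where q: "R = Suc q" using R by (cases R) auto
  define \<phi> where "\<phi> = homotopy_sum p T h"
  have \<phi>: "\<phi> x = (\<Sum>j<Suc m. (T ^^ j) (h ((T ^^ (m - j)) x)))" for x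
    by (simp add: \<phi>_def homotopy_sum_def m)
  have \<phi>_add: "\<phi> (x + y) = \<phi> x + \<phi> y" for x y
    by (simp only: \<phi> Tj.add h.add sum.distrib)
  have \<phi>T: "\<phi> (T x) = T (\<phi> x)" for x
  proof -
    have "\<phi> (T x) = (\<Sum>j<Suc m. (T ^^ j) (h ((T ^^ Suc (m - j)) x)))"
      by (simp only: \<phi> funpow_Suc_right comp_apply)
    also have "\<dots> = h ((T ^^ p) x) + (\<Sum>j<m. (T ^^ Suc j) (h ((T ^^ Suc (m - Suc j)) x)))"
      by (simp only: sum.lessThan_Suc_shift m diff_zero funpow_0)
    also have "(\<Sum>j<m. (T ^^ Suc j) (h ((T ^^ Suc (m - Suc j)) x))) = (\<Sum>j<m. (T ^^ Suc j) (h ((T ^^ (m - j)) x)))"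
      by (rule sum.cong) (simp_all only: lessThan_iff Suc_diff_Suc)
    also have "h ((T ^^ p) x) = (T ^^ Suc m) (h ((T ^^ (m - m)) x))"
      by (simp only: Tp h.zero m[symmetric])
    finally have "\<phi> (T x) = (\<Sum>j<Suc m. (T ^^ Suc j) (h ((T ^^ (m - j)) x)))"
      by (simp only: sum.lessThan_Suc add.commute)
    also have "\<dots> = T (\<phi> x)" by (simp only: \<phi> T.sum funpow.simps(2) comp_apply)
    finally show ?thesis .
  qed
  have \<rho>\<phi>: "\<rho> (\<phi> x) = \<phi> x" for x
  proof -
    have "\<rho> ((T ^^ j) (h y)) = (T ^^ j) (h y)" for j y
      by (cases j) (simp_all only: funpow_0 funpow.simps(2) comp_apply \<rho>h \<rho>T)
    then show ?thesis by (simp only: \<phi> \<rho>.sum)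
  qed
  have e': "e x = \<rho> x - \<phi> x" for x by (simp only: e \<phi>_def)
  have eT: "e (T x) = T (e x)" for x by (simp only: e' \<phi>T T.diff T\<rho> \<rho>T)
  have \<rho>e: "\<rho> (e x) = e x" for x by (simp only: e' \<rho>.diff \<rho>\<rho> \<rho>\<phi>)
  have erT: "(e ^^ r) (T x) = T ((e ^^ r) x)" for r x
    by (induction r) (simp_all only: funpow_0 funpow.simps(2) comp_apply eT)
  have erTj: "(e ^^ r) ((T ^^ j) x) = (T ^^ j) ((e ^^ r) x)" for r j x
    by (induction j) (simp_all only: funpow_0 funpow.simps(2) comp_apply erT)
  define S where "S x = (\<Sum>r<R. (e ^^ r) x)" for x
  have ST: "S ((T ^^ j) x) = (T ^^ j) (S x)" for j x by (simp only: S_def erTj Tj.sum)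
  interpret \<phi>: Modules.additive \<phi> by unfold_locales (rule \<phi>_add)
  have "homotopy_sum p T (\<lambda>x. h (S x)) x = \<phi> (S x)"
    by (simp only: homotopy_sum_def \<phi>_def ST)
  also have "\<dots> = (\<Sum>r<R. \<rho> ((e ^^ r) x)) - (\<Sum>r<R. (e ^^ Suc r) x)"
  proof -
    have "\<phi> y = \<rho> y - e y" for y by (simp add: e')
    then have "(\<Sum>r<R. \<phi> ((e ^^ r) x)) = (\<Sum>r<R. \<rho> ((e ^^ r) x) - (e ^^ Suc r) x)"
      by (intro sum.cong) (simp_all only: funpow.simps(2) comp_apply)
    then show ?thesis by (simp only: S_def \<phi>.sum sum_subtractf)
  qed
  also have "(\<Sum>r<R. \<rho> ((e ^^ r) x)) = \<rho> x + (\<Sum>r<q. (e ^^ Suc r) x)"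
    by (simp only: q sum.lessThan_Suc_shift funpow_0 funpow.simps(2) comp_apply \<rho>e)
  also have "(\<Sum>r<R. (e ^^ Suc r) x) = (\<Sum>r<q. (e ^^ Suc r) x)"
    using nil[of x] by (simp only: q sum.lessThan_Suc add_0_right)
  finally show ?thesis by (simp add: S_def)
qed

definition homogeneous_op :: "('b \<Rightarrow> int) \<Rightarrow> int \<Rightarrow> (('b \<Rightarrow> 'k::field) \<Rightarrow> 'b \<Rightarrow> 'k) \<Rightarrow> bool" where
  "homogeneous_op dg d g \<longleftrightarrow> Modules.additive g \<and> (\<forall>c f. g (\<lambda>b. c * f b) = (\<lambda>b. c * g f b)) \<and>
     (\<forall>e f. (\<forall>b. f b \<noteq> 0 \<longrightarrow> dg b = e) \<longrightarrow> (\<forall>b. g f b \<noteq> 0 \<longrightarrow> dg b = e + d))"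

lemma homogeneous_opD:
  assumes "homogeneous_op dg d g"
  shows "Modules.additive g" "g (\<lambda>b. c * f b) = (\<lambda>b. c * g f b)"
    "(\<And>b. f b \<noteq> 0 \<Longrightarrow> dg b = e) \<Longrightarrow> g f b \<noteq> 0 \<Longrightarrow> dg b = e + d"
  using assms unfolding homogeneous_op_def by blast+

lemma homogeneous_op_comp:
  assumes g: "homogeneous_op dg d g" and g': "homogeneous_op dg d' g'" and d: "d'' = d + d'"
  shows "homogeneous_op dg d'' (\<lambda>f. g' (g f))"
  unfolding homogeneous_op_def
proof (intro conjI allI impI)
  show "Modules.additive (\<lambda>f. g' (g f))"
    using homogeneous_opD(1)[OF g] homogeneous_opD(1)[OF g'] by (simp add: Modules.additive_def)
  show "g' (g (\<lambda>b. c * f b)) = (\<lambda>b. c * g' (g f) b)" for c f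
    by (simp only: homogeneous_opD(2)[OF g] homogeneous_opD(2)[OF g'])
  fix e f b assume f: "\<forall>b. f b \<noteq> 0 \<longrightarrow> dg b = e" and b: "g' (g f) b \<noteq> 0"
  have "dg b = e + d" if "g f b \<noteq> 0" for b using homogeneous_opD(3)[OF g, of f e b] f that by blast
  from homogeneous_opD(3)[OF g' this b] show "dg b = e + d''" by (simp add: d)
qed

lemma homogeneous_op_id: "homogeneous_op dg 0 (\<lambda>f. f)"
  by (simp add: homogeneous_op_def Modules.additive_def)

lemma homogeneous_op_pow:
  assumes "homogeneous_op dg d g"
  shows "homogeneous_op dg (int j * d) (g ^^ j)"
proof (induction j)
  case 0
  then show ?case using homogeneous_op_id by (simp add: id_def)
next
  case (Suc j)
  from homogeneous_op_comp[OF Suc assms, of "int (Suc j) * d"] show ?case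
    by (simp add: algebra_simps comp_def)
qed

lemma homogeneous_op_add:
  assumes g: "homogeneous_op dg d g" and g': "homogeneous_op dg d g'"
  shows "homogeneous_op dg d (\<lambda>f. g f + g' f)"
  unfolding homogeneous_op_def
proof (intro conjI allI impI)
  show "Modules.additive (\<lambda>f. g f + g' f)"
    using homogeneous_opD(1)[OF g] homogeneous_opD(1)[OF g'] by (simp add: Modules.additive_def)
  show "g (\<lambda>b. c * f b) + g' (\<lambda>b. c * f b) = (\<lambda>b. c * (g f + g' f) b)" for c f
    unfolding homogeneous_opD(2)[OF g] homogeneous_opD(2)[OF g'] by (rule ext) (simp add: distrib_left)
  fix e f b assume f: "\<forall>b. f b \<noteq> 0 \<longrightarrow> dg b = e" and b: "(g f + g' f) b \<noteq> 0"
  from b have "g f b \<noteq> 0 \<or> g' f b \<noteq> 0" by auto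
  then show "dg b = e + d"
    using homogeneous_opD(3)[OF g, of f e b] homogeneous_opD(3)[OF g', of f e b] f by blast
qed

lemma homogeneous_op_zero: "homogeneous_op dg d (\<lambda>f. 0)"
  by (simp add: homogeneous_op_def Modules.additive_def zero_fun_def)

lemma homogeneous_op_uminus:
  assumes g: "homogeneous_op dg d g"
  shows "homogeneous_op dg d (\<lambda>f. - g f)"
  unfolding homogeneous_op_def
proof (intro conjI allI impI)
  show "Modules.additive (\<lambda>f. - g f)"
    using homogeneous_opD(1)[OF g] by (simp add: Modules.additive_def)
  show "- g (\<lambda>b. c * f b) = (\<lambda>b. c * (- g f) b)" for c f
    unfolding homogeneous_opD(2)[OF g] by (rule ext) simp
  fix e f b assume f: "\<forall>b. f b \<noteq> 0 \<longrightarrow> dg b = e" and b: "(- g f) b \<noteq> 0"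
  then show "dg b = e + d" using homogeneous_opD(3)[OF g, of f e b] by simp
qed

lemma homogeneous_op_sum:
  assumes "\<And>j. j \<in> J \<Longrightarrow> homogeneous_op dg d (g j)"
  shows "homogeneous_op dg d (\<lambda>f. \<Sum>j\<in>J. g j f)"
  using assms
  by (induction J rule: infinite_finite_induct)
    (simp_all only: sum.infinite sum.empty sum.insert homogeneous_op_zero homogeneous_op_add insert_iff simp_thms)

lemma homogeneous_homotopy_sum:
  assumes T: "homogeneous_op dg 2 T" and h: "homogeneous_op dg (2 - 2 * int p) h"
  shows "homogeneous_op dg 0 (homotopy_sum p T h)"
proof -
  have "homogeneous_op dg 0 (\<lambda>x. \<Sum>j<p. (T ^^ j) (h ((T ^^ (p - 1 - j)) x)))"
  proof (rule homogeneous_op_sum)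
    fix j assume "j \<in> {..<p}"
    then have "0 = (int (p - 1 - j) * 2 + (2 - 2 * int p)) + int j * 2" by (simp add: of_nat_diff)
    then show "homogeneous_op dg 0 (\<lambda>x. (T ^^ j) (h ((T ^^ (p - 1 - j)) x)))"
      by (intro homogeneous_op_comp[OF homogeneous_op_comp[OF homogeneous_op_pow[OF T] h refl] homogeneous_op_pow[OF T]])
  qed
  then show ?thesis by (simp only: homotopy_sum_def[abs_def])
qed

text \<open>
  Each application clears the coordinates of one more weight.
\<close>

lemma triangular_nilpotent:
  fixes T h \<rho> :: "('b \<Rightarrow> 'k::field) \<Rightarrow> 'b \<Rightarrow> 'k" and \<beta> :: "'c \<Rightarrow> nat \<Rightarrow> 'b" and wt :: "'c \<Rightarrow> nat"
  assumes p: "2 \<le> p"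
    and triangular: "\<And>f c k. \<lbrakk>c \<in> S; k < p; \<And>c' k'. \<lbrakk>c' \<in> S; k' < p; wt c' < wt c\<rbrakk> \<Longrightarrow> f (\<beta> c' k') = 0\<rbrakk>
      \<Longrightarrow> T f (\<beta> c k) = (if Suc k < p then (if Suc k = p - 1 then \<sigma> c else 1) * f (\<beta> c (Suc k)) else 0)"
    and h: "\<And>f c k. \<lbrakk>c \<in> S; k < p\<rbrakk> \<Longrightarrow> h f (\<beta> c k) = (if k = p - 1 then \<sigma> c * f (\<beta> c 0) else 0)"
    and \<sigma>: "\<And>c. c \<in> S \<Longrightarrow> \<sigma> c * \<sigma> c = 1"
    and \<rho>: "\<And>f b. \<rho> f b = (if \<exists>c\<in>S. \<exists>k<p. b = \<beta> c k then f b else 0)"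
    and off: "\<And>f b. \<not> (\<exists>c\<in>S. \<exists>k<p. b = \<beta> c k) \<Longrightarrow> T f b = 0 \<and> h f b = 0"
    and wt: "\<And>c. c \<in> S \<Longrightarrow> wt c < R" and R: "0 < R"
    and e: "\<And>f. e f = \<rho> f - homotopy_sum p T h f"
  shows "(e ^^ R) f = 0"
proof -
  define F where "F w f \<longleftrightarrow> (\<forall>c\<in>S. \<forall>k<p. wt c < w \<longrightarrow> f (\<beta> c k) = 0)" for w and f :: "'b \<Rightarrow> 'k"
  have T_at: "T f (\<beta> c k) = (if Suc k < p then (if Suc k = p - 1 then \<sigma> c else 1) * f (\<beta> c (Suc k)) else 0)"
    if "F w f" "c \<in> S" "k < p" "wt c \<le> w" for f w c k
    by (rule triangular[OF that(2,3)]) (use that(1,4) in \<open>simp add: F_def\<close>)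
  have FT: "F w (T f)" if f: "F w f" for w f
    unfolding F_def
  proof (intro ballI allI impI)
    fix c k assume c: "c \<in> S" "k < p" "wt c < w"
    then have "f (\<beta> c (Suc k)) = 0" if "Suc k < p" using f that by (simp add: F_def)
    then show "T f (\<beta> c k) = 0" using T_at[OF f c(1,2)] c(3) by simp
  qed
  have FTj: "F w ((T ^^ j) f)" if "F w f" for w f j
    by (induction j) (simp_all add: that FT)
  have Fh: "F w (h f)" if f: "F w f" for w f
    unfolding F_def
  proof (intro ballI allI impI)
    fix c k assume c: "c \<in> S" "k < p" "wt c < w"
    then have "f (\<beta> c 0) = 0" using f p by (simp add: F_def)
    then show "h f (\<beta> c k) = 0" by (simp add: h[OF c(1,2)])
  qed
  have Tj_at: "(T ^^ a) f (\<beta> c k) =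
      (if k + a < p then (if 0 < a \<and> k + a = p - 1 then \<sigma> c else 1) * f (\<beta> c (k + a)) else 0)"
    if f: "F (wt c) f" and c: "c \<in> S" "k < p" for f c k a
    using c(2)
  proof (induction a arbitrary: k)
    case (Suc a)
    have "(T ^^ Suc a) f (\<beta> c k) =
        (if Suc k < p then (if Suc k = p - 1 then \<sigma> c else 1) * (T ^^ a) f (\<beta> c (Suc k)) else 0)"
      using T_at[OF FTj[OF f] c(1) Suc.prems order_refl] by simp
    also have "\<dots> = (if k + Suc a < p then (if 0 < Suc a \<and> k + Suc a = p - 1 then \<sigma> c else 1) * f (\<beta> c (k + Suc a)) else 0)"
    proof (cases "Suc k < p")
      case True
      have "a = 0" if "Suc k = p - 1" "Suc k + a < p" using that by linarith
      then show ?thesis using True Suc.IH[OF True] by (cases "a = 0") auto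
    qed auto
    finally show ?case .
  qed simp
  have term_at: "(T ^^ j) (h ((T ^^ (p - 1 - j)) f)) (\<beta> c k) = (if j = p - 1 - k then f (\<beta> c k) else 0)"
    if f: "F (wt c) f" and c: "c \<in> S" "k < p" and j: "j < p" for f c k j
  proof (cases "j = p - 1 - k")
    case False
    then have "k + j < p \<Longrightarrow> k + j \<noteq> p - 1" by linarith
    then have "h ((T ^^ (p - 1 - j)) f) (\<beta> c (k + j)) = 0" if "k + j < p" using h[OF c(1) that] that by simp
    then show ?thesis using Tj_at[OF Fh[OF FTj[OF f]] c] False by simp
  next
    case True
    then have kj: "k + j = p - 1" "p - 1 - j = k" "k + j < p" using c(2) p by linarith+
    have "0 < p" "p - 1 < p" using p by simp_all
    have "(T ^^ j) (h ((T ^^ (p - 1 - j)) f)) (\<beta> c k) =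
        (if 0 < j then \<sigma> c else 1) * (\<sigma> c * (T ^^ k) f (\<beta> c 0))"
      using Tj_at[OF Fh[OF FTj[OF f]] c, of j k] h[OF c(1) \<open>p - 1 < p\<close>] kj by simp
    also have "(T ^^ k) f (\<beta> c 0) = (if 0 < k \<and> k = p - 1 then \<sigma> c else 1) * f (\<beta> c k)"
      using Tj_at[OF f c(1) \<open>0 < p\<close>, of k] c(2) by simp
    also have "(if 0 < j then \<sigma> c else 1) * (\<sigma> c * ((if 0 < k \<and> k = p - 1 then \<sigma> c else 1) * f (\<beta> c k))) = f (\<beta> c k)"
    proof -
      have ss: "\<sigma> c * (\<sigma> c * y) = y" for y using \<sigma>[OF c(1)] by (simp add: mult.assoc[symmetric])
      show ?thesis
      proof (cases "j = 0")
        case True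
        then have kk: "(0 < k \<and> k = p - 1) = True" using kj p by auto
        show ?thesis by (simp only: kk True if_True less_irrefl if_False mult_1_left ss)
      next
        case False
        then have "\<not> (0 < k \<and> k = p - 1)" using kj by linarith
        then show ?thesis using False by (simp only: if_False if_True mult_1_left ss not_gr_zero neq0_conv simp_thms)
      qed
    qed
    finally show ?thesis using True by simp
  qed
  have sum_apply: "(\<Sum>j\<in>J. g j) b = (\<Sum>j\<in>J. g j b)" for J and g :: "nat \<Rightarrow> 'b \<Rightarrow> 'k" and b
    by (induction J rule: infinite_finite_induct) simp_all
  have e_at: "e f (\<beta> c k) = 0" if f: "F (wt c) f" and c: "c \<in> S" "k < p" for f c k
  proof -
    have "homotopy_sum p T h f (\<beta> c k) = (\<Sum>j<p. if j = p - 1 - k then f (\<beta> c k) else 0)"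
      unfolding homotopy_sum_def sum_apply using term_at[OF f c] by (intro sum.cong) simp_all
    also have "\<dots> = f (\<beta> c k)" using c(2) by simp
    finally have "homotopy_sum p T h f (\<beta> c k) = f (\<beta> c k)" .
    moreover have "\<rho> f (\<beta> c k) = f (\<beta> c k)" using c by (auto simp: \<rho>)
    ultimately show ?thesis by (simp add: e)
  qed
  have F_mono: "F w' f" if "F w f" "w' \<le> w" for w w' f using that by (simp add: F_def)
  have Fe: "F (Suc w) (e f)" if "F w f" for w f
    unfolding F_def[of "Suc w"]
  proof (intro ballI allI impI)
    fix c k assume "c \<in> S" "k < p" "wt c < Suc w"
    then show "e f (\<beta> c k) = 0" by (intro e_at F_mono[OF that]) simp_all
  qed
  have Fer: "F r ((e ^^ r) f)" for r f
    by (induction r) (simp_all add: F_def[of 0] Fe)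
  have e_off: "e f b = 0" if b: "\<not> (\<exists>c\<in>S. \<exists>k<p. b = \<beta> c k)" for f b
  proof -
    have "(T ^^ j) (h y) b = 0" for j y
      using off[OF b] by (cases j) simp_all
    then have "homotopy_sum p T h f b = 0" by (simp add: homotopy_sum_def sum_apply)
    moreover have "\<rho> f b = 0" using b by (simp only: \<rho> if_False)
    ultimately show ?thesis by (simp add: e)
  qed
  show ?thesis
  proof (cases R)
    case 0
    with R show ?thesis by simp
  next
    case (Suc q)
    show ?thesis
    proof
      fix b
      show "(e ^^ R) f b = 0 b"
      proof (cases "\<exists>c\<in>S. \<exists>k<p. b = \<beta> c k")
        case True
        then show ?thesis using Fer[of R f] wt by (auto simp: F_def)
      next
        case False
        then show ?thesis using e_off by (simp add: Suc)
      qed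
    qed
  qed
qed

context based
begin

text \<open>
  The basis contains chains \<open>\<beta> c 0, \<dots>, \<beta> c (p - 1)\<close>. The
  coordinate of \<open>\<partial>x\<close> at one member of a chain is the coordinate of
  \<open>x\<close> at the next, up to coordinates in chains of smaller weight and up to a
  sign \<open>\<sigma> c\<close> at the last step. The map that sends the coordinate at the
  start of each chain to its end contracts modulo smaller weights.
\<close>

lemma triangular_contraction:
  fixes \<beta> :: "'c \<Rightarrow> nat \<Rightarrow> 'b" and wt :: "'c \<Rightarrow> nat" and \<sigma> :: "'c \<Rightarrow> 'k"
  assumes p: "2 \<le> p" and M: "is_pcomplex p M"
    and \<beta>_in: "\<And>c k. c \<in> S \<Longrightarrow> k < p \<Longrightarrow> \<beta> c k \<in> B"
    and \<beta>_inj: "\<And>c k c' k'. \<lbrakk>c \<in> S; k < p; c' \<in> S; k' < p; \<beta> c k = \<beta> c' k'\<rbrakk> \<Longrightarrow> c = c' \<and> k = k'"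
    and \<beta>_deg: "\<And>c. c \<in> S \<Longrightarrow> deg (\<beta> c (p - 1)) = deg (\<beta> c 0) + (2 - 2 * int p)"
    and triangular: "\<And>x c k. \<lbrakk>x \<in> carrier M; c \<in> S; k < p;
        \<And>c' k'. \<lbrakk>c' \<in> S; k' < p; wt c' < wt c\<rbrakk> \<Longrightarrow> C x (\<beta> c' k') = 0\<rbrakk>
      \<Longrightarrow> C (del M x) (\<beta> c k) = (if Suc k < p then (if Suc k = p - 1 then \<sigma> c else 1) * C x (\<beta> c (Suc k)) else 0)"
    and \<sigma>: "\<And>c. c \<in> S \<Longrightarrow> \<sigma> c * \<sigma> c = 1"
    and off_image: "\<And>x b. \<lbrakk>x \<in> carrier M; \<not> (\<exists>c\<in>S. \<exists>k<p. b = \<beta> c k)\<rbrakk> \<Longrightarrow> C (del M x) b = 0"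
    and off_kernel: "\<And>x. \<lbrakk>x \<in> carrier M; \<And>c k. c \<in> S \<Longrightarrow> k < p \<Longrightarrow> C x (\<beta> c k) = 0\<rbrakk> \<Longrightarrow> del M x = \<zero>\<^bsub>M\<^esub>"
    and wt: "\<And>c. c \<in> S \<Longrightarrow> wt c < R" and R: "0 < R"
  shows "\<exists>h. graded_linear (2 - 2 * int p) M M h \<and> (\<forall>x\<in>carrier M.
    finsum M (\<lambda>j. (del M ^^ j) (h ((del M ^^ (p - 1 - j)) x))) {..<p} =
      vec (\<lambda>b. if \<exists>c\<in>S. \<exists>k<p. b = \<beta> c k then C x b else 0))"
proof -
  define T where "T f = C (del M (vec f))" for f
  define \<rho> :: "('b \<Rightarrow> 'k) \<Rightarrow> 'b \<Rightarrow> 'k" where "\<rho> f = (\<lambda>b. if \<exists>c\<in>S. \<exists>k<p. b = \<beta> c k then f b else 0)" for f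
  define top where "top b = (SOME c. c \<in> S \<and> b = \<beta> c (p - 1))" for b
  define h0 :: "('b \<Rightarrow> 'k) \<Rightarrow> 'b \<Rightarrow> 'k"
    where "h0 f = (\<lambda>b. if \<exists>c\<in>S. b = \<beta> c (p - 1) then \<sigma> (top b) * f (\<beta> (top b) 0) else 0)" for f
  define e where "e f = \<rho> f - homotopy_sum p T h0 f" for f
  define h where "h f = h0 (\<Sum>r<R. (e ^^ r) f)" for f
  have p0: "0 < p" "p - 1 < p" using p by simp_all
  have D: "graded_linear 2 M M (del M)" and Dp: "\<And>x. x \<in> carrier M \<Longrightarrow> (del M ^^ p) x = \<zero>\<^bsub>M\<^esub>"
    using M by (auto simp: is_pcomplex_def)
  note DD = graded_linearD[OF D]
  have top_in: "top b \<in> S \<and> b = \<beta> (top b) (p - 1)" if "\<exists>c\<in>S. b = \<beta> c (p - 1)" for b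
    unfolding top_def by (rule someI_ex) (use that in blast)
  have top_\<beta>: "top (\<beta> c (p - 1)) = c" if "c \<in> S" for c
    using top_in[of "\<beta> c (p - 1)"] \<beta>_inj[OF that p0(2)] that p0(2) by metis
  have vec_add: "vec (f + g) = vec f \<oplus>\<^bsub>M\<^esub> vec g" for f g
    by (rule coord_eqI) (simp_all add: vec_in add_in coord_add coord_vec)
  have vec_scale: "vec (\<lambda>b. c * f b) = c \<odot>\<^bsub>M\<^esub> vec f" for c f
    by (rule coord_eqI) (simp_all add: vec_in smult_in coord_smult coord_vec)
  have vec_grade: "vec f \<in> grade M d" if "\<And>b. f b \<noteq> 0 \<Longrightarrow> deg b = d" for f d
    using that by (simp add: grade_iff vec_in coord_vec)
  have T_op: "homogeneous_op deg 2 T"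
    unfolding homogeneous_op_def
  proof (intro conjI allI impI)
    show "Modules.additive T"
      by unfold_locales (rule ext, simp add: T_def vec_add DD(1,2) vec_in coord_add)
    show "T (\<lambda>b. c * f b) = (\<lambda>b. c * T f b)" for c f
      by (rule ext) (simp add: T_def vec_scale DD(1,3) vec_in coord_smult)
    fix d f b assume f: "\<forall>b. f b \<noteq> 0 \<longrightarrow> deg b = d" and b: "T f b \<noteq> 0"
    have "del M (vec f) \<in> grade M (d + 2)" by (rule DD(4)) (rule vec_grade, use f in blast)
    with b show "deg b = d + 2" unfolding T_def grade_iff by blast
  qed
  have \<rho>_op: "homogeneous_op deg 0 \<rho>"
    unfolding homogeneous_op_def \<rho>_def Modules.additive_def by (auto simp: fun_eq_iff)
  have h0_op: "homogeneous_op deg (2 - 2 * int p) h0"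
    unfolding homogeneous_op_def
  proof (intro conjI allI impI)
    show "Modules.additive h0"
      by unfold_locales (rule ext, simp add: h0_def distrib_left)
    show "h0 (\<lambda>b. c * f b) = (\<lambda>b. c * h0 f b)" for c f
      by (rule ext) (simp add: h0_def)
    fix d f b assume f: "\<forall>b. f b \<noteq> 0 \<longrightarrow> deg b = d" and b: "h0 f b \<noteq> 0"
    then have t: "\<exists>c\<in>S. b = \<beta> c (p - 1)" and nz: "f (\<beta> (top b) 0) \<noteq> 0"
      unfolding h0_def by (simp_all split: if_splits)
    from nz f have "deg (\<beta> (top b) 0) = d" by blast
    with \<beta>_deg[of "top b"] top_in[OF t] show "deg b = d + (2 - 2 * int p)" by metis
  qed
  have e_op: "homogeneous_op deg 0 e"
    using homogeneous_op_add[OF \<rho>_op homogeneous_op_uminus[OF homogeneous_homotopy_sum[OF T_op h0_op]]]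
    by (simp add: e_def[abs_def])
  have S_op: "homogeneous_op deg 0 (\<lambda>f. \<Sum>r<R. (e ^^ r) f)"
    by (rule homogeneous_op_sum) (use homogeneous_op_pow[OF e_op] in simp)
  have h_op: "homogeneous_op deg (2 - 2 * int p) h"
    using homogeneous_op_comp[OF S_op h0_op, of "2 - 2 * int p"] by (simp add: h_def[abs_def])
  have T_pow: "(T ^^ j) (C x) = C ((del M ^^ j) x) \<and> (del M ^^ j) x \<in> carrier M" if "x \<in> carrier M" for x j
    by (induction j) (simp_all add: that T_def vec_coord DD(1))
  have T_vec: "T f = T (C (vec f))" for f by (simp add: T_def vec_coord vec_in)
  have Tp: "(T ^^ p) f = 0" for f
  proof -
    obtain m where m: "p = Suc m" using p0 by (cases p) auto
    have "(T ^^ p) f = (T ^^ m) (T f)" by (simp only: m funpow_Suc_right comp_apply)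
    also have "\<dots> = (T ^^ p) (C (vec f))" by (simp only: m funpow_Suc_right comp_apply T_vec[of f])
    also have "\<dots> = C \<zero>\<^bsub>M\<^esub>" using T_pow[OF vec_in] Dp[OF vec_in] by simp
    also have "\<dots> = 0" by (rule ext) (simp add: coord_zero)
    finally show ?thesis .
  qed
  have \<rho>T: "\<rho> (T f) = T f" for f
    by (rule ext) (simp add: \<rho>_def T_def off_image vec_in)
  have \<rho>h0: "\<rho> (h0 f) = h0 f" for f
    using p0(2) by (intro ext) (auto simp: \<rho>_def h0_def)
  have \<rho>\<rho>: "\<rho> (\<rho> f) = \<rho> f" for f
    by (rule ext) (simp add: \<rho>_def)
  have T\<rho>: "T (\<rho> f) = T f" for f
  proof -
    have "del M (vec (f - \<rho> f)) = \<zero>\<^bsub>M\<^esub>"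
    proof (rule off_kernel[OF vec_in])
      fix c k assume "c \<in> S" "k < p"
      then show "C (vec (f - \<rho> f)) (\<beta> c k) = 0" by (auto simp: coord_vec \<rho>_def)
    qed
    then have "T (f - \<rho> f) = 0" by (intro ext) (simp add: T_def coord_zero)
    then show ?thesis using Modules.additive.diff[OF homogeneous_opD(1)[OF T_op], of f "\<rho> f"] by simp
  qed
  have nil: "(e ^^ R) f = 0" for f
  proof (rule triangular_nilpotent[where T = T and h = h0 and \<rho> = \<rho> and \<beta> = \<beta> and wt = wt and \<sigma> = \<sigma> and S = S and p = p])
    show "T f (\<beta> c k) = (if Suc k < p then (if Suc k = p - 1 then \<sigma> c else 1) * f (\<beta> c (Suc k)) else 0)"
      if c: "c \<in> S" "k < p" and van: "\<And>c' k'. \<lbrakk>c' \<in> S; k' < p; wt c' < wt c\<rbrakk> \<Longrightarrow> f (\<beta> c' k') = 0" for f c k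
      unfolding T_def
      using triangular[OF vec_in[of f] c] van \<beta>_in[OF c(1)] by (simp add: coord_vec)
    show "h0 f (\<beta> c k) = (if k = p - 1 then \<sigma> c * f (\<beta> c 0) else 0)" if c: "c \<in> S" "k < p" for f c k
    proof (cases "k = p - 1")
      case True
      have "\<exists>c'\<in>S. \<beta> c k = \<beta> c' (p - 1)" using c True by blast
      then show ?thesis using top_\<beta>[OF c(1)] True by (simp only: h0_def if_True simp_thms)
    next
      case False
      then have "\<not> (\<exists>c'\<in>S. \<beta> c k = \<beta> c' (p - 1))" using \<beta>_inj[OF c _ p0(2)] by blast
      then show ?thesis using False by (simp only: h0_def if_False)
    qed
    show "T f b = 0 \<and> h0 f b = 0" if "\<not> (\<exists>c\<in>S. \<exists>k<p. b = \<beta> c k)" for f b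
    proof -
      have "\<not> (\<exists>c\<in>S. b = \<beta> c (p - 1))" using that p0(2) by blast
      then show ?thesis using off_image[OF vec_in that] by (simp only: h0_def if_False T_def)
    qed
    show "\<rho> f b = (if \<exists>c\<in>S. \<exists>k<p. b = \<beta> c k then f b else 0)" for f b by (simp only: \<rho>_def)
    show "e f = \<rho> f - homotopy_sum p T h0 f" for f by (simp only: e_def)
  qed (use p \<sigma> wt R in auto)
  have main: "homotopy_sum p T h f = \<rho> f" for f
    unfolding h_def
    by (rule unipotent_homotopy[OF homogeneous_opD(1)[OF T_op] homogeneous_opD(1)[OF h0_op]
        homogeneous_opD(1)[OF \<rho>_op] \<rho>T T\<rho> \<rho>h0 \<rho>\<rho> Tp p0(1) e_def nil R])
  define H where "H x = vec (h (C x))" for x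
  have hD: "h (f + g) = h f + h g" "h (\<lambda>b. c * f b) = (\<lambda>b. c * h f b)" for f g c
    using homogeneous_opD(1,2)[OF h_op] by (simp_all add: Modules.additive_def)
  have "graded_linear (2 - 2 * int p) M M H"
    unfolding graded_linear_def
  proof (intro conjI ballI allI)
    show "H \<in> carrier M \<rightarrow> carrier M" by (simp add: H_def vec_in)
    fix x assume x: "x \<in> carrier M"
    show "H (x \<oplus>\<^bsub>M\<^esub> y) = H x \<oplus>\<^bsub>M\<^esub> H y" if y: "y \<in> carrier M" for y
    proof -
      have "C (x \<oplus>\<^bsub>M\<^esub> y) = C x + C y" by (rule ext) (simp add: coord_add x y)
      then show ?thesis by (simp only: H_def hD(1) vec_add)
    qed
    show "H (c \<odot>\<^bsub>M\<^esub> x) = c \<odot>\<^bsub>M\<^esub> H x" for c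
    proof -
      have "C (c \<odot>\<^bsub>M\<^esub> x) = (\<lambda>b. c * C x b)" by (rule ext) (simp add: coord_smult x)
      then show ?thesis by (simp only: H_def hD(2) vec_scale)
    qed
  next
    fix d x assume x: "x \<in> grade M d"
    show "H x \<in> grade M (d + (2 - 2 * int p))"
      unfolding H_def
    proof (rule vec_grade)
      fix b assume "h (C x) b \<noteq> 0"
      then show "deg b = d + (2 - 2 * int p)"
        using x by (intro homogeneous_opD(3)[OF h_op, of "C x" d b]) (simp_all add: grade_iff)
    qed
  qed
  moreover have "finsum M (\<lambda>j. (del M ^^ j) (H ((del M ^^ (p - 1 - j)) x))) {..<p} = vec (\<rho> (C x))"
    if x: "x \<in> carrier M" for x
  proof (rule coord_eqI)
    have in_M: "(del M ^^ j) (H y) \<in> carrier M" for j y using T_pow[of "H y"] by (simp add: H_def vec_in)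
    note fs = coord_finsum[of "{..<p}" "\<lambda>j. (del M ^^ j) (H ((del M ^^ (p - 1 - j)) x))", OF in_M]
    show "finsum M (\<lambda>j. (del M ^^ j) (H ((del M ^^ (p - 1 - j)) x))) {..<p} \<in> carrier M"
      using fs by blast
    fix b
    have h_off: "h f b = 0" if "b \<notin> B" for f b
    proof -
      have "\<not> (\<exists>c\<in>S. b = \<beta> c (p - 1))" using \<beta>_in p0(2) that by blast
      then show ?thesis by (simp only: h_def h0_def if_False)
    qed
    have CH: "C (H y) = h (C y)" for y
      by (rule ext) (simp add: H_def coord_vec h_off)
    have sum_apply: "(\<Sum>j\<in>J. g j) b = (\<Sum>j\<in>J. g j b)" for J and g :: "nat \<Rightarrow> 'b \<Rightarrow> 'k" and b
      by (induction J rule: infinite_finite_induct) simp_all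
    have "C (finsum M (\<lambda>j. (del M ^^ j) (H ((del M ^^ (p - 1 - j)) x))) {..<p}) b =
        (\<Sum>j<p. C ((del M ^^ j) (H ((del M ^^ (p - 1 - j)) x))) b)" using fs by blast
    also have "\<dots> = homotopy_sum p T h (C x) b"
      unfolding homotopy_sum_def sum_apply
    proof (rule sum.cong)
      fix j
      have "C ((del M ^^ j) (H ((del M ^^ (p - 1 - j)) x))) = (T ^^ j) (C (H ((del M ^^ (p - 1 - j)) x)))"
        using T_pow[of "H ((del M ^^ (p - 1 - j)) x)" j] by (simp add: H_def vec_in)
      also have "\<dots> = (T ^^ j) (h ((T ^^ (p - 1 - j)) (C x)))" using T_pow[OF x] by (simp add: CH)
      finally show "C ((del M ^^ j) (H ((del M ^^ (p - 1 - j)) x))) b = (T ^^ j) (h ((T ^^ (p - 1 - j)) (C x))) b"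
        by simp
    qed simp
    also have "\<dots> = C (vec (\<rho> (C x))) b"
      unfolding main using coord_off[OF x] by (simp add: coord_vec \<rho>_def)
    finally show "C (finsum M (\<lambda>j. (del M ^^ j) (H ((del M ^^ (p - 1 - j)) x))) {..<p}) b = C (vec (\<rho> (C x))) b" .
  qed (rule vec_in)
  ultimately show ?thesis unfolding \<rho>_def by blast
qed

end

section \<open>Two strands\<close>

text \<open>
  Positions \<open>0, \<dots>, p - 1\<close> of the main strand (\<open>False\<close>) and
  \<open>1, \<dots>, p\<close> of the other one (\<open>True\<close>). Position 0 is the
  generator \<open>w\<close>, position \<open>p\<close> is \<open>v\<close>.
\<close>

definition on_strand :: "nat \<Rightarrow> bool \<Rightarrow> nat \<Rightarrow> bool" where
  "on_strand p s k \<longleftrightarrow> (if s then 1 \<le> k \<and> k \<le> p else k < p)"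

type_synonym 'k strands = "bool \<times> nat \<times> nat \<times> nat \<Rightarrow> 'k"

text \<open>
  The differential of the cell module on coordinate functions indexed by strand, position,
  first vertex and \<open>D\<close>. The target vertex is determined by the position. The
  exponents 0, 1, 2 are the numbers of steps in the chosen direction of the paths that occur
  in the differentials of the generators.
\<close>

fun strand_del :: "nat \<Rightarrow> 'k::field strands \<Rightarrow> 'k strands" where
  "strand_del p f (s, k, j, D) = (if on_strand p s k then
     shift_del (\<lambda>D. f (s, k, j, D)) D +
     (if s then (if k < p then f (True, Suc k, j, D) else 0)
      else (if Suc k < p then f (False, Suc k, j, D) else 0) +
        (if k = 0 then (if 1 \<le> D then f (True, 1, j, D - 1) else 0)
         else (if 2 \<le> D then f (True, k, j, D - 2) else 0)) -
        (if Suc k = p \<and> 1 \<le> D then f (True, p, j, D - 1) else 0))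
   else 0)"

definition strand_supported :: "nat \<Rightarrow> 'k::field strands \<Rightarrow> bool" where
  "strand_supported p f \<longleftrightarrow> (\<forall>s k j D. \<not> on_strand p s k \<longrightarrow> f (s, k, j, D) = 0)"

text \<open>
  Adding a multiple of the second strand to the first absorbs the terms that connect the
  strands.
\<close>

fun untwist :: "nat \<Rightarrow> 'k::field strands \<Rightarrow> 'k strands" where
  "untwist p f (s, k, j, D) = f (s, k, j, D) +
     (if \<not> s \<and> 1 \<le> k \<and> k < p \<and> 1 \<le> D then f (True, k, j, D - 1) else 0)"

text \<open>
  The weighted shift plus a step along the strand; these two commute.
\<close>

fun untwisted_del :: "'k::field strands \<Rightarrow> 'k strands" where
  "untwisted_del f (s, k, j, D) =
     (if s \<and> k = 0 then 0 else shift_del (\<lambda>D. f (s, k, j, D)) D + f (s, Suc k, j, D))"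

lemma strand_supported_del: "strand_supported p (strand_del p f)"
  by (simp add: strand_supported_def)

text \<open>
  At interior positions the connecting term \<open>D - 2\<close> is the difference between
  the weights \<open>D - 1\<close> and \<open>D - 2\<close> times the added multiple. At
  position 0 it is the multiple added at position 1, and at position \<open>p - 1\<close>
  the term from \<open>v\<close> makes up for the multiple that is not added at position
  \<open>p\<close>.
\<close>

lemma untwist_del:
  assumes p: "2 \<le> p" and f: "strand_supported p f"
  shows "untwist p (strand_del p f) = untwisted_del (untwist p f)"
proof
  fix b :: "bool \<times> nat \<times> nat \<times> nat"
  obtain s k j D where b: "b = (s, k, j, D)" by (cases b)
  have off: "f (s, k, j, D) = 0" if "\<not> on_strand p s k" for s k j D
    using f that by (simp add: strand_supported_def)
  show "untwist p (strand_del p f) b = untwisted_del (untwist p f) b"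
  proof (cases "on_strand p s k")
    case False
    then show ?thesis
      using off[of s k] off[of s "Suc k"] p
      unfolding b by (cases s) (auto simp: on_strand_def shift_del_def)
  next
    case True
    show ?thesis
    proof (cases s)
      case True
      then show ?thesis
        using \<open>on_strand p s k\<close> off[of True "Suc k" j D] unfolding b
        by (cases "k < p") (auto simp: on_strand_def shift_del_def)
    next
      case s: False
      have k: "k < p" using True s by (simp add: on_strand_def)
      show ?thesis
      proof (cases "k = 0")
        case True
        then show ?thesis using p s unfolding b by (auto simp: on_strand_def shift_del_def)
      next
        case k0: False
        have on: "on_strand p False k" "on_strand p True k" using k k0 by (simp_all add: on_strand_def)
        have last: "Suc k < p \<or> p = Suc k \<and> f (False, Suc k, j, D) = 0"
          using k off[of False "Suc k" j D] by (auto simp: on_strand_def)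
        consider (0) "D = 0" | (1) "D = 1" | (2) E where "D = Suc (Suc E)"
          by (cases D; cases "D - 1") auto
        then show ?thesis
        proof cases
          case 0
          with last s k k0 show ?thesis unfolding b
            by (elim disjE) (auto simp: on shift_del_def on_strand_def)
        next
          case 1
          with last s k k0 show ?thesis unfolding b
            by (elim disjE) (auto simp: on shift_del_def on_strand_def)
        next
          case (2 E)
          with last s k k0 show ?thesis unfolding b
            by (elim disjE) (auto simp: on shift_del_def on_strand_def algebra_simps)
        qed
      qed
    qed
  qed
qed

lemma shift_del_add: "shift_del (\<lambda>D. f D + g D) D = shift_del f D + shift_del g D"
  by (simp add: shift_del_def distrib_left)

lemma shift_del_scale: "shift_del (\<lambda>D. c * f D) D = c * shift_del f D"
  by (simp add: shift_del_def)

lemma shift_del_sum: "finite J \<Longrightarrow> shift_del (\<lambda>D. \<Sum>a\<in>J. c a * f a D) D = (\<Sum>a\<in>J. c a * shift_del (f a) D)"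
  by (induction J rule: finite_induct) (simp_all add: shift_del_add shift_del_scale, simp add: shift_del_def)

lemma pascal_sum:
  fixes g :: "nat \<Rightarrow> nat \<Rightarrow> 'k::field"
  shows "(\<Sum>a\<le>Suc r. of_nat (Suc r choose a) * g (Suc r - a) a) =
    (\<Sum>a\<le>r. of_nat (r choose a) * g (Suc (r - a)) a) + (\<Sum>a\<le>r. of_nat (r choose a) * g (r - a) (Suc a))"
proof -
  have "(\<Sum>a\<le>Suc r. of_nat (Suc r choose a) * g (Suc r - a) a) =
      g (Suc r) 0 + (\<Sum>a\<le>r. of_nat (r choose a) * g (r - a) (Suc a) + of_nat (r choose Suc a) * g (r - a) (Suc a))"
    by (simp only: sum.atMost_Suc_shift) (simp add: distrib_right)
  also have "\<dots> = g (Suc r) 0 + (\<Sum>a\<le>r. of_nat (r choose Suc a) * g (r - a) (Suc a)) + (\<Sum>a\<le>r. of_nat (r choose a) * g (r - a) (Suc a))"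
    by (simp add: sum.distrib)
  also have "g (Suc r) 0 + (\<Sum>a\<le>r. of_nat (r choose Suc a) * g (r - a) (Suc a)) =
      (\<Sum>a\<le>Suc r. of_nat (r choose a) * g (Suc r - a) a)"
    by (simp only: sum.atMost_Suc_shift) simp
  also have "\<dots> = (\<Sum>a\<le>r. of_nat (r choose a) * g (Suc (r - a)) a)"
  proof -
    have "(\<Sum>a\<le>r. of_nat (r choose a) * g (Suc r - a) a) = (\<Sum>a\<le>r. of_nat (r choose a) * g (Suc (r - a)) a)"
      by (rule sum.cong) (simp_all add: Suc_diff_le)
    then show ?thesis by (simp add: binomial_eq_0)
  qed
  finally show ?thesis .
qed

text \<open>
  The binomial theorem for two commuting operators, written out in coordinates.
\<close>

lemma untwisted_del_pow:
  assumes "\<not> (s \<and> k = 0)"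
  shows "(untwisted_del ^^ r) f (s, k, j, D) =
    (\<Sum>a\<le>r. of_nat (r choose a) * (shift_del ^^ (r - a)) (\<lambda>D. f (s, k + a, j, D)) D)"
  using assms
proof (induction r arbitrary: k D)
  case (Suc r)
  have "(untwisted_del ^^ Suc r) f (s, k, j, D) =
      shift_del (\<lambda>D. (untwisted_del ^^ r) f (s, k, j, D)) D + (untwisted_del ^^ r) f (s, Suc k, j, D)"
    by (simp only: funpow.simps(2) comp_apply untwisted_del.simps if_not_P[OF Suc.prems])
  also have "shift_del (\<lambda>D. (untwisted_del ^^ r) f (s, k, j, D)) D =
      (\<Sum>a\<le>r. of_nat (r choose a) * (shift_del ^^ Suc (r - a)) (\<lambda>D. f (s, k + a, j, D)) D)"
    by (simp only: Suc.IH[OF Suc.prems] shift_del_sum[OF finite_atMost] funpow.simps(2) comp_apply)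
  also have "(untwisted_del ^^ r) f (s, Suc k, j, D) =
      (\<Sum>a\<le>r. of_nat (r choose a) * (shift_del ^^ (r - a)) (\<lambda>D. f (s, k + Suc a, j, D)) D)"
    by (simp add: Suc.IH)
  finally show ?case
    by (simp only: pascal_sum[of r "\<lambda>m a. (shift_del ^^ m) (\<lambda>D. f (s, k + a, j, D)) D"])
qed simp

text \<open>
  In the binomial expansion of the \<open>p\<close>-th power the middle coefficients are
  divisible by \<open>p\<close>, the \<open>p\<close>-th power of the weighted shift
  vanishes, and \<open>p\<close> steps leave the strand.
\<close>

lemma strand_del_pow_zero:
  fixes f :: "'k::field strands"
  assumes prime: "prime p" and char: "CHAR('k) = p" and f: "strand_supported p f"
  shows "(strand_del p ^^ p) f = (\<lambda>b. 0)"
proof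
  fix b :: "bool \<times> nat \<times> nat \<times> nat"
  have p: "2 \<le> p" "0 < p" using prime by (auto simp: prime_ge_2_nat prime_gt_0_nat)
  have supp: "strand_supported p ((strand_del p ^^ r) f)" for r
    using f strand_supported_del by (cases r) simp_all
  have tw: "untwist p ((strand_del p ^^ r) f) = (untwisted_del ^^ r) (untwist p f)" for r
    by (induction r) (simp_all add: untwist_del[OF p(1) supp])
  have zero: "(untwisted_del ^^ p) (untwist p f) (s, k, j, D) = 0" if k: "\<not> (s \<and> k = 0)" for s k j D
  proof -
    have "of_nat (p choose a) * (shift_del ^^ (p - a)) (\<lambda>D. untwist p f (s, k + a, j, D)) D = (0 :: 'k)" if ap: "a \<le> p" for a
    proof -
      consider "a = 0" | "a = p" | "0 < a" "a < p" using ap by linarith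
      then show ?thesis
      proof cases
        case 1
        then show ?thesis using shift_del_pow_char[OF char p(2)] by simp
      next
        case 2
        have "\<not> on_strand p s (k + p)" "\<not> k + p < p" using k by (auto simp: on_strand_def)
        then have "untwist p f (s, k + p, j, D) = 0" using f by (simp add: strand_supported_def)
        with 2 show ?thesis by simp
      next
        case 3
        then have "p dvd (p choose a)" using prime by (intro dvd_choose_prime) auto
        then have "of_nat (p choose a) = (0 :: 'k)" using char of_nat_eq_0_iff_char_dvd by blast
        then show ?thesis by simp
      qed
    qed
    then show ?thesis unfolding untwisted_del_pow[OF k] by (intro sum.neutral) simp
  qed
  obtain s k j D where b: "b = (s, k, j, D)" by (cases b)
  have T: "(strand_del p ^^ p) f (True, k, j, D) = 0" for k j D
  proof (cases "k = 0")
    case True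
    then show ?thesis using supp[of p] by (simp add: strand_supported_def on_strand_def)
  next
    case False
    then show ?thesis using zero[of True k j D] unfolding tw[symmetric] by simp
  qed
  show "(strand_del p ^^ p) f b = 0"
    using T zero[of False k j D] unfolding b tw[symmetric]
    by (cases s) (simp_all cong: if_cong)
qed

definition strand_vertex :: "bool \<Rightarrow> nat \<Rightarrow> nat \<Rightarrow> bool \<Rightarrow> nat \<Rightarrow> nat" where
  "strand_vertex u i p s k =
     (if (\<not> s \<and> k = 0) \<or> (s \<and> k = p) then i else if s = u then i - 1 else i + 1)"

text \<open>
  Classes of paths beyond the cutoff vanish.
\<close>

fun strand_trunc :: "bool \<Rightarrow> nat \<Rightarrow> nat \<Rightarrow> 'k::field strands \<Rightarrow> 'k strands" where
  "strand_trunc u i p f (s, k, j, D) = (if D < cutoff u j (strand_vertex u i p s k) then f (s, k, j, D) else 0)"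

text \<open>
  A coordinate beyond the cutoff never contributes to one below it, so the truncation may be
  postponed to the end of a computation.
\<close>

lemma strand_trunc_del:
  assumes p: "2 \<le> p" and i: "1 \<le> i"
  shows "strand_trunc u i p (strand_del p (strand_trunc u i p f)) = strand_trunc u i p (strand_del p f)"
proof
  fix b :: "bool \<times> nat \<times> nat \<times> nat"
  obtain s k j D where b: "b = (s, k, j, D)" by (cases b)
  have key: "strand_del p (strand_trunc u i p f) (s, k, j, D) = strand_del p f (s, k, j, D)"
    if D: "D < cutoff u j (strand_vertex u i p s k)"
  proof -
    note defs = cutoff_def strand_vertex_def
    have 1: "D - 1 < cutoff u j (strand_vertex u i p s k)" using D by simp
    have 2: "D < cutoff u j (strand_vertex u i p True (Suc k))" if "s" "1 \<le> k" "k < p"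
      using D that by (auto simp: defs split: if_splits)
    have 3: "D < cutoff u j (strand_vertex u i p False (Suc k))" if "\<not> s"
      using D that by (auto simp: defs split: if_splits)
    have 4: "D - 1 < cutoff u j (strand_vertex u i p True 1)" if "\<not> s" "k = 0" "1 \<le> D"
      using D that p by (auto simp: defs split: if_splits)
    have 5: "D - 2 < cutoff u j (strand_vertex u i p True k)" if "\<not> s" "k \<noteq> 0" "k < p" "2 \<le> D"
      using D that p by (auto simp: defs split: if_splits)
    have 6: "D - 1 < cutoff u j (strand_vertex u i p True p)" if "\<not> s" "Suc k = p" "1 \<le> D"
      using D that p by (auto simp: defs split: if_splits)
    have sd: "shift_del (\<lambda>D. strand_trunc u i p f (s, k, j, D)) D = shift_del (\<lambda>D. f (s, k, j, D)) D"
      using 1 by (simp add: shift_del_def)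
    show ?thesis
      unfolding strand_del.simps sd using 2 3 4 5 6
      by (cases s) (auto simp: on_strand_def)
  qed
  show "strand_trunc u i p (strand_del p (strand_trunc u i p f)) b = strand_trunc u i p (strand_del p f) b"
    unfolding b using key by simp
qed

fun strand_basis :: "bool \<Rightarrow> nat \<Rightarrow> nat \<Rightarrow> nat \<Rightarrow> bool \<times> nat \<times> nat \<times> nat \<Rightarrow> bool" where
  "strand_basis u i p n (s, k, j, D) \<longleftrightarrow> on_strand p s k \<and> (j, strand_vertex u i p s k, D) \<in> coords u n"

text \<open>
  Chains that run along the main strand or along the other one, and the exceptional chains
  that pass from one strand to the other: \<open>Bottom\<close> chains begin in
  \<open>w\<close> and continue in the other strand; \<open>Top\<close> chains run in the
  main strand and end in \<open>v\<close>. The latter occur only for the direction up.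
\<close>

datatype chain_kind = Main | Other | Bottom | Top

fun chain_elem :: "nat \<Rightarrow> chain_kind \<times> nat \<times> nat \<Rightarrow> nat \<Rightarrow> bool \<times> nat \<times> nat \<times> nat" where
  "chain_elem p (Main, j, D) k = (False, k, j, D)"
| "chain_elem p (Other, j, D) k = (True, Suc k, j, D)"
| "chain_elem p (Bottom, j, D) k = (if k = 0 then (False, 0, j, Suc D) else (True, k, j, D))"
| "chain_elem p (Top, j, D) k = (if Suc k = p then (True, p, j, D - 1) else (False, Suc k, j, D))"

fun chains :: "bool \<Rightarrow> nat \<Rightarrow> nat \<Rightarrow> chain_kind \<times> nat \<times> nat \<Rightarrow> bool" where
  "chains u i n (Main, j, D) \<longleftrightarrow> j \<in> {1..n} \<and> (if u then i + 1 - j \<le> D \<and> D < i else j - (i - 1) \<le> D \<and> D < j)"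
| "chains u i n (Other, j, D) \<longleftrightarrow> j \<in> {1..n} \<and> (if u then i - j \<le> D \<and> D < i - 1 else j - i \<le> D \<and> D < j)"
| "chains u i n (Bottom, j, D) \<longleftrightarrow> j \<in> {1..n} \<and> (if u then Suc D + j = i else Suc D + i = j)"
| "chains u i n (Top, j, D) \<longleftrightarrow> j \<in> {1..n} \<and> u \<and> D = i"

definition strand_degree :: "bool \<Rightarrow> nat \<Rightarrow> nat \<Rightarrow> bool \<times> nat \<times> nat \<times> nat \<Rightarrow> int" where
  "strand_degree u i p = (\<lambda>(s, k, j, D). cdeg u j (strand_vertex u i p s k) D +
     (if \<not> s \<and> k = 0 then 0 else if s \<and> k = p then 2 - 2 * int p else 1 - 2 * int k))"

context
  fixes u :: bool and i p n :: nat
  assumes p: "2 \<le> p" and i: "1 \<le> i" "i < n"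
begin

lemma strand_basis_vertex:
  "strand_basis u i p n (False, 0, j, D) \<longleftrightarrow> j \<in> {1..n} \<and> (if u then i - j \<le> D \<and> D < i else j - i \<le> D \<and> D < j)"
  "strand_basis u i p n (True, p, j, D) \<longleftrightarrow> j \<in> {1..n} \<and> (if u then i - j \<le> D \<and> D < i else j - i \<le> D \<and> D < j)"
  "\<lbrakk>1 \<le> k; k < p\<rbrakk> \<Longrightarrow> strand_basis u i p n (False, k, j, D) \<longleftrightarrow>
     j \<in> {1..n} \<and> (if u then i + 1 - j \<le> D \<and> D < i + 1 else j - (i - 1) \<le> D \<and> D < j)"
  "\<lbrakk>1 \<le> k; k < p\<rbrakk> \<Longrightarrow> strand_basis u i p n (True, k, j, D) \<longleftrightarrow>
     j \<in> {1..n} \<and> (if u then i - 1 - j \<le> D \<and> D < i - 1 else j - (i + 1) \<le> D \<and> D < j)"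
  using p i by (auto simp: strand_basis.simps on_strand_def coords_def strand_vertex_def low_def cutoff_def)

declare strand_basis.simps [simp del]

lemma chain_elem_basis:
  assumes "chains u i n c" "k < p"
  shows "strand_basis u i p n (chain_elem p c k)"
proof -
  obtain x j D where c: "c = (x, j, D)" by (cases c)
  note sb = strand_basis_vertex
  show ?thesis
  proof (cases x)
    case Main
    then show ?thesis using assms unfolding c
      by (cases "k = 0") (auto simp: sb split: if_splits)
  next
    case Other
    then show ?thesis using assms p unfolding c
      by (cases "Suc k = p") (auto simp: sb split: if_splits)
  next
    case Bottom
    then show ?thesis using assms p i unfolding c
      by (cases "k = 0") (auto simp: sb split: if_splits)
  next
    case Top
    then have "1 \<le> j" using assms(1) by (simp add: c)
    then have "i - j \<le> i - Suc 0" "Suc i - j \<le> i" by linarith+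
    with Top show ?thesis using assms p i sb(2)[of j "i - 1"] sb(3)[of "Suc k" j i] unfolding c
      by (cases "Suc k = p") (simp_all split: if_splits)
  qed
qed

lemma chain_elem_inj:
  assumes "chains u i n c" "k < p" "chains u i n c'" "k' < p" "chain_elem p c k = chain_elem p c' k'"
  shows "c = c' \<and> k = k'"
proof -
  obtain x j D where c: "c = (x, j, D)" by (cases c)
  obtain x' j' D' where c': "c' = (x', j', D')" by (cases c')
  show ?thesis
    using assms p i unfolding c c'
    by (cases x; cases x') (auto split: if_splits)
qed

text \<open>
  The excluded vector is the class of \<open>(i)\<close> at \<open>w\<close>, which spans
  the simple module.
\<close>

lemma chain_elem_cover:
  assumes "strand_basis u i p n b" "b \<noteq> (False, 0, i, 0)"
  shows "\<exists>c k. chains u i n c \<and> k < p \<and> b = chain_elem p c k"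
proof -
  obtain s k j D where b: "b = (s, k, j, D)" by (cases b)
  note sb = strand_basis_vertex
  have on: "on_strand p s k" using assms(1) by (simp add: b strand_basis.simps)
  consider (w) "\<not> s" "k = 0" | (m) "\<not> s" "1 \<le> k" "k < p" | (o) "s" "1 \<le> k" "k < p" | (v) "s" "k = p"
    using on by (cases s; cases "k = 0"; cases "k = p") (auto simp: on_strand_def)
  then show ?thesis
  proof cases
    case w
    show ?thesis
    proof (cases "chains u i n (Main, j, D)")
      case True
      then show ?thesis using w p by (intro exI[of _ "(Main, j, D)"] exI[of _ 0]) (auto simp: b simp del: chains.simps)
    next
      case False
      then have D: "j \<in> {1..n}" "if u then D + j = i else D + i = j"
        using assms(1) w i unfolding b by (auto simp: sb split: if_splits)
      have "D \<noteq> 0" using D(2) assms(2) w by (auto simp: b split: if_splits)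
      then obtain E where E: "D = Suc E" by (cases D) auto
      have "chains u i n (Bottom, j, E)" using D by (auto simp: E split: if_splits)
      then show ?thesis using w p by (intro exI[of _ "(Bottom, j, E)"] exI[of _ 0]) (auto simp: b E simp del: chains.simps)
    qed
  next
    case m
    show ?thesis
    proof (cases "chains u i n (Main, j, D)")
      case True
      then show ?thesis using m by (intro exI[of _ "(Main, j, D)"] exI[of _ k]) (auto simp: b simp del: chains.simps)
    next
      case False
      then have "chains u i n (Top, j, D)"
        using assms(1) m i unfolding b by (auto simp: sb split: if_splits)
      then show ?thesis using m by (intro exI[of _ "(Top, j, D)"] exI[of _ "k - 1"]) (auto simp: b simp del: chains.simps)
    qed
  next
    case o
    show ?thesis
    proof (cases "chains u i n (Other, j, D)")
      case True
      then show ?thesis using o by (intro exI[of _ "(Other, j, D)"] exI[of _ "k - 1"]) (auto simp: b simp del: chains.simps)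
    next
      case False
      then have "chains u i n (Bottom, j, D)"
        using assms(1) o i unfolding b by (auto simp: sb split: if_splits)
      then show ?thesis using o by (intro exI[of _ "(Bottom, j, D)"] exI[of _ k]) (auto simp: b simp del: chains.simps)
    qed
  next
    case v
    show ?thesis
    proof (cases "chains u i n (Other, j, D)")
      case True
      then show ?thesis using v p by (intro exI[of _ "(Other, j, D)"] exI[of _ "p - 1"]) (auto simp: b simp del: chains.simps)
    next
      case False
      then have "chains u i n (Top, j, Suc D)"
        using assms(1) v i unfolding b by (auto simp: sb split: if_splits)
      then show ?thesis using v p by (intro exI[of _ "(Top, j, Suc D)"] exI[of _ "p - 1"]) (auto simp: b simp del: chains.simps)
    qed
  qed
qed

lemma simple_not_in_chain:
  assumes "chains u i n c" "k < p"
  shows "chain_elem p c k \<noteq> (False, 0, i, 0)"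
proof -
  obtain x j D where c: "c = (x, j, D)" by (cases c)
  show ?thesis using assms p i unfolding c by (cases x) (auto split: if_splits)
qed

text \<open>
  The \<open>p - 1\<close> steps of a chain have degree 2 each.
\<close>

lemma chain_elem_degree:
  assumes "chains u i n c"
  shows "strand_degree u i p (chain_elem p c (p - 1)) = strand_degree u i p (chain_elem p c 0) + (2 - 2 * int p)"
proof -
  obtain x j D where c: "c = (x, j, D)" by (cases c)
  have p': "p - 1 \<noteq> 0" "p - 1 \<noteq> p" "Suc (p - 1) = p" "int (p - 1) = int p - 1" "Suc 0 \<noteq> p" using p by auto
  show ?thesis
  proof (cases x)
    case Top
    then have "u" "D = i" using assms c by auto
    moreover have "int (i - 1) = int i - 1" using i by simp
    ultimately show ?thesis using p' Top i unfolding c strand_degree_def strand_vertex_def cdeg_def by auto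
  qed (use p' assms i c in \<open>auto simp: strand_degree_def strand_vertex_def cdeg_def\<close>)
qed

definition strand_map :: "'k::field strands \<Rightarrow> 'k strands" where
  "strand_map f = (\<lambda>b. if strand_basis u i p n b then strand_del p f b else 0)"

text \<open>
  Every summand of the differential other than the step along the chain refers to a vector
  in a chain of smaller \<open>D\<close>, or to a triple that is no basis vector. A
  \<open>Top\<close> chain enters \<open>v\<close> with the sign of that arrow.
\<close>

lemma strand_map_triangular:
  fixes f :: "'k::field strands"
  assumes f: "\<And>b. \<not> strand_basis u i p n b \<Longrightarrow> f b = 0"
    and c: "chains u i n c" "k < p"
    and low: "\<And>c' k'. \<lbrakk>chains u i n c'; k' < p; snd (snd c') < snd (snd c)\<rbrakk> \<Longrightarrow> f (chain_elem p c' k') = 0"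
  shows "strand_map f (chain_elem p c k) =
    (if Suc k < p then (if Suc k = p - 1 then (if fst c = Top then -1 else 1) else 1) * f (chain_elem p c (Suc k)) else 0)"
proof -
  obtain x j D where cc: "c = (x, j, D)" by (cases c)
  note sb = strand_basis_vertex
  have basis: "strand_basis u i p n (chain_elem p c k)" by (rule chain_elem_basis[OF c])
  have zero: "f b = 0" if "strand_basis u i p n b \<Longrightarrow> \<exists>c' k'. chains u i n c' \<and> k' < p \<and> b = chain_elem p c' k' \<and> snd (snd c') < D" for b
  proof (cases "strand_basis u i p n b")
    case True
    from that[OF this] obtain c' k' where c': "chains u i n c'" "k' < p" "b = chain_elem p c' k'" "snd (snd c') < D"
      by blast
    then show ?thesis using low[OF c'(1,2)] unfolding cc by simp
  qed (rule f)
  have j: "j \<in> {1..n}" using c(1) unfolding cc by (cases x) auto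

  have other: "f (True, k, j, E) = 0" if "1 \<le> k" "k < p" "E < D" for k E
  proof (rule zero)
    assume "strand_basis u i p n (True, k, j, E)"
    from chain_elem_cover[OF this] obtain c' k' where c': "chains u i n c'" "k' < p" "(True, k, j, E) = chain_elem p c' k'" by auto
    obtain x' j' D' where "c' = (x', j', D')" by (cases c')
    then have "snd (snd c') < D" using c' that by (cases x') (auto split: if_splits)
    with c' show "\<exists>c' k'. chains u i n c' \<and> k' < p \<and> (True, k, j, E) = chain_elem p c' k' \<and> snd (snd c') < D" by blast
  qed
  have main: "f (False, k, j, E) = 0" if "k < p" "E < D" "(False, k, j, E) \<noteq> (False, 0, i, 0)" for k E
  proof (rule zero)
    assume "strand_basis u i p n (False, k, j, E)"
    from chain_elem_cover[OF this that(3)] obtain c' k' where c': "chains u i n c'" "k' < p" "(False, k, j, E) = chain_elem p c' k'" by blast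
    obtain x' j' D' where "c' = (x', j', D')" by (cases c')
    then have "snd (snd c') < D" using c' that by (cases x') (auto split: if_splits)
    with c' show "\<exists>c' k'. chains u i n c' \<and> k' < p \<and> (False, k, j, E) = chain_elem p c' k' \<and> snd (snd c') < D" by blast
  qed
  have source: "f (True, p, j, E) = 0" if "E < D" "\<not> u \<or> Suc E \<noteq> i \<or> Suc E < D" for E
  proof (rule zero)
    assume "strand_basis u i p n (True, p, j, E)"
    from chain_elem_cover[OF this] obtain c' k' where c': "chains u i n c'" "k' < p" "(True, p, j, E) = chain_elem p c' k'" by auto
    obtain x' j' D' where "c' = (x', j', D')" by (cases c')
    then have "snd (snd c') < D" using c' that i by (cases x') (auto split: if_splits)
    with c' show "\<exists>c' k'. chains u i n c' \<and> k' < p \<and> (True, p, j, E) = chain_elem p c' k' \<and> snd (snd c') < D" by blast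
  qed
  have sd_main: "shift_del (\<lambda>D. f (False, k, j, D)) D = 0" if "k < p" for k
  proof (cases "D = 0 \<or> D = 1")
    case True
    then show ?thesis by (auto simp: shift_del_def)
  next
    case False
    then have "f (False, k, j, D - 1) = 0" using that by (intro main) auto
    then show ?thesis by (simp add: shift_del_def)
  qed
  have sd_other: "shift_del (\<lambda>D. f (True, k, j, D)) D = 0" if "1 \<le> k" "k < p" for k
    using other[OF that, of "D - 1"] by (simp add: shift_del_def)
  have eq: "strand_map f (chain_elem p c k) = strand_del p f (chain_elem p c k)"
    using basis by (simp add: strand_map_def)
  show ?thesis
  proof (cases x)
    case Main
    have D: "D < (if u then i else j)" using c(1) unfolding cc Main by (auto split: if_splits)
    have "f (True, p, j, D - 1) = 0" if "1 \<le> D" using that D by (intro source) (auto split: if_splits)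
    moreover have "f (True, 1, j, D - 1) = 0" if "1 \<le> D" using that p by (intro other) auto
    moreover have "f (True, k, j, D - 2) = 0" if "2 \<le> D" "k \<noteq> 0" using that c(2) by (intro other) auto
    ultimately show ?thesis
      using c(2) sd_main[OF c(2)] unfolding eq unfolding cc Main by (auto simp: on_strand_def)
  next
    case Other
    have D: "D < (if u then i - 1 else j)" using c(1) unfolding cc Other by (auto split: if_splits)
    have "shift_del (\<lambda>D. f (True, Suc k, j, D)) D = 0"
    proof (cases "Suc k < p")
      case True
      then show ?thesis by (intro sd_other) auto
    next
      case False
      then have "Suc k = p" using c(2) by simp
      moreover have "f (True, p, j, D - 1) = 0" if "0 < D" using that D by (intro source) (auto split: if_splits)
      ultimately show ?thesis by (simp add: shift_del_def)
    qed
    then show ?thesis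
      using c(2) unfolding eq unfolding cc Other by (auto simp: on_strand_def)
  next
    case Bottom
    have D: "if u then Suc D + j = i else Suc D + i = j" using c(1) unfolding cc Bottom by auto
    show ?thesis
    proof (cases "k = 0")
      case True
      have "f (False, 0, j, D) = 0" by (rule f) (use D in \<open>auto simp: sb split: if_splits\<close>)
      moreover have "f (False, 1, j, Suc D) = 0"
        by (rule f) (use D p i in \<open>auto simp: sb split: if_splits\<close>)
      ultimately show ?thesis
        using True p unfolding eq unfolding cc Bottom by (auto simp: on_strand_def shift_del_def)
    next
      case False
      have "f (True, p, j, D) = 0" by (rule f) (use D in \<open>auto simp: sb split: if_splits\<close>)
      then show ?thesis
        using False c(2) sd_other[of k] p unfolding eq unfolding cc Bottom
        by (cases "Suc k = p") (auto simp: on_strand_def)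
    qed
  next
    case Top
    have D: "u" "D = i" using c(1) unfolding cc Top by auto
    show ?thesis
    proof (cases "Suc k = p")
      case True
      have "f (True, p, j, D - 2) = 0" if "2 \<le> D" using that D by (intro source) auto
      then have "shift_del (\<lambda>D. f (True, p, j, D)) (D - 1) = 0"
        by (cases "2 \<le> D") (auto simp: shift_del_def numeral_2_eq_2)
      then show ?thesis
        using True p unfolding eq unfolding cc Top by (auto simp: on_strand_def)
    next
      case False
      then have k: "Suc k < p" using c(2) by simp
      have "f (True, Suc k, j, D - 2) = 0" if "2 \<le> D" using that k by (intro other) auto
      then show ?thesis
        using k sd_main[OF k] D i unfolding eq unfolding cc Top by (auto simp: on_strand_def)
    qed
  qed
qed

lemma strand_map_simple:
  fixes f :: "'k::field strands"
  assumes "\<And>b. \<not> strand_basis u i p n b \<Longrightarrow> f b = 0"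
  shows "strand_map f (False, 0, i, 0) = 0"
proof -
  have "f (False, 1, i, 0) = 0" by (rule assms) (use p i strand_basis_vertex(3)[of 1 i 0] in \<open>auto split: if_splits\<close>)
  then show ?thesis by (simp add: strand_map_def shift_del_def)
qed

lemma strand_map_kernel:
  fixes f :: "'k::field strands"
  assumes "\<And>b. b \<noteq> (False, 0, i, 0) \<Longrightarrow> f b = 0"
  shows "strand_map f b = 0"
proof -
  obtain s k j D where b: "b = (s, k, j, D)" by (cases b)
  have "shift_del (\<lambda>D. f (s, k, j, D)) D = 0"
  proof (cases "D = 0 \<or> D = 1")
    case False
    then have "f (s, k, j, D - 1) = 0" by (intro assms) auto
    then show ?thesis by (simp add: shift_del_def)
  qed (auto simp: shift_del_def)
  then show ?thesis unfolding b strand_map_def using assms by simp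
qed

end

section \<open>Submodules and quotients\<close>

lemma restrict_based:
  fixes M :: "('k::field, 'a, 'v) pdg_module"
  assumes M: "based M B dgr C" and S: "S = {x \<in> carrier M. \<forall>b. b \<notin> T \<longrightarrow> C x b = 0}"
  shows "based (restrict_module M S) (B \<inter> T) dgr C"
proof -
  interpret based M B dgr C by (rule M)
  show ?thesis
  proof
    fix x y b F c d
    show "finite (B \<inter> T)" using finite_basis by blast
    show "\<zero>\<^bsub>restrict_module M S\<^esub> \<in> carrier (restrict_module M S)"
      by (simp add: restrict_module_def S zero_in coord_zero)
    show "\<exists>x\<in>carrier (restrict_module M S). \<forall>b\<in>B \<inter> T. C x b = F b"
      by (rule bexI[of _ "vec (\<lambda>b. if b \<in> T then F b else 0)"])
        (simp_all add: restrict_module_def S vec_in coord_vec)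
    show "C \<zero>\<^bsub>restrict_module M S\<^esub> b = 0" by (simp add: restrict_module_def coord_zero)
    show "x \<in> grade (restrict_module M S) d \<longleftrightarrow> x \<in> carrier (restrict_module M S) \<and> (\<forall>b. C x b \<noteq> 0 \<longrightarrow> dgr b = d)"
      by (auto simp: restrict_module_def S grade_iff)
    assume "x \<in> carrier (restrict_module M S)"
    then have x: "x \<in> carrier M" "\<And>b. b \<notin> T \<Longrightarrow> C x b = 0" by (simp_all add: restrict_module_def S)
    show "c \<odot>\<^bsub>restrict_module M S\<^esub> x \<in> carrier (restrict_module M S)"
      using x by (simp add: restrict_module_def S smult_in coord_smult)
    show "C (c \<odot>\<^bsub>restrict_module M S\<^esub> x) b = c * C x b"
      using x by (simp add: restrict_module_def coord_smult)
    show "C x b = 0" if "b \<notin> B \<inter> T" using that x coord_off by blast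
    assume "y \<in> carrier (restrict_module M S)"
    then have y: "y \<in> carrier M" "\<And>b. b \<notin> T \<Longrightarrow> C y b = 0" by (simp_all add: restrict_module_def S)
    show "x \<oplus>\<^bsub>restrict_module M S\<^esub> y \<in> carrier (restrict_module M S)"
      using x y by (simp add: restrict_module_def S add_in coord_add)
    show "C (x \<oplus>\<^bsub>restrict_module M S\<^esub> y) b = C x b + C y b"
      using x y by (simp add: restrict_module_def coord_add)
    show "x = y" if eq: "\<And>b. b \<in> B \<inter> T \<Longrightarrow> C x b = C y b"
    proof (rule coord_inj[OF x(1) y(1)])
      fix b assume "b \<in> B"
      then show "C x b = C y b" using eq[of b] x(2)[of b] y(2)[of b] by (cases "b \<in> T") simp_all
    qed
  qed
qed

lemma left_pdg_restrict:
  fixes M :: "('k::field, 'a, 'v) pdg_module" and A :: "('k, 'a, 'z) pcomplex_scheme"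
  assumes M: "left_pdg_module p A M" and based: "based M B dgr C"
    and S: "S = {x \<in> carrier M. \<forall>b. b \<notin> T \<longrightarrow> C x b = 0}"
    and del: "\<And>x. x \<in> S \<Longrightarrow> del M x \<in> S" and act: "\<And>a x. a \<in> carrier A \<Longrightarrow> x \<in> S \<Longrightarrow> act M a x \<in> S"
  shows "left_pdg_module p A (restrict_module M S)"
proof -
  interpret R: based "restrict_module M S" "B \<inter> T" dgr C by (rule restrict_based[OF based S])
  have sub: "x \<in> carrier M" if "x \<in> S" for x using that S by simp
  have act_M: "pdg_action p A M" using M by (simp add: left_pdg_module_def)
  then have pM: "is_pcomplex p M" by (simp add: pdg_action_def)
  then have lin: "graded_linear 2 M M (del M)" by (simp add: is_pcomplex_def)
  have "graded_linear 2 (restrict_module M S) (restrict_module M S) (del M)"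
    using graded_linearD(2-4)[OF lin] sub del
    by (simp add: graded_linear_def restrict_module_def)
  moreover have "(del M ^^ p) x = \<zero>\<^bsub>M\<^esub>" if "x \<in> S" for x using pM sub[OF that] by (simp add: is_pcomplex_def)
  ultimately have "is_pcomplex p (restrict_module M S)"
    by (intro R.is_pcomplexI) (simp_all add: restrict_module_def)
  moreover have "a \<in> carrier A" if "a \<in> grade A d" for a d
    using act_M that by (auto simp: pdg_action_def pdg_algebra_def is_pcomplex_def direct_sum_of_def)
  ultimately show ?thesis
    using M sub act unfolding left_pdg_module_def pdg_action_def
    by (simp add: restrict_module_def Pi_iff)
qed

text \<open>
  The fibres of \<open>\<phi>\<close> are the cosets of \<open>S\<close>. Writing \<open>K
  v\<close> for the fibre over \<open>v\<close>, all operations on cosets become operations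
  on \<open>v\<close>. The section \<open>\<psi>\<close> guarantees nonempty fibres and
  homogeneous representatives.
\<close>

lemma quotient_isomorphicI:
  fixes M :: "('k::field, 'a, 'v) pdg_module" and N :: "('k, 'a, 'w) pdg_module"
  assumes ag: "abelian_group M" and S: "S \<subseteq> carrier M"
    and hom: "pdg_hom A M N \<phi>" and zero: "\<phi> \<zero>\<^bsub>M\<^esub> = \<zero>\<^bsub>N\<^esub>"
    and ker: "\<And>x y. x \<in> carrier M \<Longrightarrow> y \<in> carrier M \<Longrightarrow> \<phi> x = \<phi> y \<longleftrightarrow> (\<exists>s\<in>S. x = s \<oplus>\<^bsub>M\<^esub> y)"
    and \<psi>: "\<And>v. v \<in> carrier N \<Longrightarrow> \<psi> v \<in> carrier M" "\<And>v. v \<in> carrier N \<Longrightarrow> \<phi> (\<psi> v) = v"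
      "\<And>v d. v \<in> grade N d \<Longrightarrow> \<psi> v \<in> grade M d"
    and sub: "\<And>d. grade M d \<subseteq> carrier M" "\<And>d. grade N d \<subseteq> carrier N"
    and closed: "\<And>c x. x \<in> carrier M \<Longrightarrow> c \<odot>\<^bsub>M\<^esub> x \<in> carrier M" "\<And>x. x \<in> carrier M \<Longrightarrow> del M x \<in> carrier M"
      "\<And>a x. a \<in> carrier A \<Longrightarrow> x \<in> carrier M \<Longrightarrow> act M a x \<in> carrier M"
  shows "pdg_isomorphic A (quotient_module M S) N"
proof -
  interpret M: abelian_group M by (rule ag)
  have \<phi>lin: "graded_linear 0 M N \<phi>" using hom by (simp add: pdg_hom_def pcomplex_hom_def)
  note \<phi>D = graded_linearD[OF \<phi>lin]
  have \<phi>del: "\<phi> (del M x) = del N (\<phi> x)" if "x \<in> carrier M" for x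
    using hom that by (simp add: pdg_hom_def pcomplex_hom_def)
  have \<phi>act: "\<phi> (act M a x) = act N a (\<phi> x)" if "a \<in> carrier A" "x \<in> carrier M" for a x
    using hom that by (simp add: pdg_hom_def)
  define K where "K v = {y \<in> carrier M. \<phi> y = v}" for v
  have coset: "S +>\<^bsub>M\<^esub> x = K (\<phi> x)" if x: "x \<in> carrier M" for x
  proof -
    have "y \<in> S +>\<^bsub>M\<^esub> x \<longleftrightarrow> y \<in> K (\<phi> x)" for y
      using ker[OF _ x, of y] S x by (auto simp: a_r_coset_def' K_def)
    then show ?thesis by blast
  qed
  have \<psi>K: "\<psi> v \<in> K v" if "v \<in> carrier N" for v using \<psi>(1,2)[OF that] by (simp add: K_def)
  have UNK: "(\<Union>x\<in>K v. S +>\<^bsub>M\<^esub> f x) = K (f' v)"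
    if v: "v \<in> carrier N" and f: "\<And>x. x \<in> carrier M \<Longrightarrow> f x \<in> carrier M \<and> \<phi> (f x) = f' (\<phi> x)" for f f' v
  proof -
    have "S +>\<^bsub>M\<^esub> f x = K (f' v)" if x: "x \<in> K v" for x
    proof -
      have xM: "x \<in> carrier M" and xv: "\<phi> x = v" using x by (simp_all add: K_def)
      from f[OF xM] coset[of "f x"] show ?thesis by (simp add: xv)
    qed
    then show ?thesis using \<psi>K[OF v] by blast
  qed
  have carr: "carrier (quotient_module M S) = K ` carrier N"
  proof -
    have "carrier (quotient_module M S) = (\<lambda>x. K (\<phi> x)) ` carrier M"
      by (auto simp: quotient_module_def A_RCOSETS_def' coset)
    also have "\<dots> = K ` carrier N"
    proof (intro equalityI subsetI)
      fix Y assume "Y \<in> (\<lambda>x. K (\<phi> x)) ` carrier M"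
      then show "Y \<in> K ` carrier N" using \<phi>D(1) by blast
    next
      fix Y assume "Y \<in> K ` carrier N"
      then obtain v where v: "v \<in> carrier N" "Y = K v" by blast
      have "Y = K (\<phi> (\<psi> v))" using v \<psi>(2) by simp
      then show "Y \<in> (\<lambda>x. K (\<phi> x)) ` carrier M" using \<psi>(1)[OF v(1)] by blast
    qed
    finally show ?thesis .
  qed
  have gr: "grade (quotient_module M S) d = K ` grade N d" for d
  proof (intro equalityI subsetI)
    fix Y assume "Y \<in> grade (quotient_module M S) d"
    then obtain x where x: "x \<in> grade M d" "Y = S +>\<^bsub>M\<^esub> x" by (auto simp: quotient_module_def)
    have "Y = K (\<phi> x)" using x coset[of x] sub(1)[of d] by blast
    moreover have "\<phi> x \<in> grade N d" using \<phi>D(4)[OF x(1)] by simp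
    ultimately show "Y \<in> K ` grade N d" by blast
  next
    fix Y assume "Y \<in> K ` grade N d"
    then obtain v where v: "v \<in> grade N d" "Y = K v" by blast
    then have vN: "v \<in> carrier N" using sub(2) by blast
    have "Y = S +>\<^bsub>M\<^esub> \<psi> v" using coset[OF \<psi>(1)[OF vN]] \<psi>(2)[OF vN] v(2) by simp
    then show "Y \<in> grade (quotient_module M S) d" using \<psi>(3)[OF v(1)] by (simp add: quotient_module_def)
  qed
  have sm: "c \<odot>\<^bsub>quotient_module M S\<^esub> K v = K (c \<odot>\<^bsub>N\<^esub> v)" if "v \<in> carrier N" for c v
    using UNK[OF that, of "\<lambda>x. c \<odot>\<^bsub>M\<^esub> x" "\<lambda>x. c \<odot>\<^bsub>N\<^esub> x"] closed(1) \<phi>D(3) by (simp add: quotient_module_def)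
  have dl: "del (quotient_module M S) (K v) = K (del N v)" if "v \<in> carrier N" for v
    using UNK[OF that, of "del M" "del N"] closed(2) \<phi>del by (simp add: quotient_module_def)
  have ac: "act (quotient_module M S) a (K v) = K (act N a v)" if "a \<in> carrier A" "v \<in> carrier N" for a v
    using UNK[OF that(2), of "act M a" "act N a"] closed(3) \<phi>act that(1) by (simp add: quotient_module_def)
  have ad: "K v \<oplus>\<^bsub>quotient_module M S\<^esub> K w = K (v \<oplus>\<^bsub>N\<^esub> w)" if v: "v \<in> carrier N" and w: "w \<in> carrier N" for v w
  proof -
    have "z \<in> K (v \<oplus>\<^bsub>N\<^esub> w) \<longleftrightarrow> (\<exists>x\<in>K v. \<exists>y\<in>K w. z = x \<oplus>\<^bsub>M\<^esub> y)" for z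
    proof
      assume "z \<in> K (v \<oplus>\<^bsub>N\<^esub> w)"
      then have z: "z \<in> carrier M" "\<phi> z = \<phi> (\<psi> v \<oplus>\<^bsub>M\<^esub> \<psi> w)"
        using \<phi>D(2)[OF \<psi>(1)[OF v] \<psi>(1)[OF w]] \<psi>(2) v w by (simp_all add: K_def)
      obtain s where s: "s \<in> S" "z = s \<oplus>\<^bsub>M\<^esub> (\<psi> v \<oplus>\<^bsub>M\<^esub> \<psi> w)"
        using z ker[OF z(1) M.a_closed[OF \<psi>(1)[OF v] \<psi>(1)[OF w]]] by blast
      have sM: "s \<in> carrier M" using s(1) S by blast
      have "s \<oplus>\<^bsub>M\<^esub> \<psi> v \<in> K v"
        using ker[OF M.a_closed[OF sM \<psi>(1)[OF v]] \<psi>(1)[OF v]] s(1) \<psi>(1,2)[OF v] sM by (auto simp: K_def)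
      moreover have "z = (s \<oplus>\<^bsub>M\<^esub> \<psi> v) \<oplus>\<^bsub>M\<^esub> \<psi> w"
        using s(2) sM \<psi>(1)[OF v] \<psi>(1)[OF w] by (simp add: M.a_assoc)
      ultimately show "\<exists>x\<in>K v. \<exists>y\<in>K w. z = x \<oplus>\<^bsub>M\<^esub> y" using \<psi>K[OF w] by blast
    next
      assume "\<exists>x\<in>K v. \<exists>y\<in>K w. z = x \<oplus>\<^bsub>M\<^esub> y"
      then obtain x y where "x \<in> K v" "y \<in> K w" "z = x \<oplus>\<^bsub>M\<^esub> y" by blast
      then show "z \<in> K (v \<oplus>\<^bsub>N\<^esub> w)" using \<phi>D(2)[of x y] by (simp add: K_def)
    qed
    then show ?thesis by (auto simp: quotient_module_def set_add_def' )
  qed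
  have K_hom: "pdg_hom A N (quotient_module M S) K"
    unfolding pdg_hom_def pcomplex_hom_def graded_linear_def
    by (simp add: carr gr sm dl ac ad)
  define f where "f Y = \<phi> (SOME y. y \<in> Y)" for Y
  have fK: "f (K v) = v" if "v \<in> carrier N" for v
    using someI[of "\<lambda>y. y \<in> K v", OF \<psi>K[OF that]] by (simp add: f_def K_def)
  have N_closed: "\<And>v w. \<lbrakk>v \<in> carrier N; w \<in> carrier N\<rbrakk> \<Longrightarrow> v \<oplus>\<^bsub>N\<^esub> w \<in> carrier N"
    "\<And>v c. v \<in> carrier N \<Longrightarrow> c \<odot>\<^bsub>N\<^esub> v \<in> carrier N" "\<And>v. v \<in> carrier N \<Longrightarrow> del N v \<in> carrier N"
    "\<And>v a. \<lbrakk>a \<in> carrier A; v \<in> carrier N\<rbrakk> \<Longrightarrow> act N a v \<in> carrier N"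
    subgoal for v w using \<phi>D(1)[of "\<psi> v \<oplus>\<^bsub>M\<^esub> \<psi> w"] \<phi>D(2)[of "\<psi> v" "\<psi> w"] \<psi>(1,2)[of v] \<psi>(1,2)[of w] by simp
    subgoal for v c using \<phi>D(1)[of "c \<odot>\<^bsub>M\<^esub> \<psi> v"] \<phi>D(3)[of "\<psi> v" c] \<psi>(1,2)[of v] closed(1) by simp
    subgoal for v using \<phi>D(1)[of "del M (\<psi> v)"] \<phi>del[of "\<psi> v"] \<psi>(1,2)[of v] closed(2) by simp
    subgoal for v a using \<phi>D(1)[of "act M a (\<psi> v)"] \<phi>act[of a "\<psi> v"] \<psi>(1,2)[of v] closed(3) by simp
    done
  have f_hom: "pdg_hom A (quotient_module M S) N f"
    unfolding pdg_hom_def pcomplex_hom_def graded_linear_def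
  proof (intro conjI ballI allI funcsetI)
    fix x y c a e
    show "f x \<in> grade N (e + 0)" if "x \<in> grade (quotient_module M S) e"
      using that fK sub(2)[of e] unfolding gr by auto
    assume "x \<in> carrier (quotient_module M S)"
    then obtain v where v: "v \<in> carrier N" "x = K v" unfolding carr by blast
    show "f x \<in> carrier N" using fK v by simp
    show "f (c \<odot>\<^bsub>quotient_module M S\<^esub> x) = c \<odot>\<^bsub>N\<^esub> f x" using fK v sm N_closed by simp
    show "f (del (quotient_module M S) x) = del N (f x)" using fK v dl N_closed by simp
    show "f (act (quotient_module M S) a x) = act N a (f x)" if "a \<in> carrier A" using that fK v ac N_closed by simp
    assume "y \<in> carrier (quotient_module M S)"
    then obtain w where w: "w \<in> carrier N" "y = K w" unfolding carr by blast
    show "f (x \<oplus>\<^bsub>quotient_module M S\<^esub> y) = f x \<oplus>\<^bsub>N\<^esub> f y" using fK v w ad N_closed by simp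
  qed
  have "\<forall>x\<in>carrier (quotient_module M S). K (f x) = x" unfolding carr using fK by simp
  with K_hom f_hom fK show ?thesis unfolding pdg_isomorphic_def by blast
qed

section \<open>Cell sums over an algebra with path coordinates\<close>

text \<open>
  A twisted sum of shifted projectives in which the differential of every generator is a
  combination of generators with multiples of single basis paths as coefficients: \<open>ex
  g h\<close> is the number of steps of the path from \<open>g\<close> to \<open>h\<close>,
  and \<open>coe g h\<close> its coefficient.
\<close>

locale cell_sum = coord_algebra A p n u co
  for A :: "('k::field, 'a) pcomplex" and p n :: nat and u :: bool and co :: "'a \<Rightarrow> nat \<Rightarrow> nat \<Rightarrow> nat \<Rightarrow> 'k" +
  fixes G :: "'g set" and vx :: "'g \<Rightarrow> nat" and wt :: "'g \<Rightarrow> int" and ee :: "nat \<Rightarrow> 'a"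
    and dg :: "'g \<Rightarrow> 'g \<Rightarrow> 'a" and ex :: "'g \<Rightarrow> 'g \<Rightarrow> nat" and coe :: "'g \<Rightarrow> 'g \<Rightarrow> 'k"
  assumes G_finite: "finite G"
    and ee_in: "ee m \<in> carrier A"
    and co_ee: "co (ee m) j l D = (if (j, l, D) = (m, m, 0) then of_bool (m \<in> {1..n}) else 0)"
    and dg_in: "dg g h \<in> carrier A"
    and co_dg: "\<lbrakk>g \<in> G; h \<in> G\<rbrakk> \<Longrightarrow> co (dg g h) j l D = (if (j, l, D) = (vx g, vx h, ex g h) then coe g h else 0)"
    and dg_off: "\<lbrakk>g \<in> G; h \<notin> G\<rbrakk> \<Longrightarrow> dg g h = \<zero>\<^bsub>A\<^esub>"
    and coe_degree: "\<lbrakk>g \<in> G; h \<in> G; coe g h \<noteq> 0\<rbrakk> \<Longrightarrow> cdeg u (vx g) (vx h) (ex g h) + wt h = wt g + 2"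
begin

abbreviation Xs :: "('k, 'a, 'g \<Rightarrow> 'a) pdg_module" where
  "Xs \<equiv> left_cell_sum A G (\<lambda>g. ee (vx g)) wt dg"

definition cell_coord :: "('g \<Rightarrow> 'a) \<Rightarrow> 'g \<times> nat \<times> nat \<Rightarrow> 'k" where
  "cell_coord x = (\<lambda>(g, j, D). co (x g) j (vx g) D)"

definition cell_basis :: "('g \<times> nat \<times> nat) set" where
  "cell_basis = {(g, j, D). g \<in> G \<and> (j, vx g, D) \<in> coords u n}"

definition cell_degree :: "'g \<times> nat \<times> nat \<Rightarrow> int" where
  "cell_degree = (\<lambda>(g, j, D). cdeg u j (vx g) D + wt g)"

text \<open>
  The projective at \<open>m\<close> consists of the paths that end in \<open>m\<close>.
\<close>

lemma P_carrier: "carrier (left_projective A (ee m)) = {a \<in> carrier A. \<forall>h l D. l \<noteq> m \<longrightarrow> co a h l D = 0}"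
proof (intro equalityI subsetI)
  fix a assume "a \<in> carrier (left_projective A (ee m))"
  then obtain b where b: "b \<in> carrier A" "a = b \<otimes>\<^bsub>A\<^esub> ee m" by (auto simp: left_projective_def)
  have "co a h l D = 0" if "l \<noteq> m" for h l D
    using co_mult_monomial[OF b(1) ee_in co_ee] that unfolding b(2) by simp
  then show "a \<in> {a \<in> carrier A. \<forall>h l D. l \<noteq> m \<longrightarrow> co a h l D = 0}" using b ee_in by simp
next
  fix a assume "a \<in> {a \<in> carrier A. \<forall>h l D. l \<noteq> m \<longrightarrow> co a h l D = 0}"
  then have a: "a \<in> carrier A" "\<And>h l D. l \<noteq> m \<Longrightarrow> co a h l D = 0" by auto
  have "a = a \<otimes>\<^bsub>A\<^esub> ee m"
  proof (rule co_eqI)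
    fix h l D
    show "co a h l D = co (a \<otimes>\<^bsub>A\<^esub> ee m) h l D"
      using co_mult_monomial[OF a(1) ee_in co_ee] a(2)[of l h D] co_off[OF a(1), of h l D]
      by (auto simp: coords_def)
  qed (use a ee_in in auto)
  then show "a \<in> carrier (left_projective A (ee m))" using a(1) by (auto simp: left_projective_def)
qed

lemma P_simps:
  "zero (left_projective A e) = \<zero>\<^bsub>A\<^esub>" "add (left_projective A e) = add A"
  "module.smult (left_projective A e) = module.smult A"
  "grade (left_projective A e) d = grade A d \<inter> carrier (left_projective A e)"
  "del (left_projective A e) = del A" "act (left_projective A e) a x = a \<otimes>\<^bsub>A\<^esub> x"
  by (simp_all add: left_projective_def)

lemma X_carrier: "x \<in> carrier Xs \<longleftrightarrow>
    (\<forall>g. x g \<in> carrier A) \<and> (\<forall>g h l D. l \<noteq> vx g \<longrightarrow> co (x g) h l D = 0) \<and> (\<forall>g. g \<notin> G \<longrightarrow> x g = \<zero>\<^bsub>A\<^esub>)"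
proof
  assume "x \<in> carrier Xs"
  then have x: "\<And>g. g \<in> G \<Longrightarrow> x g \<in> carrier (left_projective A (ee (vx g)))" "\<And>g. g \<notin> G \<Longrightarrow> x g = \<zero>\<^bsub>A\<^esub>"
    by (auto simp: left_cell_sum_def Let_def)
  have "x g \<in> carrier A \<and> (\<forall>h l D. l \<noteq> vx g \<longrightarrow> co (x g) h l D = 0)" for g
    using x(1)[of g] x(2)[of g] AB.zero_in unfolding P_carrier by (cases "g \<in> G") (auto simp: co_zero)
  with x(2) show "(\<forall>g. x g \<in> carrier A) \<and> (\<forall>g h l D. l \<noteq> vx g \<longrightarrow> co (x g) h l D = 0) \<and> (\<forall>g. g \<notin> G \<longrightarrow> x g = \<zero>\<^bsub>A\<^esub>)"
    by blast
qed (simp add: left_cell_sum_def Let_def P_carrier)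

lemma X_simps:
  "\<zero>\<^bsub>Xs\<^esub> = (\<lambda>g. \<zero>\<^bsub>A\<^esub>)" "x \<oplus>\<^bsub>Xs\<^esub> y = (\<lambda>g. x g \<oplus>\<^bsub>A\<^esub> y g)" "c \<odot>\<^bsub>Xs\<^esub> x = (\<lambda>g. c \<odot>\<^bsub>A\<^esub> x g)"
  "act Xs a x = (\<lambda>g. a \<otimes>\<^bsub>A\<^esub> x g)"
  "del Xs x = (\<lambda>h. del A (x h) \<oplus>\<^bsub>A\<^esub> finsum A (\<lambda>g. x g \<otimes>\<^bsub>A\<^esub> dg g h) G)"
  by (simp_all add: left_cell_sum_def Let_def)

lemma X_in: "x \<in> carrier Xs \<Longrightarrow> x g \<in> carrier A"
  by (simp add: X_carrier)

lemma X_grade: "x \<in> grade Xs d \<longleftrightarrow> x \<in> carrier Xs \<and> (\<forall>g\<in>G. x g \<in> grade A (d - wt g))"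
  by (auto simp: left_cell_sum_def Let_def shift_def P_simps)

lemma P_zero_in: "\<zero>\<^bsub>A\<^esub> \<in> grade A d"
  by (simp add: A_grade_iff AB.zero_in co_zero)

lemma X_grade_coord: "x \<in> grade Xs d \<longleftrightarrow> x \<in> carrier Xs \<and> (\<forall>b. cell_coord x b \<noteq> 0 \<longrightarrow> cell_degree b = d)"
proof (cases "x \<in> carrier Xs")
  case x: True
  note xc = x[unfolded X_carrier]
  have "x \<in> grade Xs d \<longleftrightarrow> (\<forall>g. x g \<in> grade A (d - wt g))"
    using x xc P_zero_in by (auto simp: X_grade)
  also have "\<dots> \<longleftrightarrow> (\<forall>g j l D. co (x g) j l D \<noteq> 0 \<longrightarrow> cdeg u j l D = d - wt g)"
    using xc by (simp add: A_grade_iff)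
  also have "\<dots> \<longleftrightarrow> (\<forall>g j D. co (x g) j (vx g) D \<noteq> 0 \<longrightarrow> cdeg u j (vx g) D = d - wt g)"
    using xc by metis
  also have "\<dots> \<longleftrightarrow> (\<forall>b. cell_coord x b \<noteq> 0 \<longrightarrow> cell_degree b = d)"
    by (auto simp: cell_coord_def cell_degree_def eq_diff_eq)
  finally show ?thesis using x by simp
qed (simp add: X_grade)

lemma X_based: "based Xs cell_basis cell_degree cell_coord"
proof
  fix x y b F c d
  have "cell_basis \<subseteq> (\<lambda>(g, h, l, D). (g, h, D)) ` (G \<times> coords u n)"
    by (force simp: cell_basis_def)
  then show "finite cell_basis"
    using G_finite AB.finite_basis by (meson finite_SigmaI finite_imageI finite_subset)
  show "\<zero>\<^bsub>Xs\<^esub> \<in> carrier Xs" by (simp add: X_carrier X_simps AB.zero_in co_zero)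
  show "cell_coord \<zero>\<^bsub>Xs\<^esub> b = 0" by (simp add: X_simps cell_coord_def co_zero split: prod.split)
  show "x \<in> grade Xs d \<longleftrightarrow> x \<in> carrier Xs \<and> (\<forall>b. cell_coord x b \<noteq> 0 \<longrightarrow> cell_degree b = d)"
    by (rule X_grade_coord)
  show "\<exists>x\<in>carrier Xs. \<forall>b\<in>cell_basis. cell_coord x b = F b"
  proof (rule bexI)
    let ?x = "\<lambda>g. if g \<in> G then AB.vec (\<lambda>(h, l, D). if l = vx g then F (g, h, D) else 0) else \<zero>\<^bsub>A\<^esub>"
    have co: "co (?x g) h l D = (if g \<in> G \<and> (h, l, D) \<in> coords u n \<and> l = vx g then F (g, h, D) else 0)" for g h l D
      using AB.coord_vec[of "\<lambda>(h, l, D). if l = vx g then F (g, h, D) else 0" "(h, l, D)"]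
      by (auto simp: co_zero)
    show "\<forall>b\<in>cell_basis. cell_coord ?x b = F b" by (auto simp: cell_coord_def cell_basis_def co)
    show "?x \<in> carrier Xs" unfolding X_carrier co by (simp add: AB.vec_in AB.zero_in)
  qed
  assume x: "x \<in> carrier Xs"
  note xc = x[unfolded X_carrier]
  show "c \<odot>\<^bsub>Xs\<^esub> x \<in> carrier Xs"
    using xc by (simp add: X_carrier X_simps AB.smult_in co_smult) (metis AB.smult_zero)
  show "cell_coord (c \<odot>\<^bsub>Xs\<^esub> x) b = c * cell_coord x b"
    using xc by (simp add: X_simps cell_coord_def co_smult split: prod.split)
  show "cell_coord x b = 0" if "b \<notin> cell_basis"
  proof -
    obtain g j D where b: "b = (g, j, D)" by (cases b)
    show ?thesis using that xc co_off[of "x g" j "vx g" D]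
      by (cases "g \<in> G") (auto simp: b cell_basis_def cell_coord_def co_zero)
  qed
  assume y: "y \<in> carrier Xs"
  note yc = y[unfolded X_carrier]
  show "x \<oplus>\<^bsub>Xs\<^esub> y \<in> carrier Xs"
    using xc yc by (simp add: X_carrier X_simps AB.add_in co_add)
  show "cell_coord (x \<oplus>\<^bsub>Xs\<^esub> y) b = cell_coord x b + cell_coord y b"
    using xc yc by (simp add: X_simps cell_coord_def co_add split: prod.split)
  show "x = y" if eq: "\<And>b. b \<in> cell_basis \<Longrightarrow> cell_coord x b = cell_coord y b"
  proof
    fix g
    show "x g = y g"
    proof (cases "g \<in> G")
      case True
      show ?thesis
      proof (rule co_eqI[OF X_in[OF x] X_in[OF y]])
        fix h l D
        show "co (x g) h l D = co (y g) h l D"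
          using eq[of "(g, h, D)"] xc yc True co_off[OF X_in[OF x], of h l D g] co_off[OF X_in[OF y], of h l D g]
          by (cases "l = vx g"; cases "(h, l, D) \<in> coords u n") (auto simp: cell_basis_def cell_coord_def)
      qed
    qed (use xc yc in auto)
  qed
qed

sublocale X: based Xs cell_basis cell_degree cell_coord by (rule X_based)

lemma X_term_in: "x \<in> carrier Xs \<Longrightarrow> x g \<otimes>\<^bsub>A\<^esub> dg g h \<in> carrier A"
  by (intro A.m_closed X_in dg_in)

lemma X_sum_in: "x \<in> carrier Xs \<Longrightarrow> finsum A (\<lambda>g. x g \<otimes>\<^bsub>A\<^esub> dg g h) G \<in> carrier A"
  by (intro A.finsum_closed funcsetI X_term_in)

lemma co_X_del:
  assumes x: "x \<in> carrier Xs" and h: "h \<in> G"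
  shows "co (del Xs x h) j l D = (if l = vx h \<and> D < cutoff u j l then shift_del (co (x h) j l) D +
    (\<Sum>g\<in>G. if ex g h \<le> D then co (x g) j (vx g) (D - ex g h) * coe g h else 0) else 0)"
proof -
  let ?t = "\<lambda>g. if l = vx h \<and> ex g h \<le> D \<and> D < cutoff u j l then co (x g) j (vx g) (D - ex g h) * coe g h else 0"
  let ?s = "\<lambda>g. if ex g h \<le> D then co (x g) j (vx g) (D - ex g h) * coe g h else 0"
  have t: "co (x g \<otimes>\<^bsub>A\<^esub> dg g h) j l D = ?t g" if g: "g \<in> G" for g
    by (rule co_mult_monomial[OF X_in[OF x] dg_in co_dg[OF g h]])
  have fs: "co (finsum A (\<lambda>g. x g \<otimes>\<^bsub>A\<^esub> dg g h) G) j l D = (\<Sum>g\<in>G. ?t g)"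
    unfolding co_finsum[OF X_term_in[OF x]] by (rule sum.cong[OF refl t])
  have base: "co (del Xs x h) j l D = (if D < cutoff u j l then shift_del (co (x h) j l) D else 0) + (\<Sum>g\<in>G. ?t g)"
    unfolding X_simps(5) co_add[OF A_del_in[OF X_in[OF x]] X_sum_in[OF x]] co_del[OF X_in[OF x]] fs by (rule refl)
  show ?thesis
  proof (cases "l = vx h \<and> D < cutoff u j l")
    case True
    then have lD: "l = vx h" "D < cutoff u j l" by blast+
    have "?t g = ?s g" for g by (cases "ex g h \<le> D") (simp_all only: lD(2) lD(1)[symmetric] simp_thms if_True if_False)
    then have "(\<Sum>g\<in>G. ?t g) = (\<Sum>g\<in>G. ?s g)" by (intro sum.cong[OF refl])
    then show ?thesis unfolding base if_P[OF lD(2)] if_P[OF True] by (simp only:)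
  next
    case False
    have "?t g = 0" for g by (rule if_not_P) (use False in blast)
    then have "(\<Sum>g\<in>G. ?t g) = 0" by (rule sum.neutral[OF ballI])
    moreover have "(if D < cutoff u j l then shift_del (co (x h) j l) D else 0) = 0"
    proof (cases "D < cutoff u j l")
      case True
      with False have "l \<noteq> vx h" by blast
      then have "co (x h) j l (D - 1) = 0" using x unfolding X_carrier by blast
      then show ?thesis by (simp only: shift_del_def mult_zero_right if_cancel)
    qed (rule if_not_P)
    ultimately show ?thesis unfolding base if_not_P[OF False] by (simp only: add_0)
  qed
qed

lemma X_del_off: "x \<in> carrier Xs \<Longrightarrow> h \<notin> G \<Longrightarrow> del Xs x h = \<zero>\<^bsub>A\<^esub>"
proof -
  assume x: "x \<in> carrier Xs" and h: "h \<notin> G"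
  have xh: "x h = \<zero>\<^bsub>A\<^esub>" using x h by (simp add: X_carrier)
  have "finsum A (\<lambda>g. x g \<otimes>\<^bsub>A\<^esub> dg g h) G = finsum A (\<lambda>g. \<zero>\<^bsub>A\<^esub>) G"
    by (rule A.finsum_cong') (use X_in[OF x] h in \<open>auto simp: dg_off\<close>)
  moreover have "del A \<zero>\<^bsub>A\<^esub> = \<zero>\<^bsub>A\<^esub>" by (rule AB.graded_linear_zero[OF A_del_graded])
  ultimately show ?thesis by (simp add: X_simps xh)
qed

lemma X_del_in: "x \<in> carrier Xs \<Longrightarrow> del Xs x \<in> carrier Xs"
proof -
  assume x: "x \<in> carrier Xs"
  have "del Xs x g \<in> carrier A" for g
    unfolding X_simps by (intro AB.add_in A_del_in X_in[OF x] X_sum_in[OF x])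
  moreover have "co (del Xs x g) h l D = 0" if "l \<noteq> vx g" for g h l D
    using co_X_del[OF x, of g h l D] X_del_off[OF x, of g] that by (cases "g \<in> G") (simp_all add: co_zero)
  ultimately show ?thesis unfolding X_carrier using X_del_off[OF x] by blast
qed

lemma coord_X_del:
  assumes x: "x \<in> carrier Xs" and h: "h \<in> G"
  shows "cell_coord (del Xs x) (h, j, D) = (if D < cutoff u j (vx h) then shift_del (\<lambda>D. cell_coord x (h, j, D)) D +
    (\<Sum>g\<in>G. if ex g h \<le> D then cell_coord x (g, j, D - ex g h) * coe g h else 0) else 0)"
  unfolding cell_coord_def prod.case using co_X_del[OF assms, of j "vx h" D] by simp

lemma X_del_graded: "graded_linear 2 Xs Xs (del Xs)"
  unfolding graded_linear_def
proof (intro conjI ballI allI)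
  show "del Xs \<in> carrier Xs \<rightarrow> carrier Xs" by (rule funcsetI) (rule X_del_in)
next
  fix x y assume x: "x \<in> carrier Xs" and y: "y \<in> carrier Xs"
  note xy = X.add_in[OF x y] and dx = X_del_in[OF x] and dy = X_del_in[OF y]
  show "del Xs (x \<oplus>\<^bsub>Xs\<^esub> y) = del Xs x \<oplus>\<^bsub>Xs\<^esub> del Xs y"
  proof (rule X.coord_inj[OF X_del_in[OF xy] X.add_in[OF dx dy]])
    fix b assume "b \<in> cell_basis"
    then obtain h j D where b: "b = (h, j, D)" "h \<in> G" by (auto simp: cell_basis_def)
    have "(\<Sum>g\<in>G. if ex g h \<le> D then (cell_coord x (g, j, D - ex g h) + cell_coord y (g, j, D - ex g h)) * coe g h else 0) =
        (\<Sum>g\<in>G. if ex g h \<le> D then cell_coord x (g, j, D - ex g h) * coe g h else 0) +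
        (\<Sum>g\<in>G. if ex g h \<le> D then cell_coord y (g, j, D - ex g h) * coe g h else 0)"
      unfolding sum.distrib[symmetric] by (rule sum.cong) (simp_all add: distrib_right)
    then show "cell_coord (del Xs (x \<oplus>\<^bsub>Xs\<^esub> y)) b = cell_coord (del Xs x \<oplus>\<^bsub>Xs\<^esub> del Xs y) b"
      unfolding X.coord_add[OF dx dy] b(1) coord_X_del[OF x b(2)] coord_X_del[OF y b(2)] coord_X_del[OF xy b(2)]
        X.coord_add[OF x y] shift_del_add
      by simp
  qed
next
  fix c x assume x: "x \<in> carrier Xs"
  note cx = X.smult_in[OF x, of c] and dx = X_del_in[OF x]
  show "del Xs (c \<odot>\<^bsub>Xs\<^esub> x) = c \<odot>\<^bsub>Xs\<^esub> del Xs x"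
  proof (rule X.coord_inj[OF X_del_in[OF cx] X.smult_in[OF dx]])
    fix b assume "b \<in> cell_basis"
    then obtain h j D where b: "b = (h, j, D)" "h \<in> G" by (auto simp: cell_basis_def)
    have "(\<Sum>g\<in>G. if ex g h \<le> D then c * cell_coord x (g, j, D - ex g h) * coe g h else 0) =
        c * (\<Sum>g\<in>G. if ex g h \<le> D then cell_coord x (g, j, D - ex g h) * coe g h else 0)"
      by (simp add: sum_distrib_left if_distrib mult.assoc cong: if_cong)
    then show "cell_coord (del Xs (c \<odot>\<^bsub>Xs\<^esub> x)) b = cell_coord (c \<odot>\<^bsub>Xs\<^esub> del Xs x) b"
      unfolding X.coord_smult[OF dx] b(1) coord_X_del[OF x b(2)] coord_X_del[OF cx b(2)]
        X.coord_smult[OF x] shift_del_scale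
      by (simp add: distrib_left)
  qed
next
  fix e x assume "x \<in> grade Xs e"
  then have x: "x \<in> carrier Xs" and xe: "\<And>b. cell_coord x b \<noteq> 0 \<Longrightarrow> cell_degree b = e" by (auto simp: X_grade_coord)
  have "cell_degree b = e + 2" if nz: "cell_coord (del Xs x) b \<noteq> 0" for b
  proof -
    have "b \<in> cell_basis" using nz X.coord_off[OF X_del_in[OF x]] by blast
    then obtain h j D where b: "b = (h, j, D)" "h \<in> G" by (auto simp: cell_basis_def)
    have "shift_del (\<lambda>D. cell_coord x (h, j, D)) D \<noteq> 0 \<or>
      (\<exists>g\<in>G. ex g h \<le> D \<and> cell_coord x (g, j, D - ex g h) * coe g h \<noteq> 0)"
    proof (rule ccontr)
      assume neg: "\<not> ?thesis"
      then have "(\<Sum>g\<in>G. if ex g h \<le> D then cell_coord x (g, j, D - ex g h) * coe g h else 0) = 0"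
        by (intro sum.neutral) auto
      moreover have "shift_del (\<lambda>D. cell_coord x (h, j, D)) D = 0" using neg by blast
      ultimately have "cell_coord (del Xs x) b = 0"
        unfolding b(1) coord_X_del[OF x b(2)] by (simp only: add_0 if_cancel)
      with nz show False by contradiction
    qed
    then consider (1) "shift_del (\<lambda>D. cell_coord x (h, j, D)) D \<noteq> 0"
      | (2) g where "g \<in> G" "ex g h \<le> D" "cell_coord x (g, j, D - ex g h) * coe g h \<noteq> 0" by blast
    then show ?thesis
    proof cases
      case 1
      then have "0 < D" "cell_coord x (h, j, D - 1) \<noteq> 0" by (auto simp: shift_del_def split: if_splits)
      then show ?thesis using xe[of "(h, j, D - 1)"] by (simp add: b cell_degree_def cdeg_def of_nat_diff)
    next
      case (2 g)
      have "cell_degree (g, j, D - ex g h) = e" using xe[of "(g, j, D - ex g h)"] 2(3) by fastforce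
      moreover have "cdeg u (vx g) (vx h) (ex g h) + wt h = wt g + 2" using coe_degree[OF 2(1) b(2)] 2(3) by fastforce
      ultimately show ?thesis using 2(2) by (simp add: b cell_degree_def cdeg_def of_nat_diff split: if_splits)
    qed
  qed
  then show "del Xs x \<in> grade Xs (e + 2)" using X_del_in[OF x] by (simp add: X_grade_coord)
qed

lemma X_act_in: "a \<in> carrier A \<Longrightarrow> x \<in> carrier Xs \<Longrightarrow> act Xs a x \<in> carrier Xs"
proof -
  assume a: "a \<in> carrier A" and x: "x \<in> carrier Xs"
  have "a \<otimes>\<^bsub>A\<^esub> x g \<in> carrier (left_projective A (ee (vx g)))" for g
  proof -
    have "x g \<in> carrier (left_projective A (ee (vx g)))" using x by (simp add: P_carrier X_carrier)
    then obtain b where b: "b \<in> carrier A" "x g = b \<otimes>\<^bsub>A\<^esub> ee (vx g)" by (auto simp: left_projective_def)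
    have "a \<otimes>\<^bsub>A\<^esub> x g = (a \<otimes>\<^bsub>A\<^esub> b) \<otimes>\<^bsub>A\<^esub> ee (vx g)" using a b ee_in by (simp add: A.m_assoc)
    then show ?thesis using a b by (auto simp: left_projective_def)
  qed
  then show ?thesis using a x by (simp add: X_carrier X_simps P_carrier)
qed

lemma X_act_del:
  assumes a: "a \<in> carrier A" and x: "x \<in> carrier Xs"
  shows "del Xs (act Xs a x) = act Xs (del A a) x \<oplus>\<^bsub>Xs\<^esub> act Xs a (del Xs x)"
proof
  fix h
  have fs: "finsum A (\<lambda>g. (a \<otimes>\<^bsub>A\<^esub> x g) \<otimes>\<^bsub>A\<^esub> dg g h) G = a \<otimes>\<^bsub>A\<^esub> finsum A (\<lambda>g. x g \<otimes>\<^bsub>A\<^esub> dg g h) G"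
    using A.finsum_rdistr[OF G_finite a, of "\<lambda>g. x g \<otimes>\<^bsub>A\<^esub> dg g h"] X_term_in[OF x]
    by (simp add: Pi_iff A.m_assoc[OF a X_in[OF x] dg_in])
  show "del Xs (act Xs a x) h = (act Xs (del A a) x \<oplus>\<^bsub>Xs\<^esub> act Xs a (del Xs x)) h"
    unfolding X_simps fs A_leibniz[OF a X_in[OF x]]
    using A.m_closed[OF A_del_in[OF a] X_in[OF x, of h]] A.m_closed[OF a A_del_in[OF X_in[OF x, of h]]] 
      A.m_closed[OF a X_sum_in[OF x, of h]] A_del_in[OF X_in[OF x, of h]] X_sum_in[OF x, of h] a
    by (simp add: A.r_distr A.a_assoc)
qed

lemma X_module:
  assumes nil: "\<And>x. x \<in> carrier Xs \<Longrightarrow> (del Xs ^^ p) x = \<zero>\<^bsub>Xs\<^esub>"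
  shows "left_pdg_module p A Xs"
  unfolding left_pdg_module_def pdg_action_def
proof (intro conjI allI ballI funcsetI)
  show "pdg_algebra p A" by (rule A_pdg)
  show "is_pcomplex p Xs" by (rule X.is_pcomplexI[OF X_del_graded nil])
next
  fix d e a x assume a: "a \<in> grade A d" and x: "x \<in> grade Xs e"
  then have in': "a \<in> carrier A" "x \<in> carrier Xs" by (simp_all add: A_grade_iff X_grade)
  have "a \<otimes>\<^bsub>A\<^esub> x g \<in> grade A (d + e - wt g)" if "g \<in> G" for g
    using A_grade[OF a, of "x g" "e - wt g"] x that by (simp add: X_grade add_diff_eq)
  then show "act Xs a x \<in> grade Xs (d + e)" using X_act_in[OF in'] by (simp add: X_grade X_simps(4))
next
  fix a x assume "a \<in> carrier A" "x \<in> carrier Xs"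
  then show "act Xs a x \<in> carrier Xs" "del Xs (act Xs a x) = act Xs (del A a) x \<oplus>\<^bsub>Xs\<^esub> act Xs a (del Xs x)"
    by (rule X_act_in, rule X_act_del)
qed (simp_all add: X_simps(1-4) X_in A.l_distr A.r_distr A.m_assoc A_scalar X_del_in)

text \<open>
  Numbers the generators consecutively in the order given by \<open>\<omega>\<close>, as the
  steps of the filtration must not be trivial.
\<close>

lemma strict_rank:
  fixes \<omega> :: "'g \<Rightarrow> nat"
  assumes "finite V" "inj_on \<omega> V"
  shows "\<exists>rk. bij_betw rk V {..<card V} \<and> (\<forall>g\<in>V. \<forall>h\<in>V. \<omega> g < \<omega> h \<longrightarrow> rk g < (rk h :: nat))"
proof -
  obtain f where f: "bij_betw f {..<card (\<omega> ` V)} (\<omega> ` V)" "strict_mono_on {..<card (\<omega> ` V)} f"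
    using ex_bij_betw_strict_mono_card[of "\<omega> ` V"] assms(1) by blast
  let ?N = "{..<card (\<omega> ` V)}"
  let ?rk = "inv_into ?N f \<circ> \<omega>"
  have "bij_betw ?rk V ?N"
    by (rule bij_betw_trans[of _ _ "\<omega> ` V"]) (use assms(2) bij_betw_inv_into[OF f(1)] in \<open>auto simp: bij_betw_def\<close>)
  moreover have "?rk g < ?rk h" if "g \<in> V" "h \<in> V" "\<omega> g < \<omega> h" for g h
  proof -
    have im: "f ` ?N = \<omega> ` V" using f(1) by (simp add: bij_betw_def)
    then have "f (?rk g) = \<omega> g" "f (?rk h) = \<omega> h" "?rk g \<in> ?N" "?rk h \<in> ?N"
      using that by (simp_all add: f_inv_into_f inv_into_into del: lessThan_iff)
    with that strict_mono_on_less[OF f(2), of "?rk g" "?rk h"] show ?thesis by simp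
  qed
  moreover have "card (\<omega> ` V) = card V" by (rule card_image[OF assms(2)])
  ultimately show ?thesis by auto
qed

text \<open>
  Generators whose vertex is not in the quiver contribute zero and are skipped. The
  remaining ones are added in increasing order of \<open>\<omega>\<close>; the subquotient
  at \<open>g\<close> is the slot of \<open>g\<close>, because no generator added up to then
  has \<open>g\<close> in its differential.
\<close>

lemma X_finite_cell:
  fixes \<omega> :: "'g \<Rightarrow> nat"
  assumes module: "left_pdg_module p A Xs" and inj: "inj_on \<omega> G"
    and dec: "\<And>g h. \<lbrakk>g \<in> G; h \<in> G; coe g h \<noteq> 0\<rbrakk> \<Longrightarrow> \<omega> h < \<omega> g"
  shows "finite_cell_module (left_pdg_module p A) A (\<lambda>j. left_projective A (ee j)) {1..n} Xs"
proof -
  define V where "V = {g \<in> G. vx g \<in> {1..n}}"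
  have V: "finite V" "inj_on \<omega> V" using G_finite inj by (auto simp: V_def inj_on_def)
  obtain rk where rk: "bij_betw rk V {..<card V}" "\<And>g h. \<lbrakk>g \<in> V; h \<in> V; \<omega> g < \<omega> h\<rbrakk> \<Longrightarrow> rk g < rk h"
    using strict_rank[OF V] by blast
  define F where "F t = {x \<in> carrier Xs. \<forall>b. b \<notin> {(g, j, D). g \<in> V \<and> rk g < t} \<longrightarrow> cell_coord x b = 0}" for t
  have F_iff: "x \<in> F t \<longleftrightarrow> x \<in> carrier Xs \<and> (\<forall>g j D. cell_coord x (g, j, D) \<noteq> 0 \<longrightarrow> g \<in> V \<and> rk g < t)" for x t
    by (auto simp: F_def)
  have visible: "h \<in> V" if "x \<in> carrier Xs" "cell_coord x (h, j, D) \<noteq> 0" for x h j D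
    using X.coord_off[OF that(1), of "(h, j, D)"] that(2) by (auto simp: V_def cell_basis_def coords_def)
  have term0: "cell_coord x (g, j, E) * coe g h = 0"
    if x: "x \<in> F t" and gh: "g \<in> G" "h \<in> V" "\<not> Suc (rk h) < t" for x t g h j E
  proof (rule ccontr)
    assume "\<not> ?thesis"
    then have nz: "cell_coord x (g, j, E) \<noteq> 0" "coe g h \<noteq> 0" by auto
    then have g: "g \<in> V" "rk g < t" using x by (auto simp: F_iff)
    have "\<omega> h < \<omega> g" using gh nz by (intro dec) (auto simp: V_def)
    then have "rk h < rk g" by (rule rk(2)[OF gh(2) g(1)])
    with g gh show False by simp
  qed
  have F_mono: "F t \<subseteq> F (Suc t)" for t
  proof
    fix x assume "x \<in> F t"
    then show "x \<in> F (Suc t)" unfolding F_iff by (meson less_SucI)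
  qed
  have F_del: "del Xs x \<in> F t" if x: "x \<in> F t" for x t
  proof -
    have xX: "x \<in> carrier Xs" using x by (simp add: F_iff)
    have "h \<in> V \<and> rk h < t" if nz: "cell_coord (del Xs x) (h, j, D) \<noteq> 0" for h j D
    proof -
      have h: "h \<in> V" by (rule visible[OF X_del_in[OF xX] nz])
      have "rk h < t"
      proof (rule ccontr)
        assume t: "\<not> rk h < t"
        then have "shift_del (\<lambda>D. cell_coord x (h, j, D)) D = 0" using x by (auto simp: F_iff shift_del_def)
        moreover have "(\<Sum>g\<in>G. if ex g h \<le> D then cell_coord x (g, j, D - ex g h) * coe g h else 0) = 0"
          by (rule sum.neutral) (use term0[OF x _ h] t in simp)
        moreover have "h \<in> G" using h by (simp add: V_def)
        ultimately show False using nz unfolding coord_X_del[OF xX \<open>h \<in> G\<close>] by (auto split: if_splits)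
      qed
      with h show ?thesis by simp
    qed
    then show ?thesis using X_del_in[OF xX] by (simp add: F_iff)
  qed
  have coord_zero: "cell_coord x (g, j, D) = 0" if "x g = \<zero>\<^bsub>A\<^esub>" for x g j D
    using that by (simp add: cell_coord_def co_zero)
  have slot_zero: "x g = \<zero>\<^bsub>A\<^esub>" if x: "x \<in> carrier Xs" and z: "\<And>j D. cell_coord x (g, j, D) = 0" for x g
  proof (rule co_eqI[OF X_in[OF x] AB.zero_in])
    fix h l D
    show "co (x g) h l D = co \<zero>\<^bsub>A\<^esub> h l D"
      using x z[of h D] by (cases "l = vx g") (auto simp: X_carrier cell_coord_def co_zero)
  qed
  have F_act: "act Xs a x \<in> F t" if a: "a \<in> carrier A" and x: "x \<in> F t" for a x t
  proof -
    have xX: "x \<in> carrier Xs" using x by (simp add: F_iff)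
    have "g \<in> V \<and> rk g < t" if nz: "cell_coord (act Xs a x) (g, j, D) \<noteq> 0" for g j D
    proof (rule ccontr)
      assume "\<not> (g \<in> V \<and> rk g < t)"
      then have "x g = \<zero>\<^bsub>A\<^esub>" using x by (intro slot_zero[OF xX]) (auto simp: F_iff)
      then have "act Xs a x g = \<zero>\<^bsub>A\<^esub>" using a by (simp add: X_simps)
      with nz show False by (simp add: coord_zero)
    qed
    then show ?thesis using X_act_in[OF a xX] by (simp add: F_iff)
  qed
  have restr: "left_pdg_module p A (restrict_module Xs (F t))" for t
    by (rule left_pdg_restrict[OF module X_based F_def]) (use F_del F_act in auto)
  have F0: "F 0 = {\<zero>\<^bsub>Xs\<^esub>}"
  proof (intro equalityI subsetI)
    fix x assume "x \<in> F 0"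
    then have "x = \<zero>\<^bsub>Xs\<^esub>" using X.zero_in by (intro X.coord_inj) (auto simp: F_iff X.coord_zero)
    then show "x \<in> {\<zero>\<^bsub>Xs\<^esub>}" by simp
  qed (auto simp: F_iff X.zero_in X.coord_zero)
  have FN: "F (card V) = carrier Xs"
  proof -
    have "rk g < card V" if "g \<in> V" for g using rk(1) that by (auto simp: bij_betw_def)
    then show ?thesis using visible by (auto simp: F_iff)
  qed
  have quot: "\<exists>j\<in>{1..n}. \<exists>l. pdg_isomorphic A (quotient_module (restrict_module Xs (F (Suc t))) (F t))
      (shift l (left_projective A (ee j)))" if t: "t < card V" for t
  proof -
    obtain g0 where g0: "g0 \<in> V" "rk g0 = t" using rk(1) t by (metis bij_betw_def imageE lessThan_iff)
    have g0G: "g0 \<in> G" "vx g0 \<in> {1..n}" using g0 by (auto simp: V_def)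
    have only: "g = g0" if "g \<in> V" "rk g = t" for g
      using that g0 rk(1) by (auto simp: bij_betw_def inj_on_def)
    let ?M = "restrict_module Xs (F (Suc t))"
    let ?P = "left_projective A (ee (vx g0))"
    define \<psi> where "\<psi> a = (\<lambda>g. if g = g0 then a else \<zero>\<^bsub>A\<^esub>)" for a
    have FX: "x \<in> carrier Xs" if "x \<in> F s" for x s using that by (simp add: F_iff)
    have M_simps: "carrier ?M = F (Suc t)" "zero ?M = zero Xs" "add ?M = add Xs" "module.smult ?M = module.smult Xs"
      "grade ?M d = grade Xs d \<inter> F (Suc t)" "del ?M = del Xs" "act ?M = act Xs" for d
      by (simp_all add: restrict_module_def)
    have inP: "x g0 \<in> carrier ?P" if "x \<in> carrier Xs" for x using that by (simp add: X_carrier P_carrier)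
    have del0: "del Xs x g0 = del A (x g0)" if x: "x \<in> F (Suc t)" for x
    proof (rule co_eqI)
      note xX = FX[OF x]
      show "del Xs x g0 \<in> carrier A" "del A (x g0) \<in> carrier A" using X_in[OF X_del_in[OF xX]] A_del_in[OF X_in[OF xX]] by auto
      fix h l D
      have "(\<Sum>g\<in>G. if ex g g0 \<le> D then co (x g) h (vx g) (D - ex g g0) * coe g g0 else 0) = 0"
        by (rule sum.neutral) (use term0[OF x _ g0(1)] g0(2) in \<open>simp add: cell_coord_def\<close>)
      moreover have "shift_del (co (x g0) h l) D = 0" if "l \<noteq> vx g0"
        using xX that by (simp add: X_carrier shift_del_def)
      ultimately show "co (del Xs x g0) h l D = co (del A (x g0)) h l D"
        using co_X_del[OF xX g0G(1), of h l D] co_del[OF X_in[OF xX], of g0 h l D] by auto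
    qed
    have \<psi>_in: "\<psi> a \<in> F (Suc t)" if "a \<in> carrier ?P" for a
    proof -
      have "\<psi> a \<in> carrier Xs" using that g0G by (auto simp: X_carrier P_carrier \<psi>_def AB.zero_in co_zero)
      then show ?thesis using g0 by (auto simp: F_iff \<psi>_def cell_coord_def co_zero)
    qed
    have "pdg_isomorphic A (quotient_module ?M (F t)) (shift (wt g0) ?P)"
    proof (rule quotient_isomorphicI[where \<phi> = "\<lambda>x. x g0" and \<psi> = \<psi>])
      have "is_pcomplex p ?M" using restr by (simp add: left_pdg_module_def pdg_action_def)
      then have "module scalars ?M" by (simp add: is_pcomplex_def)
      then show ag: "abelian_group ?M" by (rule module.axioms)
      show "F t \<subseteq> carrier ?M" unfolding M_simps using F_mono .
      show "pdg_hom A ?M (shift (wt g0) ?P) (\<lambda>x. x g0)"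
        unfolding pdg_hom_def pcomplex_hom_def graded_linear_def M_simps shift_def
        using inP FX del0 g0G(1) by (auto simp: P_simps X_simps(1-4) X_grade)
      show "\<zero>\<^bsub>?M\<^esub> g0 = \<zero>\<^bsub>shift (wt g0) ?P\<^esub>" by (simp add: M_simps X_simps shift_def P_simps)
      show "grade ?M d \<subseteq> carrier ?M" "grade (shift (wt g0) ?P) d \<subseteq> carrier (shift (wt g0) ?P)" for d
        by (auto simp: M_simps shift_def P_simps)
      show "del ?M x \<in> carrier ?M" if "x \<in> carrier ?M" for x using that F_del by (simp add: M_simps)
      show "act ?M a x \<in> carrier ?M" if "a \<in> carrier A" "x \<in> carrier ?M" for a x using that F_act by (simp add: M_simps)
      show "c \<odot>\<^bsub>?M\<^esub> x \<in> carrier ?M" if "x \<in> carrier ?M" for c x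
        using that by (auto simp: M_simps F_iff X.smult_in X.coord_smult)
      fix v d
      show "\<psi> v \<in> grade ?M d" if "v \<in> grade (shift (wt g0) ?P) d"
      proof -
        have v: "v \<in> grade A (d - wt g0)" "v \<in> carrier ?P" using that by (auto simp: shift_def P_simps)
        have "\<psi> v \<in> grade Xs d" using \<psi>_in[OF v(2)] v(1) P_zero_in by (auto simp: X_grade \<psi>_def F_iff)
        then show ?thesis using \<psi>_in[OF v(2)] by (simp add: M_simps)
      qed
      assume "v \<in> carrier (shift (wt g0) ?P)"
      then have v: "v \<in> carrier ?P" by (simp add: shift_def)
      show "\<psi> v \<in> carrier ?M" using \<psi>_in[OF v] by (simp add: M_simps)
      show "\<psi> v g0 = v" by (simp add: \<psi>_def)
    next
      fix x y assume "x \<in> carrier ?M" "y \<in> carrier ?M"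
      then have x: "x \<in> F (Suc t)" and y: "y \<in> F (Suc t)" by (simp_all add: M_simps)
      note xX = FX[OF x] and yX = FX[OF y]
      interpret XG: abelian_group Xs using X.is_module by (rule module.axioms)
      show "x g0 = y g0 \<longleftrightarrow> (\<exists>s\<in>F t. x = s \<oplus>\<^bsub>?M\<^esub> y)"
      proof
        assume eq: "x g0 = y g0"
        have s: "x \<ominus>\<^bsub>Xs\<^esub> y \<in> carrier Xs" using xX yX by (rule XG.minus_closed)
        have "g \<in> V \<and> rk g < t" if nz: "cell_coord (x \<ominus>\<^bsub>Xs\<^esub> y) (g, j, D) \<noteq> 0" for g j D
        proof -
          have "g \<noteq> g0" using nz eq unfolding X.coord_minus[OF xX yX] by (auto simp: cell_coord_def)
          moreover have "g \<in> V \<and> rk g < Suc t"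
          proof (rule ccontr)
            assume "\<not> ?thesis"
            then have "cell_coord x (g, j, D) = 0" "cell_coord y (g, j, D) = 0" using x y by (auto simp: F_iff)
            then show False using nz unfolding X.coord_minus[OF xX yX] by simp
          qed
          ultimately show ?thesis using only[of g] by (auto simp: less_Suc_eq)
        qed
        then have "x \<ominus>\<^bsub>Xs\<^esub> y \<in> F t" using s by (simp add: F_iff)
        moreover have "x = (x \<ominus>\<^bsub>Xs\<^esub> y) \<oplus>\<^bsub>Xs\<^esub> y"
          by (rule X.coord_eqI[OF xX X.add_in[OF s yX]]) (simp add: X.coord_add[OF s yX] X.coord_minus[OF xX yX])
        ultimately show "\<exists>s\<in>F t. x = s \<oplus>\<^bsub>?M\<^esub> y" unfolding M_simps by blast
      next
        assume "\<exists>s\<in>F t. x = s \<oplus>\<^bsub>?M\<^esub> y"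
        then obtain s where s: "s \<in> F t" "x = s \<oplus>\<^bsub>Xs\<^esub> y" unfolding M_simps by blast
        have "s g0 = \<zero>\<^bsub>A\<^esub>" using s(1) g0 by (intro slot_zero[OF FX[OF s(1)]]) (auto simp: F_iff)
        then show "x g0 = y g0" using s(2) X_in[OF yX] by (simp add: X_simps)
      qed
    qed
    then show ?thesis using g0G(2) by blast
  qed
  have "F t \<subseteq> carrier Xs" for t by (auto simp: F_def)
  with F_mono module F0 FN restr quot show ?thesis unfolding finite_cell_module_def
    by (intro conjI exI[of _ "card V"] exI[of _ F]) auto
qed

end

section \<open>The two-strand cell module\<close>

text \<open>
  The lower bounds on \<open>D\<close> are preserved by the differential, so truncation
  above already removes everything that is not a basis vector.
\<close>

lemma strand_map_trunc:
  fixes f :: "'k::field strands"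
  assumes p: "2 \<le> p" and i: "1 \<le> i" "i < n" and f: "\<And>b. \<not> strand_basis u i p n b \<Longrightarrow> f b = 0"
  shows "strand_map u i p n f = strand_trunc u i p (strand_del p f)"
proof
  fix b :: "bool \<times> nat \<times> nat \<times> nat"
  obtain s k j D where b: "b = (s, k, j, D)" by (cases b)
  note defs = strand_basis.simps on_strand_def coords_def strand_vertex_def low_def cutoff_def
  show "strand_map u i p n f b = strand_trunc u i p (strand_del p f) b"
  proof (cases "strand_basis u i p n b")
    case True
    then have "D < cutoff u j (strand_vertex u i p s k)" by (simp add: b strand_basis.simps coords_def)
    then show ?thesis using True by (simp add: strand_map_def[OF p i] b)
  next
    case False
    have "strand_del p f (s, k, j, D) = 0" if on: "on_strand p s k" and D: "D < cutoff u j (strand_vertex u i p s k)"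
    proof -
      note nb = False[unfolded b]
      have 1: "f (s, k, j, D - 1) = 0"
        by (rule f, rule notI, rule notE[OF nb]) (use on D in \<open>auto simp: strand_basis.simps coords_def\<close>)
      have 2: "f (True, Suc k, j, D) = 0" if "s" "k < p"
        by (rule f, rule notI, rule notE[OF nb]) (use on D p i that in \<open>auto simp: defs split: if_splits\<close>)
      have 3: "f (False, Suc k, j, D) = 0" if "\<not> s" "Suc k < p"
        by (rule f, rule notI, rule notE[OF nb]) (use on D p i that in \<open>auto simp: defs split: if_splits\<close>)
      have 4: "f (True, 1, j, D - 1) = 0" if "\<not> s" "k = 0" "1 \<le> D"
        by (rule f, rule notI, rule notE[OF nb]) (use on D p i that in \<open>auto simp: defs split: if_splits\<close>)
      have 5: "f (True, k, j, D - 2) = 0" if "\<not> s" "k \<noteq> 0" "2 \<le> D"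
        by (rule f, rule notI, rule notE[OF nb]) (use on D p i that in \<open>auto simp: defs split: if_splits\<close>)
      have 6: "f (True, p, j, D - 1) = 0" if "\<not> s" "Suc k = p" "1 \<le> D"
        by (rule f, rule notI, rule notE[OF nb]) (use on D p i that in \<open>auto simp: defs split: if_splits\<close>)
      have sd: "shift_del (\<lambda>D. f (s, k, j, D)) D = 0" using 1 by (simp add: shift_del_def)
      show ?thesis unfolding strand_del.simps sd using 2 3 4 5 6 by (cases s) auto
    qed
    then have "strand_trunc u i p (strand_del p f) b = 0" unfolding b by (auto simp del: strand_del.simps simp: strand_del.simps[of p f s k j D] split: if_splits)
    then show ?thesis using False by (simp add: strand_map_def[OF p i])
  qed
qed

lemma strand_map_pow_zero:
  fixes f :: "'k::field strands"
  assumes prime: "prime p" and char: "CHAR('k) = p" and i: "1 \<le> i" "i < n"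
    and f: "\<And>b. \<not> strand_basis u i p n b \<Longrightarrow> f b = 0"
  shows "(strand_map u i p n ^^ p) f = (\<lambda>b. 0)"
proof -
  have p: "2 \<le> p" using prime by (rule prime_ge_2_nat)
  have off: "(strand_map u i p n ^^ r) f b = 0" if "\<not> strand_basis u i p n b" for r b
    using that f by (cases r) (simp_all add: strand_map_def[OF p i])
  have pow: "(strand_map u i p n ^^ r) f = strand_trunc u i p ((strand_del p ^^ r) f)" for r
  proof (induction r)
    case 0
    show ?case
    proof
      fix b :: "bool \<times> nat \<times> nat \<times> nat"
      obtain s k j D where b: "b = (s, k, j, D)" by (cases b)
      show "(strand_map u i p n ^^ 0) f b = strand_trunc u i p ((strand_del p ^^ 0) f) b"
        using f[of b] unfolding b by (cases "D < cutoff u j (strand_vertex u i p s k)") (simp_all add: strand_basis.simps coords_def)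
    qed
  next
    case (Suc r)
    have "(strand_map u i p n ^^ Suc r) f = strand_trunc u i p (strand_del p ((strand_map u i p n ^^ r) f))"
      using strand_map_trunc[where u = u and f = "(strand_map u i p n ^^ r) f", OF p i off] by simp
    then show ?case unfolding Suc.IH strand_trunc_del[OF p i(1)] by simp
  qed
  have "strand_supported p f"
    unfolding strand_supported_def using f by (auto simp: strand_basis.simps)
  from strand_del_pow_zero[OF prime char this] show ?thesis
    unfolding pow by (intro ext) (metis strand_trunc.simps prod_cases4)
qed

text \<open>
  The main strand consists of the generators \<open>b\<^sub>k\<close> for the direction up
  and of the \<open>a\<^sub>k\<close> for the direction down.
\<close>

definition strand_gen :: "bool \<Rightarrow> nat \<Rightarrow> bool \<Rightarrow> nat \<Rightarrow> gen" where
  "strand_gen u p s k = (if \<not> s \<and> k = 0 then GenW else if s \<and> k = p then GenV else if s = u then GenA k else GenB k)"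

fun strand_index :: "bool \<Rightarrow> nat \<Rightarrow> gen \<Rightarrow> bool \<times> nat" where
  "strand_index u p GenV = (True, p)"
| "strand_index u p GenW = (False, 0)"
| "strand_index u p (GenA k) = (u, k)"
| "strand_index u p (GenB k) = (\<not> u, k)"

text \<open>
  The coefficients of the differentials of the generators. The parameter \<open>e\<close> is
  the sign with which \<open>v\<close> maps to the other strand; it maps to the main strand
  with the opposite sign.
\<close>

fun strand_coeff :: "'k::field \<Rightarrow> nat \<Rightarrow> bool \<times> nat \<Rightarrow> bool \<times> nat \<Rightarrow> 'k" where
  "strand_coeff e p (s, k) (s', k') =
     (if \<not> s then of_bool (\<not> s' \<and> k = Suc k')
      else if k = p then (if Suc k' = p then (if s' then e else - e) else 0)
      else of_bool (if s' then k = Suc k' else k = max 1 k'))"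

fun strand_exp :: "nat \<Rightarrow> bool \<times> nat \<Rightarrow> bool \<times> nat \<Rightarrow> nat" where
  "strand_exp p (s, k) (s', k') = (if s \<and> \<not> s' then (if k' = 0 \<or> k = p then 1 else 2) else 0)"

lemma strand_index_gen: "strand_index u p (strand_gen u p s k) = (s, k)"
  by (auto simp: strand_gen_def)

lemma gen_vertex_strand: "gen_vertex i (strand_gen u p s k) = strand_vertex u i p s k"
  by (auto simp: strand_gen_def strand_vertex_def)

lemma gen_degree_strand: "gen_degree p (strand_gen u p s k) =
    (if \<not> s \<and> k = 0 then 0 else if s \<and> k = p then 2 - 2 * int p else 1 - 2 * int k)"
  by (auto simp: strand_gen_def)

lemma strand_gen_in: "2 \<le> p \<Longrightarrow> on_strand p s k \<Longrightarrow> strand_gen u p s k \<in> gens p"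
  by (auto simp: strand_gen_def gens_def on_strand_def split: if_splits)

lemma gens_strand:
  assumes p: "2 \<le> p" and g: "g \<in> gens p"
  obtains s k where "on_strand p s k" "g = strand_gen u p s k"
proof -
  obtain s k where sk: "strand_index u p g = (s, k)" by (cases "strand_index u p g")
  have "on_strand p s k \<and> g = strand_gen u p s k"
    using p g sk by (auto simp: gens_def on_strand_def strand_gen_def)
  with that show thesis by blast
qed

lemma sum_gens:
  assumes p: "2 \<le> p"
  shows "(\<Sum>g\<in>gens p. F g) = (\<Sum>k<p. F (strand_gen u p False k)) + (\<Sum>k\<in>{1..p}. F (strand_gen u p True k))"
proof -
  have inj: "inj_on (strand_gen u p s) J" for s J
    by (rule inj_onI) (metis strand_index_gen prod.inject)
  have "gens p = strand_gen u p False ` {..<p} \<union> strand_gen u p True ` {1..p}"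
  proof (intro equalityI subsetI)
    fix g assume "g \<in> gens p"
    from gens_strand[OF p this] obtain s k where "on_strand p s k" "g = strand_gen u p s k" .
    then show "g \<in> strand_gen u p False ` {..<p} \<union> strand_gen u p True ` {1..p}"
      by (cases s) (auto simp: on_strand_def)
  next
    fix g assume "g \<in> strand_gen u p False ` {..<p} \<union> strand_gen u p True ` {1..p}"
    then show "g \<in> gens p" using strand_gen_in[OF p] by (auto simp: on_strand_def)
  qed
  moreover have "strand_gen u p False ` {..<p} \<inter> strand_gen u p True ` {1..p} = {}"
  proof -
    have "strand_gen u p False k \<noteq> strand_gen u p True k'" for k k'
      by (metis strand_index_gen prod.inject)
    then show ?thesis by blast
  qed
  ultimately show ?thesis by (simp add: sum.union_disjoint sum.reindex[OF inj])
qed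

lemma strand_coeff_degree:
  fixes e :: "'k::field"
  assumes "2 \<le> p" "1 \<le> i" "on_strand p s k" "on_strand p s' k'"
    and "strand_coeff e p (s, k) (s', k') \<noteq> 0"
  shows "cdeg u (strand_vertex u i p s k) (strand_vertex u i p s' k') (strand_exp p (s, k) (s', k'))
    + gen_degree p (strand_gen u p s' k') = gen_degree p (strand_gen u p s k) + 2"
proof -
  have ii: "int (i - Suc 0) = int i - 1" using assms(2) by simp
  show ?thesis
    using assms unfolding gen_degree_strand
    by (cases u; cases s; cases s'; cases "k = p"; cases "k' = 0")
      (auto simp: cdeg_def strand_vertex_def on_strand_def ii max_def split: if_splits)
qed

text \<open>
  The simple module, with the scalar action given by an abstract functional
  \<open>idc\<close> so that the algebra and its opposite are treated alike.
\<close>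

definition line_module :: "('k::field, 'a) pcomplex \<Rightarrow> ('a \<Rightarrow> 'k) \<Rightarrow> ('g \<Rightarrow> 'a) \<Rightarrow> ('k, 'a, 'g \<Rightarrow> 'a) pdg_module" where
  "line_module A idc y = \<lparr>carrier = {\<lambda>g. c \<odot>\<^bsub>A\<^esub> y g | c. True}, monoid.mult = undefined, one = undefined,
     zero = (\<lambda>g. \<zero>\<^bsub>A\<^esub>), add = (\<lambda>x y g. x g \<oplus>\<^bsub>A\<^esub> y g), module.smult = (\<lambda>c x g. c \<odot>\<^bsub>A\<^esub> x g),
     grade = (\<lambda>d. if d = 0 then {\<lambda>g. c \<odot>\<^bsub>A\<^esub> y g | c. True} else {\<lambda>g. \<zero>\<^bsub>A\<^esub>}),
     del = (\<lambda>x g. \<zero>\<^bsub>A\<^esub>), act = (\<lambda>a x g. idc a \<odot>\<^bsub>A\<^esub> x g)\<rparr>"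

text \<open>
  The common form of the four cell modules. A vertex 0 occurs for \<open>i = 1\<close>; the
  paths through it are zero.
\<close>

locale strand_cell = coord_algebra A p n u co
  for A :: "('k::field, 'a) pcomplex" and p n :: nat and u :: bool and co :: "'a \<Rightarrow> nat \<Rightarrow> nat \<Rightarrow> nat \<Rightarrow> 'k" +
  fixes i :: nat and ee :: "nat \<Rightarrow> 'a" and dg :: "gen \<Rightarrow> gen \<Rightarrow> 'a" and idc :: "'a \<Rightarrow> 'k"
  assumes prime: "prime p" and i: "1 \<le> i" "i < n"
    and ee_in: "ee m \<in> carrier A"
    and co_ee: "co (ee m) j l D = (if (j, l, D) = (m, m, 0) then of_bool (m \<in> {1..n}) else 0)"
    and dg_in: "dg g h \<in> carrier A"
    and dg_off: "\<lbrakk>g \<in> gens p; h \<notin> gens p\<rbrakk> \<Longrightarrow> dg g h = \<zero>\<^bsub>A\<^esub>"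
    and co_dg: "\<lbrakk>on_strand p s k; on_strand p s' k'\<rbrakk> \<Longrightarrow>
      co (dg (strand_gen u p s k) (strand_gen u p s' k')) j l D =
        (if (j, l, D) = (strand_vertex u i p s k, strand_vertex u i p s' k', strand_exp p (s, k) (s', k')) \<and> j \<noteq> 0 \<and> l \<noteq> 0
         then strand_coeff (if u then 1 else - 1) p (s, k) (s', k') else 0)"
    and idc: "a \<in> carrier A \<Longrightarrow> idc a = co a i i 0"
begin

abbreviation eps :: 'k where "eps \<equiv> (if u then 1 else - 1)"

lemma p2: "2 \<le> p" using prime by (rule prime_ge_2_nat)

definition gexp :: "gen \<Rightarrow> gen \<Rightarrow> nat" where
  "gexp g h = strand_exp p (strand_index u p g) (strand_index u p h)"

definition gcoeff :: "gen \<Rightarrow> gen \<Rightarrow> 'k" where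
  "gcoeff g h = (if gen_vertex i g \<noteq> 0 \<and> gen_vertex i h \<noteq> 0
     then strand_coeff eps p (strand_index u p g) (strand_index u p h) else 0)"

sublocale cell_sum A p n u co "gens p" "gen_vertex i" "gen_degree p" ee dg gexp gcoeff
proof
  show "finite (gens p)" by (simp add: gens_def)
  fix g h :: gen and j l D m
  show "ee m \<in> carrier A" "dg g h \<in> carrier A" by (rule ee_in, rule dg_in)
  show "co (ee m) j l D = (if (j, l, D) = (m, m, 0) then of_bool (m \<in> {1..n}) else 0)" by (rule co_ee)
  assume g: "g \<in> gens p"
  show "dg g h = \<zero>\<^bsub>A\<^esub>" if "h \<notin> gens p" by (rule dg_off[OF g that])
  assume h: "h \<in> gens p"
  obtain s k where gs: "on_strand p s k" "g = strand_gen u p s k" by (rule gens_strand[OF p2 g])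
  obtain s' k' where hs: "on_strand p s' k'" "h = strand_gen u p s' k'" by (rule gens_strand[OF p2 h])
  show "co (dg g h) j l D = (if (j, l, D) = (gen_vertex i g, gen_vertex i h, gexp g h) then gcoeff g h else 0)"
    using co_dg[OF gs(1) hs(1), of j l D]
    by (auto simp: gs hs gen_vertex_strand gexp_def gcoeff_def strand_index_gen)
  show "cdeg u (gen_vertex i g) (gen_vertex i h) (gexp g h) + gen_degree p h = gen_degree p g + 2"
    if "gcoeff g h \<noteq> 0"
    unfolding gs(2) hs(2) gen_vertex_strand gexp_def strand_index_gen
    by (rule strand_coeff_degree[OF p2 i(1) gs(1) hs(1), of eps])
      (use that in \<open>auto simp: gs hs gcoeff_def strand_index_gen simp del: strand_coeff.simps split: if_splits\<close>)
qed

definition sg :: "bool \<Rightarrow> nat \<Rightarrow> 'k" where "sg s k = (if s \<and> k = p then eps else 1)"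

text \<open>
  The coordinates of the cell module as a pair of strands. The sign at \<open>v\<close>
  normalises the arrow from \<open>v\<close> to the other strand to coefficient one.
\<close>

fun st :: "(gen \<Rightarrow> 'a) \<Rightarrow> 'k strands" where
  "st x (s, k, j, D) = (if on_strand p s k then sg s k * cell_coord x (strand_gen u p s k, j, D) else 0)"

lemma sg_sg: "sg s k * sg s k = 1" by (simp add: sg_def)

lemma cell_st: "on_strand p s k \<Longrightarrow> cell_coord x (strand_gen u p s k, j, D) = sg s k * st x (s, k, j, D)"
  by (simp add: sg_sg mult.assoc[symmetric])

lemma strand_cell_basis: "on_strand p s k \<Longrightarrow> (strand_gen u p s k, j, D) \<in> cell_basis \<longleftrightarrow> strand_basis u i p n (s, k, j, D)"
  by (simp add: cell_basis_def strand_basis.simps gen_vertex_strand strand_gen_in[OF p2])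

lemma st_off: "x \<in> carrier Xs \<Longrightarrow> \<not> strand_basis u i p n b \<Longrightarrow> st x b = 0"
proof -
  assume x: "x \<in> carrier Xs" and nb: "\<not> strand_basis u i p n b"
  obtain s k j D where b: "b = (s, k, j, D)" by (cases b)
  show ?thesis
  proof (cases "on_strand p s k")
    case True
    then have "(strand_gen u p s k, j, D) \<notin> cell_basis" using nb strand_cell_basis b by blast
    then show ?thesis using X.coord_off[OF x] by (simp add: b)
  qed (simp add: b)
qed

lemma st_zero_imp: "x \<in> carrier Xs \<Longrightarrow> (\<And>b. st x b = 0) \<Longrightarrow> x = \<zero>\<^bsub>Xs\<^esub>"
proof (rule X.coord_inj[OF _ X.zero_in])
  fix b assume x: "x \<in> carrier Xs" and z: "\<And>b. st x b = 0" and "b \<in> cell_basis"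
  then obtain g j D where b: "b = (g, j, D)" "g \<in> gens p" by (auto simp: cell_basis_def)
  obtain s k where "on_strand p s k" "g = strand_gen u p s k" by (rule gens_strand[OF p2 b(2)])
  then show "cell_coord x b = cell_coord \<zero>\<^bsub>Xs\<^esub> b"
    using cell_st[of s k x j D] z[of "(s, k, j, D)"] by (simp only: b X.coord_zero mult_zero_right)
qed

text \<open>
  The sum over all generators collapses to the few that map to the given one.
\<close>

lemma st_del:
  assumes x: "x \<in> carrier Xs"
  shows "st (del Xs x) = strand_map u i p n (st x)"
proof
  fix b :: "bool \<times> nat \<times> nat \<times> nat"
  obtain s k j D where b: "b = (s, k, j, D)" by (cases b)
  show "st (del Xs x) b = strand_map u i p n (st x) b"
  proof (cases "strand_basis u i p n b")
    case False
    then show ?thesis using st_off[OF X_del_in[OF x]] by (simp add: strand_map_def[OF p2 i])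
  next
    case True
    have on: "on_strand p s k" and D: "D < cutoff u j (strand_vertex u i p s k)" and vis: "strand_vertex u i p s k \<noteq> 0"
      using True by (auto simp: b strand_basis.simps coords_def)
    define y where "y s' k' E = cell_coord x (strand_gen u p s' k', j, E)" for s' k' E
    define T where "T s' k' = (if strand_exp p (s', k') (s, k) \<le> D
      then y s' k' (D - strand_exp p (s', k') (s, k)) * strand_coeff eps p (s', k') (s, k) else 0)" for s' k'
    have T: "(if gexp (strand_gen u p s' k') (strand_gen u p s k) \<le> D
        then cell_coord x (strand_gen u p s' k', j, D - gexp (strand_gen u p s' k') (strand_gen u p s k))
          * gcoeff (strand_gen u p s' k') (strand_gen u p s k) else 0) = T s' k'" for s' k'
    proof (cases "strand_vertex u i p s' k' = 0")
      case True
      have "cell_coord x (strand_gen u p s' k', j, E) = 0" for E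
        using True X.coord_off[OF x, of "(strand_gen u p s' k', j, E)"]
        by (simp add: cell_basis_def gen_vertex_strand coords_def)
      then show ?thesis by (simp add: T_def y_def)
    next
      case False
      then show ?thesis using vis by (simp only: T_def y_def gexp_def gcoeff_def strand_index_gen gen_vertex_strand simp_thms if_True)
    qed
    have lhs: "cell_coord (del Xs x) (strand_gen u p s k, j, D) =
        shift_del (\<lambda>D. y s k D) D + ((\<Sum>k'<p. T False k') + (\<Sum>k'\<in>{1..p}. T True k'))"
      unfolding coord_X_del[OF x strand_gen_in[OF p2 on]] gen_vertex_strand if_P[OF D] sum_gens[OF p2, of _ u] T y_def
      by (rule refl)
    have rhs: "strand_map u i p n (st x) b = strand_del p (st x) (s, k, j, D)"
      using True by (simp add: strand_map_def[OF p2 i] b)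
    have sd: "shift_del (\<lambda>D. st x (s, k, j, D)) D = sg s k * shift_del (\<lambda>D. y s k D) D"
      using on by (simp add: y_def shift_del_scale)
    have st_y: "st x (s', k', j, E) = sg s' k' * y s' k' E" if "on_strand p s' k'" for s' k' E
      using that by (simp add: y_def)
    show ?thesis
    proof (cases s)
      case s: True
      have k: "1 \<le> k" "k \<le> p" using on s by (simp_all add: on_strand_def)
      have "T False k' = 0" for k' using s by (simp add: T_def)
      moreover have "T True k' = (if Suc k = k' then sg True (Suc k) * y True (Suc k) D else 0)" for k'
        using s k by (auto simp: T_def sg_def)
      moreover have "st x (True, Suc k, j, D) = sg True (Suc k) * y True (Suc k) D" if "k < p"
        using that by (intro st_y) (simp add: on_strand_def)
      ultimately show ?thesis
        unfolding rhs strand_del.simps if_P[OF on] sd unfolding b st.simps if_P[OF on] lhs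
        using s k by (simp add: sg_def distrib_left)
    next
      case s: False
      have k: "k < p" using on s by (simp add: on_strand_def)
      define Oc where "Oc = (if k = 0 then (if 1 \<le> D then y True 1 (D - 1) else 0) else (if 2 \<le> D then y True k (D - 2) else 0))"
      define V where "V = (if Suc k = p \<and> 1 \<le> D then eps * y True p (D - 1) else 0)"
      have 1: "T False k' = (if Suc k = k' then y False (Suc k) D else 0)" for k'
        using s by (auto simp: T_def)
      have m: "max 1 k < p" "1 \<le> max 1 k" using k p2 by auto
      have 2: "T True k' = (if max 1 k = k' then Oc else 0) + (if p = k' then - V else 0)" for k'
      proof -
        consider "k' = p" | "k' = max 1 k" "k' \<noteq> p" | "k' \<noteq> p" "k' \<noteq> max 1 k" by blast
        then show ?thesis
        proof cases
          case 1
          then show ?thesis using s m p2 by (auto simp: T_def V_def)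
        next
          case 2
          then show ?thesis using s m k p2 by (cases "k = 0") (auto simp: T_def Oc_def max_def)
        next
          case 3
          then show ?thesis using s by (auto simp: T_def)
        qed
      qed
      have "(\<Sum>k'<p. T False k') = (if Suc k < p then y False (Suc k) D else 0)"
        unfolding 1 by simp
      moreover have "(\<Sum>k'\<in>{1..p}. T True k') = Oc - V"
        unfolding 2 sum.distrib using m p2 by (simp add: sum.delta)
      moreover have "(if Suc k < p then st x (False, Suc k, j, D) else 0) = (if Suc k < p then y False (Suc k) D else 0)"
        using st_y[of False "Suc k" D] by (simp add: on_strand_def sg_def del: st.simps)
      moreover have "(if k = 0 then (if 1 \<le> D then st x (True, 1, j, D - 1) else 0) else (if 2 \<le> D then st x (True, k, j, D - 2) else 0)) = Oc"
        using st_y[of True 1 "D - 1"] st_y[of True k "D - 2"] k p2 by (cases "k = 0") (auto simp: Oc_def on_strand_def sg_def simp del: st.simps)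
      moreover have "(if Suc k = p \<and> 1 \<le> D then st x (True, p, j, D - 1) else 0) = V"
        using st_y[of True p "D - 1"] p2 by (simp add: V_def on_strand_def sg_def del: st.simps)
      ultimately show ?thesis
        unfolding rhs strand_del.simps if_P[OF on] sd unfolding b st.simps(1)[of "del Xs x" s k j D] if_P[OF on] lhs
        using s by (simp only: if_False sg_def simp_thms mult_1_left) (simp add: algebra_simps)
    qed
  qed
qed

lemma Xs_nilpotent: "x \<in> carrier Xs \<Longrightarrow> (del Xs ^^ p) x = \<zero>\<^bsub>Xs\<^esub>"
proof -
  assume x: "x \<in> carrier Xs"
  have "(del Xs ^^ r) x \<in> carrier Xs \<and> st ((del Xs ^^ r) x) = (strand_map u i p n ^^ r) (st x)" for r
    by (induction r) (simp_all add: x X_del_in st_del del: st.simps)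
  with strand_map_pow_zero[OF prime char i, of u "st x", OF st_off[OF x]] show ?thesis
    by (intro st_zero_imp) (simp_all del: st.simps)
qed

lemma Xs_module: "left_pdg_module p A Xs"
  by (rule X_module[OF Xs_nilpotent])

lemma Xs_finite_cell: "finite_cell_module (left_pdg_module p A) A (\<lambda>j. left_projective A (ee j)) {1..n} Xs"
proof (rule X_finite_cell[OF Xs_module])
  let ?w = "\<lambda>g. case strand_index u p g of (s, k) \<Rightarrow> if s then p + k else k"
  show "inj_on ?w (gens p)"
  proof (rule inj_onI)
    fix g h assume gh: "g \<in> gens p" "h \<in> gens p" and eq: "?w g = ?w h"
    obtain s k where gs: "on_strand p s k" "g = strand_gen u p s k" by (rule gens_strand[OF p2 gh(1)])
    obtain s' k' where hs: "on_strand p s' k'" "h = strand_gen u p s' k'" by (rule gens_strand[OF p2 gh(2)])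
    have "s = s' \<and> k = k'" using eq gs hs by (auto simp: strand_index_gen on_strand_def split: if_splits)
    then show "g = h" by (simp add: gs hs)
  qed
  fix g h assume gh: "g \<in> gens p" "h \<in> gens p" "gcoeff g h \<noteq> 0"
  obtain s k where gs: "on_strand p s k" "g = strand_gen u p s k" by (rule gens_strand[OF p2 gh(1)])
  obtain s' k' where hs: "on_strand p s' k'" "h = strand_gen u p s' k'" by (rule gens_strand[OF p2 gh(2)])
  have "strand_coeff eps p (s, k) (s', k') \<noteq> 0"
    using gh(3) by (auto simp: gs hs gcoeff_def strand_index_gen simp del: strand_coeff.simps split: if_splits)
  then show "?w h < ?w g"
    using gs(1) hs(1) unfolding gs(2) hs(2) strand_index_gen by (cases s; cases s') (auto simp: on_strand_def split: if_splits)
qed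

definition simple_gen :: "gen \<Rightarrow> 'a" where
  "simple_gen = (\<lambda>h. if h = GenW then ee i else \<zero>\<^bsub>A\<^esub>)"

abbreviation Ls :: "('k, 'a, gen \<Rightarrow> 'a) pdg_module" where
  "Ls \<equiv> line_module A idc simple_gen"

text \<open>
  The coefficient of the class of \<open>(i)\<close> at \<open>w\<close>.
\<close>

definition head :: "(gen \<Rightarrow> 'a) \<Rightarrow> 'k" where
  "head x = cell_coord x (GenW, i, 0)"

lemma GenW_in: "GenW \<in> gens p" by (simp add: gens_def)

lemma simple_gen_in: "simple_gen \<in> carrier Xs"
  using GenW_in by (auto simp: X_carrier simple_gen_def ee_in AB.zero_in co_zero co_ee)

lemma coord_simple_gen: "cell_coord simple_gen b = of_bool (b = (GenW, i, 0))"
  using i by (cases b) (auto simp: cell_coord_def simple_gen_def co_zero co_ee)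

lemma Ls_simps:
  "carrier Ls = {c \<odot>\<^bsub>Xs\<^esub> simple_gen | c. True}" "zero Ls = zero Xs" "x \<oplus>\<^bsub>Ls\<^esub> y = x \<oplus>\<^bsub>Xs\<^esub> y" "c \<odot>\<^bsub>Ls\<^esub> x = c \<odot>\<^bsub>Xs\<^esub> x"
  "grade Ls d = (if d = 0 then carrier Ls else {\<zero>\<^bsub>Xs\<^esub>})" "del Ls x = \<zero>\<^bsub>Xs\<^esub>" "act Ls a x = idc a \<odot>\<^bsub>Xs\<^esub> x"
  by (simp_all add: line_module_def X_simps)

lemma Ls_sub: "x \<in> carrier Ls \<Longrightarrow> x \<in> carrier Xs"
  using X.smult_in[OF simple_gen_in] by (auto simp: Ls_simps)

lemma coord_line: "cell_coord (c \<odot>\<^bsub>Xs\<^esub> simple_gen) b = (if b = (GenW, i, 0) then c else 0)"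
  by (simp add: X.coord_smult[OF simple_gen_in] coord_simple_gen)

lemma head_line: "head (c \<odot>\<^bsub>Xs\<^esub> simple_gen) = c"
  by (simp add: head_def coord_line)

lemma Ls_eq: "x \<in> carrier Ls \<Longrightarrow> x = head x \<odot>\<^bsub>Xs\<^esub> simple_gen"
  by (auto simp: Ls_simps(1) head_line)

lemma Ls_memI: "c \<odot>\<^bsub>Xs\<^esub> simple_gen \<in> carrier Ls" by (auto simp: Ls_simps)

lemma line_ops:
  "\<zero>\<^bsub>Xs\<^esub> = 0 \<odot>\<^bsub>Xs\<^esub> simple_gen"
  "(c \<odot>\<^bsub>Xs\<^esub> simple_gen) \<oplus>\<^bsub>Xs\<^esub> (d \<odot>\<^bsub>Xs\<^esub> simple_gen) = (c + d) \<odot>\<^bsub>Xs\<^esub> simple_gen"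
  "c \<odot>\<^bsub>Xs\<^esub> (d \<odot>\<^bsub>Xs\<^esub> simple_gen) = (c * d) \<odot>\<^bsub>Xs\<^esub> simple_gen"
proof -
  note in' = X.smult_in[OF simple_gen_in]
  show "\<zero>\<^bsub>Xs\<^esub> = 0 \<odot>\<^bsub>Xs\<^esub> simple_gen"
    by (rule X.coord_eqI[OF X.zero_in in']) (simp add: X.coord_zero coord_line)
  show "(c \<odot>\<^bsub>Xs\<^esub> simple_gen) \<oplus>\<^bsub>Xs\<^esub> (d \<odot>\<^bsub>Xs\<^esub> simple_gen) = (c + d) \<odot>\<^bsub>Xs\<^esub> simple_gen"
    by (rule X.coord_eqI[OF X.add_in[OF in' in'] in']) (simp add: X.coord_add[OF in' in'] coord_line)
  show "c \<odot>\<^bsub>Xs\<^esub> (d \<odot>\<^bsub>Xs\<^esub> simple_gen) = (c * d) \<odot>\<^bsub>Xs\<^esub> simple_gen"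
    by (rule X.coord_eqI[OF X.smult_in[OF in'] in']) (simp add: X.coord_smult[OF in'] coord_line)
qed

lemma Ls_based: "based Ls {()} (\<lambda>_. 0) (\<lambda>x _. head x)"
proof
  fix x y F c d b
  show "\<zero>\<^bsub>Ls\<^esub> \<in> carrier Ls" unfolding Ls_simps(2) line_ops(1) by (rule Ls_memI)
  show "head \<zero>\<^bsub>Ls\<^esub> = 0" unfolding Ls_simps(2) line_ops(1) head_line ..
  show "\<exists>x\<in>carrier Ls. \<forall>b\<in>{()}. head x = F b" using Ls_memI[of "F ()"] head_line by auto
  show "x \<in> grade Ls d \<longleftrightarrow> x \<in> carrier Ls \<and> (\<forall>b. head x \<noteq> 0 \<longrightarrow> 0 = d)"
  proof (cases "d = 0")
    case False
    have "x = \<zero>\<^bsub>Xs\<^esub> \<longleftrightarrow> x \<in> carrier Ls \<and> head x = 0"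
      using Ls_eq[of x] Ls_memI[of 0] head_line[of 0] unfolding line_ops(1) by metis
    then show ?thesis using False by (simp add: Ls_simps(5))
  qed (simp add: Ls_simps(5))
  assume x: "x \<in> carrier Ls"
  show "head x = 0" if "b \<notin> {()}" using that by simp
  obtain r where r: "x = r \<odot>\<^bsub>Xs\<^esub> simple_gen" using x by (auto simp: Ls_simps(1))
  show "c \<odot>\<^bsub>Ls\<^esub> x \<in> carrier Ls" unfolding r Ls_simps(4) line_ops(3) by (rule Ls_memI)
  show "head (c \<odot>\<^bsub>Ls\<^esub> x) = c * head x" unfolding r Ls_simps(4) line_ops(3) head_line ..
  assume y: "y \<in> carrier Ls"
  obtain t where t: "y = t \<odot>\<^bsub>Xs\<^esub> simple_gen" using y by (auto simp: Ls_simps(1))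
  show "x \<oplus>\<^bsub>Ls\<^esub> y \<in> carrier Ls" unfolding r t Ls_simps(3) line_ops(2) by (rule Ls_memI)
  show "head (x \<oplus>\<^bsub>Ls\<^esub> y) = head x + head y" unfolding r t Ls_simps(3) line_ops(2) head_line ..
  show "x = y" if "\<And>b. b \<in> {()} \<Longrightarrow> head x = head y" using that unfolding r t head_line by simp
qed simp

sublocale L: based Ls "{()}" "\<lambda>_. 0" "\<lambda>x _. head x" by (rule Ls_based)

lemma idc_one: "idc \<one>\<^bsub>A\<^esub> = 1"
proof -
  have "co (\<one>\<^bsub>A\<^esub> \<otimes>\<^bsub>A\<^esub> ee i) i i 0 = co \<one>\<^bsub>A\<^esub> i i 0 * co (ee i) i i 0" by (rule co_mult_loop[OF A.one_closed ee_in])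
  then show ?thesis using i by (simp add: ee_in co_ee idc)
qed

lemma Ls_pcomplex: "is_pcomplex p Ls"
proof (rule L.is_pcomplexI)
  show "graded_linear 2 Ls Ls (del Ls)"
    unfolding graded_linear_def Ls_simps(3,4,6)
    using L.zero_in L.coord_zero unfolding Ls_simps(2)
    by (simp add: L.grade_iff) (metis add_0 line_ops mult_zero_right)
  show "(del Ls ^^ p) x = \<zero>\<^bsub>Ls\<^esub>" for x
    using p by (cases p) (simp_all add: Ls_simps)
qed

lemma Ls_module: "left_pdg_module p A Ls"
  unfolding left_pdg_module_def pdg_action_def
proof (intro conjI allI ballI funcsetI)
  show "pdg_algebra p A" by (rule A_pdg)
  show "is_pcomplex p Ls" by (rule Ls_pcomplex)
next
  fix d e a m assume a: "a \<in> grade A d" and m: "m \<in> grade Ls e"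
  have aA: "a \<in> carrier A" and mL: "m \<in> carrier Ls" using a m by (simp_all add: A_grade_iff L.grade_iff)
  have "0 = d" if nz: "co a i i 0 \<noteq> 0"
  proof -
    have "cdeg u i i 0 = d" using a nz unfolding A_grade_iff by blast
    then show ?thesis by (simp add: cdeg_def)
  qed
  moreover have "0 = e" if "head m \<noteq> 0" using m that by (simp add: L.grade_iff)
  ultimately show "act Ls a m \<in> grade Ls (d + e)"
    using L.smult_in[OF mL, of "idc a"] L.coord_smult[OF mL, of "idc a"] idc[OF aA]
    by (auto simp: Ls_simps(4,7) L.grade_iff)
next
  fix a b m x y c assume m: "m \<in> carrier Ls" and a: "a \<in> carrier A"
  obtain r where r: "m = r \<odot>\<^bsub>Xs\<^esub> simple_gen" using m by (auto simp: Ls_simps(1))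
  show "act Ls a m \<in> carrier Ls" using L.smult_in[OF m] by (simp add: Ls_simps(4,7))
  show "act Ls (c \<odot>\<^bsub>A\<^esub> a) m = c \<odot>\<^bsub>Ls\<^esub> act Ls a m" "act Ls a (c \<odot>\<^bsub>Ls\<^esub> m) = c \<odot>\<^bsub>Ls\<^esub> act Ls a m"
    by (simp_all add: Ls_simps(4,7) r line_ops idc a AB.smult_in co_smult mult_ac)
  show "del Ls (act Ls a m) = act Ls (del A a) m \<oplus>\<^bsub>Ls\<^esub> act Ls a (del Ls m)"
    using a by (simp add: Ls_simps(3,6,7) r line_ops idc A_del_in co_del shift_del_def)
  assume b: "b \<in> carrier A"
  show "act Ls (a \<oplus>\<^bsub>A\<^esub> b) m = act Ls a m \<oplus>\<^bsub>Ls\<^esub> act Ls b m"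
    using a b by (simp add: Ls_simps(3,7) r line_ops idc AB.add_in co_add distrib_right)
  show "act Ls (a \<otimes>\<^bsub>A\<^esub> b) m = act Ls a (act Ls b m)"
    using a b by (simp add: Ls_simps(3,7) r line_ops idc co_mult_loop mult.assoc)
next
  fix m assume "m \<in> carrier Ls"
  then show "act Ls \<one>\<^bsub>A\<^esub> m = m" by (auto simp: Ls_simps(1,7) idc_one line_ops)
next
  fix a x y assume a: "a \<in> carrier A" and "x \<in> carrier Ls" "y \<in> carrier Ls"
  then show "act Ls a (x \<oplus>\<^bsub>Ls\<^esub> y) = act Ls a x \<oplus>\<^bsub>Ls\<^esub> act Ls a y"
    by (auto simp: Ls_simps(1,3,7) line_ops distrib_left)
qed

definition chain_coord :: "chain_kind \<times> nat \<times> nat \<Rightarrow> nat \<Rightarrow> gen \<times> nat \<times> nat" where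
  "chain_coord c k = (case chain_elem p c k of (s, k, j, D) \<Rightarrow> (strand_gen u p s k, j, D))"

lemma chain_coord_st:
  assumes c: "chains u i n c" "k < p"
  shows "cell_coord x (chain_coord c k) =
    (if Suc k = p \<and> (fst c = Other \<or> fst c = Top) then eps else 1) * st x (chain_elem p c k)"
proof -
  obtain z j D where cc: "c = (z, j, D)" by (cases c)
  obtain s l j' D' where e: "chain_elem p c k = (s, l, j', D')" by (cases "chain_elem p c k")
  have on: "on_strand p s l" using chain_elem_basis[OF p2 i c] by (simp add: e strand_basis.simps)
  have "sg s l = (if Suc k = p \<and> (fst c = Other \<or> fst c = Top) then eps else 1)"
    using e c(2) p2 unfolding cc sg_def by (cases z) (auto split: if_splits)
  then show ?thesis using cell_st[OF on, of x j' D'] by (simp only: chain_coord_def e prod.case)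
qed

lemma chain_coord_cover:
  assumes "b \<in> cell_basis" "b \<noteq> (GenW, i, 0)"
  shows "\<exists>c\<in>{c. chains u i n c}. \<exists>k<p. b = chain_coord c k"
proof -
  obtain g j D where b: "b = (g, j, D)" "g \<in> gens p" using assms by (auto simp: cell_basis_def)
  obtain s k where gs: "on_strand p s k" "g = strand_gen u p s k" by (rule gens_strand[OF p2 b(2)])
  have "strand_basis u i p n (s, k, j, D)" using assms(1) strand_cell_basis[OF gs(1)] by (simp add: b gs)
  moreover have "(s, k, j, D) \<noteq> (False, 0, i, 0)"
  proof
    assume "(s, k, j, D) = (False, 0, i, 0)"
    then have "b = (GenW, i, 0)" by (simp add: b gs strand_gen_def)
    with assms(2) show False by contradiction
  qed
  ultimately obtain c k' where c: "chains u i n c" "k' < p" "(s, k, j, D) = chain_elem p c k'"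
    using chain_elem_cover[OF p2 i] by blast
  then have "b = chain_coord c k'" by (simp add: chain_coord_def c(3)[symmetric] b gs)
  with c show ?thesis by blast
qed

lemma chain_coord_in: "chains u i n c \<Longrightarrow> k < p \<Longrightarrow> chain_coord c k \<in> cell_basis"
proof -
  assume c: "chains u i n c" "k < p"
  obtain s l j D where e: "chain_elem p c k = (s, l, j, D)" by (cases "chain_elem p c k")
  have sb: "strand_basis u i p n (s, l, j, D)" using chain_elem_basis[OF p2 i c] by (simp add: e)
  then have "on_strand p s l" by (simp add: strand_basis.simps)
  with sb strand_cell_basis show ?thesis by (simp add: chain_coord_def e)
qed

lemma chain_coord_simple: "chains u i n c \<Longrightarrow> k < p \<Longrightarrow> chain_coord c k \<noteq> (GenW, i, 0)"
  using simple_not_in_chain[OF p2 i, of u c k]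
  by (auto simp: chain_coord_def strand_gen_def split: prod.splits if_splits)

lemma Xs_contraction:
  "\<exists>h. graded_linear (2 - 2 * int p) Xs Xs h \<and> (\<forall>x\<in>carrier Xs.
    finsum Xs (\<lambda>j. (del Xs ^^ j) (h ((del Xs ^^ (p - 1 - j)) x))) {..<p} =
      X.vec (\<lambda>b. if \<exists>c\<in>{c. chains u i n c}. \<exists>k<p. b = chain_coord c k then cell_coord x b else 0))"
proof (rule X.triangular_contraction[where wt = "\<lambda>c. snd (snd c)" and R = "n + 2"
      and \<sigma> = "\<lambda>c. if fst c = Top then - eps else if fst c = Other then eps else 1"])
  show "2 \<le> p" by (rule p2)
  show "is_pcomplex p Xs" using Xs_module by (simp add: left_pdg_module_def pdg_action_def)
  show "0 < n + 2" by simp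
next
  fix c k assume "c \<in> {c. chains u i n c}"
  then have c: "chains u i n c" by simp
  show "chain_coord c k \<in> cell_basis" if "k < p" by (rule chain_coord_in[OF c that])
  show "cell_degree (chain_coord c (p - 1)) = cell_degree (chain_coord c 0) + (2 - 2 * int p)"
  proof -
    have "cell_degree (chain_coord c k) = strand_degree u i p (chain_elem p c k)" for k
      by (simp add: chain_coord_def cell_degree_def strand_degree_def gen_degree_strand gen_vertex_strand split: prod.split)
    then show ?thesis using chain_elem_degree[OF p2 i c] by simp
  qed
  show "(if fst c = Top then - eps else if fst c = Other then eps else 1) *
      (if fst c = Top then - eps else if fst c = Other then eps else 1) = 1" by simp
  obtain z j D where cc: "c = (z, j, D)" by (cases c)
  show "snd (snd c) < n + 2" using c i unfolding cc by (cases z) (auto split: if_splits)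
next
  fix c k c' k' assume c: "c \<in> {c. chains u i n c}" "k < p" "c' \<in> {c. chains u i n c}" "k' < p"
    and eq: "chain_coord c k = chain_coord c' k'"
  have "chain_elem p c k = chain_elem p c' k'"
    using eq strand_index_gen[of u p] by (auto simp: chain_coord_def split: prod.splits) (metis prod.inject)+
  then show "c = c' \<and> k = k'" using c by (intro chain_elem_inj[OF p2 i, of u]) simp_all
next
  fix x c k assume x: "x \<in> carrier Xs" and "c \<in> {c. chains u i n c}" and k: "k < p"
    and low: "\<And>c' k'. \<lbrakk>c' \<in> {c. chains u i n c}; k' < p; snd (snd c') < snd (snd c)\<rbrakk> \<Longrightarrow> cell_coord x (chain_coord c' k') = 0"
  then have c: "chains u i n c" by simp
  have low': "st x (chain_elem p c' k') = 0" if "chains u i n c'" "k' < p" "snd (snd c') < snd (snd c)" for c' k'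
    using low[of c' k'] that unfolding chain_coord_st[OF that(1,2)] by (simp split: if_splits del: st.simps)
  have tri: "st (del Xs x) (chain_elem p c k) = (if Suc k < p then
      (if Suc k = p - 1 then (if fst c = Top then - 1 else 1) else 1) * st x (chain_elem p c (Suc k)) else 0)"
    unfolding st_del[OF x]
    by (rule strand_map_triangular[OF p2 i _ c k]) (rule st_off[OF x], assumption, rule low')
  show "cell_coord (del Xs x) (chain_coord c k) = (if Suc k < p then
      (if Suc k = p - 1 then if fst c = Top then - eps else if fst c = Other then eps else 1 else 1)
        * cell_coord x (chain_coord c (Suc k)) else 0)"
  proof (cases "Suc k < p")
    case True
    have iff: "Suc k = p - 1 \<longleftrightarrow> Suc (Suc k) = p" using True by linarith
    have "Suc k \<noteq> p" using True by simp
    then show ?thesis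
      unfolding chain_coord_st[OF c k] chain_coord_st[OF c True] tri iff
      by (cases "fst c") (simp_all del: st.simps)
  next
    case False
    then show ?thesis unfolding chain_coord_st[OF c k] tri by (simp only: if_False mult_zero_right)
  qed
next
  fix x b assume x: "x \<in> carrier Xs" and nb: "\<not> (\<exists>c\<in>{c. chains u i n c}. \<exists>k<p. b = chain_coord c k)"
  show "cell_coord (del Xs x) b = 0"
  proof (cases "b = (GenW, i, 0)")
    case True
    have "cell_coord (del Xs x) (strand_gen u p False 0, i, 0) = sg False 0 * st (del Xs x) (False, 0, i, 0)"
      using p2 by (intro cell_st) (simp add: on_strand_def)
    also have "\<dots> = 0" unfolding st_del[OF x] using strand_map_simple[where u = u and f = "st x", OF p2 i st_off[OF x]] by simp
    finally show ?thesis by (simp add: True strand_gen_def)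
  next
    case False
    then have "b \<notin> cell_basis" using chain_coord_cover nb by blast
    then show ?thesis by (rule X.coord_off[OF X_del_in[OF x]])
  qed
next
  fix x assume x: "x \<in> carrier Xs" and z: "\<And>c k. c \<in> {c. chains u i n c} \<Longrightarrow> k < p \<Longrightarrow> cell_coord x (chain_coord c k) = 0"
  have off: "st x b = 0" if ne: "b \<noteq> (False, 0, i, 0)" for b
  proof (cases "strand_basis u i p n b")
    case True
    then obtain c k where c: "chains u i n c" "k < p" "b = chain_elem p c k"
      using chain_elem_cover[OF p2 i _ ne] by blast
    have "cell_coord x (chain_coord c k) = 0" using z c by simp
    then show ?thesis unfolding chain_coord_st[OF c(1,2)] c(3) by (simp split: if_splits del: st.simps)
  qed (rule st_off[OF x])
  show "del Xs x = \<zero>\<^bsub>Xs\<^esub>"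
    by (rule st_zero_imp[OF X_del_in[OF x]]) (unfold st_del[OF x], rule strand_map_kernel[OF p2 i], rule off)
qed

definition proj :: "(gen \<Rightarrow> 'a) \<Rightarrow> gen \<Rightarrow> 'a" where
  "proj x = head x \<odot>\<^bsub>Xs\<^esub> simple_gen"

lemma head_del: "x \<in> carrier Xs \<Longrightarrow> head (del Xs x) = 0"
proof -
  assume x: "x \<in> carrier Xs"
  have "cell_coord (del Xs x) (strand_gen u p False 0, i, 0) = sg False 0 * st (del Xs x) (False, 0, i, 0)"
    using p2 by (intro cell_st) (simp add: on_strand_def)
  also have "\<dots> = 0" unfolding st_del[OF x] using strand_map_simple[where u = u and f = "st x", OF p2 i st_off[OF x]] by simp
  finally show ?thesis by (simp add: head_def strand_gen_def)
qed

lemma del_line: "x \<in> carrier Ls \<Longrightarrow> del Xs x = \<zero>\<^bsub>Xs\<^esub>"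
proof -
  assume x: "x \<in> carrier Ls"
  note xX = Ls_sub[OF x]
  have off: "st x b = 0" if "b \<noteq> (False, 0, i, 0)" for b
  proof -
    obtain s k j D where b: "b = (s, k, j, D)" by (cases b)
    have "strand_gen u p s k = GenW \<Longrightarrow> s = False \<and> k = 0" by (auto simp: strand_gen_def split: if_splits)
    then have "cell_coord x (strand_gen u p s k, j, D) = 0"
      using that coord_line[of "head x" "(strand_gen u p s k, j, D)"] unfolding Ls_eq[OF x, symmetric] b by auto
    then show ?thesis by (simp add: b)
  qed
  show ?thesis
    by (rule st_zero_imp[OF X_del_in[OF xX]]) (unfold st_del[OF xX], rule strand_map_kernel[OF p2 i], rule off)
qed

lemma proj_hom: "pdg_hom A Xs Ls proj"
  unfolding pdg_hom_def pcomplex_hom_def graded_linear_def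
proof (intro conjI ballI allI funcsetI)
  fix x y c a e
  show "proj x \<in> grade Ls (e + 0)" if "x \<in> grade Xs e"
  proof -
    have "e = 0" if nz: "head x \<noteq> 0"
    proof -
      have "cell_degree (GenW, i, 0) = e"
        using \<open>x \<in> grade Xs e\<close> nz unfolding X_grade_coord head_def by blast
      then show ?thesis by (simp add: cell_degree_def cdeg_def split: if_splits)
    qed
    then show ?thesis using Ls_memI[of "head x"] by (auto simp: L.grade_iff proj_def head_line)
  qed
  assume x: "x \<in> carrier Xs"
  show "proj x \<in> carrier Ls" unfolding proj_def by (rule Ls_memI)
  show "proj (c \<odot>\<^bsub>Xs\<^esub> x) = c \<odot>\<^bsub>Ls\<^esub> proj x"
    by (simp add: proj_def Ls_simps(4) line_ops head_def X.coord_smult[OF x])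
  show "proj (del Xs x) = del Ls (proj x)" by (simp add: proj_def head_del[OF x] Ls_simps(6) line_ops(1))
  show "proj (act Xs a x) = act Ls a (proj x)" if a: "a \<in> carrier A"
  proof -
    have "head (act Xs a x) = idc a * head x"
      using co_mult_loop[OF a X_in[OF x], of GenW i] by (simp add: head_def cell_coord_def X_simps idc[OF a])
    then show ?thesis by (simp add: proj_def Ls_simps(7) line_ops)
  qed
  assume y: "y \<in> carrier Xs"
  show "proj (x \<oplus>\<^bsub>Xs\<^esub> y) = proj x \<oplus>\<^bsub>Ls\<^esub> proj y"
    by (simp add: proj_def Ls_simps(3) line_ops head_def X.coord_add[OF x y])
qed

lemma incl_hom: "pcomplex_hom Ls Xs (\<lambda>x. x)"
  unfolding pcomplex_hom_def graded_linear_def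
proof (intro conjI ballI allI funcsetI)
  fix x y c e
  show "x \<in> grade Xs (e + 0)" if "x \<in> grade Ls e"
  proof -
    have x: "x \<in> carrier Ls" and e: "head x \<noteq> 0 \<Longrightarrow> e = 0" using that by (auto simp: L.grade_iff)
    have "cell_degree b = e" if "cell_coord x b \<noteq> 0" for b
      using that e coord_line[of "head x" b] unfolding Ls_eq[OF x, symmetric]
      by (auto simp: cell_degree_def cdeg_def split: if_splits)
    then show ?thesis using Ls_sub[OF x] by (simp add: X_grade_coord)
  qed
  assume x: "x \<in> carrier Ls"
  show "x \<in> carrier Xs" by (rule Ls_sub[OF x])
  show "del Ls x = del Xs x" by (simp add: Ls_simps(6) del_line[OF x])
qed (simp_all add: Ls_simps(3,4))

text \<open>
  The inclusion of the line is an inverse. The composite on the line is the identity; on the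
  cell module it differs from the identity by the projection to the chains, which is
  null-homotopic.
\<close>

lemma simple_quasi_iso: "pdg_quasi_iso p A Xs Ls proj"
proof -
  have pX: "is_pcomplex p Xs" using Xs_module by (simp add: left_pdg_module_def pdg_action_def)
  obtain h where h: "graded_linear (2 - 2 * int p) Xs Xs h"
    and hs: "\<And>x. x \<in> carrier Xs \<Longrightarrow> finsum Xs (\<lambda>j. (del Xs ^^ j) (h ((del Xs ^^ (p - 1 - j)) x))) {..<p} =
      X.vec (\<lambda>b. if \<exists>c\<in>{c. chains u i n c}. \<exists>k<p. b = chain_coord c k then cell_coord x b else 0)"
    using Xs_contraction by blast
  note Dj = graded_linear_funpow[OF X_del_graded]
  have sub: "grade Xs e \<subseteq> carrier Xs" for e by (auto simp: X_grade)
  note DjD = graded_linearD[OF Dj[OF sub]] and hD = graded_linearD[OF h]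
  interpret XG: abelian_group Xs using X.is_module by (rule module.axioms)
  interpret LG: abelian_group Ls using L.is_module by (rule module.axioms)
  define h' where "h' x = (- 1) \<odot>\<^bsub>Xs\<^esub> h x" for x
  have h': "graded_linear (2 - 2 * int p) Xs Xs h'"
    unfolding graded_linear_def
  proof (intro conjI ballI allI funcsetI)
    fix x y c e
    show "h' x \<in> grade Xs (e + (2 - 2 * int p))" if "x \<in> grade Xs e"
    proof -
      have "h x \<in> grade Xs (e + (2 - 2 * int p))" by (rule hD(4)[OF that])
      then have c: "h x \<in> carrier Xs" and d: "\<And>b. cell_coord (h x) b \<noteq> 0 \<Longrightarrow> cell_degree b = e + (2 - 2 * int p)"
        unfolding X_grade_coord by blast+
      have "cell_degree b = e + (2 - 2 * int p)" if "- 1 * cell_coord (h x) b \<noteq> 0" for b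
        by (rule d) (use that in force)
      then show ?thesis unfolding X_grade_coord h'_def X.coord_smult[OF c] using X.smult_in[OF c] by blast
    qed
    assume x: "x \<in> carrier Xs"
    show "h' x \<in> carrier Xs" unfolding h'_def by (rule X.smult_in[OF hD(1)[OF x]])
    show "h' (c \<odot>\<^bsub>Xs\<^esub> x) = c \<odot>\<^bsub>Xs\<^esub> h' x"
      unfolding h'_def hD(3)[OF x]
      by (rule X.coord_eqI) (simp_all add: X.smult_in X.coord_smult hD(1)[OF x])
    assume y: "y \<in> carrier Xs"
    show "h' (x \<oplus>\<^bsub>Xs\<^esub> y) = h' x \<oplus>\<^bsub>Xs\<^esub> h' y"
      unfolding h'_def hD(2)[OF x y]
      by (rule X.coord_eqI) (simp_all add: X.smult_in X.add_in X.coord_smult X.coord_add hD(1)[OF x] hD(1)[OF y])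
  qed
  have homotopic: "proj x \<ominus>\<^bsub>Xs\<^esub> x = finsum Xs (\<lambda>j. (del Xs ^^ j) (h' ((del Xs ^^ (p - 1 - j)) x))) {..<p}"
    if x: "x \<in> carrier Xs" for x
  proof -
    define t where "t j = (del Xs ^^ j) (h ((del Xs ^^ (p - 1 - j)) x))" for j
    have t_in: "t j \<in> carrier Xs" for j unfolding t_def by (intro DjD(1) hD(1) x)
    have t': "(del Xs ^^ j) (h' ((del Xs ^^ (p - 1 - j)) x)) = (- 1) \<odot>\<^bsub>Xs\<^esub> t j" for j
      unfolding h'_def t_def by (rule DjD(3)[OF hD(1)[OF DjD(1)[OF x]]])
    note nt = X.smult_in[OF t_in, of "- 1"]
    have px: "proj x \<in> carrier Xs" unfolding proj_def by (rule X.smult_in[OF simple_gen_in])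
    show ?thesis unfolding t'
    proof (rule X.coord_inj)
      show "proj x \<ominus>\<^bsub>Xs\<^esub> x \<in> carrier Xs" by (rule XG.minus_closed[OF px x])
      show "finsum Xs (\<lambda>j. (- 1) \<odot>\<^bsub>Xs\<^esub> t j) {..<p} \<in> carrier Xs" by (rule conjunct1[OF X.coord_finsum[OF nt]])
      fix b assume b: "b \<in> cell_basis"
      have "cell_coord (finsum Xs (\<lambda>j. (- 1) \<odot>\<^bsub>Xs\<^esub> t j) {..<p}) b = (\<Sum>j<p. cell_coord ((- 1) \<odot>\<^bsub>Xs\<^esub> t j) b)"
        using X.coord_finsum[of "{..<p}" "\<lambda>j. (- 1) \<odot>\<^bsub>Xs\<^esub> t j" b, OF nt] by simp
      also have "\<dots> = - (\<Sum>j<p. cell_coord (t j) b)"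
        by (simp add: X.coord_smult[OF t_in] sum_negf)
      also have "(\<Sum>j<p. cell_coord (t j) b) = cell_coord (finsum Xs t {..<p}) b"
        using X.coord_finsum[of "{..<p}" t b, OF t_in] by simp
      also have "\<dots> = (if \<exists>c\<in>{c. chains u i n c}. \<exists>k<p. b = chain_coord c k then cell_coord x b else 0)"
        using hs[OF x] b unfolding t_def[symmetric] by (simp add: X.coord_vec)
      also have "\<dots> = (if b = (GenW, i, 0) then 0 else cell_coord x b)"
      proof (cases "b = (GenW, i, 0)")
        case True
        have "\<not> (\<exists>c\<in>{c. chains u i n c}. \<exists>k<p. b = chain_coord c k)"
        proof
          assume "\<exists>c\<in>{c. chains u i n c}. \<exists>k<p. b = chain_coord c k"
          then obtain c k where ck: "chains u i n c" "k < p" "b = chain_coord c k" by blast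
          have "chain_coord c k = (GenW, i, 0)" by (rule trans[OF ck(3)[symmetric] True])
          with chain_coord_simple[OF ck(1,2)] show False by contradiction
        qed
        then show ?thesis using True by (simp only: if_False if_True simp_thms)
      next
        case False
        show ?thesis unfolding if_P[OF chain_coord_cover[OF b False]] if_not_P[OF False] ..
      qed
      finally show "cell_coord (proj x \<ominus>\<^bsub>Xs\<^esub> x) b = cell_coord (finsum Xs (\<lambda>j. (- 1) \<odot>\<^bsub>Xs\<^esub> t j) {..<p}) b"
        unfolding X.coord_minus[OF px x] unfolding proj_def coord_line by (simp add: head_def)
    qed
  qed
  have p0: "0 < p" using p2 by simp
  have 1: "stably_zero p Xs Xs (\<lambda>x. proj x \<ominus>\<^bsub>Xs\<^esub> x)"
    by (rule X.stably_zero_homotopy[OF p0 pX h' homotopic])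
  have z: "graded_linear (2 - 2 * int p) Ls Ls (\<lambda>x. \<zero>\<^bsub>Ls\<^esub>)"
  proof -
    have "\<zero>\<^bsub>Ls\<^esub> \<in> grade Ls e" for e unfolding L.grade_iff L.coord_zero using L.zero_in by blast
    then show ?thesis unfolding graded_linear_def
      by (intro conjI ballI allI funcsetI) (simp_all only: L.zero_in L.add_zero L.smult_zero)
  qed
  have Ldel: "graded_linear 2 Ls Ls (del Ls)" using Ls_pcomplex by (simp add: is_pcomplex_def)
  have Lsub: "grade Ls e \<subseteq> carrier Ls" for e by (auto simp: L.grade_iff)
  have 2: "stably_zero p Ls Ls (\<lambda>y. proj y \<ominus>\<^bsub>Ls\<^esub> y)"
  proof (rule L.stably_zero_homotopy[OF p0 Ls_pcomplex z])
    fix y assume y: "y \<in> carrier Ls"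
    have "proj y = y" unfolding proj_def by (rule Ls_eq[OF y, symmetric])
    then have "proj y \<ominus>\<^bsub>Ls\<^esub> y = \<zero>\<^bsub>Ls\<^esub>" using LG.r_neg[OF y] by (simp only: a_minus_def)
    also have "\<dots> = finsum Ls (\<lambda>j. (del Ls ^^ j) \<zero>\<^bsub>Ls\<^esub>) {..<p}"
      unfolding L.graded_linear_zero[OF graded_linear_funpow[OF Ldel Lsub]] by (rule LG.finsum_zero[symmetric])
    finally show "proj y \<ominus>\<^bsub>Ls\<^esub> y = finsum Ls (\<lambda>j. (del Ls ^^ j) \<zero>\<^bsub>Ls\<^esub>) {..<p}" .
  qed
  have ph: "pcomplex_hom Xs Ls proj" using proj_hom unfolding pdg_hom_def by (rule conjunct1)
  have "stable_iso p Xs Ls proj"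
    unfolding stable_iso_def
    by (rule conjI[OF ph], rule exI[of _ "\<lambda>x. x"], rule conjI[OF incl_hom], rule conjI, rule 1, rule 2)
  with proj_hom show ?thesis unfolding pdg_quasi_iso_def by (rule conjI)
qed

end

section \<open>Left and right modules over the opposite algebra\<close>

lemma right_pdg_module_opp:
  fixes A :: "('a::field, 'b) pcomplex"
  assumes "pdg_algebra p A" "pdg_algebra p (opp A)"
  shows "left_pdg_module p (opp A) = right_pdg_module p A"
proof
  fix M :: "('a, 'b, 'c) pdg_module"
  have "pdg_action p (opp A) M = pdg_action p A M" using assms by (simp add: pdg_action_def)
  then show "left_pdg_module p (opp A) M = right_pdg_module p A M"
    unfolding left_pdg_module_def right_pdg_module_def opp_simps by blast
qed

lemma right_projective_opp: "left_projective (opp A) e = right_projective A e"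
  by (simp add: left_projective_def right_projective_def)

lemma finsum_opp: "finsum (opp A) = finsum A"
proof -
  have "add_monoid (opp A) = add_monoid A" by (simp add: opp_def)
  then show ?thesis by (intro ext) (simp add: finsum_def)
qed

lemma right_cell_sum_opp: "left_cell_sum (opp A) G e wt dg = right_cell_sum A G e wt dg"
  by (simp add: left_cell_sum_def right_cell_sum_def right_projective_opp finsum_opp Let_def)

lemma pdg_hom_opp: "pdg_hom (opp A) = pdg_hom A"
  by (intro ext) (simp add: pdg_hom_def)

lemma finite_cell_opp: "finite_cell_module ob (opp A) P J M = finite_cell_module ob A P J M"
  by (simp add: finite_cell_module_def pdg_isomorphic_def pdg_hom_opp)

lemma pdg_quasi_iso_opp: "pdg_quasi_iso p (opp A) = pdg_quasi_iso p A"
  by (intro ext) (simp add: pdg_quasi_iso_def pdg_hom_opp)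

lemma line_module_opp: "line_module (opp A) idc y = line_module A idc y"
  unfolding line_module_def opp_simps by (rule refl)

section \<open>Coordinates of path classes\<close>

declare split_of_bool [split del]

context
  fixes n :: nat
  assumes n: "2 \<le> n"
begin

lemma path_class_cls: "path_class n q = cls n (if q \<in> quiver_paths n then Poly_Mapping.single q (1::'k::field) else 0)"
  using Ashriek_ops(3)[OF n, of "0 :: 'k"] by (simp add: path_class_def cls_def Ashriek_def)

lemma path_class_in: "path_class n q \<in> carrier (Ashriek n lam)"
  unfolding path_class_cls Ashriek_ops(1)[OF n] by (rule imageI) simp

lemma coord_path_class: "coord u (path_class n q :: 'k::field path_comb set) h l D =
    (if q \<in> quiver_paths n \<and> (h, l, D) = (hd q, last q, steps u q) \<and> D < cutoff u h l then 1 else 0)"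
  unfolding path_class_cls coord_cls[OF n] by (auto simp: pcoord_single)

lemma Ashriek_ring_ops:
  "zero (Ashriek_ring n) = zero (Ashriek n lam)" "add (Ashriek_ring n) = add (Ashriek n lam)"
  "x \<ominus>\<^bsub>Ashriek_ring n\<^esub> y = x \<ominus>\<^bsub>Ashriek n lam\<^esub> y"
  by (simp_all add: Ashriek_def a_minus_def a_inv_def m_inv_def)

lemma gterm_in: "gterm n q g h \<in> carrier (Ashriek n (of_bool u :: 'k::field))"
  using based.zero_in[OF Ashriek_based[OF n, of u]]
  by (cases "h = g") (simp_all add: gterm_def path_class_in Ashriek_ring_ops(1)[where lam = "of_bool u :: 'k"])

lemma gplus_in: "\<lbrakk>x h \<in> carrier (Ashriek n (of_bool u :: 'k::field)); y h \<in> carrier (Ashriek n (of_bool u :: 'k))\<rbrakk>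
    \<Longrightarrow> gplus n x y h \<in> carrier (Ashriek n (of_bool u :: 'k))"
  using based.add_in[OF Ashriek_based[OF n, of u], of "x h" "y h"]
  by (simp add: gplus_def Ashriek_ring_ops(2)[where lam = "of_bool u :: 'k"])

lemma gminus_in: "\<lbrakk>x h \<in> carrier (Ashriek n (of_bool u :: 'k::field)); y h \<in> carrier (Ashriek n (of_bool u :: 'k))\<rbrakk>
    \<Longrightarrow> gminus n x y h \<in> carrier (Ashriek n (of_bool u :: 'k))"
  using abelian_group.minus_closed[OF module.axioms(2)[OF based.is_module[OF Ashriek_based[OF n, of u]]], of "x h" "y h"]
  by (simp add: gminus_def Ashriek_ring_ops(3)[where lam = "of_bool u :: 'k"])

lemma coord_gterm: "coord u (gterm n q g h :: 'k::field path_comb set) a b D =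
    (if h = g \<and> q \<in> quiver_paths n \<and> steps u q < cutoff u (hd q) (last q) \<and> (a, b, D) = (hd q, last q, steps u q) then 1 else 0)"
proof -
  have "based (Ashriek n (of_bool u :: 'k)) (coords u n) (\<lambda>(h, l, D). cdeg u h l D) (\<lambda>a (h, l, D). coord u a h l D)"
    by (rule Ashriek_based[OF n])
  from based.coord_zero[OF this, of "(a, b, D)"] show ?thesis
    by (cases "h = g") (auto simp: gterm_def coord_path_class Ashriek_ring_ops(1)[where lam = "of_bool u :: 'k"])
qed

lemma coord_gplus: "\<lbrakk>x h \<in> carrier (Ashriek n (of_bool u :: 'k::field)); y h \<in> carrier (Ashriek n (of_bool u :: 'k))\<rbrakk>
    \<Longrightarrow> coord u (gplus n x y h) a b D = coord u (x h) a b D + coord u (y h) a b D"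
  using based.coord_add[OF Ashriek_based[OF n, of u], of "x h" "y h" "(a, b, D)"]
  by (simp add: gplus_def Ashriek_ring_ops(2)[where lam = "of_bool u :: 'k"])

lemma coord_gminus: "\<lbrakk>x h \<in> carrier (Ashriek n (of_bool u :: 'k::field)); y h \<in> carrier (Ashriek n (of_bool u :: 'k))\<rbrakk>
    \<Longrightarrow> coord u (gminus n x y h) a b D = coord u (x h) a b D - coord u (y h) a b D"
  using based.coord_minus[OF Ashriek_based[OF n, of u], of "x h" "y h" "(a, b, D)"]
  by (simp add: gminus_def Ashriek_ring_ops(3)[where lam = "of_bool u :: 'k"])

lemma coord_gterm_sum:
  "coord u (gplus n (gterm n q g) (gterm n r g') h :: 'k::field path_comb set) a b D =
     coord u (gterm n q g h :: 'k path_comb set) a b D + coord u (gterm n r g' h :: 'k path_comb set) a b D"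
  "coord u (gminus n (gterm n q g) (gterm n r g') h :: 'k path_comb set) a b D =
     coord u (gterm n q g h :: 'k path_comb set) a b D - coord u (gterm n r g' h :: 'k path_comb set) a b D"
  by (rule coord_gplus[OF gterm_in gterm_in], rule coord_gminus[OF gterm_in gterm_in])

lemma coord_gzero: "coord u (\<zero>\<^bsub>Ashriek_ring n\<^esub> :: 'k::field path_comb set) a b D = 0"
proof -
  have "based (Ashriek n (of_bool u :: 'k)) (coords u n) (\<lambda>(h, l, D). cdeg u h l D) (\<lambda>a (h, l, D). coord u a h l D)"
    by (rule Ashriek_based[OF n])
  from based.coord_zero[OF this, of "(a, b, D)"] show ?thesis
    by (simp add: Ashriek_ring_ops(1)[where lam = "of_bool u :: 'k"])
qed

lemma gzero_in: "\<zero>\<^bsub>Ashriek_ring n\<^esub> \<in> carrier (Ashriek n (of_bool u :: 'k::field))"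
  using based.zero_in[OF Ashriek_based[OF n, of u]] by (simp add: Ashriek_ring_ops(1)[where lam = "of_bool u :: 'k"])

lemma gzero_ops:
  "(\<zero>\<^bsub>Ashriek_ring n\<^esub> :: 'k::field path_comb set) \<oplus>\<^bsub>Ashriek_ring n\<^esub> \<zero>\<^bsub>Ashriek_ring n\<^esub> = \<zero>\<^bsub>Ashriek_ring n\<^esub>"
  "(\<zero>\<^bsub>Ashriek_ring n\<^esub> :: 'k path_comb set) \<ominus>\<^bsub>Ashriek_ring n\<^esub> \<zero>\<^bsub>Ashriek_ring n\<^esub> = \<zero>\<^bsub>Ashriek_ring n\<^esub>"
proof -
  interpret abelian_group "Ashriek n (of_bool False :: 'k)"
    by (rule module.axioms(2)[OF based.is_module[OF Ashriek_based[OF n]]])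
  show "(\<zero>\<^bsub>Ashriek_ring n\<^esub> :: 'k path_comb set) \<oplus>\<^bsub>Ashriek_ring n\<^esub> \<zero>\<^bsub>Ashriek_ring n\<^esub> = \<zero>\<^bsub>Ashriek_ring n\<^esub>"
    "(\<zero>\<^bsub>Ashriek_ring n\<^esub> :: 'k path_comb set) \<ominus>\<^bsub>Ashriek_ring n\<^esub> \<zero>\<^bsub>Ashriek_ring n\<^esub> = \<zero>\<^bsub>Ashriek_ring n\<^esub>"
    unfolding Ashriek_ring_ops(3)[where lam = "of_bool False :: 'k"]
    unfolding Ashriek_ring_ops(1,2)[where lam = "of_bool False :: 'k"]
    unfolding a_minus_def by (rule r_zero r_neg zero_closed)+
qed

text \<open>
  A closed path without steps in the chosen direction has length zero.
\<close>

lemma idem_coeff_coord: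
  assumes a: "a \<in> carrier (Ashriek n (of_bool u :: 'k::field))" and i: "1 \<le> i" "i < n"
  shows "idem_coeff i a = coord u a i i 0"
proof -
  obtain f where f: "a = cls n f" "Poly_Mapping.keys f \<subseteq> quiver_paths n" using a by (auto simp: Ashriek_ops(1)[OF n])
  define g where "g = (SOME g. g \<in> a)"
  have "g \<in> a" unfolding g_def f(1) by (rule someI[of "\<lambda>g. g \<in> cls n f", OF cls_self[OF n]])
  then have "g - f \<in> relation_ideal n" by (simp add: f(1) mem_cls)
  then have "Poly_Mapping.keys (g - f) \<subseteq> quiver_paths n"
    using ideal.axioms(1)[OF relation_ideal_ideal[OF n], THEN additive_subgroup.a_subset] by (auto simp: path_algebra_def)
  then have k: "Poly_Mapping.keys g \<subseteq> quiver_paths n"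
    using keys_add_subset[of "g - f" "quiver_paths n" f] f(2) by simp
  have "pcoord u g i i 0 = (\<Sum>q\<in>Poly_Mapping.keys g. if q = [i] then Poly_Mapping.lookup g q else 0)"
    unfolding pcoord_def
  proof (rule sum.cong[OF refl])
    fix q assume "q \<in> Poly_Mapping.keys g"
    then have q: "q \<in> quiver_paths n" using k by blast
    have "q = [i]" if e: "hd q = i" "last q = i" "steps u q = 0"
    proof -
      have "int (length q) - 1 = 0" using length_cdeg[OF q, of u] by (simp add: e cdeg_def split: if_splits)
      then have "length q = Suc 0" by simp
      then show ?thesis using e(1) by (auto simp: length_Suc_conv)
    qed
    then have "hd q = i \<and> last q = i \<and> steps u q = 0 \<and> 0 < cutoff u i i \<longleftrightarrow> q = [i]"
      using i by (auto simp: cutoff_def)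
    then show "(if hd q = i \<and> last q = i \<and> steps u q = 0 \<and> 0 < cutoff u i i then Poly_Mapping.lookup g q else 0) =
        (if q = [i] then Poly_Mapping.lookup g q else 0)" by (simp only:)
  qed
  also have "\<dots> = Poly_Mapping.lookup g [i]" by (simp add: in_keys_iff)
  finally show ?thesis by (simp add: idem_coeff_def coord_def g_def)
qed

lemma strand_cases:
  assumes "on_strand p s k" "2 \<le> p"
  obtains (W) "\<not> s" "k = 0" | (V) "s" "k = p" | (M) "\<not> s" "1 \<le> k" "k < p" | (Q) "s" "1 \<le> k" "k < p"
  using assms by (cases s; cases "k = 0"; cases "k = p") (auto simp: on_strand_def)

lemma strand_source_cases:
  assumes "on_strand p s k" "2 \<le> p"
  obtains (W) "\<not> s" "k = 0" | (V) "s" "k = p" | (M1) "\<not> s" "k = 1" | (M2) m where "\<not> s" "k = Suc m" "1 \<le> m" "Suc m < p"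
    | (Q1) "s" "k = 1" "1 < p" | (Q2) m where "s" "k = Suc m" "1 \<le> m" "Suc m < p"
proof -
  consider (0) "\<not> s" "k = 0" | (1) "s" "k = p" | (2) "\<not> s" "1 \<le> k" "k < p" | (3) "s" "1 \<le> k" "k < p"
    by (cases rule: strand_cases[OF assms]) simp_all
  then show ?thesis
  proof cases
    case 0
    then show ?thesis by (rule W)
  next
    case 1
    then show ?thesis by (rule V)
  next
    case 2
    show ?thesis
    proof (cases "k = 1")
      case True
      then show ?thesis using 2 by (intro M1)
    qed (rule M2[of "k - 1"], use 2 in auto)
  next
    case 3
    show ?thesis
    proof (cases "k = 1")
      case True
      then show ?thesis using 3 by (intro Q1) simp_all
    qed (rule Q2[of "k - 1"], use 3 in auto)
  qed
qed

lemma vertex_cases: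
  assumes "1 \<le> i"
  obtains "i = 1" | m where "i = Suc (Suc m)"
  using assms by (cases i; cases "i - 1") auto

lemma coord_left_del0:
  assumes "2 \<le> p" "1 \<le> i" "i < n" and gs: "on_strand p s k" and hs: "on_strand p s' k'"
  shows "coord False (left_del0 n p i (strand_gen False p s k) (strand_gen False p s' k') :: 'k::field path_comb set) j l D =
    (if (j, l, D) = (strand_vertex False i p s k, strand_vertex False i p s' k', strand_exp p (s, k) (s', k')) \<and> j \<noteq> 0 \<and> l \<noteq> 0
     then strand_coeff (- 1) p (s, k) (s', k') else 0)"
proof -
  have pk: "k' = p - Suc 0 \<longleftrightarrow> Suc k' = p" using assms(1) by linarith
  show ?thesis
    using assms(1,3) pk
    by (cases rule: vertex_cases[OF assms(2)]; cases rule: strand_source_cases[OF gs assms(1)];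
        cases rule: strand_cases[OF hs assms(1)];
        (simp add: strand_gen_def strand_vertex_def coord_gterm coord_gterm_sum coord_gzero quiver_paths_def cutoff_def split: split_of_bool cong: conj_cong; fail)
        | (auto simp: strand_gen_def strand_vertex_def coord_gterm coord_gterm_sum coord_gzero quiver_paths_def cutoff_def split: split_of_bool))
qed

lemma coord_left_del1:
  assumes "2 \<le> p" "1 \<le> i" "i < n" and gs: "on_strand p s k" and hs: "on_strand p s' k'"
  shows "coord True (left_del1 n p i (strand_gen True p s k) (strand_gen True p s' k') :: 'k::field path_comb set) j l D =
    (if (j, l, D) = (strand_vertex True i p s k, strand_vertex True i p s' k', strand_exp p (s, k) (s', k')) \<and> j \<noteq> 0 \<and> l \<noteq> 0
     then strand_coeff 1 p (s, k) (s', k') else 0)"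
proof -
  have pk: "k' = p - Suc 0 \<longleftrightarrow> Suc k' = p" using assms(1) by linarith
  show ?thesis
    using assms(1,3) pk
    by (cases rule: vertex_cases[OF assms(2)]; cases rule: strand_source_cases[OF gs assms(1)];
        cases rule: strand_cases[OF hs assms(1)];
        (simp add: strand_gen_def strand_vertex_def coord_gterm coord_gterm_sum coord_gzero quiver_paths_def cutoff_def split: split_of_bool cong: conj_cong; fail)
        | (auto simp: strand_gen_def strand_vertex_def coord_gterm coord_gterm_sum coord_gzero quiver_paths_def cutoff_def split: split_of_bool))
qed

lemma coord_right_del0:
  assumes "2 \<le> p" "1 \<le> i" "i < n" and gs: "on_strand p s k" and hs: "on_strand p s' k'"
  shows "coord False (right_del0 n p i (strand_gen True p s k) (strand_gen True p s' k') :: 'k::field path_comb set) l j D =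
    (if (j, l, D) = (strand_vertex True i p s k, strand_vertex True i p s' k', strand_exp p (s, k) (s', k')) \<and> j \<noteq> 0 \<and> l \<noteq> 0
     then strand_coeff 1 p (s, k) (s', k') else 0)"
proof -
  have pk: "k' = p - Suc 0 \<longleftrightarrow> Suc k' = p" using assms(1) by linarith
  show ?thesis
    using assms(1,3) pk
    by (cases rule: vertex_cases[OF assms(2)]; cases rule: strand_source_cases[OF gs assms(1)];
        cases rule: strand_cases[OF hs assms(1)];
        (simp add: strand_gen_def strand_vertex_def coord_gterm coord_gterm_sum coord_gzero quiver_paths_def cutoff_def split: split_of_bool cong: conj_cong; fail)
        | (auto simp: strand_gen_def strand_vertex_def coord_gterm coord_gterm_sum coord_gzero quiver_paths_def cutoff_def split: split_of_bool))
qed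

lemma coord_right_del1:
  assumes "2 \<le> p" "1 \<le> i" "i < n" and gs: "on_strand p s k" and hs: "on_strand p s' k'"
  shows "coord True (right_del1 n p i (strand_gen False p s k) (strand_gen False p s' k') :: 'k::field path_comb set) l j D =
    (if (j, l, D) = (strand_vertex False i p s k, strand_vertex False i p s' k', strand_exp p (s, k) (s', k')) \<and> j \<noteq> 0 \<and> l \<noteq> 0
     then strand_coeff (- 1) p (s, k) (s', k') else 0)"
proof -
  have pk: "k' = p - Suc 0 \<longleftrightarrow> Suc k' = p" using assms(1) by linarith
  show ?thesis
    using assms(1,3) pk
    by (cases rule: vertex_cases[OF assms(2)]; cases rule: strand_source_cases[OF gs assms(1)];
        cases rule: strand_cases[OF hs assms(1)];
        (simp add: strand_gen_def strand_vertex_def coord_gterm coord_gterm_sum coord_gzero quiver_paths_def cutoff_def split: split_of_bool cong: conj_cong; fail)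
        | (auto simp: strand_gen_def strand_vertex_def coord_gterm coord_gterm_sum coord_gzero quiver_paths_def cutoff_def split: split_of_bool))
qed

lemma cell_del_in:
  fixes u :: bool
  shows "left_del0 n p i g h \<in> carrier (Ashriek n (of_bool u :: 'k::field))"
    "left_del1 n p i g h \<in> carrier (Ashriek n (of_bool u :: 'k))"
    "right_del0 n p i g h \<in> carrier (Ashriek n (of_bool u :: 'k))"
    "right_del1 n p i g h \<in> carrier (Ashriek n (of_bool u :: 'k))"
  by (cases g; simp add: gplus_in gminus_in gterm_in gzero_in)+

lemma cell_del_off:
  assumes "2 \<le> p" "g \<in> gens p" "h \<notin> gens p"
  shows "left_del0 n p i g h = (\<zero>\<^bsub>Ashriek_ring n\<^esub> :: 'k::field path_comb set)"
    "left_del1 n p i g h = (\<zero>\<^bsub>Ashriek_ring n\<^esub> :: 'k path_comb set)"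
    "right_del0 n p i g h = (\<zero>\<^bsub>Ashriek_ring n\<^esub> :: 'k path_comb set)"
    "right_del1 n p i g h = (\<zero>\<^bsub>Ashriek_ring n\<^esub> :: 'k path_comb set)"
proof -
  have h: "h \<noteq> GenV" "h \<noteq> GenW" "h \<noteq> GenA k" "h \<noteq> GenB k" if "1 \<le> k" "k \<le> p - 1" for k
    using assms(3) that by (auto simp: gens_def)
  have hp: "h \<noteq> GenV" "h \<noteq> GenW" "h \<noteq> GenA (p - 1)" "h \<noteq> GenB (p - 1)" using h[of "p - 1"] assms(1) by auto
  have hk: "h \<noteq> GenA k" "h \<noteq> GenB k" "k \<noteq> 1 \<Longrightarrow> h \<noteq> GenA (k - 1)" "k \<noteq> 1 \<Longrightarrow> h \<noteq> GenB (k - 1)"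
    if "g = GenA k \<or> g = GenB k" for k
  proof -
    have k: "1 \<le> k" "k \<le> p - 1" using that assms(2) by (auto simp: gens_def)
    show "h \<noteq> GenA k" "h \<noteq> GenB k" using h(3,4)[OF k] by auto
    show "h \<noteq> GenA (k - 1)" "h \<noteq> GenB (k - 1)" if "k \<noteq> 1" using h(3,4)[of "k - 1"] k that by auto
  qed
  show "left_del0 n p i g h = (\<zero>\<^bsub>Ashriek_ring n\<^esub> :: 'k path_comb set)"
    "left_del1 n p i g h = (\<zero>\<^bsub>Ashriek_ring n\<^esub> :: 'k path_comb set)"
    "right_del0 n p i g h = (\<zero>\<^bsub>Ashriek_ring n\<^esub> :: 'k path_comb set)"
    "right_del1 n p i g h = (\<zero>\<^bsub>Ashriek_ring n\<^esub> :: 'k path_comb set)"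
    using hp hk by (cases g; simp add: gplus_def gminus_def gterm_def gzero_ops)+
qed

text \<open>
  The hypotheses on \<open>dg\<close> say that it has the coordinates of a two-strand
  module.
\<close>

lemma left_resolution:
  assumes p: "prime p" "CHAR('k::field) = p" and i: "1 \<le> i" "i < n"
    and dg: "\<And>g h. dg g h \<in> carrier (Ashriek n (of_bool u :: 'k))"
      "\<And>g h. \<lbrakk>g \<in> gens p; h \<notin> gens p\<rbrakk> \<Longrightarrow> dg g h = (\<zero>\<^bsub>Ashriek_ring n\<^esub> :: 'k path_comb set)"
      "\<And>s k s' k' j l D. \<lbrakk>on_strand p s k; on_strand p s' k'\<rbrakk> \<Longrightarrow>
      coord u (dg (strand_gen u p s k) (strand_gen u p s' k')) j l D =
        (if (j, l, D) = (strand_vertex u i p s k, strand_vertex u i p s' k', strand_exp p (s, k) (s', k')) \<and> j \<noteq> 0 \<and> l \<noteq> 0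
         then strand_coeff (if u then 1 else - 1) p (s, k) (s', k') else 0)"
  shows "finite_cell_module (left_pdg_module p (Ashriek n (of_bool u))) (Ashriek n (of_bool u :: 'k)) (left_P n (of_bool u)) {1..n}
       (left_X n p i (of_bool u) dg)
     \<and> quasi_isomorphic (left_pdg_module p (Ashriek n (of_bool u :: 'k))) p (Ashriek n (of_bool u))
       (simple_module n i (of_bool u)) (left_X n p i (of_bool u) dg)"
proof -
  let ?A = "Ashriek n (of_bool u :: 'k)"
  have ca: "coord_algebra ?A p n u (coord u)"
    by (rule Ashriek_coord_algebra[OF n prime_gt_0_nat[OF p(1)] p(2)])
  interpret strand_cell ?A p n u "coord u" i "\<lambda>m. path_class n [m]" dg "idem_coeff i"
  proof (rule strand_cell.intro[OF ca strand_cell_axioms.intro])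
    fix m j l D
    show "coord u (path_class n [m] :: 'k path_comb set) j l D = (if (j, l, D) = (m, m, 0) then of_bool (m \<in> {1..n}) else 0)"
      by (auto simp: coord_path_class quiver_paths_def cutoff_def split: split_of_bool)
    show "prime p" "1 \<le> i" "i < n" by (rule p(1), rule i, rule i)
    show "path_class n [m] \<in> carrier ?A" by (rule path_class_in)
    show "dg g h \<in> carrier ?A" for g h by (rule dg(1))
    show "dg g h = \<zero>\<^bsub>?A\<^esub>" if "g \<in> gens p" "h \<notin> gens p" for g h
      using dg(2)[OF that] by (simp only: Ashriek_ring_ops(1)[where lam = "of_bool u :: 'k"])
    show "idem_coeff i a = coord u a i i 0" if "a \<in> carrier ?A" for a by (rule idem_coeff_coord[OF that i])
  qed (rule dg(3))
  have X: "left_X n p i (of_bool u) dg = Xs" by (simp add: left_X_def)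
  have L: "simple_module n i (of_bool u) = Ls"
    unfolding simple_module_def line_module_def Let_def simple_gen_def gterm_def
      Ashriek_ring_ops(1)[where lam = "of_bool u :: 'k"] by (rule refl)
  show ?thesis unfolding X L
    by (intro conjI Xs_finite_cell quasi_isomorphicI[where s = proj] Xs_module Ls_module simple_quasi_iso)
qed

text \<open>
  The previous argument over the opposite algebra, which has the opposite direction.
\<close>

lemma right_resolution:
  assumes p: "prime p" "CHAR('k::field) = p" and i: "1 \<le> i" "i < n"
    and dg: "\<And>g h. dg g h \<in> carrier (Ashriek n (of_bool (\<not> u) :: 'k))"
      "\<And>g h. \<lbrakk>g \<in> gens p; h \<notin> gens p\<rbrakk> \<Longrightarrow> dg g h = (\<zero>\<^bsub>Ashriek_ring n\<^esub> :: 'k path_comb set)"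
      "\<And>s k s' k' j l D. \<lbrakk>on_strand p s k; on_strand p s' k'\<rbrakk> \<Longrightarrow>
      coord (\<not> u) (dg (strand_gen u p s k) (strand_gen u p s' k')) l j D =
        (if (j, l, D) = (strand_vertex u i p s k, strand_vertex u i p s' k', strand_exp p (s, k) (s', k')) \<and> j \<noteq> 0 \<and> l \<noteq> 0
         then strand_coeff (if u then 1 else - 1) p (s, k) (s', k') else 0)"
  shows "finite_cell_module (right_pdg_module p (Ashriek n (of_bool (\<not> u)))) (Ashriek n (of_bool (\<not> u) :: 'k)) (right_P n (of_bool (\<not> u))) {1..n}
       (right_X n p i (of_bool (\<not> u)) dg)
     \<and> quasi_isomorphic (right_pdg_module p (Ashriek n (of_bool (\<not> u) :: 'k))) p (Ashriek n (of_bool (\<not> u)))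
       (simple_module n i (of_bool (\<not> u))) (right_X n p i (of_bool (\<not> u)) dg)"
proof -
  let ?A = "Ashriek n (of_bool (\<not> u) :: 'k)"
  have ca': "coord_algebra ?A p n (\<not> u) (coord (\<not> u))"
    by (rule Ashriek_coord_algebra[OF n prime_gt_0_nat[OF p(1)] p(2)])
  have ca: "coord_algebra (opp ?A) p n u (\<lambda>a h l D. coord (\<not> u) a l h D)"
    using coord_algebra_opp[OF ca'] by (simp only: not_not)
  interpret strand_cell "opp ?A" p n u "\<lambda>a h l D. coord (\<not> u) a l h D" i "\<lambda>m. path_class n [m]" dg "idem_coeff i"
  proof (rule strand_cell.intro[OF ca strand_cell_axioms.intro])
    fix m j l D
    show "coord (\<not> u) (path_class n [m] :: 'k path_comb set) l j D = (if (j, l, D) = (m, m, 0) then of_bool (m \<in> {1..n}) else 0)"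
      by (auto simp: coord_path_class quiver_paths_def cutoff_def split: split_of_bool)
    show "prime p" "1 \<le> i" "i < n" by (rule p(1), rule i, rule i)
    show "path_class n [m] \<in> carrier (opp ?A)" unfolding opp_simps by (rule path_class_in)
    show "dg g h \<in> carrier (opp ?A)" for g h unfolding opp_simps by (rule dg(1))
    show "dg g h = \<zero>\<^bsub>opp ?A\<^esub>" if "g \<in> gens p" "h \<notin> gens p" for g h
      using dg(2)[OF that] by (simp only: opp_simps Ashriek_ring_ops(1)[where lam = "of_bool (\<not> u) :: 'k"])
    show "idem_coeff i a = coord (\<not> u) a i i 0" if "a \<in> carrier (opp ?A)" for a
      using that unfolding opp_simps by (rule idem_coeff_coord[OF _ i])
  qed (rule dg(3))
  have ob: "left_pdg_module p (opp ?A) = right_pdg_module p ?A"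
    by (rule right_pdg_module_opp[OF coord_algebra.A_pdg[OF ca'] coord_algebra.A_pdg[OF ca]])
  have X: "right_X n p i (of_bool (\<not> u)) dg = Xs" by (simp only: right_X_def right_cell_sum_opp)
  have L: "simple_module n i (of_bool (\<not> u)) = Ls"
    unfolding line_module_opp simple_module_def line_module_def Let_def simple_gen_def gterm_def opp_simps
      Ashriek_ring_ops(1)[where lam = "of_bool (\<not> u) :: 'k"] by (rule refl)
  show ?thesis
    using Xs_finite_cell quasi_isomorphicI[where ob = "right_pdg_module p ?A" and A = ?A and p = p and s = proj and M = Xs and N = Ls]
      Xs_module Ls_module simple_quasi_iso
    unfolding X L ob finite_cell_opp right_projective_opp pdg_quasi_iso_opp by (intro conjI)
qed

end

section \<open>The four resolutions\<close>

theorem lemma5p1: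
  fixes n i p :: nat
  assumes "prime p" and "CHAR('k::field) = p" and "2 \<le> n" and "1 \<le> i" and "i \<le> n - 1"
  shows
    "finite_cell_module (left_pdg_module p (Ashriek n (0::'k))) (Ashriek n 0) (left_P n 0) {1..n}
       (left_X n p i 0 (left_del0 n p i))
     \<and> quasi_isomorphic (left_pdg_module p (Ashriek n (0::'k))) p (Ashriek n 0)
       (simple_module n i 0) (left_X n p i 0 (left_del0 n p i))
     \<and> finite_cell_module (right_pdg_module p (Ashriek n (0::'k))) (Ashriek n 0) (right_P n 0) {1..n}
       (right_X n p i 0 (right_del0 n p i))
     \<and> quasi_isomorphic (right_pdg_module p (Ashriek n (0::'k))) p (Ashriek n 0)
       (simple_module n i 0) (right_X n p i 0 (right_del0 n p i))
     \<and> finite_cell_module (left_pdg_module p (Ashriek n (1::'k))) (Ashriek n 1) (left_P n 1) {1..n}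
       (left_X n p i 1 (left_del1 n p i))
     \<and> quasi_isomorphic (left_pdg_module p (Ashriek n (1::'k))) p (Ashriek n 1)
       (simple_module n i 1) (left_X n p i 1 (left_del1 n p i))
     \<and> finite_cell_module (right_pdg_module p (Ashriek n (1::'k))) (Ashriek n 1) (right_P n 1) {1..n}
       (right_X n p i 1 (right_del1 n p i))
     \<and> quasi_isomorphic (right_pdg_module p (Ashriek n (1::'k))) p (Ashriek n 1)
       (simple_module n i 1) (right_X n p i 1 (right_del1 n p i))"
proof -
  note pc = assms(1,2) and n = assms(3)
  have i: "1 \<le> i" "i < n" using assms(3-5) by linarith+
  have p: "2 \<le> p" using assms(1) by (rule prime_ge_2_nat)
  note left0 = left_resolution[OF n pc i, where u = False and dg = "left_del0 n p i",
      unfolded if_True if_False not_False_eq_True not_True_eq_False,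
      OF cell_del_in(1)[OF n, where u = False] cell_del_off(1)[OF n p] coord_left_del0[OF n p i], unfolded of_bool_eq]
  note left1 = left_resolution[OF n pc i, where u = True and dg = "left_del1 n p i",
      unfolded if_True if_False not_False_eq_True not_True_eq_False,
      OF cell_del_in(2)[OF n, where u = True] cell_del_off(2)[OF n p] coord_left_del1[OF n p i], unfolded of_bool_eq]
  note right0 = right_resolution[OF n pc i, where u = True and dg = "right_del0 n p i",
      unfolded if_True if_False not_False_eq_True not_True_eq_False,
      OF cell_del_in(3)[OF n, where u = False] cell_del_off(3)[OF n p] coord_right_del0[OF n p i], unfolded of_bool_eq]
  note right1 = right_resolution[OF n pc i, where u = False and dg = "right_del1 n p i",
      unfolded if_True if_False not_False_eq_True not_True_eq_False,
      OF cell_del_in(4)[OF n, where u = True] cell_del_off(4)[OF n p] coord_right_del1[OF n p i], unfolded of_bool_eq]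
  show ?thesis using left0 right0 left1 right1 by blast
qed

end
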